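(* The Gowers–Maurey space $X_{GM}$ is Q.H.I.; that is, for every closed subspace $Y$ of $X_{GM}$ such that $X_{GM}/Y$ is infinite dimensional, the quotient $X_{GM}/Y$ is hereditarily indecomposable.
   Context: A Banach space is hereditarily indecomposable (H.I.) if it is infinite dimensional and none of its closed subspaces is the topological direct sum of two infinite dimensional closed subspaces. A Banach space is Q.H.I. (quotient hereditarily indecomposable) if each of its infinite dimensional quotients by a closed subspace is H.I. Definition of the Gowers–Maurey space. Let $c_{00}$ be the space of finitely supported scalar sequences with unit vector basis $(e_i)$. An interval is a set $\{a,a+1,\dots,b\}\subset\mathbf N$; for an interval $E$, $E$ also denotes the coordinate projection $E(\sum a_ie_i)=\sum_{i\in E}a_ie_i$. The range $\mathrm{ran}(x)$ of $x\in c_{00}$ is the smallest interval $E$ with $Ex=x$; $E<F$ means $\max E<\min F$; vectors are successive, $x_1<\dots<x_n$, if their ranges are. Let $f(x)=\log_2(x+1)$. Let $J=\{j_1<j_2<\cdots\}\subset\mathbf N$ satisfy $f(j_1)>256$ and $\log\log\log j_{n+1}\ge 4j_n^2$ for all $n$; put $K=\{j_1,j_3,j_5,\dots\}$, $L=\{j_2,j_4,j_6,\dots\}$. Let $\mathbf Q\subset c_{00}$ be the set of finitely supported sequences with rational coordinates (rational real and imaginary parts in the complex case) and all coordinates of modulus at most $1$. Let $\sigma$ be an injection from the collection of finite sequences of successive elements of $\mathbf Q$ into $L$. Let $\|\cdot\|$ be a norm on $c_{00}$ and let $\|\cdot\|^*$ be the dual norm of functionals in $c_{00}$. For $m\in\mathbf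 N$ let $A_m^*$ be the set of functionals $f(m)^{-1}\sum_{i=1}^m x_i^*$ with $x_1^*<\dots<x_m^*$ in $c_{00}$ and $\|x_i^*\|^*\le1$. For $k\in K$, a special sequence of length $k$ (relative to $\|\cdot\|$) is a sequence $y_1^*<\dots<y_k^*$ of elements of $\mathbf Q$ with $y_1^*\in A^*_{j_{2k}}$ and $y_{i+1}^*\in A^*_{\sigma(y_1^*,\dots,y_i^* )}$ for $1\le i\le k-1$; the corresponding special functional is $f(k)^{-1/2}\sum_{i=1}^k y_i^*$. Define norms on $c_{00}$ by $\|x\|_0=\max_i|x_i|$ and $$\|x\|_{n+1}=\max\Big(\sup\Big\{f(N)^{-1}\sum_{i=1}^N\|E_ix\|_n: N\ge1,\ E_1<\dots<E_N \text{ intervals}\Big\},\ \sup\{|g(Ex)|\}\Big),$$ the second supremum being over all intervals $E$, all $k\in K$ and all special functionals $g$ of length $k$ relative to $\|\cdot\|_n$. The norms increase to a limit norm $\|\cdot\|$, and $X_{GM}$ is the completion of $(c_{00},\|\cdot\|)$. The limit norm satisfies $$\|x\|=\max\Big(\|x\|_{\infty},\ \sup_{N\ge2,\,E_1<\dots<E_N}f(N)^{-1}\sum_{i=1}^N\|E_ix\|,\ \sup|g(Ex)|\Big),$$ the last supremum being over intervals $E$ and special functionals $g$ (relative to $\|\cdot\|$) of length $k\in K$. *)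

theory Defs
  imports
    "HOL-Analysis.Analysis"
    "HOL-Algebra.Module"
    "HOL-Algebra.AbelCoset"
    "HOL-Algebra.Algebraic_Closure_Type"
begin

section \<open>Normed spaces with explicit carriers\<close>

text \<open>
  A normed space over the scalar field \<open>'k\<close> (later: real or complex numbers) is a
  module in the sense of HOL-Algebra over the ring \<open>ring_of_type_algebra\<close> (the type \<open>'k\<close>
  viewed as a ring with carrier \<open>UNIV\<close>), together with a norm.  The multiplicative fields
  that the record type \<open>module\<close> inherits from rings play no role.
\<close>

record ('k, 'v) nspace = "('k, 'v) module" +
  nrm :: "'v \<Rightarrow> real"

locale normed_space =
  Module.module "ring_of_type_algebra :: 'k ring" V
  for V :: "('k::real_normed_field, 'v) nspace" (structure) +
  assumes nrm_eq_zero: "x \<in> carrier V \<Longrightarrow> nrm V x = 0 \<longleftrightarrow> x = \<zero>"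
    and nrm_triangle: "\<lbrakk>x \<in> carrier V; y \<in> carrier V\<rbrakk> \<Longrightarrow> nrm V (x \<oplus> y) \<le> nrm V x + nrm V y"
    and nrm_smult: "x \<in> carrier V \<Longrightarrow> nrm V (c \<odot> x) = norm c * nrm V x"

text \<open>Cut off outside the carrier, because the locale \<open>Metric_space\<close> demands symmetry and
  nonnegativity on the whole type.\<close>

definition nmetric :: "('k, 'v) nspace \<Rightarrow> 'v \<Rightarrow> 'v \<Rightarrow> real" where
  "nmetric V x y = (if x \<in> carrier V \<and> y \<in> carrier V then nrm V (x \<ominus>\<^bsub>V\<^esub> y) else 0)"

definition ntopology :: "('k, 'v) nspace \<Rightarrow> 'v topology" where
  "ntopology V = Metric_space.mtopology (carrier V) (nmetric V)"

definition banach_space :: "('k::real_normed_field, 'v) nspace \<Rightarrow> bool" where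
  "banach_space V \<longleftrightarrow> normed_space V \<and> Metric_space.mcomplete (carrier V) (nmetric V)"

definition lin_subspace :: "('k::real_normed_field, 'v) nspace \<Rightarrow> 'v set \<Rightarrow> bool" where
  "lin_subspace V W \<longleftrightarrow> submodule W (ring_of_type_algebra :: 'k ring) V"

definition closed_subspace :: "('k::real_normed_field, 'v) nspace \<Rightarrow> 'v set \<Rightarrow> bool" where
  "closed_subspace V W \<longleftrightarrow> lin_subspace V W \<and> closedin (ntopology V) W"

definition infinite_dim :: "('k::real_normed_field, 'v) nspace \<Rightarrow> 'v set \<Rightarrow> bool" where
  "infinite_dim V W \<longleftrightarrow> \<not> (\<exists>S. finite S \<and> S \<subseteq> W \<and> lin_subspace V hull S = W)"

text \<open>Bijectivity of the addition map (part of \<open>homeomorphic_map\<close>) expresses that the sum is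
  algebraically direct.\<close>

definition topological_direct_sum ::
    "('k::real_normed_field, 'v) nspace \<Rightarrow> 'v set \<Rightarrow> 'v set \<Rightarrow> 'v set \<Rightarrow> bool" where
  "topological_direct_sum V Z A B \<longleftrightarrow>
     lin_subspace V Z \<and> lin_subspace V A \<and> lin_subspace V B \<and>
     homeomorphic_map
       (prod_topology (subtopology (ntopology V) A) (subtopology (ntopology V) B))
       (subtopology (ntopology V) Z)
       (\<lambda>(a, b). a \<oplus>\<^bsub>V\<^esub> b)"

definition quotient_space :: "('k, 'v) nspace \<Rightarrow> 'v set \<Rightarrow> ('k, 'v set) nspace" where
  "quotient_space V Y =
     \<lparr>carrier = a_rcosets\<^bsub>V\<^esub> Y, mult = undefined, one = undefined,
      zero = Y, add = set_add V,
      smult = (\<lambda>c C. \<Union>x\<in>C. Y +>\<^bsub>V\<^esub> (c \<odot>\<^bsub>V\<^esub> x)),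
      nrm = (\<lambda>C. INF x\<in>C. nrm V x)\<rparr>"

definition HI :: "('k::real_normed_field, 'v) nspace \<Rightarrow> bool" where
  "HI V \<longleftrightarrow> banach_space V \<and> infinite_dim V (carrier V) \<and>
     \<not> (\<exists>Z A B. closed_subspace V Z \<and>
           closed_subspace V A \<and> infinite_dim V A \<and>
           closed_subspace V B \<and> infinite_dim V B \<and>
           topological_direct_sum V Z A B)"

definition QHI :: "('k::real_normed_field, 'v) nspace \<Rightarrow> bool" where
  "QHI V \<longleftrightarrow> banach_space V \<and>
     (\<forall>Y. closed_subspace V Y \<and>
          infinite_dim (quotient_space V Y) (carrier (quotient_space V Y)) \<longrightarrow>
          HI (quotient_space V Y))"

text \<open>\<open>C\<close> is a completion of \<open>V\<close> via the isometric embedding \<open>\<iota>\<close>; this determines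
  \<open>C\<close> up to isometric isomorphism.\<close>

definition is_completion ::
    "('k::real_normed_field, 'u) nspace \<Rightarrow> ('k, 'v) nspace \<Rightarrow> ('u \<Rightarrow> 'v) \<Rightarrow> bool" where
  "is_completion V C \<iota> \<longleftrightarrow>
     banach_space C \<and>
     \<iota> \<in> carrier V \<rightarrow> carrier C \<and>
     (\<forall>x\<in>carrier V. \<forall>y\<in>carrier V. \<iota> (x \<oplus>\<^bsub>V\<^esub> y) = \<iota> x \<oplus>\<^bsub>C\<^esub> \<iota> y) \<and>
     (\<forall>c. \<forall>x\<in>carrier V. \<iota> (c \<odot>\<^bsub>V\<^esub> x) = c \<odot>\<^bsub>C\<^esub> \<iota> x) \<and>
     (\<forall>x\<in>carrier V. nrm C (\<iota> x) = nrm V x) \<and>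
     Abstract_Topology.closure_of (ntopology C) (\<iota> ` carrier V) = carrier C"


section \<open>Finitely supported sequences\<close>

text \<open>Coordinates are indexed by \<open>nat\<close> starting from 0; only the order of the indices
  matters.\<close>

definition c00 :: "(nat \<Rightarrow> 'k::zero) set" where
  "c00 = {x. finite {i. x i \<noteq> 0}}"

definition intervals :: "nat set set" where
  "intervals = {{a..b} | a b. a \<le> b}"

definition proj :: "nat set \<Rightarrow> (nat \<Rightarrow> 'k::zero) \<Rightarrow> nat \<Rightarrow> 'k" where
  "proj E x = (\<lambda>i. if i \<in> E then x i else 0)"

text \<open>The intersection of all intervals fixing \<open>x\<close> is the smallest one if \<open>x \<noteq> 0\<close>, and
  empty if \<open>x = 0\<close>.\<close>

definition ran :: "(nat \<Rightarrow> 'k::zero) \<Rightarrow> nat set" where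
  "ran x = \<Inter>{E \<in> intervals. proj E x = x}"

definition before :: "nat set \<Rightarrow> nat set \<Rightarrow> bool" where
  "before E F \<longleftrightarrow> E \<noteq> {} \<and> F \<noteq> {} \<and> Max E < Min F"

definition interval_lists :: "nat set list set" where
  "interval_lists = {Es. Es \<noteq> [] \<and> set Es \<subseteq> intervals \<and> sorted_wrt before Es}"

text \<open>Successive vectors are nonzero, also in lists of length one.\<close>

definition successive :: "(nat \<Rightarrow> 'k::zero) list \<Rightarrow> bool" where
  "successive xs \<longleftrightarrow> (\<forall>x\<in>set xs. x \<noteq> (\<lambda>i. 0)) \<and> sorted_wrt (\<lambda>x y. before (ran x) (ran y)) xs"

definition vsum :: "(nat \<Rightarrow> 'k::comm_monoid_add) list \<Rightarrow> nat \<Rightarrow> 'k" where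
  "vsum xs = (\<lambda>i. \<Sum>x\<leftarrow>xs. x i)"

text \<open>The (bilinear) action of \<open>g \<in> c00\<close> as a functional on \<open>x \<in> c00\<close>.\<close>

definition pairing :: "(nat \<Rightarrow> 'k::comm_semiring_0) \<Rightarrow> (nat \<Rightarrow> 'k) \<Rightarrow> 'k" where
  "pairing g x = (\<Sum>i | x i \<noteq> 0. g i * x i)"

definition dual_norm ::
    "((nat \<Rightarrow> 'k) \<Rightarrow> real) \<Rightarrow> (nat \<Rightarrow> 'k::real_normed_field) \<Rightarrow> real" where
  "dual_norm p g = (SUP x\<in>{x \<in> c00. p x \<le> 1}. norm (pairing g x))"


section \<open>The Gowers--Maurey norm\<close>

definition gm_f :: "nat \<Rightarrow> real" where
  "gm_f n = log 2 (real n + 1)"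

text \<open>The set \<open>J\<close> is given by its increasing enumeration \<open>j 1 < j 2 < \<dots>\<close>; the value \<open>j 0\<close> is
  irrelevant.\<close>

definition gm_lacunary :: "(nat \<Rightarrow> nat) \<Rightarrow> bool" where
  "gm_lacunary j \<longleftrightarrow> strict_mono_on {1..} j \<and> gm_f (j 1) > 256 \<and>
     (\<forall>n\<ge>1. ln (ln (ln (real (j (n + 1))))) \<ge> 4 * (real (j n))\<^sup>2)"

definition gm_K :: "(nat \<Rightarrow> nat) \<Rightarrow> nat set" where
  "gm_K j = {j n | n. n \<ge> 1 \<and> odd n}"

definition gm_L :: "(nat \<Rightarrow> nat) \<Rightarrow> nat set" where
  "gm_L j = {j n | n. n \<ge> 1 \<and> even n}"

text \<open>\<open>R\<close> is the set of rational scalars.\<close>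

definition gm_Q :: "'k::real_normed_field set \<Rightarrow> (nat \<Rightarrow> 'k) set" where
  "gm_Q R = {x \<in> c00. \<forall>i. x i \<in> R \<and> norm (x i) \<le> 1}"

definition gm_coding ::
    "'k::real_normed_field set \<Rightarrow> (nat \<Rightarrow> nat) \<Rightarrow> ((nat \<Rightarrow> 'k) list \<Rightarrow> nat) \<Rightarrow> bool" where
  "gm_coding R j \<sigma> \<longleftrightarrow>
     (let S = {ys. ys \<noteq> [] \<and> successive ys \<and> set ys \<subseteq> gm_Q R}
      in inj_on \<sigma> S \<and> \<sigma> ` S \<subseteq> gm_L j)"

text \<open>\<open>A\<^sub>m\<^sup>*\<close> relative to the norm \<open>p\<close>\<close>

definition gm_A ::
    "((nat \<Rightarrow> 'k) \<Rightarrow> real) \<Rightarrow> nat \<Rightarrow> (nat \<Rightarrow> 'k::real_normed_field) set" where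
  "gm_A p m = {(\<lambda>i. vsum xs i / of_real (gm_f m)) | xs.
     length xs = m \<and> successive xs \<and> set xs \<subseteq> c00 \<and> (\<forall>x\<in>set xs. dual_norm p x \<le> 1)}"

text \<open>The list entry \<open>ys ! i\<close> is the vector \<open>y\<^sub>i\<^sub>+\<^sub>1\<^sup>*\<close>, and \<open>take i ys\<close> is
  \<open>y\<^sub>1\<^sup>*, \<dots>, y\<^sub>i\<^sup>*\<close>.\<close>

definition special_sequence ::
    "'k::real_normed_field set \<Rightarrow> (nat \<Rightarrow> nat) \<Rightarrow> ((nat \<Rightarrow> 'k) list \<Rightarrow> nat) \<Rightarrow>
     ((nat \<Rightarrow> 'k) \<Rightarrow> real) \<Rightarrow> nat \<Rightarrow> (nat \<Rightarrow> 'k) list \<Rightarrow> bool" where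
  "special_sequence R j \<sigma> p k ys \<longleftrightarrow>
     length ys = k \<and> successive ys \<and> set ys \<subseteq> gm_Q R \<and>
     ys ! 0 \<in> gm_A p (j (2 * k)) \<and>
     (\<forall>i. 1 \<le> i \<and> i < k \<longrightarrow> ys ! i \<in> gm_A p (\<sigma> (take i ys)))"

definition special_functionals ::
    "'k::real_normed_field set \<Rightarrow> (nat \<Rightarrow> nat) \<Rightarrow> ((nat \<Rightarrow> 'k) list \<Rightarrow> nat) \<Rightarrow>
     ((nat \<Rightarrow> 'k) \<Rightarrow> real) \<Rightarrow> (nat \<Rightarrow> 'k) set" where
  "special_functionals R j \<sigma> p =
     {(\<lambda>i. vsum ys i / of_real (sqrt (gm_f k))) | k ys.
        k \<in> gm_K j \<and> special_sequence R j \<sigma> p k ys}"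

primrec gm_norm_seq ::
    "'k::real_normed_field set \<Rightarrow> (nat \<Rightarrow> nat) \<Rightarrow> ((nat \<Rightarrow> 'k) list \<Rightarrow> nat) \<Rightarrow> nat \<Rightarrow>
     (nat \<Rightarrow> 'k) \<Rightarrow> real" where
  "gm_norm_seq R j \<sigma> 0 = (\<lambda>x. SUP i. norm (x i))"
| "gm_norm_seq R j \<sigma> (Suc n) = (\<lambda>x. max
     (SUP Es\<in>interval_lists. (\<Sum>E\<leftarrow>Es. gm_norm_seq R j \<sigma> n (proj E x)) / gm_f (length Es))
     (SUP (E, g)\<in>intervals \<times> special_functionals R j \<sigma> (gm_norm_seq R j \<sigma> n).
        norm (pairing g (proj E x))))"

definition gm_norm ::
    "'k::real_normed_field set \<Rightarrow> (nat \<Rightarrow> nat) \<Rightarrow> ((nat \<Rightarrow> 'k) list \<Rightarrow> nat) \<Rightarrow>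
     (nat \<Rightarrow> 'k) \<Rightarrow> real" where
  "gm_norm R j \<sigma> x = lim (\<lambda>n. gm_norm_seq R j \<sigma> n x)"

definition gm_c00 ::
    "'k::real_normed_field set \<Rightarrow> (nat \<Rightarrow> nat) \<Rightarrow> ((nat \<Rightarrow> 'k) list \<Rightarrow> nat) \<Rightarrow>
     ('k, nat \<Rightarrow> 'k) nspace" where
  "gm_c00 R j \<sigma> =
     \<lparr>carrier = c00, mult = undefined, one = undefined,
      zero = (\<lambda>i. 0), add = (\<lambda>x y i. x i + y i),
      smult = (\<lambda>c x i. c * x i),
      nrm = gm_norm R j \<sigma>\<rparr>"

definition complex_rationals :: "complex set" where
  "complex_rationals = {z. Re z \<in> \<rat> \<and> Im z \<in> \<rat>}"

end

theory Submission
  imports Defs "HOL-Library.Function_Algebras" "HOL-Real_Asymp.Real_Asymp"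
begin

text \<open>
  Realise \<open>X\<^sub>G\<^sub>M\<close> as the space \<open>G\<close> of all sequences whose finite sections are bounded in the norm.
  Let \<open>Y\<close> be a closed subspace and let \<open>A\<close>, \<open>B\<close> be subspaces containing \<open>Y\<close> with infinite dimensional
  images modulo \<open>Y\<close>. Bounded sequences in \<open>Y\<close> that converge coordinatewise have their limit in \<open>Y\<close>: iterated
  averages of blocks have small norm. Hence, by the Hahn--Banach theorem on finitely many coordinates,
  vectors far from \<open>Y\<close> are separated from it by finitely supported functionals that are almost zero on \<open>Y\<close>.
  The lower estimate with \<open>f\<close> survives in the quotient, which gives near \<open>A\<close> and near \<open>B\<close> vectors \<open>x\<close> that
  average like \<open>\<ell>\<^sub>1\<close>, together with functionals \<open>y\<close> almost vanishing on \<open>Y\<close> such that \<open>y(x) = 1\<close>. Coding the \<open>y\<close>'s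
  as a special sequence of length \<open>k\<close> with the \<open>x\<close>'s alternately near \<open>A\<close> and near \<open>B\<close>, the special
  functional shows that \<open>\<Sum> x\<^sub>i\<close> has distance at least about \<open>k / sqrt (f k)\<close> from \<open>Y\<close>, whereas
  \<open>\<Sum> (-1)\<^sup>i x\<^sub>i\<close> has norm at most a constant times \<open>k / f k\<close>. So the images of \<open>A\<close> and \<open>B\<close> modulo
  \<open>Y\<close> contain \<open>a\<close>, \<open>b\<close> with \<open>a - b\<close> arbitrarily small compared with \<open>a + b\<close>, and their sum cannot be
  a topological direct sum.
\<close>

section \<open>Sequences, projections and functionals\<close>

text \<open>The coding accepts only finitely supported vectors with rational coordinates, and the
  annihilator of \<open>Y\<close> need not contain any; the functionals therefore satisfy only
  \<open>norm (act g y) <= \<eta> * N y\<close> on \<open>Y\<close>, with \<open>\<eta>\<close>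
  small against the length of the special sequence to be formed. Two further obstacles shape the
  argument. The quotient has no basis, so its lower estimates come from functionals upstairs that
  live on disjoint intervals. And the norm is a limit of levels \<open>p n\<close>, whose special
  functionals are relative to \<open>p n\<close>: upper estimates go by induction on the level, and
  functionals are built with norm at most 1/2, which by compactness puts them in the dual unit ball
  of all late levels. Origin of the constants: blocks have norm at most 4, averaging costs a factor
  2, division by a functional value of modulus at least 1/20 leads to 160, a normalised sum of such
  vectors costs a factor 48, a rational factor used by the coding another 2, and the upper estimate
  a factor 3; this gives 160, 7680, 15360 and 46080.\<close>

definition scl :: "'k::times \<Rightarrow> (nat \<Rightarrow> 'k) \<Rightarrow> nat \<Rightarrow> 'k" where
  "scl c x = (\<lambda>i. c * x i)"

text \<open>The sum runs over the support of the functional, so that it makes sense for every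
  sequence \<open>z\<close>; \<open>pairing\<close> sums over the support of the argument
  instead.\<close>

definition act :: "(nat \<Rightarrow> 'k::comm_semiring_0) \<Rightarrow> (nat \<Rightarrow> 'k) \<Rightarrow> 'k" where
  "act g z = (\<Sum>i | g i \<noteq> 0. g i * z i)"

definition l1 :: "(nat \<Rightarrow> 'k::real_normed_field) \<Rightarrow> real" where
  "l1 x = (\<Sum>i | x i \<noteq> 0. norm (x i))"

text \<open>The intervals are half-open, so that consecutive blocks share a breakpoint; the zero
  vector is supported in each of them, also in empty ones.\<close>

definition supp_in :: "(nat \<Rightarrow> 'k::zero) \<Rightarrow> nat \<Rightarrow> nat \<Rightarrow> bool" where
  "supp_in x a b \<longleftrightarrow> (\<forall>i. x i \<noteq> 0 \<longrightarrow> a \<le> i \<and> i < b)"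

lemma sum_fun_apply: "(\<Sum>i\<in>A. x i) k = (\<Sum>i\<in>A. x i k)"
  for x :: "'a \<Rightarrow> nat \<Rightarrow> 'k::comm_monoid_add"
  by (induction A rule: infinite_finite_induct) auto

lemma scl_apply [simp]: "scl c x i = c * x i"
  by (simp add: scl_def)

lemma proj_apply [simp]: "proj E x i = (if i \<in> E then x i else 0)"
  by (simp add: proj_def)

lemma proj_add: "proj E (x + y) = proj E x + proj E y" for x :: "nat \<Rightarrow> 'k::real_normed_field"
  by auto

lemma proj_diff: "proj E (x - y) = proj E x - proj E y" for x :: "nat \<Rightarrow> 'k::real_normed_field"
  by auto

lemma proj_scl: "proj E (scl c x) = scl c (proj E x)" for x :: "nat \<Rightarrow> 'k::real_normed_field"
  by auto

lemma proj_sum: "proj E (\<Sum>i\<in>A. x i) = (\<Sum>i\<in>A. proj E (x i))"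
  for x :: "'a \<Rightarrow> nat \<Rightarrow> 'k::real_normed_field"
  by (rule ext) (simp add: sum_fun_apply)

lemma proj_proj [simp]: "proj E (proj F x) = proj (E \<inter> F) x"
  by auto

lemma proj_zero [simp]: "proj E 0 = (0::nat \<Rightarrow> 'k::real_normed_field)" "proj {} y = (0::nat \<Rightarrow> 'k::real_normed_field)"
  by auto

lemma scl_add: "scl c (x + y) = scl c x + scl c y" for x :: "nat \<Rightarrow> 'k::real_normed_field"
  by (auto simp: algebra_simps)

lemma scl_diff: "scl c (x - y) = scl c x - scl c y" for x :: "nat \<Rightarrow> 'k::real_normed_field"
  by (auto simp: algebra_simps)

lemma scl_sum: "scl c (\<Sum>i\<in>A. x i) = (\<Sum>i\<in>A. scl c (x i))"
  for x :: "'a \<Rightarrow> nat \<Rightarrow> 'k::real_normed_field"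
  by (rule ext) (simp add: sum_fun_apply sum_distrib_left)

lemma scl_scl [simp]: "scl c (scl d x) = scl (c * d) x" for x :: "nat \<Rightarrow> 'k::real_normed_field"
  by auto

lemma scl_simps [simp]: "scl 1 x = x" "scl 0 x = 0" "scl (c::'k) 0 = 0" "scl (- 1) x = - x"
  for x :: "nat \<Rightarrow> 'k::real_normed_field"
  by (rule ext, simp)+

lemmas seq_apply = proj_apply scl_apply plus_fun_apply zero_fun_apply minus_apply uminus_apply

declare proj_apply [simp del] scl_apply [simp del] plus_fun_apply [simp del] zero_fun_apply [simp del]
  minus_apply [simp del] uminus_apply [simp del]

section \<open>Supports of finitely supported sequences\<close>

lemma c00_iff: "x \<in> c00 \<longleftrightarrow> (\<exists>r. supp_in x 0 r)"
  unfolding c00_def supp_in_def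
  by (auto simp: finite_nat_set_iff_bounded)

lemma c00E: assumes "x \<in> c00" obtains r where "supp_in x 0 r"
  using assms c00_iff by blast

lemma supp_in_c00: "supp_in x a b \<Longrightarrow> x \<in> c00"
  unfolding c00_iff supp_in_def by auto

lemma supp_in_mono: "supp_in x a b \<Longrightarrow> a' \<le> a \<Longrightarrow> b \<le> b' \<Longrightarrow> supp_in x a' b'"
  by (force simp: supp_in_def)

lemma supp_in_zero: "supp_in x a b \<Longrightarrow> i < a \<or> b \<le> i \<Longrightarrow> x i = 0"
  by (force simp: supp_in_def)

lemma supp_in_proj_eq: "supp_in x a b \<Longrightarrow> proj {a..<b} x = x"
  by (rule ext) (auto simp: supp_in_def seq_apply)

lemma supp_in_proj [intro]: "supp_in (proj {a..<b} x) a b"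
  by (auto simp: supp_in_def seq_apply)

lemma supp_in_proj2: "supp_in x a b \<Longrightarrow> supp_in (proj E x) a b"
  by (auto simp: supp_in_def seq_apply)

lemma proj_disjoint: "supp_in x a b \<Longrightarrow> d \<le> a \<or> b \<le> c \<Longrightarrow> proj {c..<d} x = 0" for x :: "nat \<Rightarrow> 'k::real_normed_field"
  by (rule ext) (auto simp: supp_in_def seq_apply)

lemma supp_in_add: "supp_in x a b \<Longrightarrow> supp_in y a b \<Longrightarrow> supp_in (x + y) a b" for x :: "nat \<Rightarrow> 'k::real_normed_field"
  unfolding supp_in_def by (metis add.right_neutral plus_fun_apply)

lemma supp_in_diff: "supp_in x a b \<Longrightarrow> supp_in y a b \<Longrightarrow> supp_in (x - y) a b" for x :: "nat \<Rightarrow> 'k::real_normed_field"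
  unfolding supp_in_def by (metis diff_zero minus_apply)

lemma supp_in_scl: "supp_in x a b \<Longrightarrow> supp_in (scl c x) a b" for x :: "nat \<Rightarrow> 'k::real_normed_field"
  by (auto simp: supp_in_def seq_apply)

lemma supp_in_0 [simp]: "supp_in (0::nat \<Rightarrow> 'k::real_normed_field) a b"
  by (auto simp: supp_in_def seq_apply)

lemma supp_in_sum: "(\<And>i. i \<in> A \<Longrightarrow> supp_in (x i) a b) \<Longrightarrow> supp_in (\<Sum>i\<in>A. x i) a b"
  for x :: "'a \<Rightarrow> nat \<Rightarrow> 'k::real_normed_field"
  by (induction A rule: infinite_finite_induct) (auto intro: supp_in_add)

lemma c00_zero [simp]: "(0::nat \<Rightarrow> 'k::real_normed_field) \<in> c00"
  by (auto simp: c00_def seq_apply)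

lemma c00_add [intro]: "x \<in> c00 \<Longrightarrow> y \<in> c00 \<Longrightarrow> x + y \<in> c00" for x :: "nat \<Rightarrow> 'k::real_normed_field"
  unfolding c00_def by (rule CollectI, rule finite_subset[of _ "{i. x i \<noteq> 0} \<union> {i. y i \<noteq> 0}"]) (auto simp: seq_apply)

lemma c00_diff [intro]: "x \<in> c00 \<Longrightarrow> y \<in> c00 \<Longrightarrow> x - y \<in> c00" for x :: "nat \<Rightarrow> 'k::real_normed_field"
  unfolding c00_def by (rule CollectI, rule finite_subset[of _ "{i. x i \<noteq> 0} \<union> {i. y i \<noteq> 0}"]) (auto simp: seq_apply)

lemma c00_scl [intro]: "x \<in> c00 \<Longrightarrow> scl c x \<in> c00" for x :: "nat \<Rightarrow> 'k::real_normed_field"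
  unfolding c00_def by (rule CollectI, rule finite_subset[of _ "{i. x i \<noteq> 0}"]) (auto simp: seq_apply)

lemma c00_sum [intro]: "(\<And>i. i \<in> A \<Longrightarrow> x i \<in> c00) \<Longrightarrow> (\<Sum>i\<in>A. x i) \<in> c00"
  for x :: "'a \<Rightarrow> nat \<Rightarrow> 'k::real_normed_field"
  by (induction A rule: infinite_finite_induct) auto

lemma c00_proj [intro]: "x \<in> c00 \<Longrightarrow> proj E x \<in> c00"
  unfolding c00_def by (rule CollectI, rule finite_subset[of _ "{i. x i \<noteq> 0}"]) (auto simp: seq_apply)

lemma c00_proj_fin [intro]: "proj {a..<b} x \<in> c00"
  by (rule supp_in_c00[OF supp_in_proj])

section \<open>Finitely supported functionals acting on arbitrary sequences\<close>

lemma act_eq: "supp_in g a b \<Longrightarrow> act g z = (\<Sum>i=a..<b. g i * z i)"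
  unfolding act_def by (rule sum.mono_neutral_left) (auto simp: supp_in_def seq_apply)

lemma act_add: "act g (x + y) = act g x + act g y"
  by (simp add: act_def seq_apply algebra_simps sum.distrib)

lemma act_diff: "act g (x - y) = act g x - act g y" for x :: "nat \<Rightarrow> 'k::real_normed_field"
  by (simp add: act_def seq_apply algebra_simps sum_subtractf)

lemma act_scl: "act g (scl c x) = c * act g x" for x :: "nat \<Rightarrow> 'k::real_normed_field"
  by (simp add: act_def seq_apply sum_distrib_left mult_ac)

lemma act_zero [simp]: "act g 0 = 0" for g :: "nat \<Rightarrow> 'k::real_normed_field"
  by (simp add: act_def seq_apply)

lemma act_zero_left [simp]: "act 0 x = 0" for x :: "nat \<Rightarrow> 'k::real_normed_field"
  by (simp add: act_def seq_apply)

lemma act_sum: "act g (\<Sum>i\<in>A. x i) = (\<Sum>i\<in>A. act g (x i))"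
  for x :: "'a \<Rightarrow> nat \<Rightarrow> 'k::real_normed_field"
  by (induction A rule: infinite_finite_induct) (simp_all add: act_add)

lemma act_add_left: fixes g :: "nat \<Rightarrow> 'k::real_normed_field" assumes "g \<in> c00" "h \<in> c00" shows "act (g + h) x = act g x + act h x"
proof -
  obtain r s where "supp_in g 0 r" "supp_in h 0 s" using assms c00E by metis
  then have "supp_in g 0 (max r s)" "supp_in h 0 (max r s)" by (auto intro: supp_in_mono)
  then show ?thesis
    using act_eq supp_in_add[of g 0 "max r s" h] by (simp add: act_eq seq_apply sum.distrib algebra_simps)
qed

lemma act_scl_left: "act (scl c g) x = c * act g x" for g :: "nat \<Rightarrow> 'k::real_normed_field"
  by (cases "c = 0") (auto simp: act_def seq_apply sum_distrib_left mult_ac)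

lemma act_sum_left: fixes g :: "'a \<Rightarrow> nat \<Rightarrow> 'k::real_normed_field" assumes "\<And>i. i \<in> A \<Longrightarrow> g i \<in> c00"
  shows "act (\<Sum>i\<in>A. g i) x = (\<Sum>i\<in>A. act (g i) x)"
  using assms
  by (induction A rule: infinite_finite_induct) (simp_all add: act_add_left c00_sum)

lemma act_proj: "supp_in g a b \<Longrightarrow> act g x = act g (proj {a..<b} x)" for x :: "nat \<Rightarrow> 'k::real_normed_field"
  by (simp add: act_eq seq_apply)

lemma pairing_eq_act: fixes g :: "nat \<Rightarrow> 'k::real_normed_field" assumes that: "g \<in> c00" "x \<in> c00" shows "pairing g x = act g x"
proof -
  have "pairing g x = (\<Sum>i\<in>{i. x i \<noteq> 0} \<union> {i. g i \<noteq> 0}. g i * x i)"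
    unfolding pairing_def using that by (intro sum.mono_neutral_left) (auto simp: c00_def seq_apply)
  also have "\<dots> = act g x"
    unfolding act_def using that by (intro sum.mono_neutral_right) (auto simp: c00_def seq_apply)
  finally show ?thesis .
qed

section \<open>The l1 norm of finitely supported sequences\<close>

lemma l1_eq: "supp_in x a b \<Longrightarrow> l1 x = (\<Sum>i=a..<b. norm (x i))"
  unfolding l1_def by (rule sum.mono_neutral_left) (auto simp: supp_in_def seq_apply)

lemma l1_nonneg [simp]: "l1 x \<ge> 0"
  by (simp add: l1_def sum_nonneg)

lemma l1_mono: assumes "x \<in> c00" "\<And>i. norm (y i) \<le> norm (x i)" shows "l1 y \<le> l1 x"
proof -
  have "{i. y i \<noteq> 0} \<subseteq> {i. x i \<noteq> 0}" using assms(2)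
    by (metis (mono_tags, lifting) Collect_mono norm_le_zero_iff norm_zero)
  then have "(\<Sum>i | y i \<noteq> 0. norm (y i)) \<le> (\<Sum>i | x i \<noteq> 0. norm (y i))"
    using assms(1) by (intro sum_mono2) (auto simp: c00_def seq_apply)
  also have "\<dots> \<le> l1 x" unfolding l1_def using assms(2) by (rule sum_mono)
  finally show ?thesis by (simp add: l1_def seq_apply)
qed

lemma l1_proj: "x \<in> c00 \<Longrightarrow> l1 (proj E x) \<le> l1 x"
  by (rule l1_mono) (auto simp: seq_apply)

lemma l1_add: "x \<in> c00 \<Longrightarrow> y \<in> c00 \<Longrightarrow> l1 (x + y) \<le> l1 x + l1 y"
proof -
  assume "x \<in> c00" "y \<in> c00"
  then obtain r s where "supp_in x 0 r" "supp_in y 0 s" using c00E by metis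
  then have a: "supp_in x 0 (max r s)" "supp_in y 0 (max r s)" by (auto intro: supp_in_mono)
  show ?thesis
    unfolding l1_eq[OF a(1)] l1_eq[OF a(2)] l1_eq[OF supp_in_add[OF a]] sum.distrib[symmetric]
    by (rule sum_mono) (auto simp: norm_triangle_ineq seq_apply)
qed

lemma l1_zero [simp]: "l1 0 = 0"
  by (simp add: l1_def seq_apply)

lemma l1_scl: "l1 (scl c x) = norm c * l1 x"
  by (cases "c = 0") (auto simp: l1_def seq_apply norm_mult sum_distrib_left)

lemma norm_act_le_l1: "g \<in> c00 \<Longrightarrow> x \<in> c00 \<Longrightarrow> (\<And>i. norm (g i) \<le> C) \<Longrightarrow> norm (act g x) \<le> C * l1 x"
proof -
  assume a: "g \<in> c00" "x \<in> c00" "\<And>i. norm (g i) \<le> C"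
  have "norm (pairing g x) \<le> (\<Sum>i | x i \<noteq> 0. C * norm (x i))"
    unfolding pairing_def by (rule sum_norm_le) (auto simp: norm_mult a(3) mult_right_mono)
  then show ?thesis using a by (simp add: pairing_eq_act l1_def sum_distrib_left)
qed

lemma norm_act_le_l1': "g \<in> c00 \<Longrightarrow> (\<And>i. norm (x i) \<le> C) \<Longrightarrow> norm (act g x) \<le> l1 g * C"
proof -
  assume a: "g \<in> c00" "\<And>i. norm (x i) \<le> C"
  have "norm (act g x) \<le> (\<Sum>i | g i \<noteq> 0. norm (g i) * C)"
    unfolding act_def by (rule sum_norm_le) (auto simp: norm_mult a(2) mult_left_mono)
  then show ?thesis by (simp add: l1_def sum_distrib_right)
qed

lemma sum_l1_proj_le:
  assumes "mono t" "x \<in> c00"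
  shows "(\<Sum>l<M. l1 (proj {t l..<t (Suc l)} x)) \<le> l1 x"
proof -
  have "(\<Sum>l<M. l1 (proj {t l..<t (Suc l)} x)) \<le> l1 (proj {..<t M} x)" for M
  proof (induction M)
    case (Suc M)
    have *: "l1 (proj {..<t (Suc M)} x) = l1 (proj {..<t M} x) + l1 (proj {t M..<t (Suc M)} x)"
    proof -
      have le: "t M \<le> t (Suc M)" using assms(1) by (simp add: mono_def)
      have s: "supp_in (proj {..<b} x) 0 b" for b by (auto simp: supp_in_def proj_apply)
      have "l1 (proj {..<t (Suc M)} x) = (\<Sum>i=0..<t (Suc M). norm (x i))"
        by (subst l1_eq[OF s]) (auto simp: proj_apply)
      also have "\<dots> = (\<Sum>i=0..<t M. norm (x i)) + (\<Sum>i=t M..<t (Suc M). norm (x i))"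
        using le by (simp add: sum.atLeastLessThan_concat)
      finally show ?thesis by (subst l1_eq[OF s]) (subst l1_eq[OF supp_in_proj], auto simp: proj_apply)
    qed
    show ?case using Suc * by simp
  qed (simp add: sum_nonneg)
  then show ?thesis using l1_proj[OF assms(2)] order_trans by blast
qed

section \<open>Successive sets and breakpoints\<close>

text \<open>Lists of successive sets are traded for one monotone sequence of breakpoints, the form
  in which the norm is handled from here on. A gap between two sets goes to the interval of the
  earlier one; beyond the last set the breakpoints are constant.\<close>

lemma breakpoints_of_before:
  assumes "sorted_wrt before Es" "\<And>E. E \<in> set Es \<Longrightarrow> finite E \<and> E \<noteq> {}"
  obtains t where "mono t" "\<And>l. l < length Es \<Longrightarrow> Es ! l \<subseteq> {t l..<t (Suc l)}"
proof
  let ?M = "length Es"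
  define t where "t l = (if l < ?M then Min (Es ! l) else if Es = [] then 0 else Suc (Max (last Es)))" for l
  have fin: "finite (Es ! l)" "Es ! l \<noteq> {}" if "l < ?M" for l using assms(2) that by auto
  have lt: "Max (Es ! l) < t (Suc l)" if "l < ?M" for l
  proof (cases "Suc l < ?M")
    case True
    then show ?thesis using assms(1) that unfolding t_def sorted_wrt_iff_nth_less before_def by auto
  next
    case False
    then have "l = ?M - 1" "Es \<noteq> []" using that by auto
    then show ?thesis by (simp add: t_def last_conv_nth)
  qed
  show "mono t"
  proof (rule mono_iff_le_Suc[THEN iffD2], rule)
    fix l show "t l \<le> t (Suc l)"
    proof (cases "l < ?M")
      case True
      then have "t l \<le> Max (Es ! l)" using fin by (simp add: t_def)
      then show ?thesis using lt[OF True] by simp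
    qed (simp add: t_def)
  qed
  fix l assume l: "l < ?M"
  show "Es ! l \<subseteq> {t l..<t (Suc l)}"
  proof
    fix i assume "i \<in> Es ! l"
    then have "t l \<le> i" "i \<le> Max (Es ! l)" using l fin by (auto simp: t_def)
    then show "i \<in> {t l..<t (Suc l)}" using lt[OF l] by simp
  qed
qed

lemma ran_props:
  assumes "x \<in> c00" "x \<noteq> (\<lambda>i. 0)"
  shows "finite (ran x)" "ran x \<noteq> {}" "x i \<noteq> 0 \<Longrightarrow> i \<in> ran x" "supp_in x a b \<Longrightarrow> ran x \<subseteq> {a..<b}"
proof -
  have mem: "i \<in> ran x" if "x i \<noteq> 0" for i
  proof -
    have "i \<in> E" if "proj E x = x" for E
      using fun_cong[OF that, of i] \<open>x i \<noteq> 0\<close> by (auto simp: proj_apply split: if_splits)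
    then show ?thesis unfolding ran_def by blast
  qed
  have sub: "ran x \<subseteq> {a..<b}" if "supp_in x a b" for a b
  proof -
    obtain i where "x i \<noteq> 0" using assms(2) by auto
    then have "a < b" using that unfolding supp_in_def by force
    then have "{a..b - 1} = {a..<b}" by auto
    moreover have "{a..b-1} \<in> intervals" using \<open>a < b\<close> unfolding intervals_def by (metis (mono_tags, lifting) mem_Collect_eq Suc_pred' less_Suc_eq_le less_nat_zero_code neq0_conv)
    ultimately show ?thesis unfolding ran_def using supp_in_proj_eq[OF that] by auto
  qed
  obtain r where "supp_in x 0 r" using assms c00E by metis
  then show "finite (ran x)" using sub finite_subset by blast
  show "ran x \<noteq> {}" using mem assms(2) by auto
  show "x i \<noteq> 0 \<Longrightarrow> i \<in> ran x" using mem .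
  show "supp_in x a b \<Longrightarrow> ran x \<subseteq> {a..<b}" using sub .
qed

lemma breakpoints_of_successive:
  assumes "successive xs" "set xs \<subseteq> c00"
  obtains t where "mono t" "\<And>l. l < length xs \<Longrightarrow> supp_in (xs ! l) (t l) (t (Suc l))"
proof -
  have xs: "x \<in> c00" "x \<noteq> (\<lambda>i. 0)" if "x \<in> set xs" for x using assms that by (auto simp: successive_def)
  have "sorted_wrt before (map ran xs)" using assms(1) by (auto simp: successive_def sorted_wrt_map)
  then have "\<exists>t. mono t \<and> (\<forall>l. l < length (map ran xs) \<longrightarrow> map ran xs ! l \<subseteq> {t l..<t (Suc l)})"
    using breakpoints_of_before[of "map ran xs"] xs ran_props(1,2) by (smt (verit) imageE list.set_map)
  then obtain t where t: "mono t" "\<And>l. l < length (map ran xs) \<Longrightarrow> map ran xs ! l \<subseteq> {t l..<t (Suc l)}"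
    by blast
  show ?thesis
  proof (rule that[OF t(1)])
    fix l assume "l < length xs"
    then show "supp_in (xs ! l) (t l) (t (Suc l))"
      using t(2)[of l] ran_props(3)[OF xs[of "xs ! l"]] unfolding supp_in_def by fastforce
  qed
qed

lemma before_ran: "x \<in> c00 \<Longrightarrow> y \<in> c00 \<Longrightarrow> x \<noteq> (\<lambda>i. 0) \<Longrightarrow> y \<noteq> (\<lambda>i. 0) \<Longrightarrow> supp_in x a b \<Longrightarrow> supp_in y b' c \<Longrightarrow> b \<le> b'
   \<Longrightarrow> before (ran x) (ran y)"
proof -
  assume a: "x \<in> c00" "y \<in> c00" "x \<noteq> (\<lambda>i. 0)" "y \<noteq> (\<lambda>i. 0)" "supp_in x a b" "supp_in y b' c" "b \<le> b'"
  note rx = ran_props[OF a(1,3)] and ry = ran_props[OF a(2,4)]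
  have "Max (ran x) \<in> ran x" "Min (ran y) \<in> ran y" using rx(1,2) ry(1,2) by (auto intro: Max_in Min_in)
  moreover have "ran x \<subseteq> {a..<b}" "ran y \<subseteq> {b'..<c}" using rx(4) ry(4) a by blast+
  ultimately have "Max (ran x) < b" "b' \<le> Min (ran y)" by auto
  then show ?thesis unfolding before_def using rx(2) ry(2) a(7) by auto
qed

lemma successive_of_breakpoints:
  assumes "mono t" "\<And>l. l < M \<Longrightarrow> supp_in (x l) (t l) (t (Suc l))" "\<And>l. l < M \<Longrightarrow> x l \<noteq> (\<lambda>i. 0)"
  shows "successive (map x [0..<M])"
  unfolding successive_def
proof
  show "\<forall>v\<in>set (map x [0..<M]). v \<noteq> (\<lambda>i. 0)" using assms(3) by auto
  show "sorted_wrt (\<lambda>x y. before (ran x) (ran y)) (map x [0..<M])"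
    unfolding sorted_wrt_iff_nth_less
  proof (intro allI impI)
    fix a b assume ab: "a < b" "b < length (map x [0..<M])"
    then have "t (Suc a) \<le> t b" using assms(1) by (simp add: mono_def)
    then show "before (ran (map x [0..<M] ! a)) (ran (map x [0..<M] ! b))"
      using ab assms(2,3)[of a] assms(2,3)[of b]
      by (auto intro: before_ran[of _ _ "t a" "t (Suc a)" "t b" "t (Suc b)"] supp_in_c00)
  qed
qed

lemma vsum_eq: "vsum xs = (\<Sum>l<length xs. xs ! l)" for xs :: "(nat \<Rightarrow> 'k::real_normed_field) list"
  unfolding vsum_def by (rule ext) (simp add: sum_fun_apply sum_list_sum_nth atLeast0LessThan)

section \<open>Numerical facts about the function \<open>gm_f\<close>\<close>

lemma gm_f_1 [simp]: "gm_f 1 = 1" "gm_f (Suc 0) = 1" "gm_f 0 = 0"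
  by (simp_all add: gm_f_def)

lemma gm_f_mono: "m \<le> n \<Longrightarrow> gm_f m \<le> gm_f n"
  by (simp add: gm_f_def)

lemma gm_f_ge1: "m \<ge> 1 \<Longrightarrow> gm_f m \<ge> 1"
  using gm_f_mono[of 1 m] by simp

lemma gm_f_nonneg [simp]: "gm_f m \<ge> 0"
  using gm_f_mono[of 0 m] by simp

lemma gm_f_pos: "m \<ge> 1 \<Longrightarrow> gm_f m > 0"
  using gm_f_ge1[of m] by simp

lemma gm_f_at_top: "filterlim gm_f at_top sequentially"
  unfolding gm_f_def by real_asymp

lemma gm_f_over_n: "(\<lambda>n. gm_f n / real n) \<longlonglongrightarrow> 0"
  unfolding gm_f_def by real_asymp


section \<open>Dual norms and special functionals\<close>

text \<open>The properties shared by all levels of the norm: a norm on \<open>c00\<close> between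
  the sup norm and the l1 norm for which interval projections are contractions. They keep the
  suprema in the next level bounded.\<close>

definition good :: "((nat \<Rightarrow> 'k::real_normed_field) \<Rightarrow> real) \<Rightarrow> bool" where
  "good q \<longleftrightarrow> (\<forall>x\<in>c00. (\<forall>i. norm (x i) \<le> q x) \<and> q x \<le> l1 x \<and> (\<forall>y\<in>c00. q (x + y) \<le> q x + q y) \<and>
     (\<forall>c. q (scl c x) = norm c * q x) \<and> (\<forall>a b. q (proj {a..<b} x) \<le> q x))"

lemma goodD:
  assumes "good q" "x \<in> c00"
  shows "norm (x i) \<le> q x" "q x \<le> l1 x" "y \<in> c00 \<Longrightarrow> q (x + y) \<le> q x + q y"
    "q (scl c x) = norm c * q x" "q (proj {a..<b} x) \<le> q x" "q x \<ge> 0"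
proof -
  show "norm (x i) \<le> q x" "q x \<le> l1 x" "y \<in> c00 \<Longrightarrow> q (x + y) \<le> q x + q y"
    "q (scl c x) = norm c * q x" "q (proj {a..<b} x) \<le> q x" using assms unfolding good_def by auto
  show "q x \<ge> 0" using assms order_trans[OF norm_ge_zero] unfolding good_def by blast
qed

lemma good_zero: "good q \<Longrightarrow> q 0 = 0"
  using goodD(4)[of q 0 0] by simp

lemma dual_norm_upper:
  assumes "good q" "g \<in> c00" "x \<in> c00"
  shows "norm (act g x) \<le> dual_norm q g * q x"
proof -
  \<comment> \<open>\<open>dual_norm\<close> is a supremum of reals, so it is an upper bound only
    once boundedness is known; the sup norm bound in \<open>good\<close> supplies this.\<close>
  have "norm (act g y) \<le> l1 g * 1" if "y \<in> c00" "q y \<le> 1" for y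
    using goodD(1)[OF assms(1) that(1)] that(2) by (intro norm_act_le_l1' assms) (meson order_trans)
  then have bdd: "bdd_above ((\<lambda>x. norm (pairing g x)) ` {x \<in> c00. q x \<le> 1})"
    using assms by (intro bdd_aboveI2[of _ _ "l1 g"]) (auto simp: pairing_eq_act)
  show ?thesis
  proof (cases "q x = 0")
    case True
    then have "x = 0" using goodD(1)[OF assms(1,3)] by (auto simp: fun_eq_iff seq_apply)
    then show ?thesis using True by simp
  next
    case False
    then have pos: "q x > 0" using goodD(6)[OF assms(1,3)] by simp
    let ?x = "scl (of_real (1 / q x)) x"
    have "q ?x = 1" using goodD(4)[OF assms(1,3)] pos by (simp add: norm_divide)
    then have "norm (pairing g ?x) \<le> dual_norm q g"
      unfolding dual_norm_def using assms by (intro cSUP_upper bdd) auto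
    then have "norm (act g x) / q x \<le> dual_norm q g"
      using assms pos by (subst (asm) pairing_eq_act) (auto simp: act_scl norm_mult norm_divide)
    then show ?thesis using pos by (simp add: field_simps)
  qed
qed

lemma dual_norm_least:
  assumes "good q" "g \<in> c00" "\<And>x. x \<in> c00 \<Longrightarrow> q x \<le> 1 \<Longrightarrow> norm (act g x) \<le> C"
  shows "dual_norm q g \<le> C"
  unfolding dual_norm_def
  by (rule cSUP_least) (use assms in \<open>auto simp: pairing_eq_act good_zero intro!: exI[of _ 0]\<close>)

text \<open>A functional in \<open>gm_A q m\<close> is dominated by one of the averages over
  \<open>m\<close> intervals that define the next level of the norm; the breakpoints
  \<open>t\<close> are those of its \<open>m\<close> summands.\<close>

lemma gm_A_D:
  assumes "y \<in> gm_A q m" "good q"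
  shows "y \<in> c00" "\<exists>t. mono t \<and> (\<forall>x\<in>c00. norm (act y x) \<le> (\<Sum>s<m. q (proj {t s..<t (Suc s)} x)) / gm_f m)"
proof -
  obtain xs where xs: "length xs = m" "successive xs" "set xs \<subseteq> c00" "\<forall>x\<in>set xs. dual_norm q x \<le> 1"
    and y: "y = (\<lambda>i. vsum xs i / of_real (gm_f m))" using assms unfolding gm_A_def by auto
  obtain t where t: "mono t" "\<And>l. l < length xs \<Longrightarrow> supp_in (xs ! l) (t l) (t (Suc l))"
    using breakpoints_of_successive xs by blast
  have y': "y = scl (1 / of_real (gm_f m)) (\<Sum>l<m. xs ! l)" by (auto simp: y vsum_eq xs seq_apply)
  have c: "xs ! l \<in> c00" if "l < m" for l using xs that by auto
  show "y \<in> c00" unfolding y' using c by auto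
  show "\<exists>t. mono t \<and> (\<forall>x\<in>c00. norm (act y x) \<le> (\<Sum>s<m. q (proj {t s..<t (Suc s)} x)) / gm_f m)"
  proof (intro exI conjI ballI)
    fix x :: "nat \<Rightarrow> 'a" assume x: "x \<in> c00"
    have "norm (act y x) = norm (\<Sum>l<m. act (xs ! l) x) / gm_f m"
      unfolding y' using c act_sum_left[of "{..<m}" "(!) xs" x] by (simp add: act_scl_left norm_mult norm_divide)
    also have "\<dots> \<le> (\<Sum>s<m. q (proj {t s..<t (Suc s)} x)) / gm_f m"
    proof (intro divide_right_mono sum_norm_le)
      fix s assume s: "s \<in> {..<m}"
      have "norm (act (xs ! s) x) = norm (act (xs ! s) (proj {t s..<t (Suc s)} x))"
        using act_proj[OF t(2)[of s]] s xs by simp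
      also have "\<dots> \<le> dual_norm q (xs ! s) * q (proj {t s..<t (Suc s)} x)"
        using s c x assms by (intro dual_norm_upper) auto
      also have "\<dots> \<le> q (proj {t s..<t (Suc s)} x)"
        using xs s goodD(6)[OF assms(2), of "proj {t s..<t (Suc s)} x"] x mult_right_mono[of "dual_norm q (xs!s)" 1] by fastforce
      finally show "norm (act (xs ! s) x) \<le> q (proj {t s..<t (Suc s)} x)" .
    qed simp
    finally show "norm (act y x) \<le> (\<Sum>s<m. q (proj {t s..<t (Suc s)} x)) / gm_f m" .
  qed (rule t(1))
qed

lemma gm_A_I:
  assumes "good q" "mono t" "\<And>l. l < m \<Longrightarrow> supp_in (z l) (t l) (t (Suc l))" "\<And>l. l < m \<Longrightarrow> z l \<noteq> 0"
    "\<And>l x. l < m \<Longrightarrow> x \<in> c00 \<Longrightarrow> norm (act (z l) x) \<le> q x"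
  shows "scl (1 / of_real (gm_f m)) (\<Sum>l<m. z l) \<in> gm_A q m"
  unfolding gm_A_def
proof (intro CollectI exI conjI)
  let ?xs = "map z [0..<m]"
  have c: "z l \<in> c00" if "l < m" for l using assms(3) that supp_in_c00 by blast
  show "scl (1 / of_real (gm_f m)) (\<Sum>l<m. z l) = (\<lambda>i. vsum ?xs i / of_real (gm_f m))"
    by (rule ext) (simp add: vsum_eq seq_apply)
  show "successive ?xs" using assms by (intro successive_of_breakpoints) (auto simp: zero_fun_def)
  show "set ?xs \<subseteq> c00" using c by auto
  show "\<forall>x\<in>set ?xs. dual_norm q x \<le> 1"
  proof
    fix x assume "x \<in> set ?xs"
    then obtain l where l: "l < m" "x = z l" by auto
    show "dual_norm q x \<le> 1" unfolding l(2)
      using assms(5)[OF l(1)] c[OF l(1)] by (intro dual_norm_least[OF assms(1)]) (meson order_trans)+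
  qed
qed simp

lemma successive_snoc:
  assumes "successive xs" "\<And>x. x \<in> set xs \<Longrightarrow> supp_in x 0 b" "supp_in v b c" "v \<noteq> 0"
  shows "successive (xs @ [v])"
  using assms unfolding successive_def
  by (auto simp: sorted_wrt_append zero_fun_def intro!: before_ran supp_in_c00)

lemma gm_lacunaryD:
  assumes "gm_lacunary j"
  shows "1 \<le> a \<Longrightarrow> a < b \<Longrightarrow> j a < j b" "1 \<le> a \<Longrightarrow> gm_f (j a) > 256" "1 \<le> a \<Longrightarrow> j a \<ge> 2"
    "1 \<le> a \<Longrightarrow> a < b \<Longrightarrow> ln (ln (ln (real (j b)))) \<ge> 4 * (real (j a))\<^sup>2"
proof -
  show mono: "j a < j b" if "1 \<le> a" "a < b" for a b
    using assms that unfolding gm_lacunary_def strict_mono_on_def by auto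
  show f: "gm_f (j a) > 256" if "1 \<le> a" for a
    using assms gm_f_mono[of "j 1" "j a"] mono[of 1 a] that unfolding gm_lacunary_def
    by (cases "a = 1") auto
  show "j a \<ge> 2" if "1 \<le> a"
    using f[OF that] gm_f_mono[of "j a" 1] by (cases "j a \<le> 1") auto
  show "ln (ln (ln (real (j b)))) \<ge> 4 * (real (j a))\<^sup>2" if "1 \<le> a" "a < b"
  proof -
    obtain c where c: "b = Suc c" "a \<le> c" using \<open>a < b\<close> by (cases b) auto
    have "j a \<le> j c" using mono[of a c] c that by (cases "a = c") auto
    then have "(real (j a))\<^sup>2 \<le> (real (j c))\<^sup>2" by (simp add: power_mono)
    moreover have "ln (ln (ln (real (j (c + 1))))) \<ge> 4 * (real (j c))\<^sup>2"
      using assms c that unfolding gm_lacunary_def by auto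
    ultimately have "4 * (real (j a))\<^sup>2 \<le> ln (ln (ln (real (j (c + 1)))))" by linarith
    then show ?thesis using c(1) by simp
  qed
qed

text \<open>Real and complex scalars are covered together: \<open>rho\<close> is the real part,
  which is the identity for real scalars, and \<open>rho_rep\<close> says that every real-linear
  functional on the scalar field is the real part of a multiplication. \<open>R\<close> stands for
  the rational scalars.\<close>

locale gm =
  fixes R :: "'k::{real_normed_field,heine_borel} set" and j :: "nat \<Rightarrow> nat"
    and \<sigma> :: "(nat \<Rightarrow> 'k) list \<Rightarrow> nat" and rho :: "'k \<Rightarrow> real"
  assumes lac: "gm_lacunary j" and coding: "gm_coding R j \<sigma>"
    and R_rat: "q \<in> \<rat> \<Longrightarrow> of_real q \<in> R" and R_mult: "a \<in> R \<Longrightarrow> b \<in> R \<Longrightarrow> a * b \<in> R"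
    and R_dense: "e > 0 \<Longrightarrow> \<exists>r\<in>R. norm (x - r) < e"
    and rho_add: "rho (x + y) = rho x + rho y" and rho_scale: "rho (of_real r * x) = r * rho x"
    and rho_le: "\<bar>rho x\<bar> \<le> norm x" and rho_of_real: "rho (of_real r) = r"
    and rho_rep: "(\<And>x y. u (x + y) = u x + u y) \<Longrightarrow> (\<And>r x. u (of_real r * x) = r * u x) \<Longrightarrow>
      \<exists>a. \<forall>x. u x = rho (a * x)"
begin

abbreviation "SF \<equiv> special_functionals R j \<sigma>"

lemma R_0: "0 \<in> R" using R_rat[of 0] by simp

lemma inR_Q: "x \<in> gm_Q R \<Longrightarrow> x \<in> c00" "x \<in> gm_Q R \<Longrightarrow> norm (x i) \<le> 1"
  by (auto simp: gm_Q_def)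

lemma sigma_L: "ys \<noteq> [] \<Longrightarrow> successive ys \<Longrightarrow> set ys \<subseteq> gm_Q R \<Longrightarrow> \<exists>n\<ge>1. even n \<and> \<sigma> ys = j n"
  using coding unfolding gm_coding_def Let_def gm_L_def by blast

lemma sigma_inj: "ys \<noteq> [] \<Longrightarrow> successive ys \<Longrightarrow> set ys \<subseteq> gm_Q R \<Longrightarrow>
   zs \<noteq> [] \<Longrightarrow> successive zs \<Longrightarrow> set zs \<subseteq> gm_Q R \<Longrightarrow> \<sigma> ys = \<sigma> zs \<Longrightarrow> ys = zs"
  using coding unfolding gm_coding_def Let_def inj_on_def by blast

lemma K_ge: "k \<in> gm_K j \<Longrightarrow> k \<ge> 2"
  using gm_lacunaryD(3)[OF lac] unfolding gm_K_def by auto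

text \<open>A vector that is constant on an interval of length \<open>m\<close> is the simplest
  rational element of \<open>gm_A q m\<close>, since by the sup norm bound in \<open>good\<close> a
  unit vector times a scalar of modulus at most 1 lies in the dual unit ball. Such vectors serve to
  exhibit a special sequence.\<close>

lemma flat_vector:
  assumes "good q" "m \<ge> 1"
  shows "\<exists>v. v \<in> gm_A q m \<and> v \<in> gm_Q R \<and> supp_in v b (b + m) \<and> v \<noteq> 0"
proof -
  have f: "gm_f m \<ge> 1" using gm_f_ge1 assms by auto
  \<comment> \<open>A rational number below \<open>1 / gm_f m\<close> is taken as the coordinate,
    because \<open>1 / gm_f m\<close> itself may be irrational.\<close>
  then obtain c where c: "c \<in> \<rat>" "0 < c" "c < 1 / gm_f m" using Rats_dense_in_real[of 0 "1 / gm_f m"] by auto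
  define z :: "nat \<Rightarrow> nat \<Rightarrow> 'k" where "z l = (\<lambda>i. if i = b + l then of_real (c * gm_f m) else 0)" for l
  define v where "v = scl (1 / of_real (gm_f m)) (\<Sum>l<m. z l)"
  have v: "v i = (if b \<le> i \<and> i < b + m then of_real c else 0)" for i
  proof -
    have "(\<Sum>l<m. z l i) = (\<Sum>l<m. if l = i - b \<and> b \<le> i then of_real (c * gm_f m) else 0)"
      unfolding z_def by (rule sum.cong) auto
    also have "\<dots> = (if i - b < m \<and> b \<le> i then of_real (c * gm_f m) else 0)" by (cases "b \<le> i") auto
    finally show ?thesis unfolding v_def using f by (auto simp: sum_fun_apply seq_apply)
  qed
  have zs: "supp_in (z l) (b + l) (b + Suc l)" for l by (auto simp: supp_in_def z_def)
  have "v \<in> gm_A q m" unfolding v_def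
  proof (rule gm_A_I[OF assms(1), of "\<lambda>l. b + l"])
    show "mono (\<lambda>l. b + l)" by (simp add: mono_def)
    show "z l \<noteq> 0" for l using c f by (auto simp: z_def fun_eq_iff seq_apply)
    fix l and x :: "nat \<Rightarrow> 'k" assume x: "x \<in> c00"
    have "act (z l) x = of_real (c * gm_f m) * x (b + l)" by (subst act_eq[OF zs]) (simp add: z_def)
    then have "norm (act (z l) x) = c * gm_f m * norm (x (b + l))" using c f by (simp add: norm_mult)
    also have "\<dots> \<le> 1 * q x" using c f goodD(1)[OF assms(1) x] by (intro mult_mono) (auto simp: field_simps)
    finally show "norm (act (z l) x) \<le> q x" by simp
  qed (rule zs)
  moreover have "c \<le> 1" using c f by (meson divide_le_eq_1_pos less_le_not_le linorder_not_le order_trans zero_less_one less_eq_real_def)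
  then have "v \<in> gm_Q R" using c R_rat R_0 supp_in_c00[of v b "b + m"] unfolding gm_Q_def
    by (auto simp: v supp_in_def)
  moreover have "v b \<noteq> 0" using c assms by (simp add: v)
  then have "v \<noteq> 0" by (auto simp: fun_eq_iff seq_apply)
  moreover have "supp_in v b (b + m)" by (auto simp: v supp_in_def)
  ultimately show ?thesis by blast
qed

lemma sigma_ge: "ys \<noteq> [] \<Longrightarrow> successive ys \<Longrightarrow> set ys \<subseteq> gm_Q R \<Longrightarrow> \<sigma> ys \<ge> 2"
  using sigma_L gm_lacunaryD(3)[OF lac] by metis

text \<open>A supremum of reals over the empty set would carry no information, so the recursion
  requires some special functional to exist. The sequence is extended by flat vectors of the weight
  that \<open>\<sigma>\<close> prescribes, placed to the right of all earlier supports.\<close>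

lemma SF_nonempty: assumes "good q" shows "SF q \<noteq> {}"
proof -
  define k where "k = j 1"
  have k: "k \<in> gm_K j" unfolding gm_K_def k_def by (auto intro!: exI[of _ 1])
  have "j (2 * k) \<ge> 2" using gm_lacunaryD(3)[OF lac, of "2 * k"] K_ge[OF k] by auto
  have "\<exists>ys b. length ys = Suc i \<and> successive ys \<and> set ys \<subseteq> gm_Q R \<and> (\<forall>y\<in>set ys. supp_in y 0 b) \<and>
     ys ! 0 \<in> gm_A q (j (2 * k)) \<and> (\<forall>i'. 1 \<le> i' \<and> i' < Suc i \<longrightarrow> ys ! i' \<in> gm_A q (\<sigma> (take i' ys)))" for i
  proof (induction i)
    case 0
    obtain v where "v \<in> gm_A q (j (2*k))" "v \<in> gm_Q R" "supp_in v 0 (0 + j (2*k))" "v \<noteq> 0"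
      using flat_vector[OF assms, of "j (2*k)" 0] \<open>j (2*k) \<ge> 2\<close> by auto
    then show ?case by (intro exI[of _ "[v]"]) (auto simp: successive_def zero_fun_def)
  next
    case (Suc i)
    then obtain ys b where ys: "length ys = Suc i" "successive ys" "set ys \<subseteq> gm_Q R" "\<forall>y\<in>set ys. supp_in y 0 b"
     "ys ! 0 \<in> gm_A q (j (2 * k))" "\<forall>i'. 1 \<le> i' \<and> i' < Suc i \<longrightarrow> ys ! i' \<in> gm_A q (\<sigma> (take i' ys))" by blast
    have ne: "ys \<noteq> []" using ys(1) by auto
    have sg: "\<sigma> ys \<ge> 2" by (rule sigma_ge[OF ne ys(2,3)])
    then obtain v where v: "v \<in> gm_A q (\<sigma> ys)" "v \<in> gm_Q R" "supp_in v b (b + \<sigma> ys)" "v \<noteq> 0"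
      using flat_vector[OF assms, of "\<sigma> ys" b] by (metis one_le_numeral order_trans)
    have "successive (ys @ [v])" by (rule successive_snoc[OF ys(2) _ v(3,4)]) (use ys(4) in blast)
    moreover have "(ys @ [v]) ! i' \<in> gm_A q (\<sigma> (take i' (ys @ [v])))" if "1 \<le> i'" "i' < Suc (Suc i)" for i'
      using ys v that by (cases "i' = Suc i") (auto simp: nth_append)
    moreover have "\<forall>y\<in>set (ys @ [v]). supp_in y 0 (b + \<sigma> ys)" using ys(4) v(3) supp_in_mono[OF _ le_refl, of _ 0 b "b + \<sigma> ys"] supp_in_mono[OF v(3), of 0 "b + \<sigma> ys"] by auto
    ultimately show ?case using ys v by (intro exI[of _ "ys @ [v]"] exI[of _ "b + \<sigma> ys"]) (simp add: nth_append)
  qed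
  from this[of "k - 1"] obtain ys where "special_sequence R j \<sigma> q k ys"
    using K_ge[OF k] unfolding special_sequence_def by auto
  then show ?thesis unfolding special_functionals_def using k by auto
qed

lemma SF_D:
  assumes "g \<in> SF q" "good q"
  obtains k ys t where "k \<in> gm_K j" "special_sequence R j \<sigma> q k ys" "g = scl (1 / of_real (sqrt (gm_f k))) (\<Sum>l<k. ys ! l)"
    "mono t" "\<And>l. l < k \<Longrightarrow> supp_in (ys ! l) (t l) (t (Suc l))" "\<And>l. l < k \<Longrightarrow> ys ! l \<in> c00"
proof -
  obtain k ys where k: "k \<in> gm_K j" "special_sequence R j \<sigma> q k ys"
    "g = (\<lambda>i. vsum ys i / of_real (sqrt (gm_f k)))" using assms unfolding special_functionals_def by auto
  have ys: "length ys = k" "successive ys" "set ys \<subseteq> gm_Q R" using k(2) by (auto simp: special_sequence_def)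
  then have "set ys \<subseteq> c00" using inR_Q by auto
  then obtain t where "mono t" "\<And>l. l < length ys \<Longrightarrow> supp_in (ys ! l) (t l) (t (Suc l))"
    using breakpoints_of_successive ys by blast
  moreover have "g = scl (1 / of_real (sqrt (gm_f k))) (\<Sum>l<k. ys ! l)"
    using ys k by (auto simp: vsum_eq seq_apply)
  ultimately show ?thesis using that[of k ys t] k ys \<open>set ys \<subseteq> c00\<close> nth_mem[of _ ys] by blast
qed

text \<open>At most one member of the special sequence is nonzero at a given coordinate, and its
  coordinates are at most 1 because it lies in \<open>gm_Q R\<close>. The bound makes the action of
  special functionals at most the l1 norm.\<close>

lemma SF_c00: assumes "g \<in> SF q" "good q" shows "g \<in> c00" "norm (g i) \<le> 1"
proof -
  from assms obtain k ys t where k: "k \<in> gm_K j" "special_sequence R j \<sigma> q k ys" "g = scl (1 / of_real (sqrt (gm_f k))) (\<Sum>l<k. ys ! l)"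
    "mono t" "\<And>l. l < k \<Longrightarrow> supp_in (ys ! l) (t l) (t (Suc l))" "\<And>l. l < k \<Longrightarrow> ys ! l \<in> c00" by (rule SF_D) blast
  show "g \<in> c00" using k by auto
  have Q: "norm ((ys ! l) i) \<le> 1" if "l < k" for l
    using k(2) inR_Q(2)[of "ys ! l"] that unfolding special_sequence_def by (metis nth_mem subsetD)
  have "norm (\<Sum>l<k. (ys ! l) i) \<le> 1"
  proof (cases "\<exists>l0<k. (ys ! l0) i \<noteq> 0")
    case True
    then obtain l0 where l0: "l0 < k" "(ys ! l0) i \<noteq> 0" by auto
    have "(ys ! l) i = 0" if "l < k" "l \<noteq> l0" for l
    proof (rule ccontr)
      assume "(ys ! l) i \<noteq> 0"
      then have "t l \<le> i" "i < t (Suc l)" "t l0 \<le> i" "i < t (Suc l0)" using k(5) l0 that unfolding supp_in_def by auto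
      moreover have "Suc l \<le> l0 \<or> Suc l0 \<le> l" using that by auto
      ultimately show False using monoD[OF k(4)] by (meson leD le_trans)
    qed
    then have "(\<Sum>l<k. (ys ! l) i) = (\<Sum>l<k. if l = l0 then (ys ! l0) i else 0)" by (intro sum.cong) auto
    then show ?thesis using Q l0 by simp
  qed simp
  moreover have "sqrt (gm_f k) \<ge> 1" using K_ge[OF k(1)] gm_f_ge1[of k] by (simp add: real_le_rsqrt)
  ultimately have "norm (\<Sum>l<k. (ys ! l) i) / sqrt (gm_f k) \<le> 1"  by (subst pos_divide_le_eq) linarith+
  then show "norm (g i) \<le> 1"
    unfolding k(3) using gm_f_nonneg[of k] by (simp add: seq_apply sum_fun_apply norm_divide norm_mult)
qed

section \<open>One step of the recursion that defines the norm\<close>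

definition nxt :: "((nat \<Rightarrow> 'k) \<Rightarrow> real) \<Rightarrow> (nat \<Rightarrow> 'k) \<Rightarrow> real" where
  "nxt q x = max (SUP Es\<in>interval_lists. (\<Sum>E\<leftarrow>Es. q (proj E x)) / gm_f (length Es))
     (SUP (E, g)\<in>intervals \<times> SF q. norm (pairing g (proj E x)))"

lemma interval_list_breakpoints:
  assumes "good q" "x \<in> c00" "Es \<in> interval_lists"
  obtains t where "mono t" "(\<Sum>E\<leftarrow>Es. q (proj E x)) \<le> (\<Sum>l<length Es. q (proj {t l..<t (Suc l)} x))"
proof -
  have Es: "Es \<noteq> []" "set Es \<subseteq> intervals" "sorted_wrt before Es" using assms unfolding interval_lists_def by auto
  obtain t where t: "mono t" "\<And>l. l < length Es \<Longrightarrow> Es ! l \<subseteq> {t l..<t (Suc l)}"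
    by (rule breakpoints_of_before[OF Es(3)]) (use Es in \<open>auto simp: intervals_def\<close>)
  have "(\<Sum>E\<leftarrow>Es. q (proj E x)) = (\<Sum>l<length Es. q (proj (Es ! l) x))"
    by (simp add: sum_list_sum_nth atLeast0LessThan)
  also have "\<dots> \<le> (\<Sum>l<length Es. q (proj {t l..<t (Suc l)} x))"
  proof (rule sum_mono)
    fix l assume "l \<in> {..<length Es}"
    then have l: "l < length Es" by simp
    then have "Es ! l \<in> intervals" using Es by auto
    then obtain a b where "Es ! l = {a..b}" unfolding intervals_def by auto
    then have e: "Es ! l = {a..<Suc b}" by (simp only: atLeastLessThanSuc_atLeastAtMost)
    have sub: "{a..<Suc b} \<subseteq> {t l..<t (Suc l)}" using t(2)[OF l] unfolding e .
    have "proj {a..<Suc b} (proj {t l..<t (Suc l)} x) = proj {a..<Suc b} x"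
      unfolding proj_proj using Int_absorb2[OF sub] by (simp only:)
    then show "q (proj (Es ! l) x) \<le> q (proj {t l..<t (Suc l)} x)"
      using goodD(5)[OF assms(1) c00_proj_fin, of a "Suc b" "t l" "t (Suc l)" x] by (simp only: e)
  qed
  finally show ?thesis using that t by blast
qed

lemma nxt_bdd1:
  assumes "good q" "x \<in> c00"
  shows "bdd_above ((\<lambda>Es. (\<Sum>E\<leftarrow>Es. q (proj E x)) / gm_f (length Es)) ` interval_lists)"
proof (rule bdd_aboveI2)
  fix Es assume Es: "Es \<in> interval_lists"
  then obtain t where t: "mono t" "(\<Sum>E\<leftarrow>Es. q (proj E x)) \<le> (\<Sum>l<length Es. q (proj {t l..<t (Suc l)} x))"
    using interval_list_breakpoints assms by blast
  have "(\<Sum>l<length Es. q (proj {t l..<t (Suc l)} x)) \<le> (\<Sum>l<length Es. l1 (proj {t l..<t (Suc l)} x))"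
    using goodD(2)[OF assms(1)] by (intro sum_mono) auto
  also have "\<dots> \<le> l1 x" using sum_l1_proj_le assms t by blast
  finally have "(\<Sum>E\<leftarrow>Es. q (proj E x)) \<le> l1 x" using t by simp
  moreover have "gm_f (length Es) \<ge> 1" using Es gm_f_ge1[of "length Es"] unfolding interval_lists_def by (simp add: Suc_leI)
  ultimately show "(\<Sum>E\<leftarrow>Es. q (proj E x)) / gm_f (length Es) \<le> l1 x"
    using mult_left_mono[of 1 "gm_f (length Es)" "l1 x"] by (subst pos_divide_le_eq) auto
qed

lemma nxt_bdd2:
  assumes "good q" "x \<in> c00"
  shows "bdd_above ((\<lambda>(E, g). norm (pairing g (proj E x))) ` (intervals \<times> SF q))"
proof (rule bdd_aboveI2)
  fix Eg assume "Eg \<in> intervals \<times> SF q"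
  then obtain E g where e: "Eg = (E, g)" "g \<in> SF q" by auto
  have "norm (act g (proj E x)) \<le> 1 * l1 (proj E x)"
    using SF_c00[OF e(2) assms(1)] assms by (intro norm_act_le_l1) auto
  then show "(case Eg of (E, g) \<Rightarrow> norm (pairing g (proj E x))) \<le> l1 x"
    using e l1_proj[OF assms(2), of E] SF_c00[OF e(2) assms(1)] assms by (simp add: pairing_eq_act c00_proj)
qed

lemma nxt_le:
  assumes "good q" "x \<in> c00"
    "\<And>M t. M \<ge> 1 \<Longrightarrow> mono t \<Longrightarrow> (\<Sum>l<M. q (proj {t l..<t (Suc l)} x)) \<le> C * gm_f M"
    "\<And>a b g. g \<in> SF q \<Longrightarrow> norm (act g (proj {a..<b} x)) \<le> C"
  shows "nxt q x \<le> C"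
  unfolding nxt_def
proof (rule max.boundedI)
  show "(SUP Es\<in>interval_lists. (\<Sum>E\<leftarrow>Es. q (proj E x)) / gm_f (length Es)) \<le> C"
  proof (rule cSUP_least)
    have "[{0..0}] \<in> interval_lists" unfolding interval_lists_def intervals_def by force
    then show "interval_lists \<noteq> {}" by blast
    fix Es assume Es: "Es \<in> interval_lists"
    then obtain t where t: "mono t" "(\<Sum>E\<leftarrow>Es. q (proj E x)) \<le> (\<Sum>l<length Es. q (proj {t l..<t (Suc l)} x))"
      using interval_list_breakpoints assms by blast
    have M: "length Es \<ge> 1" using Es by (auto simp: interval_lists_def Suc_leI)
    then show "(\<Sum>E\<leftarrow>Es. q (proj E x)) / gm_f (length Es) \<le> C"
      using t assms(3)[OF M t(1)] gm_f_pos[OF M] by (simp add: pos_divide_le_eq)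
  qed
  show "(SUP (E, g)\<in>intervals \<times> SF q. norm (pairing g (proj E x))) \<le> C"
  proof (rule cSUP_least)
    have "{0..0} \<in> intervals" unfolding intervals_def by force
    then show "intervals \<times> SF q \<noteq> {}" using SF_nonempty[OF assms(1)] by auto
    fix Eg assume "Eg \<in> intervals \<times> SF q"
    then obtain a b g where e: "Eg = ({a..b}, g)" "g \<in> SF q" unfolding intervals_def by auto
    have "{a..b} = {a..<Suc b}" by (simp only: atLeastLessThanSuc_atLeastAtMost)
    then show "(case Eg of (E, g) \<Rightarrow> norm (pairing g (proj E x))) \<le> C"
      using e assms(4)[OF e(2), of a "Suc b"] SF_c00[OF e(2) assms(1)] by (simp add: pairing_eq_act c00_proj_fin)
  qed
qed

text \<open>With \<open>nxt_ge2\<close> and \<open>nxt_le\<close>, this expresses the next level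
  through breakpoints instead of lists. Empty intervals may occur among them: they contribute zero,
  and discarding them only decreases the denominator.\<close>

lemma nxt_ge1:
  assumes "good q" "x \<in> c00" "mono t"
  shows "(\<Sum>l<M. q (proj {t l..<t (Suc l)} x)) \<le> gm_f M * nxt q x"
proof -
  let ?ls = "filter (\<lambda>l. t l < t (Suc l)) [0..<M]"
  let ?Es = "map (\<lambda>l. {t l..<t (Suc l)}) ?ls"
  have eq: "(\<Sum>E\<leftarrow>?Es. q (proj E x)) = (\<Sum>l<M. q (proj {t l..<t (Suc l)} x))"
  proof -
    have "(\<Sum>E\<leftarrow>?Es. q (proj E x)) = (\<Sum>l\<leftarrow>[0..<M]. if t l < t (Suc l) then q (proj {t l..<t (Suc l)} x) else 0)"
      by (simp add: sum_list_map_filter' o_def)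
    also have "\<dots> = (\<Sum>l<M. if t l < t (Suc l) then q (proj {t l..<t (Suc l)} x) else 0)"
      by (simp add: interv_sum_list_conv_sum_set_nat atLeast0LessThan)
    also have "\<dots> = (\<Sum>l<M. q (proj {t l..<t (Suc l)} x))"
      by (rule sum.cong) (auto simp: good_zero[OF assms(1)])
    finally show ?thesis .
  qed
  have nn: "q (proj {a..<b} x) \<ge> 0" for a b using goodD(6)[OF assms(1)] by auto
  have "[{0..0}] \<in> interval_lists" unfolding interval_lists_def intervals_def by force
  then have "(\<Sum>E\<leftarrow>[{0..0}]. q (proj E x)) / gm_f (length [{0..0::nat}]) \<le>
    (SUP Es\<in>interval_lists. (\<Sum>E\<leftarrow>Es. q (proj E x)) / gm_f (length Es))"
    using nxt_bdd1[OF assms(1,2)] by (rule cSUP_upper)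
  moreover have "{0..0::nat} = {0..<1}" by auto
  ultimately have n0: "nxt q x \<ge> 0" using nn[of 0 1] unfolding nxt_def by simp
  show ?thesis
  proof (cases "?ls = []")
    case True
    then show ?thesis using eq n0 by (simp add: mult_nonneg_nonneg)
  next
    case False
    have "?Es \<in> interval_lists" unfolding interval_lists_def
    proof (intro CollectI conjI)
      show "?Es \<noteq> []" using False by auto
      have "{a..<b} \<in> intervals" if "a < b" for a b :: nat
        unfolding intervals_def mem_Collect_eq using that by (intro exI[of _ a] exI[of _ "b - 1"]) auto
      then show "set ?Es \<subseteq> intervals" by auto
      have "sorted_wrt (\<lambda>l l'. t l < t (Suc l) \<and> t l' < t (Suc l') \<and> l < l') ?ls"
      proof -
        have "sorted_wrt (<) ?ls" by (intro sorted_wrt_filter) (simp add: sorted_wrt_upt)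
        moreover have "t l < t (Suc l)" if "l \<in> set ?ls" for l using that by simp
        ultimately show ?thesis unfolding sorted_wrt_iff_nth_less by (meson nth_mem order_less_trans)
      qed
      then have "sorted_wrt (\<lambda>l l'. before {t l..<t (Suc l)} {t l'..<t (Suc l')}) ?ls"
      proof (rule sorted_wrt_mono_rel[rotated])
        fix l l' assume "t l < t (Suc l) \<and> t l' < t (Suc l') \<and> l < l'"
        then have a: "t l < t (Suc l)" "t l' < t (Suc l')" "t (Suc l) \<le> t l'" using monoD[OF assms(3), of "Suc l" l'] by auto
        have "Max {t l..<t (Suc l)} \<in> {t l..<t (Suc l)}" by (rule Max_in) (use a in auto)
        moreover have "Min {t l'..<t (Suc l')} \<in> {t l'..<t (Suc l')}" by (rule Min_in) (use a in auto)
        ultimately have "Max {t l..<t (Suc l)} < t (Suc l)" "t l' \<le> Min {t l'..<t (Suc l')}" by (simp_all only: atLeastLessThan_iff)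
        then show "before {t l..<t (Suc l)} {t l'..<t (Suc l')}" unfolding before_def using a by simp
      qed
      then show "sorted_wrt before ?Es" by (simp add: sorted_wrt_map)
    qed
    then have "(\<Sum>E\<leftarrow>?Es. q (proj E x)) / gm_f (length ?Es) \<le>
      (SUP Es\<in>interval_lists. (\<Sum>E\<leftarrow>Es. q (proj E x)) / gm_f (length Es))"
      using nxt_bdd1[OF assms(1,2)] by (rule cSUP_upper)
    then have a: "(\<Sum>E\<leftarrow>?Es. q (proj E x)) / gm_f (length ?Es) \<le> nxt q x" unfolding nxt_def by simp
    have len: "1 \<le> length ?Es" "length ?Es \<le> M" using False by (auto simp: Suc_leI intro: order_trans[OF length_filter_le])
    then have "(\<Sum>E\<leftarrow>?Es. q (proj E x)) \<le> nxt q x * gm_f (length ?Es)"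
      using a gm_f_pos[OF len(1)] by (simp add: pos_divide_le_eq)
    also have "\<dots> \<le> nxt q x * gm_f M" using gm_f_mono[OF len(2)] n0 by (rule mult_left_mono)
    finally show ?thesis using eq by (simp add: mult.commute)
  qed
qed

lemma nxt_ge2:
  assumes "good q" "x \<in> c00" "g \<in> SF q"
  shows "norm (act g (proj {a..<b} x)) \<le> nxt q x"
proof (cases "a < b")
  case True
  have e: "{a..<b} = {a..b - 1}" using True by auto
  have "{a..<b} \<in> intervals" unfolding intervals_def mem_Collect_eq using True e by (intro exI[of _ a] exI[of _ "b - 1"]) simp
  then have "(case ({a..<b}, g) of (E, g) \<Rightarrow> norm (pairing g (proj E x))) \<le>
    (SUP (E, g)\<in>intervals \<times> SF q. norm (pairing g (proj E x)))"
    using assms by (intro cSUP_upper nxt_bdd2) auto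
  then show ?thesis unfolding nxt_def using SF_c00[OF assms(3,1)] by (simp add: pairing_eq_act c00_proj_fin)
next
  case False
  then have "{a..<b} = {}" by (simp only: atLeastLessThan_empty_iff not_False_eq_True)
  then have "proj {a..<b} x = 0" by (simp only: proj_zero)
  moreover have "nxt q x \<ge> 0" using nxt_ge1[OF assms(1,2), of "\<lambda>_. 0" 1] good_zero[OF assms(1)] by (simp add: mono_def)
  ultimately show ?thesis by (simp only: act_zero norm_zero)
qed

end


section \<open>The levels of the norm and the Gowers--Maurey space as a sequence space\<close>

text \<open>Diagonal argument: a product of closed balls over \<open>nat\<close> is compact by
  Tychonoff, and in the metric space of sequences compactness yields convergent
  subsequences.\<close>

lemma coordinatewise_subseq:
  fixes z :: "nat \<Rightarrow> nat \<Rightarrow> 'k::{real_normed_field,heine_borel}"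
  assumes "\<And>m i. norm (z m i) \<le> C i"
  obtains r z' where "strict_mono (r :: nat \<Rightarrow> nat)" "\<And>i. (\<lambda>m. z (r m) i) \<longlonglongrightarrow> z' i"
proof -
  have "compact (PiE UNIV (\<lambda>i. cball (0::'k) (C i)))"
    using compactin_PiE[of "\<lambda>_::nat. euclidean :: 'k topology" UNIV "\<lambda>i. cball (0::'k) (C i)"]
    by (simp add: euclidean_product_topology)
  moreover have "\<forall>m. z m \<in> PiE UNIV (\<lambda>i. cball 0 (C i))" using assms by auto
  ultimately obtain l r where l: "strict_mono (r::nat\<Rightarrow>nat)" "(z \<circ> r) \<longlonglongrightarrow> l"
    unfolding compact_eq_seq_compact_metric seq_compact_def by meson
  have "(\<lambda>m. z (r m) i) \<longlonglongrightarrow> l i" for i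
  proof -
    have "continuous_on UNIV (\<lambda>f::nat\<Rightarrow>'k. f i)" by (rule continuous_on_product_coordinates)
    from continuous_on_tendsto_compose[OF this l(2)] show ?thesis by (simp add: o_def)
  qed
  then show ?thesis using that l by blast
qed

context gm
begin

lemma nxt_ge: assumes "good q" "x \<in> c00" shows "q x \<le> nxt q x"
proof -
  obtain r where r: "supp_in x 0 r" using assms c00E by blast
  have "mono (\<lambda>l::nat. if l = 0 then 0 else r)" by (auto simp: mono_def)
  from nxt_ge1[OF assms this, of 1] show ?thesis using supp_in_proj_eq[OF r] by simp
qed

lemma good_nxt: assumes "good q" shows "good (nxt q)"
  unfolding good_def
proof (intro ballI conjI allI)
  fix x :: "nat \<Rightarrow> 'k" assume x: "x \<in> c00"
  show "norm (x i) \<le> nxt q x" for i using nxt_ge[OF assms x] goodD(1)[OF assms x, of i] by linarith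
  show "nxt q x \<le> l1 x"
  proof (rule nxt_le[OF assms x])
    fix M :: nat and t :: "nat \<Rightarrow> nat" assume M: "1 \<le> M" "mono t"
    have "(\<Sum>l<M. q (proj {t l..<t (Suc l)} x)) \<le> (\<Sum>l<M. l1 (proj {t l..<t (Suc l)} x))"
      by (intro sum_mono goodD(2)[OF assms] c00_proj_fin)
    also have "\<dots> \<le> l1 x" using sum_l1_proj_le[OF M(2) x] .
    also have "\<dots> \<le> l1 x * gm_f M" using mult_left_mono[OF gm_f_ge1[OF M(1)], of "l1 x"] by simp
    finally show "(\<Sum>l<M. q (proj {t l..<t (Suc l)} x)) \<le> l1 x * gm_f M" .
  next
    fix a b g assume g: "g \<in> SF q"
    have "norm (act g (proj {a..<b} x)) \<le> 1 * l1 (proj {a..<b} x)"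
      using SF_c00[OF g assms] by (intro norm_act_le_l1 c00_proj_fin)
    then show "norm (act g (proj {a..<b} x)) \<le> l1 x" using l1_proj[OF x, of "{a..<b}"] by linarith
  qed
  show "nxt q (x + y) \<le> nxt q x + nxt q y" if y: "y \<in> c00" for y
  proof (rule nxt_le[OF assms c00_add[OF x y]])
    fix M :: nat and t :: "nat \<Rightarrow> nat" assume M: "1 \<le> M" "mono t"
    have "(\<Sum>l<M. q (proj {t l..<t (Suc l)} (x + y))) \<le> (\<Sum>l<M. q (proj {t l..<t (Suc l)} x) + q (proj {t l..<t (Suc l)} y))"
      unfolding proj_add by (intro sum_mono goodD(3)[OF assms] c00_proj_fin)
    also have "\<dots> \<le> gm_f M * nxt q x + gm_f M * nxt q y"
      unfolding sum.distrib using nxt_ge1[OF assms x M(2)] nxt_ge1[OF assms y M(2)] by (rule add_mono)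
    finally show "(\<Sum>l<M. q (proj {t l..<t (Suc l)} (x + y))) \<le> (nxt q x + nxt q y) * gm_f M"
      by (simp add: algebra_simps)
  next
    fix a b g assume g: "g \<in> SF q"
    have "norm (act g (proj {a..<b} (x + y))) \<le> norm (act g (proj {a..<b} x)) + norm (act g (proj {a..<b} y))"
      unfolding proj_add act_add by (rule norm_triangle_ineq)
    then show "norm (act g (proj {a..<b} (x + y))) \<le> nxt q x + nxt q y"
      using nxt_ge2[OF assms x g, of a b] nxt_ge2[OF assms y g, of a b] by linarith
  qed
  show "nxt q (proj {a..<b} x) \<le> nxt q x" for a b
  proof (rule nxt_le[OF assms c00_proj_fin])
    \<comment> \<open>Projecting to \<open>{a..<b}\<close> amounts to clamping the breakpoints to
      this interval.\<close>
    have inter: "{c..<d} \<inter> {a..<b} = {max a (min b c)..<max a (min b d)}" if "c \<le> d" for c d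
      using that by (cases "a \<le> b") auto
    fix M :: nat and t :: "nat \<Rightarrow> nat" assume M: "1 \<le> M" "mono t"
    let ?t = "\<lambda>l. max a (min b (t l))"
    have "mono ?t" using M(2) by (auto simp: mono_def min_def max_def) (meson order_trans le_cases)+
    from nxt_ge1[OF assms x this, of M]
    show "(\<Sum>l<M. q (proj {t l..<t (Suc l)} (proj {a..<b} x))) \<le> nxt q x * gm_f M"
      using inter[OF monoD[OF M(2)]] by (simp add: mult.commute)
  next
    fix c d g assume g: "g \<in> SF q"
    have "{c..<d} \<inter> {a..<b} = {max a c..<min b d}" by auto
    then show "norm (act g (proj {c..<d} (proj {a..<b} x))) \<le> nxt q x"
      using nxt_ge2[OF assms x g, of "max a c" "min b d"] by simp
  qed
  \<comment> \<open>The inequality for all scalars suffices: applied to the inverse scalar it gives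
    the converse.\<close>
  have scl_le: "nxt q (scl c x) \<le> norm c * nxt q x" if x: "x \<in> c00" for c x
  proof (rule nxt_le[OF assms c00_scl[OF x]])
    fix M :: nat and t :: "nat \<Rightarrow> nat" assume M: "1 \<le> M" "mono t"
    have "(\<Sum>l<M. q (proj {t l..<t (Suc l)} (scl c x))) = norm c * (\<Sum>l<M. q (proj {t l..<t (Suc l)} x))"
      unfolding proj_scl sum_distrib_left by (intro sum.cong goodD(4)[OF assms] c00_proj_fin refl)
    also have "\<dots> \<le> norm c * (gm_f M * nxt q x)" using nxt_ge1[OF assms x M(2)] by (rule mult_left_mono) simp
    finally show "(\<Sum>l<M. q (proj {t l..<t (Suc l)} (scl c x))) \<le> norm c * nxt q x * gm_f M"
      by (simp add: mult_ac)
  next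
    fix a b g assume g: "g \<in> SF q"
    show "norm (act g (proj {a..<b} (scl c x))) \<le> norm c * nxt q x"
      unfolding proj_scl act_scl norm_mult using nxt_ge2[OF assms x g] by (rule mult_left_mono) simp
  qed
  show "nxt q (scl c x) = norm c * nxt q x" for c
  proof (cases "c = 0")
    case True
    have "nxt q (scl c x) \<ge> 0" using nxt_ge[OF assms c00_scl[OF x], of c] goodD(6)[OF assms c00_scl[OF x], of c] by linarith
    then show ?thesis using scl_le[OF x, of c] True by simp
  next
    case False
    have "nxt q (scl (inverse c) (scl c x)) \<le> norm (inverse c) * nxt q (scl c x)"
      by (rule scl_le[OF c00_scl[OF x]])
    then have "norm c * nxt q x \<le> nxt q (scl c x)" using False by (simp add: norm_inverse norm_divide field_simps)
    then show ?thesis using scl_le[OF x, of c] by linarith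
  qed
qed

section \<open>The levels of the norm, their supremum and the sequences on which it is
  finite\<close>

abbreviation "p \<equiv> gm_norm_seq R j \<sigma>"

lemma p_Suc: "p (Suc n) = nxt (p n)"
  by (rule ext) (simp add: nxt_def)

lemma good_p0: "good (p 0)"
proof -
  have bdd: "bdd_above (range (\<lambda>i. norm (x i)))" if x: "x \<in> c00" for x :: "nat \<Rightarrow> 'k"
  proof (rule bdd_aboveI2)
    fix i
    show "norm (x i) \<le> l1 x"
      using x unfolding l1_def c00_def by (cases "x i = 0") (auto simp: sum_nonneg intro!: member_le_sum)
  qed
  have up: "norm (x i) \<le> p 0 x" if x: "x \<in> c00" for x :: "nat \<Rightarrow> 'k" and i
    by (simp, rule cSUP_upper[OF _ bdd[OF x]]) simp
  have least: "p 0 x \<le> C" if "\<And>i. norm (x i) \<le> C" for x :: "nat \<Rightarrow> 'k" and C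
    by (simp, rule cSUP_least) (use that in auto)
  show ?thesis unfolding good_def
  proof (intro ballI conjI allI)
    fix x :: "nat \<Rightarrow> 'k" assume x: "x \<in> c00"
    show "norm (x i) \<le> p 0 x" for i by (rule up[OF x])
    show "p 0 x \<le> l1 x"
    proof (rule least)
      fix i show "norm (x i) \<le> l1 x"
      using x unfolding l1_def c00_def by (cases "x i = 0") (auto simp: sum_nonneg intro!: member_le_sum)
    qed
    show "p 0 (x + y) \<le> p 0 x + p 0 y" if y: "y \<in> c00" for y
    proof (rule least)
      fix i show "norm ((x + y) i) \<le> p 0 x + p 0 y"
        unfolding plus_fun_apply using up[OF x, of i] up[OF y, of i] norm_triangle_ineq[of "x i" "y i"] by linarith
    qed
    show "p 0 (proj {a..<b} x) \<le> p 0 x" for a b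
    proof (rule least)
      fix i show "norm (proj {a..<b} x i) \<le> p 0 x"
        using up[OF x, of i] order_trans[OF norm_ge_zero up[OF x, of i]] by (simp only: proj_apply split: if_split) simp
    qed
    have scl_le: "p 0 (scl c x) \<le> norm c * p 0 x" if x: "x \<in> c00" for c x
    proof (rule least)
      fix i show "norm (scl c x i) \<le> norm c * p 0 x"
        unfolding scl_apply norm_mult using up[OF x, of i] by (rule mult_left_mono) simp
    qed
    show "p 0 (scl c x) = norm c * p 0 x" for c
    proof (cases "c = 0")
      case True
      have "p 0 (scl c x) \<ge> 0" using order_trans[OF norm_ge_zero up[OF c00_scl[OF x], of c 0]] .
      then show ?thesis using scl_le[OF x, of c] True by simp
    next
      case False
      have "p 0 (scl (inverse c) (scl c x)) \<le> norm (inverse c) * p 0 (scl c x)"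
        by (rule scl_le[OF c00_scl[OF x]])
      then have "norm c * p 0 x \<le> p 0 (scl c x)" using False by (simp add: norm_inverse norm_divide field_simps)
      then show ?thesis using scl_le[OF x, of c] by linarith
    qed
  qed
qed

lemma good_p: "good (p n)"
  by (induction n) (use good_p0 in simp, simp only: p_Suc good_nxt)

declare gm_norm_seq.simps [simp del]

lemma p_mono: "x \<in> c00 \<Longrightarrow> m \<le> n \<Longrightarrow> p m x \<le> p n x"
proof (induction n)
  case (Suc n)
  have "p n x \<le> p (Suc n) x" unfolding p_Suc by (rule nxt_ge[OF good_p Suc.prems(1)])
  then show ?case using Suc by (cases "m = Suc n") auto
qed simp

definition G :: "(nat \<Rightarrow> 'k) set" where
  "G = {z. \<exists>C. \<forall>n k. p n (proj {0..<k} z) \<le> C}"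

definition N :: "(nat \<Rightarrow> 'k) \<Rightarrow> real" where
  "N z = (SUP (n, k). p n (proj {0..<k} z))"

lemma N_upper: assumes "z \<in> G" shows "p n (proj {0..<k} z) \<le> N z"
proof -
  have "bdd_above (range (\<lambda>(n, k). p n (proj {0..<k} z)))"
    using assms unfolding G_def bdd_above_def by auto
  from cSUP_upper[OF _ this, of "(n, k)"] show ?thesis unfolding N_def by simp
qed

lemma N_least: assumes "\<And>n k. p n (proj {0..<k} z) \<le> C" shows "z \<in> G" "N z \<le> C"
  using assms unfolding G_def N_def by (auto intro!: cSUP_least)

lemma p_le_N: "x \<in> c00 \<Longrightarrow> x \<in> G \<Longrightarrow> p n x \<le> N x"
  by (metis N_upper c00E supp_in_proj_eq)

lemma N_c00_least: "x \<in> c00 \<Longrightarrow> (\<And>n. p n x \<le> C) \<Longrightarrow> x \<in> G \<and> N x \<le> C"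
  using goodD(5)[OF good_p] by (meson N_least order_trans)

lemma c00_G: "x \<in> c00 \<Longrightarrow> x \<in> G" and N_le_l1: "x \<in> c00 \<Longrightarrow> N x \<le> l1 x"
  using N_c00_least[of x "l1 x"] goodD(2)[OF good_p] by blast+

lemma p_le_N': "x \<in> c00 \<Longrightarrow> p n x \<le> N x"
  by (simp add: p_le_N c00_G)

lemma N_coord: assumes "z \<in> G" shows "norm (z i) \<le> N z"
proof -
  have "norm (proj {0..<Suc i} z i) \<le> p 0 (proj {0..<Suc i} z)" by (intro goodD(1)[OF good_p] c00_proj_fin)
  then show ?thesis using N_upper[OF assms, of 0 "Suc i"] by (simp add: proj_apply)
qed

lemma N_nonneg: "z \<in> G \<Longrightarrow> N z \<ge> 0"
  using N_coord[of z 0] norm_ge_zero order_trans by blast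

lemma N_add: assumes "z \<in> G" "w \<in> G" shows "z + w \<in> G" "N (z + w) \<le> N z + N w"
proof -
  have "p n (proj {0..<k} (z + w)) \<le> N z + N w" for n k
    unfolding proj_add using goodD(3)[OF good_p c00_proj_fin c00_proj_fin, of n 0 k z 0 k w]
      N_upper[OF assms(1), of n k] N_upper[OF assms(2), of n k] by linarith
  then show "z + w \<in> G" "N (z + w) \<le> N z + N w" by (auto intro: N_least)
qed

lemma N_scl: assumes "z \<in> G" shows "scl c z \<in> G" "N (scl c z) = norm c * N z"
proof -
  have le: "scl c z \<in> G \<and> N (scl c z) \<le> norm c * N z" if "z \<in> G" for c z
  proof -
    have "p n (proj {0..<k} (scl c z)) \<le> norm c * N z" for n k
      unfolding proj_scl goodD(4)[OF good_p c00_proj_fin] using N_upper[OF that] by (rule mult_left_mono) simp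
    then show ?thesis by (auto intro: N_least)
  qed
  then show G: "scl c z \<in> G" using assms by blast
  show "N (scl c z) = norm c * N z"
  proof (cases "c = 0")
    case True
    then show ?thesis using le[OF assms, of c] N_nonneg[OF G] by simp
  next
    case False
    have "N (scl (inverse c) (scl c z)) \<le> norm (inverse c) * N (scl c z)" using le[OF G] by blast
    then have "norm c * N z \<le> N (scl c z)" using False by (simp add: norm_inverse norm_divide field_simps)
    then show ?thesis using le[OF assms, of c] by auto
  qed
qed

lemma N_minus: "z \<in> G \<Longrightarrow> - z \<in> G \<and> N (- z) = N z"
  using N_scl[of z "-1"] by simp

lemma N_diff: assumes "z \<in> G" "w \<in> G" shows "z - w \<in> G" "N (z - w) \<le> N z + N w"
  using N_add[of z "- w"] N_minus[of w] assms by auto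

lemma N_zero [simp]: "0 \<in> G" "N 0 = 0"
  using c00_G[of 0] N_scl(2)[of 0 0] by auto

lemma N_sum: "(\<And>i. i \<in> A \<Longrightarrow> z i \<in> G) \<Longrightarrow> (\<Sum>i\<in>A. z i) \<in> G \<and> N (\<Sum>i\<in>A. z i) \<le> (\<Sum>i\<in>A. N (z i))"
proof (induction A rule: infinite_finite_induct)
  case (insert a A)
  then have IH: "(\<Sum>i\<in>A. z i) \<in> G" "N (\<Sum>i\<in>A. z i) \<le> (\<Sum>i\<in>A. N (z i))" and a: "z a \<in> G" by auto
  then show ?case using insert(1,2) N_add[OF a IH(1)] by simp
qed auto

lemma N_proj: assumes "z \<in> G" shows "N (proj {a..<b} z) \<le> N z"
proof -
  have "p n (proj {a..<b} z) \<le> N z" for n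
  proof -
    have "proj {a..<b} z = proj {a..<b} (proj {0..<b} z)" by (simp add: Int_absorb2 subset_eq)
    then show ?thesis using goodD(5)[OF good_p c00_proj_fin, of n a b 0 b z] N_upper[OF assms, of n b] by simp
  qed
  then show ?thesis using N_c00_least[OF c00_proj_fin] by blast
qed

lemma N_proj_G: "proj {a..<b} z \<in> G"
  by (rule c00_G[OF c00_proj_fin])

lemma N_tail: assumes "z \<in> G" shows "z - proj {0..<a} z \<in> G" "N (z - proj {0..<a} z) \<le> N z"
proof -
  have "p n (proj {0..<k} (z - proj {0..<a} z)) \<le> N z" for n k
  proof -
    have "proj {0..<k} (z - proj {0..<a} z) = proj {a..<k} (proj {0..<k} z)" by (rule ext) (auto simp: seq_apply)
    then show ?thesis using goodD(5)[OF good_p c00_proj_fin, of n a k 0 k z] N_upper[OF assms, of n k] by simp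
  qed
  then show "z - proj {0..<a} z \<in> G" "N (z - proj {0..<a} z) \<le> N z" by (auto intro: N_least)
qed

lemma p_tendsto_N: assumes "x \<in> c00" shows "(\<lambda>n. p n x) \<longlonglongrightarrow> N x"
proof -
  have bdd: "bdd_above (range (\<lambda>n. p n x))" by (rule bdd_aboveI2[of _ _ "N x"]) (rule p_le_N'[OF assms])
  have "incseq (\<lambda>n. p n x)" using p_mono[OF assms] by (simp add: incseq_def)
  then have lim: "(\<lambda>n. p n x) \<longlonglongrightarrow> (SUP n. p n x)" using bdd by (intro LIMSEQ_incseq_SUP)
  have "(SUP n. p n x) = N x"
  proof (rule antisym)
    show "(SUP n. p n x) \<le> N x" by (rule cSUP_least) (auto simp: p_le_N'[OF assms])
    show "N x \<le> (SUP n. p n x)" using N_c00_least[OF assms] cSUP_upper[OF _ bdd] by blast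
  qed
  then show ?thesis using lim by simp
qed

lemma gm_norm_eq_N: "x \<in> c00 \<Longrightarrow> gm_norm R j \<sigma> x = N x"
  unfolding gm_norm_def by (rule limI[OF p_tendsto_N])

text \<open>Level \<open>n + 1\<close> is built to dominate these averages of level
  \<open>n\<close>; letting the level tend to infinity gives the estimate for the limit
  norm.\<close>

lemma N_lower_estimate:
  assumes "z \<in> G" "mono t"
  shows "(\<Sum>l<M. N (proj {t l..<t (Suc l)} z)) \<le> gm_f M * N z"
proof -
  let ?x = "proj {0..<t M} z"
  have eq: "proj {t l..<t (Suc l)} z = proj {t l..<t (Suc l)} ?x" if "l < M" for l
    using monoD[OF assms(2), of "Suc l" M] that by (simp add: Int_absorb2 subset_eq)
  have "(\<lambda>n. \<Sum>l<M. p n (proj {t l..<t (Suc l)} z)) \<longlonglongrightarrow> (\<Sum>l<M. N (proj {t l..<t (Suc l)} z))"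
    by (intro tendsto_sum p_tendsto_N c00_proj_fin)
  moreover have "(\<Sum>l<M. p n (proj {t l..<t (Suc l)} z)) \<le> gm_f M * N z" for n
  proof -
    have "(\<Sum>l<M. p n (proj {t l..<t (Suc l)} z)) = (\<Sum>l<M. p n (proj {t l..<t (Suc l)} ?x))"
      using eq by (intro sum.cong) auto
    also have "\<dots> \<le> gm_f M * p (Suc n) ?x" unfolding p_Suc by (rule nxt_ge1[OF good_p c00_proj_fin assms(2)])
    also have "\<dots> \<le> gm_f M * N z" by (intro mult_left_mono N_upper assms) simp
    finally show ?thesis .
  qed
  ultimately show ?thesis by (intro LIMSEQ_le_const2) auto
qed

text \<open>On a fixed section a fixed level is continuous under coordinatewise convergence, being
  at most the l1 norm; a supremum of such functions is lower semicontinuous.\<close>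

lemma N_lsc:
  assumes "\<And>m. z m \<in> G" "\<And>m. N (z m) \<le> C" "\<And>i. (\<lambda>m. z m i) \<longlonglongrightarrow> z' i"
  shows "z' \<in> G" "N z' \<le> C"
proof -
  have "p n (proj {0..<k} z') \<le> C" for n k
  proof -
    have "(\<lambda>m. C + (\<Sum>i=0..<k. norm (z' i - z m i))) \<longlonglongrightarrow> C + (\<Sum>i=0..<k. norm (z' i - z' i))"
      by (intro tendsto_intros assms(3))
    moreover have "p n (proj {0..<k} z') \<le> C + (\<Sum>i=0..<k. norm (z' i - z m i))" for m
    proof -
      have "proj {0..<k} z' = proj {0..<k} (z m) + proj {0..<k} (z' - z m)"
        unfolding proj_diff by simp
      then have "p n (proj {0..<k} z') \<le> p n (proj {0..<k} (z m)) + p n (proj {0..<k} (z' - z m))"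
        using goodD(3)[OF good_p c00_proj_fin c00_proj_fin] by metis
      also have "p n (proj {0..<k} (z m)) \<le> C" using N_upper[OF assms(1), of n k m] assms(2)[of m] by linarith
      also have "p n (proj {0..<k} (z' - z m)) \<le> l1 (proj {0..<k} (z' - z m))" by (rule goodD(2)[OF good_p c00_proj_fin])
      also have "l1 (proj {0..<k} (z' - z m)) = (\<Sum>i=0..<k. norm (z' i - z m i))"
        by (subst l1_eq[OF supp_in_proj]) (auto simp: seq_apply)
      finally show ?thesis by linarith
    qed
    ultimately show ?thesis by (intro LIMSEQ_le_const[where X = "\<lambda>m. C + (\<Sum>i=0..<k. norm (z' i - z m i))"]) auto
  qed
  then show "z' \<in> G" "N z' \<le> C" by (auto intro: N_least)
qed

lemma N_tail_antimono: assumes "z \<in> G" "a \<le> b" shows "N (z - proj {0..<b} z) \<le> N (z - proj {0..<a} z)"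
proof -
  have "z - proj {0..<b} z = (z - proj {0..<a} z) - proj {0..<b} (z - proj {0..<a} z)"
    using assms(2) by (intro ext) (auto simp: seq_apply)
  then show ?thesis using N_tail(2)[OF N_tail(1)[OF assms(1)]] by metis
qed

text \<open>If all tails had norm above \<open>e\<close>, one could cut off \<open>M\<close>
  successive blocks of norm above \<open>e\<close>, and the lower estimate would give
  \<open>M * e <= gm_f M * N z\<close>, although \<open>gm_f M / M\<close> tends to 0. Hence
  \<open>c00\<close> is dense in \<open>G\<close>.\<close>

lemma N_tail_tendsto: assumes "z \<in> G" shows "(\<lambda>k. N (z - proj {0..<k} z)) \<longlonglongrightarrow> 0"
proof (rule ccontr)
  let ?T = "\<lambda>k. N (z - proj {0..<k} z)"
  assume no: "\<not> ?T \<longlonglongrightarrow> 0"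
  have "\<exists>e>0. \<forall>k. ?T k > e"
  proof (rule ccontr)
    assume "\<not> ?thesis"
    then have ex: "\<exists>k. ?T k \<le> e" if "e > 0" for e using that by (meson not_less)
    have "?T \<longlonglongrightarrow> 0"
    proof (rule LIMSEQ_I)
      fix e :: real assume "e > 0"
      then obtain k where k: "?T k \<le> e / 2" using ex[of "e/2"] by auto
      show "\<exists>n0. \<forall>n\<ge>n0. norm (?T n - 0) < e"
      proof (intro exI[of _ k] allI impI)
        fix n assume "k \<le> n"
        then show "norm (?T n - 0) < e" using N_tail_antimono[OF assms, of k n] k \<open>e > 0\<close> N_nonneg[OF N_tail(1)[OF assms], of n] by simp
      qed
    qed
    then show False using no by simp
  qed
  then obtain e where e: "e > 0" "\<And>k. ?T k > e" by auto
  have "\<exists>m\<ge>k. N (proj {k..<m} z) > e" for k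
  proof -
    have "\<exists>n m. p n (proj {0..<m} (z - proj {0..<k} z)) > e"
      using N_least(2)[of "z - proj {0..<k} z" e] e(2)[of k] by (meson not_less)
    then obtain n m where nm: "p n (proj {0..<m} (z - proj {0..<k} z)) > e" by auto
    have eq: "proj {0..<m} (z - proj {0..<k} z) = proj {k..<m} z" by (rule ext) (auto simp: seq_apply)
    have "m \<ge> k"
    proof (rule ccontr)
      assume "\<not> m \<ge> k"
      then have "proj {k..<m} z = 0" by simp
      then show False using nm e(1) good_zero[OF good_p] unfolding eq by simp
    qed
    then show ?thesis using nm p_le_N'[OF c00_proj_fin, of n k m z] unfolding eq by (intro exI[of _ m]) auto
  qed
  then obtain m where m: "\<And>k. m k \<ge> k" "\<And>k. N (proj {k..<m k} z) > e" by metis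
  define t where "t l = (m ^^ l) 0" for l
  have "mono t" unfolding t_def by (rule mono_iff_le_Suc[THEN iffD2]) (simp add: m(1))
  have le: "real M * e \<le> gm_f M * N z" for M
  proof -
    have "real M * e = (\<Sum>l<M. e)" by simp
    also have "\<dots> \<le> (\<Sum>l<M. N (proj {t l..<t (Suc l)} z))"
      using m(2) by (intro sum_mono) (simp add: t_def less_imp_le)
    also have "\<dots> \<le> gm_f M * N z" by (rule N_lower_estimate[OF assms \<open>mono t\<close>])
    finally show ?thesis .
  qed
  have "(\<lambda>M. gm_f M / real M * N z) \<longlonglongrightarrow> 0 * N z" by (intro tendsto_intros gm_f_over_n)
  moreover have "eventually (\<lambda>M. e \<le> gm_f M / real M * N z) sequentially"
    using eventually_gt_at_top[of 0] by eventually_elim (use le in \<open>simp add: field_simps\<close>)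
  ultimately have "e \<le> 0 * N z" by (intro tendsto_lowerbound) auto
  then show False using e(1) by simp
qed

end


section \<open>Numerical estimates\<close>

text \<open>The weighted inequality between geometric and arithmetic mean for \<open>c\<close> and
  1; \<open>ln x <= x - 1\<close> is applied to the ratios \<open>c / v\<close> and
  \<open>1 / v\<close>.\<close>

lemma bernoulli_powr:
  fixes c \<theta> :: real
  assumes "c \<ge> 0" "0 < \<theta>" "\<theta> \<le> 1"
  shows "c powr \<theta> \<le> 1 + \<theta> * (c - 1)"
proof (cases "c = 0")
  case False
  define v where "v = 1 + \<theta> * (c - 1)"
  have "v = (1 - \<theta>) + \<theta> * c" by (simp add: v_def algebra_simps)
  moreover have "\<theta> * c > 0" using assms False by simp
  ultimately have v: "v > 0" using assms(3) by linarith
  have "\<theta> * ln (c / v) + (1 - \<theta>) * ln (1 / v) \<le> \<theta> * (c / v - 1) + (1 - \<theta>) * (1 / v - 1)"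
    using assms False v by (intro add_mono mult_left_mono ln_le_minus_one) auto
  also have "\<dots> = 0" using v by (simp add: field_simps v_def)
  finally have "\<theta> * ln c \<le> ln v" using v assms False by (simp add: ln_div algebra_simps)
  then have "exp (\<theta> * ln c) \<le> v" using v ln_ge_iff by blast
  then show ?thesis using False by (simp add: powr_def v_def)
qed (use assms in simp)

text \<open>Concavity of the power function: each term lies below the tangent at the mean
  \<open>\<mu>\<close>.\<close>

lemma power_mean_powr:
  fixes t :: "'a \<Rightarrow> real" and a :: real
  assumes "finite A" "\<And>l. l \<in> A \<Longrightarrow> t l \<ge> 0" "0 < a" "a \<le> 1"
  shows "(\<Sum>l\<in>A. t l powr a) \<le> real (card A) powr (1 - a) * (\<Sum>l\<in>A. t l) powr a"
proof (cases "(\<Sum>l\<in>A. t l) = 0")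
  case True
  then have "t l = 0" if "l \<in> A" for l using sum_nonneg_eq_0_iff[OF assms(1), of t] assms(2) that by auto
  then show ?thesis by simp
next
  case False
  define S where "S = (\<Sum>l\<in>A. t l)"
  have S: "S > 0" using False sum_nonneg[of A t] assms(2) unfolding S_def by (simp add: less_le)
  have n: "card A > 0" using False assms(1) by (auto simp: card_gt_0_iff)
  define \<mu> where "\<mu> = S / card A"
  have \<mu>: "\<mu> > 0" using S n by (simp add: \<mu>_def)
  have "(\<Sum>l\<in>A. t l powr a) \<le> (\<Sum>l\<in>A. \<mu> powr a * (1 + a * (t l / \<mu> - 1)))"
  proof (rule sum_mono)
    fix l assume l: "l \<in> A"
    have "t l powr a = \<mu> powr a * (t l / \<mu>) powr a" using \<mu> assms(2)[OF l] by (simp add: powr_divide)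
    also have "\<dots> \<le> \<mu> powr a * (1 + a * (t l / \<mu> - 1))"
      using bernoulli_powr[of "t l / \<mu>" a] assms \<mu> l by (intro mult_left_mono) auto
    finally show "t l powr a \<le> \<mu> powr a * (1 + a * (t l / \<mu> - 1))" .
  qed
  also have "\<dots> = \<mu> powr a * (real (card A) + a * (S / \<mu> - card A))"
    by (simp add: sum_distrib_left[symmetric] sum.distrib sum_subtractf S_def sum_divide_distrib)
  also have "S / \<mu> = card A" using S n by (simp add: \<mu>_def)
  also have "\<mu> powr a * (real (card A) + a * (real (card A) - real (card A))) = real (card A) powr (1 - a) * S powr a"
    using S n by (simp add: \<mu>_def powr_divide powr_diff)
  finally show ?thesis by (simp add: S_def)
qed

section \<open>Logarithmic estimates and the exponent \<open>be\<close>\<close>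

lemma gm_f_ge_ln: "m \<ge> 1 \<Longrightarrow> gm_f m \<ge> ln (real m)"
proof -
  assume m: "m \<ge> 1"
  have l2: "0 < ln (2::real)" "ln (2::real) \<le> 1" using ln_le_minus_one[of "2::real"] by auto
  have "ln (real m) * ln 2 \<le> ln (real m) * 1" using l2 m by (intro mult_left_mono) auto
  also have "\<dots> \<le> ln (real m + 1)" using m by simp
  finally show ?thesis unfolding gm_f_def log_def using l2 by (simp add: pos_le_divide_eq)
qed

text \<open>The exponent \<open>be m\<close> is chosen such that \<open>m powr (1 - be m) = 8 * m / gm_f m\<close>: the power
  function with exponent \<open>1 - be m\<close> replaces \<open>x / gm_f x\<close> in upper estimates for sums of \<open>m\<close> vectors.\<close>

definition be :: "nat \<Rightarrow> real" where "be m = ln (gm_f m / 8) / ln (real m)"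

text \<open>The threshold is the one in \<open>gm_lacunary\<close>, so that all members of J are
  big.\<close>

definition big :: "nat \<Rightarrow> bool" where "big m \<longleftrightarrow> gm_f m > 256"

lemma big_ln: assumes "big m" shows "m \<ge> 2" "ln (real m) \<ge> 170"
proof -
  have f: "gm_f m > 256" using assms by (simp add: big_def)
  show m: "m \<ge> 2" using f gm_f_mono[of m 1] by (cases "m \<le> 1") auto
  have l2: "ln (2::real) \<ge> 2/3" using ln2_ge_two_thirds by simp
  have "256 < ln (real m + 1) / ln 2" using f by (simp add: gm_f_def log_def)
  then have "256 * ln 2 < ln (real m + 1)" using l2 by (simp add: pos_less_divide_eq)
  moreover have "ln (real m + 1) \<le> ln (2 * real m)" using m by (subst ln_le_cancel_iff) auto
  ultimately have "255 * ln 2 < ln (real m)" using m by (simp add: ln_mult)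
  then show "ln (real m) \<ge> 170" using l2 by linarith
qed

lemma big_f_le: assumes "big m" shows "gm_f m \<le> 2 * log 2 (real m)" "gm_f m \<le> 3 * ln (real m)"
proof -
  note m = big_ln[OF assms]
  have l2: "ln (2::real) \<ge> 2/3" "ln (2::real) \<le> 25/36" using ln2_ge_two_thirds ln2_le_25_over_36 by auto
  have "ln (real m + 1) \<le> ln (real m * 2)" using m(1) by (subst ln_le_cancel_iff) auto
  then have a: "ln (real m + 1) \<le> ln (real m) + ln 2" using m by (simp add: ln_mult)
  then have "ln (real m + 1) \<le> 2 * ln (real m)" using l2 m by linarith
  then show "gm_f m \<le> 2 * log 2 (real m)" unfolding gm_f_def log_def using l2
    by (simp add: divide_right_mono)
  have "ln (real m + 1) \<le> 3 * (2/3) * ln (real m)" using a l2 m by linarith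
  also have "\<dots> \<le> 3 * ln (real m) * ln 2" using mult_right_mono[OF l2(1), of "3 * ln (real m)"] m by simp
  finally show "gm_f m \<le> 3 * ln (real m)" unfolding gm_f_def log_def using l2 by (simp add: pos_divide_le_eq)
qed

lemma ln_le_sqrt: assumes "(y::real) \<ge> 169" shows "ln y \<le> 21/50 * sqrt y"
proof -
  define w where "w = sqrt y"
  have w: "w \<ge> 13" using assms real_le_rsqrt[of 13 y] by (simp add: w_def)
  have y: "y = w * w" using assms by (simp add: w_def)
  \<comment> \<open>The tangent of the logarithm at 8 is accurate enough near 13, the square root of
    the smallest admissible \<open>y\<close>.\<close>
  have "ln (w / 8) \<le> w / 8 - 1" using w by (intro ln_le_minus_one) auto
  moreover have "ln (8::real) = 3 * ln 2" using ln_realpow[of 2 3] by simp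
  moreover have "ln (2::real) \<le> 25/36" using ln2_le_25_over_36 by simp
  ultimately have "ln w \<le> w / 8 + 13/12" using w by (simp add: ln_div)
  then have "ln y \<le> w / 4 + 13/6" using w by (simp add: y ln_mult)
  then show ?thesis using w unfolding w_def[symmetric] by linarith
qed

text \<open>As \<open>gm_f m <= 3 * ln m\<close>, the numerator of \<open>be m\<close> is at most
  \<open>ln (ln m)\<close>, hence at most a constant times \<open>sqrt (ln m)\<close>. So
  \<open>be m\<close> is at most a constant over \<open>sqrt (ln m)\<close>, and its product with
  \<open>ln (3 * ln m)\<close> stays bounded.\<close>

lemma be_bounds:
  assumes "big m"
  shows "be m > 0" "be m \<le> 1/10" "real m powr be m = gm_f m / 8" "be m * (ln 3 + ln (ln (real m))) \<le> 1/2"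
proof -
  note m = big_ln[OF assms]
  have f: "gm_f m > 256" using assms by (simp add: big_def)
  let ?y = "ln (real m)"
  define w where "w = sqrt ?y"
  have w: "w \<ge> 13" using m real_le_rsqrt[of 13 ?y] by (simp add: w_def)
  have y: "?y = w * w" using m by (simp add: w_def)
  have "ln (gm_f m / 8) \<le> ln ?y" using f big_f_le(2)[OF assms] m by (subst ln_le_cancel_iff) auto
  also have "ln ?y \<le> 21/50 * w" using ln_le_sqrt[of ?y] m by (simp add: w_def)
  finally have l: "ln (gm_f m / 8) \<le> 21/50 * w" .
  have ly: "ln ?y \<le> 21/50 * w" using ln_le_sqrt[of ?y] m by (simp add: w_def)
  show b0: "be m > 0" unfolding be_def using f m by simp
  have b: "be m \<le> 21/50 / w"
  proof -
    have "be m \<le> 21/50 * w / (w * w)" unfolding be_def y[symmetric] using l m by (intro divide_right_mono) auto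
    then show ?thesis using w by simp
  qed
  also have "21/50 / w \<le> 1/10" using w by (simp add: field_simps)
  finally show "be m \<le> 1/10" .
  show "real m powr be m = gm_f m / 8" unfolding powr_def be_def using f m by simp
  have "ln (3::real) \<le> ln (2 * 2)" by (subst ln_le_cancel_iff) auto
  then have l3: "ln (3::real) \<le> 25/18" using ln2_le_25_over_36 by (subst (asm) ln_mult) auto
  have "be m * (ln 3 + ln ?y) \<le> 21/50 / w * (3/25 * w + 21/50 * w)"
    using b b0 ly l3 w m by (intro mult_mono) auto
  also have "\<dots> \<le> 1/2" using w by (simp add: field_simps)
  finally show "be m * (ln 3 + ln (ln (real m))) \<le> 1/2" .
qed

text \<open>For at most \<open>ln m\<close> pieces the loss caused by cutting a sum is at most 2.
  This makes special functionals of length much smaller than \<open>m\<close> harmless.\<close>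

lemma powr_be_le_2: assumes "big m" "real M \<le> ln (real m)" shows "(3 * real M) powr be m \<le> 2"
proof (cases "M = 0")
  case False
  have "ln (3 * real M) = ln 3 + ln (real M)" using False by (simp add: ln_mult)
  also have "\<dots> \<le> ln 3 + ln (ln (real m))" using False assms by simp
  finally have "be m * ln (3 * real M) \<le> be m * (ln 3 + ln (ln (real m)))"
    using be_bounds(1)[OF assms(1)] by (intro mult_left_mono) auto
  then have "be m * ln (3 * real M) \<le> ln 2"
    using be_bounds(4)[OF assms(1)] ln2_ge_two_thirds by linarith
  then show ?thesis using False unfolding powr_def by (simp add: ln_ge_iff)
qed simp

text \<open>Writing \<open>M = m powr \<theta>\<close> turns \<open>M powr be m\<close> into
  \<open>(gm_f m / 8) powr \<theta>\<close>, which Bernoulli bounds by an affine function of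
  \<open>\<theta> * gm_f m\<close>, hence of \<open>log 2 M\<close>. The 8 in \<open>be\<close>
  leaves room for the factor 3 and for small \<open>M\<close>, where \<open>gm_f M\<close> is
  small.\<close>

lemma powr_be_le_f: assumes "big m" "2 \<le> M" "M \<le> m" shows "(3 * real M) powr be m \<le> gm_f M"
proof -
  note m = big_ln[OF assms(1)] and b = be_bounds[OF assms(1)]
  have f: "gm_f m > 256" using assms by (simp add: big_def)
  define \<theta> where "\<theta> = ln (real M) / ln (real m)"
  have \<theta>: "0 < \<theta>" "\<theta> \<le> 1" using assms m by (auto simp: \<theta>_def)
  have "real M powr be m = (real m powr be m) powr \<theta>"
    unfolding powr_powr using assms m by (simp add: powr_def \<theta>_def)
  also have "\<dots> = (gm_f m / 8) powr \<theta>" by (simp add: b(3))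
  also have "\<dots> \<le> 1 + \<theta> * (gm_f m / 8 - 1)" using \<theta> f by (intro bernoulli_powr) auto
  also have "\<dots> \<le> 1 + \<theta> * gm_f m / 8" using \<theta> by (simp add: algebra_simps)
  also have "\<theta> * gm_f m \<le> \<theta> * (2 * log 2 (real m))" using big_f_le(1)[OF assms(1)] \<theta> by (intro mult_left_mono) auto
  also have "\<theta> * (2 * log 2 (real m)) = 2 * log 2 (real M)" using m by (simp add: \<theta>_def log_def)
  finally have 1: "real M powr be m \<le> 1 + log 2 (real M) / 4" by simp
  have "ln (3::real) \<le> ln (2 * 2)" by (subst ln_le_cancel_iff) auto
  then have l3: "ln (3::real) \<le> 25/18" using ln2_le_25_over_36 by (subst (asm) ln_mult) auto
  have "be m \<le> 21/50 / 13"
  proof -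
    let ?y = "ln (real m)"
    have w: "sqrt ?y \<ge> 13" using m real_le_rsqrt[of 13 ?y] by simp
    have "ln (gm_f m / 8) \<le> ln ?y" using f big_f_le(2)[OF assms(1)] m by (subst ln_le_cancel_iff) auto
    also have "ln ?y \<le> 21/50 * sqrt ?y" using ln_le_sqrt[of ?y] m by simp
    finally have "be m \<le> 21/50 * sqrt ?y / ?y" unfolding be_def using m by (intro divide_right_mono) auto
    also have "\<dots> = 21/50 / sqrt ?y" using m by (simp add: real_div_sqrt field_simps)
    also have "\<dots> \<le> 21/50 / 13" using w m by (intro divide_left_mono) auto
    finally show ?thesis .
  qed
  then have "be m * ln 3 \<le> 21/50 / 13 * (25/18)" using l3 b by (intro mult_mono) auto
  then have "be m * ln 3 \<le> 1/20" by simp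
  then have "exp (be m * ln 3) \<le> exp (1/20)" by (simp only: exp_le_cancel_iff)
  also have "\<dots> \<le> 1 + 1/20 + (1/20)\<^sup>2" using exp_bound[of "1/20::real"] by simp
  finally have "exp (be m * ln 3) \<le> 1 + 1/20 + (1/20)\<^sup>2" .
  then have 3: "3 powr be m \<le> 53/50" unfolding powr_def by (simp add: power2_eq_square)
  let ?s = "log 2 (real M)"
  have s1: "?s \<ge> 1" using assms by simp
  have "(3 * real M) powr be m = 3 powr be m * real M powr be m" by (simp add: powr_mult)
  also have "\<dots> \<le> 53/50 * (1 + ?s / 4)" using 1 3 s1 by (intro mult_mono) auto
  also have "\<dots> \<le> gm_f M"
  proof (cases "M = 2")
    case True
    have "(3/2) \<le> log 2 (3::real)"
    proof -
      have "2 powr (3/2) \<le> (3::real)"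
      proof (rule power2_le_imp_le)
        have "(2 powr (3/2))\<^sup>2 = (2::real) powr 3" by (simp add: power2_eq_square powr_add[symmetric])
        then show "(2 powr (3/2))\<^sup>2 \<le> (3::real)\<^sup>2" by simp
      qed simp
      then show ?thesis using le_log_iff[of 2 3 "3/2"] by linarith
    qed
    then show ?thesis using True by (simp add: gm_f_def)
  next
    case False
    then have M3: "real M \<ge> 3" using assms by linarith
    have "(3/2) \<le> log 2 (real M)"
    proof -
      have "2 powr (3/2) \<le> (3::real)"
      proof (rule power2_le_imp_le)
        have "(2 powr (3/2))\<^sup>2 = (2::real) powr 3" by (simp add: power2_eq_square powr_add[symmetric])
        then show "(2 powr (3/2))\<^sup>2 \<le> (3::real)\<^sup>2" by simp
      qed simp
      then show ?thesis using M3 le_log_iff[of 2 "real M" "3/2"] by linarith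
    qed
    then have "53/50 * (1 + ?s / 4) \<le> ?s" by (simp add: field_simps)
    also have "?s \<le> gm_f M" unfolding gm_f_def using M3 by simp
    finally show ?thesis .
  qed
  finally show ?thesis .
qed

lemma powr_one_minus_be: assumes "big m" shows "real m powr (1 - be m) = 8 * real m / gm_f m"
proof -
  have "real m powr (1 - be m) = real m / (real m powr be m)" using big_ln[OF assms] by (simp add: powr_diff)
  then show ?thesis unfolding be_bounds(3)[OF assms] by simp
qed

lemma powr_ge_1: "n \<ge> 1 \<Longrightarrow> a \<ge> 0 \<Longrightarrow> real n powr a \<ge> 1"
  using ge_one_powr_ge_zero[of "real n" a] by simp

text \<open>From \<open>m\<close> pieces on, \<open>gm_f M\<close> exceeds
  \<open>m powr be m\<close>, so that the trivial bound by the number of vectors is good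
  enough.\<close>

lemma le_f_powr: assumes "big m" "n \<le> m" "m \<le> M" shows "real n \<le> gm_f M * real n powr (1 - be m)"
proof (cases "n = 0")
  case False
  have "real n powr be m \<le> real m powr be m" using assms be_bounds[OF assms(1)] by (intro powr_mono2) auto
  also have "\<dots> \<le> gm_f M" using be_bounds(3)[OF assms(1)] gm_f_mono[OF assms(3)] gm_f_nonneg[of m] by linarith
  finally have "real n powr be m * real n powr (1 - be m) \<le> gm_f M * real n powr (1 - be m)"
    by (intro mult_right_mono) auto
  then show ?thesis using False by (simp add: powr_add[symmetric])
qed simp

section \<open>Gaps between the members of J\<close>

lemma J_big: "gm_lacunary j \<Longrightarrow> a \<ge> 1 \<Longrightarrow> big (j a)"
  using gm_lacunaryD(2) by (simp add: big_def)

lemma J_gap: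
  assumes "gm_lacunary j" "1 \<le> a" "a < b"
  shows "ln (real (j b)) \<ge> exp (exp (4 * (real (j a))\<^sup>2))"
proof -
  have g: "ln (ln (ln (real (j b)))) \<ge> 4 * (real (j a))\<^sup>2" by (rule gm_lacunaryD(4)[OF assms])
  have "j a \<ge> 2" using gm_lacunaryD(3)[OF assms(1,2)] .
  then have p: "4 * (real (j a))\<^sup>2 > 0" by simp
  have y: "ln (real (j b)) \<ge> 170" using big_ln[OF J_big[OF assms(1)], of b] assms by simp
  then have "ln (ln (real (j b))) > 0" by simp
  then have "exp (4 * (real (j a))\<^sup>2) \<le> ln (ln (real (j b)))" using g ln_ge_iff by blast
  then show ?thesis using y by (subst (asm) ln_ge_iff) auto
qed

text \<open>The weak consequences of the gap on which most estimates rely. The full strength of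
  \<open>J_gap\<close> enters only where the first weight of a special sequence has to exceed an
  exponential of its length.\<close>

lemma J_gap_le:
  assumes "gm_lacunary j" "1 \<le> a" "a < b"
  shows "4 * (real (j a))\<^sup>2 \<le> ln (real (j b))" "real (j a) \<le> ln (real (j b))" "(real (j a))\<^sup>2 \<le> gm_f (j b)"
proof -
  have e: "x \<le> exp x" for x :: real using exp_ge_add_one_self[of x] by linarith
  show 1: "4 * (real (j a))\<^sup>2 \<le> ln (real (j b))"
    using J_gap[OF assms] e[of "4 * (real (j a))\<^sup>2"] e[of "exp (4 * (real (j a))\<^sup>2)"] by linarith
  have ja: "real (j a) \<ge> 1" using gm_lacunaryD(3)[OF assms(1,2)] by linarith
  have "real (j a) * 1 \<le> real (j a) * real (j a)" by (rule mult_left_mono) (use ja in auto)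
  then show "real (j a) \<le> ln (real (j b))" using 1 by (simp add: power2_eq_square)
  have "j b \<ge> 1" using gm_lacunaryD(3)[OF assms(1), of b] assms by linarith
  from gm_f_ge_ln[OF this] show "(real (j a))\<^sup>2 \<le> gm_f (j b)" using 1 zero_le_power2[of "real (j a)"] by linarith
qed

lemma gm_f_power: "gm_f (2 ^ m) \<ge> real m"
proof -
  have "log 2 (2 ^ m) \<le> log 2 (2 ^ m + 1::real)" by (subst log_le_cancel_iff) (auto simp: add_pos_pos)
  then show ?thesis by (simp add: gm_f_def log_nat_power)
qed


section \<open>Upper estimates for rapidly increasing sequences\<close>

context gm
begin

text \<open>What the estimates use of an l1 average: cutting \<open>x\<close> into at most
  \<open>n\<close> intervals keeps the total norm below \<open>D\<close>.\<close>

definition spread :: "real \<Rightarrow> nat \<Rightarrow> (nat \<Rightarrow> 'k) \<Rightarrow> bool" where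
  "spread D n x \<longleftrightarrow> (\<forall>M t. M \<le> n \<longrightarrow> mono t \<longrightarrow> (\<Sum>l<M. N (proj {t l..<t (Suc l)} x)) \<le> D)"

lemma spread_N: assumes "spread D n x" "n \<ge> 1" "x \<in> c00" shows "N x \<le> D"
proof -
  obtain r where r: "supp_in x 0 r" using assms(3) c00E by blast
  have m: "mono (\<lambda>l::nat. if l = 0 then 0 else r)" by (auto simp: mono_def)
  have "(\<Sum>l<1. N (proj {(if l = 0 then 0 else r)..<(if Suc l = 0 then 0 else r)} x)) \<le> D"
    using assms(1,2) m unfolding spread_def by blast
  then show ?thesis using supp_in_proj_eq[OF r] by simp
qed

text \<open>A rapidly increasing sequence. The l1 norms of earlier vectors are small against
  \<open>gm_f (n i)\<close>, so a functional with more than \<open>n i\<close> summands, divided by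
  \<open>gm_f\<close> of their number or its square root, hardly sees them; functionals with fewer
  summands are controlled by \<open>spread\<close>. The condition on \<open>n 0\<close> also gives
  \<open>gm_f (n 0) >= m\<close>.\<close>

definition ris :: "real \<Rightarrow> nat \<Rightarrow> (nat \<Rightarrow> nat) \<Rightarrow> (nat \<Rightarrow> nat) \<Rightarrow> (nat \<Rightarrow> nat \<Rightarrow> 'k) \<Rightarrow> bool" where
  "ris D m n s x \<longleftrightarrow> D \<ge> 1 \<and> strict_mono s \<and> (\<forall>i<m. supp_in (x i) (s i) (s (Suc i)) \<and> spread D (n i) (x i) \<and>
     (\<Sum>i'<i. l1 (x i')) \<le> sqrt (gm_f (n i))) \<and> (\<forall>i<m. \<forall>i'\<le>i. n i' \<le> n i) \<and> 2 ^ m \<le> n 0"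

lemma risD:
  assumes "ris D m n s x"
  shows "D \<ge> 1" "strict_mono s" "i < m \<Longrightarrow> supp_in (x i) (s i) (s (Suc i))" "i < m \<Longrightarrow> spread D (n i) (x i)"
    "i < m \<Longrightarrow> (\<Sum>i'<i. l1 (x i')) \<le> sqrt (gm_f (n i))" "i < m \<Longrightarrow> i' \<le> i \<Longrightarrow> n i' \<le> n i" "2 ^ m \<le> n 0"
    "i < m \<Longrightarrow> x i \<in> c00" "i < m \<Longrightarrow> N (x i) \<le> D"
proof -
  show 1: "D \<ge> 1" "strict_mono s" "i < m \<Longrightarrow> supp_in (x i) (s i) (s (Suc i))" "i < m \<Longrightarrow> spread D (n i) (x i)"
    "i < m \<Longrightarrow> (\<Sum>i'<i. l1 (x i')) \<le> sqrt (gm_f (n i))" "i < m \<Longrightarrow> i' \<le> i \<Longrightarrow> n i' \<le> n i" "2 ^ m \<le> n 0" for i i'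
    using assms unfolding ris_def by blast+
  show "x i \<in> c00" if "i < m" using 1(3)[OF that] by (rule supp_in_c00)
  moreover have "n i \<ge> 1" if "i < m"
  proof -
    have "(1::nat) \<le> 2 ^ m" by simp
    then show ?thesis using 1(6)[OF that, of 0] 1(7) by linarith
  qed
  ultimately show "N (x i) \<le> D" if "i < m" using spread_N 1(4) that by blast
qed

text \<open>Each breakpoint lies strictly inside at most one block
  \<open>{s i..<s (Suc i)}\<close>.\<close>

lemma card_cut_le:
  fixes s t :: "nat \<Rightarrow> nat"
  assumes s: "strict_mono s"
  shows "card {i \<in> I. \<exists>l\<le>M. s i < t l \<and> t l < s (Suc i)} \<le> Suc M" (is "card ?S \<le> _")
proof -
  have ms: "s i \<le> s i'" if "i \<le> i'" for i i' using s that by (simp add: strict_mono_less_eq)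
  have "?S \<subseteq> (\<Union>l\<in>{..M}. {i. s i < t l \<and> t l < s (Suc i)})" by auto
  moreover have one: "card {i. s i < b \<and> b < s (Suc i)} \<le> 1 \<and> finite {i. s i < b \<and> b < s (Suc i)}" for b
  proof -
    have "i = i'" if "s i < b" "b < s (Suc i)" "s i' < b" "b < s (Suc i')" for i i'
    proof (rule ccontr)
      assume "i \<noteq> i'"
      then have "Suc i \<le> i' \<or> Suc i' \<le> i" by auto
      then have "s (Suc i) \<le> s i' \<or> s (Suc i') \<le> s i" using ms by blast
      then show False using that by linarith
    qed
    then have "\<exists>i. {i. s i < b \<and> b < s (Suc i)} \<subseteq> {i}" by blast
    then obtain i where i: "{i. s i < b \<and> b < s (Suc i)} \<subseteq> {i}" ..
    show ?thesis using card_mono[OF _ i] finite_subset[OF i] by simp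
  qed
  ultimately have "card ?S \<le> card (\<Union>l\<in>{..M}. {i. s i < t l \<and> t l < s (Suc i)})"
    by (intro card_mono) auto
  also have "\<dots> \<le> (\<Sum>l\<in>{..M}. card {i. s i < t l \<and> t l < s (Suc i)})" by (rule card_UN_le) simp
  also have "\<dots> \<le> (\<Sum>l\<in>{..M}. 1)" using one by (intro sum_mono) blast
  finally show ?thesis by simp
qed

text \<open>A family of seminorms \<open>w l\<close>, the \<open>l\<close>-th one living on the interval \<open>{t l..<t (Suc l)}\<close>.\<close>

definition wfam :: "nat \<Rightarrow> (nat \<Rightarrow> nat) \<Rightarrow> (nat \<Rightarrow> (nat \<Rightarrow> 'k) \<Rightarrow> real) \<Rightarrow> bool" where
  "wfam M t w \<longleftrightarrow> mono t \<and> (\<forall>l<M. (\<forall>u\<in>c00. \<forall>v\<in>c00. w l (u + v) \<le> w l u + w l v) \<and>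
     (\<forall>u\<in>c00. 0 \<le> w l u \<and> w l u \<le> N (proj {t l..<t (Suc l)} u)))"

lemma subadd_sum:
  assumes "\<And>u v. u \<in> c00 \<Longrightarrow> v \<in> c00 \<Longrightarrow> w (u + v) \<le> w u + w v" "w 0 = (0::real)"
    "\<And>i. i \<in> A \<Longrightarrow> x i \<in> (c00 :: (nat \<Rightarrow> 'k) set)"
  shows "w (\<Sum>i\<in>A. x i) \<le> (\<Sum>i\<in>A. w (x i))"
  using assms(3)
proof (induction A rule: infinite_finite_induct)
  case (insert a A)
  then have "w (\<Sum>i\<in>A. x i) \<le> (\<Sum>i\<in>A. w (x i))" by simp
  moreover have "w (x a + (\<Sum>i\<in>A. x i)) \<le> w (x a) + w (\<Sum>i\<in>A. x i)"
    by (rule assms(1)) (use insert.prems in auto)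
  ultimately show ?case using insert(1,2) by simp
qed (use assms(2) in simp_all)

lemma wfam_zero: "wfam M t w \<Longrightarrow> l < M \<Longrightarrow> w l 0 = 0"
  unfolding wfam_def using c00_zero N_zero(2) proj_zero(1) by (metis order_antisym)

lemma wfam_sum: "wfam M t w \<Longrightarrow> l < M \<Longrightarrow> (\<And>i. i \<in> A \<Longrightarrow> x i \<in> c00) \<Longrightarrow> w l (\<Sum>i\<in>A. x i) \<le> (\<Sum>i\<in>A. w l (x i))"
  by (rule subadd_sum) (auto simp: wfam_zero, simp add: wfam_def)

lemma wfam_spread:
  assumes "wfam M t w" "M \<le> n" "spread D n u" "u \<in> c00"
  shows "(\<Sum>l<M. w l u) \<le> D"
proof -
  have "(\<Sum>l<M. w l u) \<le> (\<Sum>l<M. N (proj {t l..<t (Suc l)} u))"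
    using assms(1,4) unfolding wfam_def by (intro sum_mono) auto
  also have "\<dots> \<le> D" using assms unfolding spread_def wfam_def by blast
  finally show ?thesis .
qed

text \<open>Up to \<open>n 0\<close> pieces every vector of the sequence is spread, so each
  contributes at most \<open>D\<close> to the whole sum.\<close>

lemma ris_mid:
  assumes "ris D m n s x" "i1 \<le> m" "wfam M t w" "M \<le> n 0"
  shows "(\<Sum>l<M. w l (\<Sum>i=i0..<i1. x i)) \<le> D * real (i1 - i0)"
proof -
  have "(\<Sum>l<M. w l (\<Sum>i=i0..<i1. x i)) \<le> (\<Sum>l<M. \<Sum>i=i0..<i1. w l (x i))"
    using risD(8)[OF assms(1)] assms(2) by (intro sum_mono wfam_sum[OF assms(3)]) auto
  also have "\<dots> = (\<Sum>i=i0..<i1. \<Sum>l<M. w l (x i))" by (rule sum.swap)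
  also have "\<dots> \<le> (\<Sum>i=i0..<i1. D)"
  proof (rule sum_mono)
    fix i assume "i \<in> {i0..<i1}"
    then have i: "i < m" using assms(2) by simp
    show "(\<Sum>l<M. w l (x i)) \<le> D"
      using wfam_spread[OF assms(3) _ risD(4)[OF assms(1) i] risD(8)[OF assms(1) i]] risD(6)[OF assms(1) i, of 0] assms(4) by simp
  qed
  finally show ?thesis by (simp add: mult.commute)
qed

text \<open>An index lies in \<open>J l\<close> if its block is inside the \<open>l\<close>-th
  interval, in \<open>S\<close> if its block is cut by one of the \<open>M + 1\<close> breakpoints;
  all other blocks are invisible. The hypothesis on subsums handles the \<open>J l\<close>,
  spreading handles \<open>S\<close>, and concavity of the power recombines the groups.\<close>

lemma ris_split:
  assumes R: "ris D m n s x" and I: "i0 < i1" "i1 \<le> m" and w: "wfam M t w" "1 \<le> M" "M \<le> n 0"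
    and B: "\<And>l c d. l < M \<Longrightarrow> i0 \<le> c \<Longrightarrow> c < d \<Longrightarrow> d \<le> i1 \<Longrightarrow> w l (\<Sum>i=c..<d. x i) \<le> B * real (d - c) powr a"
    and "B \<ge> D" "0 < a" "a \<le> 1"
  shows "(\<Sum>l<M. w l (\<Sum>i=i0..<i1. x i)) \<le> B * ((3 * real M) powr (1 - a) * real (i1 - i0) powr a)"
proof -
  have t: "mono t" using w(1) by (simp add: wfam_def)
  have s: "strict_mono s" using risD(2)[OF R] .
  have ms: "s i \<le> s i'" if "i \<le> i'" for i i' using s that by (simp add: strict_mono_less_eq)
  let ?I = "{i0..<i1}"
  have c: "x i \<in> c00" if "i \<in> ?I" for i using risD(8)[OF R] I(2) that by simp
  define J where "J l = {i \<in> ?I. t l \<le> s i \<and> s (Suc i) \<le> t (Suc l)}" for l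
  define S where "S = {i \<in> ?I. \<exists>l\<le>M. s i < t l \<and> t l < s (Suc i)}"
  have finJ: "finite (J l)" "J l \<subseteq> ?I" for l by (auto simp: J_def)
  have finS: "finite S" "S \<subseteq> ?I" by (auto simp: S_def)
  have Jint: "\<exists>c d. i0 \<le> c \<and> c < d \<and> d \<le> i1 \<and> J l = {c..<d}" if "J l \<noteq> {}" for l
  proof (intro exI conjI)
    have mi: "Min (J l) \<in> J l" "Max (J l) \<in> J l" using that finJ by auto
    show "i0 \<le> Min (J l)" "Suc (Max (J l)) \<le> i1" using mi finJ(2)[of l] by auto
    show "Min (J l) < Suc (Max (J l))" using mi finJ(1)[of l] by (simp add: le_imp_less_Suc)
    show "J l = {Min (J l)..<Suc (Max (J l))}"
    proof (intro equalityI subsetI)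
      fix i assume "i \<in> J l"
      then show "i \<in> {Min (J l)..<Suc (Max (J l))}" using finJ(1)[of l] by (simp add: le_imp_less_Suc)
    next
      fix i assume i: "i \<in> {Min (J l)..<Suc (Max (J l))}"
      then have "s (Min (J l)) \<le> s i" "s (Suc i) \<le> s (Suc (Max (J l)))" by (auto intro: ms)
      moreover have "t l \<le> s (Min (J l))" "s (Suc (Max (J l))) \<le> t (Suc l)" using mi by (auto simp: J_def)
      moreover have "i \<in> ?I" using mi i finJ(2)[of l] by auto
      ultimately show "i \<in> J l" unfolding J_def by auto
    qed
  qed
  have zero: "w l (x i) = 0" if l: "l < M" and i: "i \<in> ?I" "i \<notin> J l" "i \<notin> S" for l i
  proof -
    have sup: "supp_in (x i) (s i) (s (Suc i))" using risD(3)[OF R, of i] i I by simp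
    have n1: "\<not> (s i < t l \<and> t l < s (Suc i))" "\<not> (s i < t (Suc l) \<and> t (Suc l) < s (Suc i))"
      using i l unfolding S_def by (auto simp: Suc_le_eq less_imp_le)
    have n2: "\<not> (t l \<le> s i \<and> s (Suc i) \<le> t (Suc l))" using i unfolding J_def by auto
    have "t (Suc l) \<le> s i \<or> s (Suc i) \<le> t l" using n1 n2 by linarith
    then have "proj {t l..<t (Suc l)} (x i) = 0" by (rule proj_disjoint[OF sup])
    then show ?thesis using w(1) l c[OF i(1)] N_zero(2) unfolding wfam_def by (metis order_antisym)
  qed
  have nonneg: "w l (x i) \<ge> 0" if "l < M" "i \<in> ?I" for l i using w(1) c that unfolding wfam_def by blast
  have each: "w l (\<Sum>i\<in>?I. x i) \<le> B * real (card (J l)) powr a + (\<Sum>i\<in>S. w l (x i))" if l: "l < M" for l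
  proof -
    have "(\<Sum>i\<in>?I. x i) = (\<Sum>i\<in>?I - J l. x i) + (\<Sum>i\<in>J l. x i)"
      by (rule sum.subset_diff) (use finJ in auto)
    then have "w l (\<Sum>i\<in>?I. x i) \<le> w l (\<Sum>i\<in>?I - J l. x i) + w l (\<Sum>i\<in>J l. x i)"
    proof -
      have "(\<Sum>i\<in>A. x i) \<in> c00" if "A \<subseteq> ?I" for A by (rule c00_sum) (use c that in blast)
      then have "(\<Sum>i\<in>?I - J l. x i) \<in> c00" "(\<Sum>i\<in>J l. x i) \<in> c00" using finJ(2)[of l] by (metis Diff_subset)+
      then show ?thesis using w(1) l unfolding \<open>(\<Sum>i\<in>?I. x i) = _\<close> wfam_def by blast
    qed
    also have "w l (\<Sum>i\<in>J l. x i) \<le> B * real (card (J l)) powr a"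
    proof (cases "J l = {}")
      case True then show ?thesis using wfam_zero[OF w(1) l] by simp
    next
      case False
      then obtain c d where "i0 \<le> c" "c < d" "d \<le> i1" "J l = {c..<d}" using Jint by blast
      then show ?thesis using B[OF l, of c d] by simp
    qed
    also have "w l (\<Sum>i\<in>?I - J l. x i) \<le> (\<Sum>i\<in>?I - J l. w l (x i))" by (rule wfam_sum[OF w(1) l]) (use c in auto)
    also have "\<dots> \<le> (\<Sum>i\<in>(?I - J l) \<inter> S. w l (x i))"
    proof (rule eq_refl, rule sum.mono_neutral_right)
      show "\<forall>i\<in>?I - J l - (?I - J l) \<inter> S. w l (x i) = 0" using zero[OF l] by blast
    qed auto
    also have "\<dots> \<le> (\<Sum>i\<in>S. w l (x i))" using finS nonneg[OF l] by (intro sum_mono2) auto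
    finally show ?thesis by linarith
  qed
  have cardS: "card S \<le> Suc M" unfolding S_def by (rule card_cut_le[OF s])
  have count: "(\<Sum>l<M. card (J l)) + card S \<le> i1 - i0"
  proof -
    have disj: "J l \<inter> J l' = {}" if "l < l'" for l l'
    proof -
      have "t (Suc l) \<le> t l'" using monoD[OF t, of "Suc l" l'] that by simp
      then have "False" if "i \<in> J l" "i \<in> J l'" for i
        using that strict_monoD[OF s, of i "Suc i"] unfolding J_def by auto
      then show ?thesis by blast
    qed
    have disjS: "J l \<inter> S = {}" for l
    proof -
      have "False" if ii: "i \<in> J l" "i \<in> S" for i
      proof -
        obtain l' where l': "s i < t l'" "t l' < s (Suc i)" using ii unfolding S_def by auto
        have "l' \<le> l \<or> Suc l \<le> l'" by auto
        then have "t l' \<le> t l \<or> t (Suc l) \<le> t l'" using monoD[OF t] by blast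
        then show False using l' ii(1) unfolding J_def by auto
      qed
      then show ?thesis by blast
    qed
    have "(\<Sum>l<M. card (J l)) = card (\<Union>l\<in>{..<M}. J l)"
      by (rule card_UN_disjoint[symmetric]) (use finJ disj in \<open>auto, metis (no_types, lifting) IntI disj empty_iff nat_neq_iff\<close>)
    then have "(\<Sum>l<M. card (J l)) + card S = card ((\<Union>l\<in>{..<M}. J l) \<union> S)"
      using disjS finJ finS by (subst card_Un_disjoint) auto
    also have "\<dots> \<le> card ?I" using finJ finS by (intro card_mono) auto
    finally show ?thesis by simp
  qed
  have "(\<Sum>l<M. w l (\<Sum>i\<in>?I. x i)) \<le> (\<Sum>l<M. B * real (card (J l)) powr a + (\<Sum>i\<in>S. w l (x i)))"
    using each by (intro sum_mono) auto
  also have "\<dots> = B * (\<Sum>l<M. real (card (J l)) powr a) + (\<Sum>i\<in>S. \<Sum>l<M. w l (x i))"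
    unfolding sum.distrib sum_distrib_left by (subst sum.swap) simp
  also have "(\<Sum>i\<in>S. \<Sum>l<M. w l (x i)) \<le> (\<Sum>i\<in>S. B)"
  proof (rule sum_mono)
    fix i assume "i \<in> S"
    then have i: "i < m" using I(2) finS(2) by auto
    show "(\<Sum>l<M. w l (x i)) \<le> B"
      using wfam_spread[OF w(1) _ risD(4)[OF R i] risD(8)[OF R i]] risD(6)[OF R i, of 0] w(3) \<open>B \<ge> D\<close> by simp
  qed
  also have "(\<Sum>i\<in>S. B) = B * real (card S)" by simp
  finally have 1: "(\<Sum>l<M. w l (\<Sum>i\<in>?I. x i)) \<le> B * ((\<Sum>l<M. real (card (J l)) powr a) + real (card S))"
    by (simp add: algebra_simps)
  let ?n = "M + card S"
  \<comment> \<open>Cut blocks enter as groups of one element each; since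
    \<open>card S <= M + 1\<close> and \<open>M >= 1\<close>, there are at most \<open>3 * M\<close>
    groups.\<close>
  define \<tau> where "\<tau> l = (if l < M then real (card (J l)) else 1)" for l
  have cat: "(\<Sum>l<?n. f l) = (\<Sum>l<M. f l) + (\<Sum>l=M..<?n. f l)" for f :: "nat \<Rightarrow> real"
    using sum.atLeastLessThan_concat[of 0 M ?n f] by (simp add: atLeast0LessThan)
  have "(\<Sum>l<M. real (card (J l)) powr a) + real (card S) = (\<Sum>l<?n. \<tau> l powr a)"
    unfolding cat by (simp add: \<tau>_def)
  also have "\<dots> \<le> real (card {..<?n}) powr (1 - a) * (\<Sum>l<?n. \<tau> l) powr a"
    by (rule power_mean_powr) (use assms in \<open>auto simp: \<tau>_def\<close>)
  also have "(\<Sum>l<?n. \<tau> l) = real ((\<Sum>l<M. card (J l)) + card S)" unfolding cat by (simp add: \<tau>_def)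
  also have "real (card {..<?n}) powr (1 - a) * real ((\<Sum>l<M. card (J l)) + card S) powr a
      \<le> (3 * real M) powr (1 - a) * real (i1 - i0) powr a"
  proof (intro mult_mono powr_mono2 of_nat_0_le_iff powr_ge_zero)
    show "real (card {..<?n}) \<le> 3 * real M" using cardS w(2) by simp
    show "real ((\<Sum>l<M. card (J l)) + card S) \<le> real (i1 - i0)" using count by (simp only: of_nat_le_iff)
  qed (use assms in auto)
  finally have "(\<Sum>l<M. real (card (J l)) powr a) + real (card S) \<le> (3 * real M) powr (1 - a) * real (i1 - i0) powr a" .
  then have "B * ((\<Sum>l<M. real (card (J l)) powr a) + real (card S)) \<le> B * ((3 * real M) powr (1 - a) * real (i1 - i0) powr a)"
    using \<open>B \<ge> D\<close> risD(1)[OF R] by (intro mult_left_mono) auto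
  then show ?thesis using 1 by linarith
qed

text \<open>Let \<open>c\<close> be the last index with \<open>n c < M\<close>. The vectors before
  \<open>c\<close> are small in the l1 norm, those after \<open>c\<close> are spread for
  \<open>M\<close> pieces, and the single vector at \<open>c\<close> gets the crude bound
  \<open>E\<close>.\<close>

lemma ris_large:
  assumes R: "ris D m n s x" and I: "i1 \<le> m"
    and q: "\<And>u v. u \<in> c00 \<Longrightarrow> v \<in> c00 \<Longrightarrow> q (u + v) \<le> q u + q v" "q 0 = 0" "\<And>u. u \<in> c00 \<Longrightarrow> q u \<le> \<beta> * l1 u"
    "\<And>i. i < m \<Longrightarrow> q (x i) \<le> E" "\<And>i. i < m \<Longrightarrow> M \<le> n i \<Longrightarrow> q (x i) \<le> \<gamma>" and nn: "\<beta> \<ge> 0" "E \<ge> 0" "\<gamma> \<ge> 0"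
  shows "q (\<Sum>i=i0..<i1. x i) \<le> \<beta> * sqrt (gm_f M) + E + \<gamma> * real (i1 - i0)"
proof -
  have xc: "x i \<in> c00" if "i < i1" for i using risD(8)[OF R] that I by simp
  have qs: "q (\<Sum>i\<in>A. x i) \<le> (\<Sum>i\<in>A. q (x i))" if "A \<subseteq> {..<i1}" for A
    by (rule subadd_sum[OF q(1,2)]) (use xc that in auto)
  define P where "P i \<longleftrightarrow> i0 \<le> i \<and> i < i1 \<and> n i < M" for i
  show ?thesis
  proof (cases "\<exists>i. P i")
    case False
    have "q (\<Sum>i=i0..<i1. x i) \<le> (\<Sum>i=i0..<i1. q (x i))" by (rule qs) auto
    also have "\<dots> \<le> (\<Sum>i=i0..<i1. \<gamma>)" using False I unfolding P_def by (intro sum_mono q(5)) (auto simp: not_less)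
    also have "\<dots> = \<gamma> * real (i1 - i0)" by simp
    moreover have "\<beta> * sqrt (gm_f M) \<ge> 0" using nn(1) by simp
    ultimately show ?thesis using nn(2) by linarith
  next
    case True
    define c where "c = (GREATEST i. P i)"
    have bd: "\<forall>i. P i \<longrightarrow> i \<le> i1" unfolding P_def by auto
    have c: "P c" unfolding c_def using True bd by (metis GreatestI_nat)
    have cm: "i \<le> c" if "P i" for i unfolding c_def using that bd by (metis Greatest_le_nat)
    have cI: "i0 \<le> c" "c < i1" "n c < M" using c by (auto simp: P_def)
    have eq: "(\<Sum>i=i0..<i1. x i) = (\<Sum>i=i0..<c. x i) + (x c + (\<Sum>i=Suc c..<i1. x i))"
    proof -
      have "(\<Sum>i=i0..<i1. x i) = (\<Sum>i=i0..<c. x i) + (\<Sum>i=c..<i1. x i)"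
        using cI by (simp add: sum.atLeastLessThan_concat)
      then show ?thesis using cI by (simp add: sum.atLeast_Suc_lessThan)
    qed
    have "q (\<Sum>i=i0..<i1. x i) \<le> q (\<Sum>i=i0..<c. x i) + q (x c + (\<Sum>i=Suc c..<i1. x i))"
      unfolding eq using cI by (intro q(1) c00_add c00_sum xc) auto
    also have "q (x c + (\<Sum>i=Suc c..<i1. x i)) \<le> q (x c) + q (\<Sum>i=Suc c..<i1. x i)"
      using cI by (intro q(1) c00_sum xc) auto
    also have "q (x c) \<le> E" using q(4) cI I by simp
    also have "q (\<Sum>i=Suc c..<i1. x i) \<le> (\<Sum>i=Suc c..<i1. q (x i))" by (rule qs) auto
    also have "\<dots> \<le> (\<Sum>i=Suc c..<i1. \<gamma>)"
    proof (intro sum_mono q(5))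
      fix i assume i: "i \<in> {Suc c..<i1}"
      then show "i < m" using I by simp
      show "M \<le> n i"
      proof (rule ccontr)
        assume "\<not> M \<le> n i"
        then have "P i" using i cI unfolding P_def by auto
        then show False using cm i by fastforce
      qed
    qed
    also have "\<dots> \<le> \<gamma> * real (i1 - i0)" using cI nn(3) by (simp add: mult.commute mult_left_mono)
    also have "q (\<Sum>i=i0..<c. x i) \<le> \<beta> * l1 (\<Sum>i=i0..<c. x i)" using cI by (intro q(3) c00_sum xc) auto
    also have "l1 (\<Sum>i=i0..<c. x i) \<le> (\<Sum>i=i0..<c. l1 (x i))"
      by (rule subadd_sum) (use xc cI l1_add in auto)
    also have "\<dots> \<le> (\<Sum>i<c. l1 (x i))" by (rule sum_mono2) auto
    also have "\<dots> \<le> sqrt (gm_f (n c))" using risD(5)[OF R] cI I by simp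
    also have "\<dots> \<le> sqrt (gm_f M)" using cI gm_f_mono[of "n c" M] by simp
    finally show ?thesis using nn(1) by (simp add: mult_left_mono)
  qed
qed

lemma wfam_p: "mono t \<Longrightarrow> wfam M t (\<lambda>l u. p k (proj {t l..<t (Suc l)} u))"
  unfolding wfam_def proj_add
  by (auto intro!: goodD(3)[OF good_p] goodD(6)[OF good_p] p_le_N' c00_proj_fin)

lemma wfam_N: "mono t \<Longrightarrow> wfam M t (\<lambda>l u. N (proj {t l..<t (Suc l)} u))"
  unfolding wfam_def proj_add
  by (auto intro!: N_add N_nonneg N_proj_G)

text \<open>The bound is asked of all subsums over intervals of indices, so that in the induction
  over the level it applies to the groups left by a cut.\<close>

definition upper_level :: "real \<Rightarrow> nat \<Rightarrow> (nat \<Rightarrow> nat \<Rightarrow> 'k) \<Rightarrow> nat \<Rightarrow> bool" where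
  "upper_level B m x k \<longleftrightarrow> (\<forall>c d. c < d \<longrightarrow> d \<le> m \<longrightarrow> p k (\<Sum>i=c..<d. x i) \<le> B * real (d - c) powr (1 - be m))"

text \<open>The number of pieces decides the argument. Up to \<open>m\<close> the power bound of the
  current level is recombined, and \<open>gm_f M\<close> pays for the cutting; between
  \<open>m\<close> and \<open>n 0\<close> spreading of the single vectors suffices; beyond
  \<open>n 0\<close> there is one transitional vector, and \<open>gm_f M >= m\<close> absorbs the
  others.\<close>

lemma ris_fop:
  assumes R: "ris D m n s x" and m: "big m" and B: "B \<ge> 3 * D" and P: "upper_level B m x k"
    and I: "i0 < i1" "i1 \<le> m" and t: "mono t" "M \<ge> 1"
  shows "(\<Sum>l<M. p k (proj {t l..<t (Suc l)} (\<Sum>i=i0..<i1. x i))) \<le> gm_f M * (B * real (i1 - i0) powr (1 - be m))"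
proof -
  note b = be_bounds[OF m]
  have D: "D \<ge> 1" by (rule risD(1)[OF R])
  let ?a = "1 - be m" let ?L = "real (i1 - i0)"
  have La: "?L powr ?a \<ge> 1" using I b by (intro powr_ge_1) auto
  have xI: "(\<Sum>i=c..<d. x i) \<in> c00" if "d \<le> m" for c d using risD(8)[OF R] that by (intro c00_sum) auto
  have f1: "gm_f M \<ge> 1" using gm_f_ge1[OF t(2)] .
  have m2: "m < 2 ^ m" by (rule less_exp)
  consider "M = 1" | "2 \<le> M" "M \<le> m" | "m < M" "M \<le> n 0" | "n 0 < M" using t(2) by linarith
  then show ?thesis
  proof cases
    case 1
    have "p k (proj {t 0..<t 1} (\<Sum>i=i0..<i1. x i)) \<le> p k (\<Sum>i=i0..<i1. x i)" by (rule goodD(5)[OF good_p xI[OF I(2)]])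
    also have "\<dots> \<le> B * ?L powr ?a" using P I unfolding upper_level_def by blast
    finally show ?thesis using 1 by simp
  next
    case 2
    have "(\<Sum>l<M. p k (proj {t l..<t (Suc l)} (\<Sum>i=i0..<i1. x i))) \<le> B * ((3 * real M) powr (1 - ?a) * ?L powr ?a)"
    proof (rule ris_split[OF R I wfam_p[OF t(1)] t(2)])
      show "M \<le> n 0" using 2 m2 risD(7)[OF R] by linarith
      show "D \<le> B" using B D by linarith
      fix l c d assume "c < d" "d \<le> i1"
      then show "p k (proj {t l..<t (Suc l)} (\<Sum>i=c..<d. x i)) \<le> B * real (d - c) powr ?a"
        using goodD(5)[OF good_p xI, of d k "t l" "t (Suc l)" c] P I unfolding upper_level_def by (meson order_trans)
    qed (use b in auto)
    also have "\<dots> \<le> B * (gm_f M * ?L powr ?a)"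
      using powr_be_le_f[OF m 2] B D by (intro mult_left_mono mult_right_mono) auto
    finally show ?thesis by (simp add: mult_ac)
  next
    case 3
    have "(\<Sum>l<M. p k (proj {t l..<t (Suc l)} (\<Sum>i=i0..<i1. x i))) \<le> D * ?L"
      by (rule ris_mid[OF R I(2) wfam_p[OF t(1)] 3(2)])
    also have "\<dots> \<le> B * (gm_f M * ?L powr ?a)"
      using le_f_powr[OF m, of "i1 - i0" M] 3 I B D by (intro mult_mono) auto
    finally show ?thesis by (simp add: mult_ac)
  next
    case 4
    define q where "q u = (\<Sum>l<M. p k (proj {t l..<t (Suc l)} u))" for u
    have fm: "gm_f M \<ge> real m"
      using gm_f_power[of m] gm_f_mono[of "2 ^ m" M] risD(7)[OF R] 4 by linarith
    have "q (\<Sum>i=i0..<i1. x i) \<le> 1 * sqrt (gm_f M) + gm_f M * D + D * real (i1 - i0)"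
    proof (rule ris_large[OF R I(2)])
      show "q (u + v) \<le> q u + q v" if "u \<in> c00" "v \<in> c00" for u v
        unfolding q_def sum.distrib[symmetric] proj_add by (intro sum_mono goodD(3)[OF good_p] c00_proj_fin)
      show "q 0 = 0" unfolding q_def by (simp add: good_zero[OF good_p])
      show "q u \<le> 1 * l1 u" if "u \<in> c00" for u
      proof -
        have "q u \<le> (\<Sum>l<M. l1 (proj {t l..<t (Suc l)} u))"
          unfolding q_def by (intro sum_mono goodD(2)[OF good_p] c00_proj_fin)
        then show ?thesis using sum_l1_proj_le[OF t(1) that, of M] by simp
      qed
      show "q (x i) \<le> gm_f M * D" if "i < m" for i
      proof -
        have "q (x i) \<le> gm_f M * p (Suc k) (x i)" unfolding q_def p_Suc
          by (rule nxt_ge1[OF good_p risD(8)[OF R that] t(1)])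
        also have "p (Suc k) (x i) \<le> D" using p_le_N'[OF risD(8)[OF R that], of "Suc k"] risD(9)[OF R that] by linarith
        finally show ?thesis by (simp add: mult_left_mono)
      qed
      show "q (x i) \<le> D" if "i < m" "M \<le> n i" for i
        unfolding q_def by (rule wfam_spread[OF wfam_p[OF t(1)] that(2) risD(4)[OF R that(1)] risD(8)[OF R that(1)]])
    qed (use D in auto)
    also have "1 * sqrt (gm_f M) \<le> gm_f M * D"
    proof -
      have "sqrt (gm_f M) \<le> gm_f M" using f1 real_le_lsqrt[of "gm_f M" "gm_f M"] by (simp add: power2_eq_square)
      also have "\<dots> \<le> gm_f M * D" using f1 D by (simp add: mult_left_mono)
      finally show ?thesis by simp
    qed
    also have "D * real (i1 - i0) \<le> D * gm_f M" using fm I D by (intro mult_left_mono) auto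
    finally have "q (\<Sum>i=i0..<i1. x i) \<le> gm_f M * (3 * D)" by (simp add: algebra_simps)
    also have "\<dots> \<le> gm_f M * (B * ?L powr ?a)"
      using mult_mono[OF B La] B D f1 by (intro mult_left_mono) auto
    finally show ?thesis unfolding q_def .
  qed
qed

section \<open>Special functionals acting on rapidly increasing sequences\<close>

definition wt :: "nat \<Rightarrow> (nat \<Rightarrow> 'k) list \<Rightarrow> nat \<Rightarrow> nat" where
  "wt k ys l = (if l = 0 then j (2 * k) else \<sigma> (take l ys))"

lemma successive_take: "successive ys \<Longrightarrow> successive (take l ys)"
  unfolding successive_def by (auto dest: in_set_takeD intro: sorted_wrt_take)

text \<open>All weights in a special sequence lie in L, the first one because its index
  \<open>2 * k\<close> is even. Lengths lie in K, so a weight never equals a length.\<close>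

lemma special_member:
  assumes "special_sequence R j \<sigma> q k ys" "l < k"
  shows "ys ! l \<in> gm_A q (wt k ys l)" "\<exists>r\<ge>1. even r \<and> wt k ys l = j r"
proof -
  have ys: "length ys = k" "successive ys" "set ys \<subseteq> gm_Q R" using assms(1) by (auto simp: special_sequence_def)
  show "ys ! l \<in> gm_A q (wt k ys l)"
    using assms unfolding special_sequence_def wt_def by (cases "l = 0") auto
  show "\<exists>r\<ge>1. even r \<and> wt k ys l = j r"
  proof (cases "l = 0")
    case True
    then show ?thesis using assms unfolding wt_def by (intro exI[of _ "2 * k"]) auto
  next
    case False
    have "take l ys \<noteq> []" using False assms ys by auto
    from sigma_L[OF this successive_take[OF ys(2)]] show ?thesis
      using False ys(3) set_take_subset[of l ys] unfolding wt_def by auto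
  qed
qed

lemma wt_pos: "special_sequence R j \<sigma> q k ys \<Longrightarrow> l < k \<Longrightarrow> wt k ys l \<ge> 2"
  using special_member(2) gm_lacunaryD(3)[OF lac] by metis

lemma act_gm_A:
  assumes "y \<in> gm_A (p k) M"
  shows "\<exists>t. mono t \<and> (\<forall>u\<in>c00. \<forall>a b. norm (act y (proj {a..<b} u)) \<le> (\<Sum>s<M. p k (proj {t s..<t (Suc s)} u)) / gm_f M)"
proof -
  obtain t where t: "mono t" "\<And>u. u \<in> c00 \<Longrightarrow> norm (act y u) \<le> (\<Sum>s<M. p k (proj {t s..<t (Suc s)} u)) / gm_f M"
    using gm_A_D(2)[OF assms good_p] by blast
  have "norm (act y (proj {a..<b} u)) \<le> (\<Sum>s<M. p k (proj {t s..<t (Suc s)} u)) / gm_f M" if "u \<in> c00" for a b u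
  proof -
    have "(\<Sum>s<M. p k (proj {t s..<t (Suc s)} (proj {a..<b} u))) \<le> (\<Sum>s<M. p k (proj {t s..<t (Suc s)} u))"
    proof (rule sum_mono)
      fix s
      have "proj {t s..<t (Suc s)} (proj {a..<b} u) = proj {a..<b} (proj {t s..<t (Suc s)} u)"
        by (simp add: Int_commute)
      then show "p k (proj {t s..<t (Suc s)} (proj {a..<b} u)) \<le> p k (proj {t s..<t (Suc s)} u)"
        using goodD(5)[OF good_p c00_proj_fin] by metis
    qed
    then have "(\<Sum>s<M. p k (proj {t s..<t (Suc s)} (proj {a..<b} u))) / gm_f M \<le> (\<Sum>s<M. p k (proj {t s..<t (Suc s)} u)) / gm_f M"
      by (rule divide_right_mono) simp
    then show ?thesis using t(2)[OF c00_proj_fin, of a b u] by linarith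
  qed
  then show ?thesis using t(1) by blast
qed

lemma act_gm_A_le_N:
  assumes "y \<in> gm_A (p k) M" "M \<ge> 1" "u \<in> c00"
  shows "norm (act y (proj {a..<b} u)) \<le> N u"
proof -
  obtain t where t: "mono t" "norm (act y (proj {a..<b} u)) \<le> (\<Sum>s<M. p k (proj {t s..<t (Suc s)} u)) / gm_f M"
    using act_gm_A[OF assms(1)] assms(3) by blast
  have "(\<Sum>s<M. p k (proj {t s..<t (Suc s)} u)) \<le> gm_f M * p (Suc k) u"
    unfolding p_Suc by (rule nxt_ge1[OF good_p assms(3) t(1)])
  then have "(\<Sum>s<M. p k (proj {t s..<t (Suc s)} u)) / gm_f M \<le> p (Suc k) u"
    using gm_f_pos[OF assms(2)] by (simp add: pos_divide_le_eq mult.commute)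
  then show ?thesis using t(2) p_le_N'[OF assms(3), of "Suc k"] by linarith
qed

text \<open>The members of a special sequence have successive supports and are dominated by the
  norm, so the estimates for families of seminorms apply to the sum of their moduli.\<close>

lemma special_wfam:
  assumes "special_sequence R j \<sigma> (p lev) k ys"
  shows "\<exists>t. wfam k t (\<lambda>l u. norm (act (ys ! l) (proj {a..<b} u)))"
proof -
  have ys: "length ys = k" "successive ys" "set ys \<subseteq> gm_Q R" using assms(1) by (auto simp: special_sequence_def)
  have "set ys \<subseteq> c00" using ys inR_Q(1) by blast
  then obtain t where t: "mono t" "\<And>l. l < length ys \<Longrightarrow> supp_in (ys ! l) (t l) (t (Suc l))"
    using breakpoints_of_successive ys by blast
  have "wfam k t (\<lambda>l u. norm (act (ys ! l) (proj {a..<b} u)))" unfolding wfam_def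
  proof (intro conjI allI impI ballI t(1))
    fix l u v assume "l < k"
    show "norm (act (ys ! l) (proj {a..<b} (u + v))) \<le> norm (act (ys ! l) (proj {a..<b} u)) + norm (act (ys ! l) (proj {a..<b} v))"
      unfolding proj_add act_add by (rule norm_triangle_ineq)
  next
    fix l and u :: "nat \<Rightarrow> 'k" assume l: "l < k"
    have "act (ys ! l) (proj {a..<b} u) = act (ys ! l) (proj {t l..<t (Suc l)} (proj {a..<b} u))"
      using act_proj[OF t(2)[of l], of "proj {a..<b} u"] l ys(1) by simp
    also have "\<dots> = act (ys ! l) (proj {a..<b} (proj {t l..<t (Suc l)} u))" by (simp add: Int_commute)
    finally show "norm (act (ys ! l) (proj {a..<b} u)) \<le> N (proj {t l..<t (Suc l)} u)"
      using act_gm_A_le_N[OF special_member(1)[OF assms l] _ c00_proj_fin] wt_pos[OF assms l] by simp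
  qed simp
  then show ?thesis by blast
qed

definition spf :: "nat \<Rightarrow> (nat \<Rightarrow> 'k) list \<Rightarrow> nat \<Rightarrow> 'k" where
  "spf k ys = scl (1 / of_real (sqrt (gm_f k))) (\<Sum>l<k. ys ! l)"

lemma spf_act:
  assumes "special_sequence R j \<sigma> q k ys"
  shows "act (spf k ys) u = (\<Sum>l<k. act (ys ! l) u) / of_real (sqrt (gm_f k))"
proof -
  have "ys ! l \<in> c00" if "l < k" for l
    using assms inR_Q(1) that unfolding special_sequence_def by (metis nth_mem subsetD)
  then have "act (\<Sum>l<k. ys ! l) u = (\<Sum>l<k. act (ys ! l) u)" by (intro act_sum_left) auto
  then show ?thesis unfolding spf_def by (simp add: act_scl_left)
qed

lemma spf_norm_le:
  assumes "special_sequence R j \<sigma> q k ys"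
  shows "norm (act (spf k ys) u) \<le> (\<Sum>l<k. norm (act (ys ! l) u)) / sqrt (gm_f k)"
  unfolding spf_act[OF assms] using norm_sum[of "\<lambda>l. act (ys ! l) u" "{..<k}"]
  by (simp add: norm_divide divide_right_mono)

lemma SF_spf: "SF q = {spf k ys | k ys. k \<in> gm_K j \<and> special_sequence R j \<sigma> q k ys}"
proof -
  have "(\<lambda>i. vsum ys i / of_real (sqrt (gm_f k))) = spf k ys" if "special_sequence R j \<sigma> q k ys" for k ys
    using that unfolding spf_def special_sequence_def by (auto simp: vsum_eq seq_apply)
  then show ?thesis unfolding special_functionals_def by (auto; metis)
qed

lemma J_less_iff: "a \<ge> 1 \<Longrightarrow> b \<ge> 1 \<Longrightarrow> j a < j b \<longleftrightarrow> a < b"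
  using gm_lacunaryD(1)[OF lac] by (metis less_asym nat_neq_iff)

lemma J_eq_iff: "a \<ge> 1 \<Longrightarrow> b \<ge> 1 \<Longrightarrow> j a = j b \<longleftrightarrow> a = b"
  using gm_lacunaryD(1)[OF lac] by (metis less_irrefl nat_neq_iff)

text \<open>A special functional shorter than \<open>m\<close> has so few members that cutting costs
  only a factor 2, against a gain of \<open>sqrt (gm_f k) >= 16\<close>. For a longer one the gaps
  in J give \<open>sqrt (gm_f k) >= m\<close>, which reduces the sum of the bounds \<open>D\<close>
  for the single vectors to \<open>D\<close>; if \<open>k\<close> exceeds \<open>n 0\<close>, early
  vectors and a transitional one are added.\<close>

lemma ris_special_other:
  assumes R: "ris D m n s x" and m: "m = j r" "r \<ge> 1" and B: "B \<ge> 3 * D" and P: "upper_level B m x lev"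
    and I: "i0 < i1" "i1 \<le> m" and k: "k \<in> gm_K j" "k \<noteq> m" "special_sequence R j \<sigma> (p lev) k ys"
  shows "norm (act (spf k ys) (proj {a..<b} (\<Sum>i=i0..<i1. x i))) \<le> B * real (i1 - i0) powr (1 - be m)"
proof -
  have bm: "big m" using J_big[OF lac m(2)] m(1) by simp
  note bb = be_bounds[OF bm]
  have D: "D \<ge> 1" by (rule risD(1)[OF R])
  let ?a = "1 - be m" let ?L = "real (i1 - i0)"
  have La: "?L powr ?a \<ge> 1" using I bb by (intro powr_ge_1) auto
  have xI: "(\<Sum>i=c..<d. x i) \<in> c00" if "d \<le> m" for c d using risD(8)[OF R] that by (intro c00_sum) auto
  obtain r' where r': "r' \<ge> 1" "k = j r'" using k(1) unfolding gm_K_def by auto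
  obtain t where w: "wfam k t (\<lambda>l u. norm (act (ys ! l) (proj {a..<b} u)))" using special_wfam[OF k(3)] by blast
  have k1: "k \<ge> 1" using K_ge[OF k(1)] by simp
  have f256: "gm_f k > 256" using gm_lacunaryD(2)[OF lac r'(1)] r' by simp
  then have s16: "sqrt (gm_f k) \<ge> 16" using f256 by (intro real_le_rsqrt) simp
  have m2: "m < 2 ^ m" by (rule less_exp)
  have BL: "3 * D \<le> B * ?L powr ?a" using mult_mono[OF B La] B D by simp
  note nle = spf_norm_le[OF k(3), of "proj {a..<b} (\<Sum>i=i0..<i1. x i)"]
  show ?thesis
  proof (cases "k < m")
    case True
    then have "r' < r" using r' m J_less_iff[of r' r] by simp
    then have kl: "real k \<le> ln (real m)" using J_gap_le(2)[OF lac r'(1)] r' m by simp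
    have "(\<Sum>l<k. norm (act (ys ! l) (proj {a..<b} (\<Sum>i=i0..<i1. x i)))) \<le> B * ((3 * real k) powr (1 - ?a) * ?L powr ?a)"
    proof (rule ris_split[OF R I w k1])
      show "k \<le> n 0" using True m2 risD(7)[OF R] by linarith
      show "D \<le> B" using B D by linarith
      fix l c d assume l: "l < k" and cd: "c < d" "d \<le> i1"
      obtain t' where t': "mono t'" "\<forall>u\<in>c00. \<forall>a b. norm (act (ys ! l) (proj {a..<b} u)) \<le>
          (\<Sum>s<wt k ys l. p lev (proj {t' s..<t' (Suc s)} u)) / gm_f (wt k ys l)"
        using act_gm_A[OF special_member(1)[OF k(3) l]] by blast
      have w1: "wt k ys l \<ge> 1" using wt_pos[OF k(3) l] by simp
      have "(\<Sum>s<wt k ys l. p lev (proj {t' s..<t' (Suc s)} (\<Sum>i=c..<d. x i))) / gm_f (wt k ys l) \<le> B * real (d - c) powr ?a"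
        using ris_fop[OF R bm B P cd(1) _ t'(1) w1] cd I gm_f_pos[OF w1] by (simp add: pos_divide_le_eq mult.commute)
      then show "norm (act (ys ! l) (proj {a..<b} (\<Sum>i=c..<d. x i))) \<le> B * real (d - c) powr ?a"
        using t'(2) xI[of d c] cd I by (meson order_trans)
    qed (use bb in auto)
    also have "\<dots> \<le> B * (2 * ?L powr ?a)"
      using powr_be_le_2[OF bm kl] B D by (intro mult_left_mono mult_right_mono) auto
    finally have "(\<Sum>l<k. norm (act (ys ! l) (proj {a..<b} (\<Sum>i=i0..<i1. x i)))) \<le> 2 * (B * ?L powr ?a)" by simp
    also have "\<dots> \<le> sqrt (gm_f k) * (B * ?L powr ?a)" using s16 B D by (intro mult_right_mono) auto
    finally have "(\<Sum>l<k. norm (act (ys ! l) (proj {a..<b} (\<Sum>i=i0..<i1. x i)))) / sqrt (gm_f k) \<le> B * ?L powr ?a"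
      using s16 f256 by (subst pos_divide_le_eq) (linarith, simp only: mult.commute)
    then show ?thesis using nle by linarith
  next
    case False
    then have "r < r'" using r' m k(2) J_less_iff[of r' r] J_eq_iff[of r' r] by (cases "r < r'") auto
    then have "(real m)\<^sup>2 \<le> gm_f k" using J_gap_le(3)[OF lac m(2)] r' m by simp
    then have sk: "real m \<le> sqrt (gm_f k)" by (rule real_le_rsqrt)
    have DL: "D * ?L / sqrt (gm_f k) \<le> D"
    proof -
      have "D * ?L \<le> D * sqrt (gm_f k)" using sk I D by (intro mult_left_mono) auto
      then show ?thesis using f256 by (subst pos_divide_le_eq) auto
    qed
    show ?thesis
    proof (cases "k \<le> n 0")
      case True
      have "(\<Sum>l<k. norm (act (ys ! l) (proj {a..<b} (\<Sum>i=i0..<i1. x i)))) \<le> D * ?L"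
        by (rule ris_mid[OF R I(2) w True])
      then have "(\<Sum>l<k. norm (act (ys ! l) (proj {a..<b} (\<Sum>i=i0..<i1. x i)))) / sqrt (gm_f k) \<le> D * ?L / sqrt (gm_f k)"
        by (rule divide_right_mono) simp
      then show ?thesis using nle DL BL D by linarith
    next
      case kn: False
      let ?q = "\<lambda>u. norm (act (spf k ys) (proj {a..<b} u))"
      have wsum: "?q u \<le> C / sqrt (gm_f k)" if "(\<Sum>l<k. norm (act (ys ! l) (proj {a..<b} u))) \<le> C" for u C
        using spf_norm_le[OF k(3), of "proj {a..<b} u"] divide_right_mono[OF that, of "sqrt (gm_f k)"] by simp
      have "?q (\<Sum>i=i0..<i1. x i) \<le> (1 / sqrt (gm_f k)) * sqrt (gm_f k) + D + D / sqrt (gm_f k) * real (i1 - i0)"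
      proof (rule ris_large[OF R I(2)])
        show "?q (u + v) \<le> ?q u + ?q v" for u v unfolding proj_add act_add by (rule norm_triangle_ineq)
        show "?q 0 = 0" by simp
        show "?q u \<le> 1 / sqrt (gm_f k) * l1 u" if u: "u \<in> c00" for u
        proof -
          have "(\<Sum>l<k. norm (act (ys ! l) (proj {a..<b} u))) \<le> (\<Sum>l<k. l1 (proj {t l..<t (Suc l)} u))"
            using w u N_le_l1[OF c00_proj_fin] unfolding wfam_def by (intro sum_mono) (meson lessThan_iff order_trans)
          also have "\<dots> \<le> l1 u" using sum_l1_proj_le[OF _ u] w unfolding wfam_def by blast
          finally show ?thesis using wsum by simp
        qed
        show "?q (x i) \<le> D" if "i < m" for i
        proof -
          have "spf k ys \<in> SF (p lev)" unfolding SF_spf using k by blast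
          then have "?q (x i) \<le> p (Suc lev) (x i)" unfolding p_Suc by (rule nxt_ge2[OF good_p risD(8)[OF R that]])
          then show ?thesis using p_le_N'[OF risD(8)[OF R that], of "Suc lev"] risD(9)[OF R that] by linarith
        qed
        show "?q (x i) \<le> D / sqrt (gm_f k)" if "i < m" "k \<le> n i" for i
          by (rule wsum, rule wfam_spread[OF w that(2) risD(4)[OF R that(1)] risD(8)[OF R that(1)]])
      qed (use D in auto)
      also have "(1 / sqrt (gm_f k)) * sqrt (gm_f k) = 1" using f256 by simp
      finally show ?thesis using DL BL D by simp
    qed
  qed
qed

lemma p0_least: "(\<And>i. norm (x i) \<le> C) \<Longrightarrow> p 0 x \<le> C"
  unfolding gm_norm_seq.simps(1) by (rule cSUP_least) auto

lemma upper_level_0: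
  assumes R: "ris D m n s x" and m: "big m" and B: "B \<ge> 3 * D"
  shows "upper_level B m x 0"
  unfolding upper_level_def
proof (intro allI impI)
  fix c d assume cd: "c < d" "d \<le> m"
  have D: "D \<ge> 1" by (rule risD(1)[OF R])
  have ms: "s i \<le> s i'" if "i \<le> i'" for i i' using risD(2)[OF R] that by (simp add: strict_mono_less_eq)
  have "norm ((\<Sum>i=c..<d. x i) k) \<le> D" for k
  proof (cases "\<exists>i\<in>{c..<d}. x i k \<noteq> 0")
    case True
    then obtain i where i: "i \<in> {c..<d}" "x i k \<noteq> 0" by blast
    have "x i' k = 0" if "i' \<in> {c..<d}" "i' \<noteq> i" for i'
    proof (rule ccontr)
      assume "x i' k \<noteq> 0"
      then have "s i' \<le> k" "k < s (Suc i')" "s i \<le> k" "k < s (Suc i)"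
        using risD(3)[OF R, of i] risD(3)[OF R, of i'] i that cd unfolding supp_in_def by auto
      moreover have "Suc i \<le> i' \<or> Suc i' \<le> i" using that by auto
      ultimately show False using ms by (meson leD le_trans)
    qed
    then have "(\<Sum>i'=c..<d. x i' k) = (\<Sum>i'=c..<d. if i' = i then x i k else 0)" by (intro sum.cong) auto
    also have "\<dots> = x i k" using i by simp
    finally have "(\<Sum>i=c..<d. x i) k = x i k" by (simp add: sum_fun_apply)
    moreover have "norm (x i k) \<le> N (x i)" using i cd by (intro N_coord c00_G risD(8)[OF R]) auto
    ultimately show ?thesis using risD(9)[OF R, of i] i cd by simp
  next
    case False
    then have "(\<Sum>i=c..<d. x i) k = 0" by (simp add: sum_fun_apply)
    then show ?thesis using D by simp
  qed
  then have "p 0 (\<Sum>i=c..<d. x i) \<le> D" by (rule p0_least)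
  moreover have "real (d - c) powr (1 - be m) \<ge> 1" using cd be_bounds[OF m] by (intro powr_ge_1) auto
  then have "3 * D * 1 \<le> B * real (d - c) powr (1 - be m)" using B D by (intro mult_mono) auto
  ultimately show "p 0 (\<Sum>i=c..<d. x i) \<le> B * real (d - c) powr (1 - be m)" using D by linarith
qed

text \<open>Induction over the level. Only special functionals of length exactly \<open>m\<close>
  are left to a hypothesis, because the members of such a functional could be tuned to the vectors
  \<open>x i\<close>.\<close>

theorem ris_upper:
  assumes R: "ris D m n s x" and m: "m = j r" "r \<ge> 1" and B: "B \<ge> 3 * D"
    and H: "\<And>lev ys a b i0 i1. upper_level B m x lev \<Longrightarrow> m \<in> gm_K j \<Longrightarrow> special_sequence R j \<sigma> (p lev) m ys \<Longrightarrow>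
      i0 < i1 \<Longrightarrow> i1 \<le> m \<Longrightarrow> norm (act (spf m ys) (proj {a..<b} (\<Sum>i=i0..<i1. x i))) \<le> B * real (i1 - i0) powr (1 - be m)"
  shows "upper_level B m x lev"
proof (induction lev)
  case 0
  show ?case by (rule upper_level_0[OF R _ B]) (use J_big[OF lac m(2)] m(1) in simp)
next
  case (Suc lev)
  have bm: "big m" using J_big[OF lac m(2)] m(1) by simp
  show ?case unfolding upper_level_def p_Suc
  proof (intro allI impI nxt_le good_p)
    fix c d assume cd: "c < d" "d \<le> m"
    show "(\<Sum>i=c..<d. x i) \<in> c00" using risD(8)[OF R] cd by (intro c00_sum) auto
    show "(\<Sum>l<M. p lev (proj {t l..<t (Suc l)} (\<Sum>i=c..<d. x i))) \<le> B * real (d - c) powr (1 - be m) * gm_f M"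
      if "M \<ge> 1" "mono t" for M t
      using ris_fop[OF R bm B Suc.IH cd that(2,1)] by (simp add: mult.commute)
    fix a b g assume "g \<in> SF (p lev)"
    then obtain k ys where k: "k \<in> gm_K j" "special_sequence R j \<sigma> (p lev) k ys" "g = spf k ys" unfolding SF_spf by blast
    show "norm (act g (proj {a..<b} (\<Sum>i=c..<d. x i))) \<le> B * real (d - c) powr (1 - be m)"
    proof (cases "k = m")
      case True
      then show ?thesis using H[OF Suc.IH _ _ cd] k by blast
    next
      case False
      then show ?thesis using ris_special_other[OF R m B Suc.IH cd k(1) False k(2)] k(3) by blast
    qed
  qed
qed

lemma upper_level_N:
  assumes "\<And>lev. upper_level B m x lev" "c < d" "d \<le> m" "\<And>i. i < m \<Longrightarrow> x i \<in> c00"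
  shows "N (\<Sum>i=c..<d. x i) \<le> B * real (d - c) powr (1 - be m)"
proof -
  have "(\<Sum>i=c..<d. x i) \<in> c00" using assms by (intro c00_sum) auto
  then show ?thesis using N_c00_least assms(1-3) unfolding upper_level_def by blast
qed

text \<open>Lengths of special functionals lie in K, so for \<open>m\<close> in L the critical case
  is void.\<close>

lemma ris_upper_L:
  assumes R: "ris D m n s x" and m: "m = j r" "r \<ge> 1" "even r"
  shows "upper_level (3 * D) m x lev"
proof (rule ris_upper[OF R m(1,2) order_refl])
  assume "m \<in> gm_K j"
  then obtain r' where "m = j r'" "r' \<ge> 1" "odd r'" unfolding gm_K_def by auto
  then show "norm (act (spf m ys) (proj {a..<b} (\<Sum>i=i0..<i1. x i))) \<le> 3 * D * real (i1 - i0) powr (1 - be m)" for ys a b i0 i1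
    using J_eq_iff[of r r'] m by auto
qed

end


section \<open>Averages and weak limits\<close>

context gm
begin

text \<open>The order of the choices matters: the spreading order \<open>n\<close> of the next
  vector is fixed after the total l1 norm \<open>S\<close> of all earlier vectors is known. The
  predicate \<open>\<Phi>\<close> carries along whatever else the chosen objects have to
  satisfy.\<close>

lemma build_ris:
  fixes ve :: "'b \<Rightarrow> nat \<Rightarrow> 'k"
  assumes step: "\<And>n p. \<exists>b q. p < q \<and> supp_in (ve b) p q \<and> spread D n (ve b) \<and> \<Phi> n p q b"
    and D: "D \<ge> 1" and n0: "2 ^ m \<le> n0"
  shows "\<exists>n s b. ris D m n s (\<lambda>i. ve (b i)) \<and> n0 \<le> n 0 \<and> s 0 = p0 \<and> (\<forall>i. \<Phi> (n i) (s i) (s (Suc i)) (b i))"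
proof -
  define P where "P i st \<longleftrightarrow> (case st of (b, a, q, n, S) \<Rightarrow> a < q \<and> supp_in (ve b) a q \<and> spread D n (ve b) \<and> \<Phi> n a q b \<and> n0 \<le> n
     \<and> (i = 0 \<longrightarrow> a = p0 \<and> S = l1 (ve b)))" for i :: nat and st
  define Q where "Q st st' \<longleftrightarrow> (case st of (b, a, q, n, S) \<Rightarrow> case st' of (b', a', q', n', S') \<Rightarrow>
     a' = q \<and> n \<le> n' \<and> S \<le> sqrt (gm_f n') \<and> S' = S + l1 (ve b'))" for st st' :: "'b \<times> nat \<times> nat \<times> nat \<times> real"
  have "\<exists>st. P 0 st"
  proof -
    from step[where n=n0 and p=p0] obtain b q where "p0 < q \<and> supp_in (ve b) p0 q \<and> spread D n0 (ve b) \<and> \<Phi> n0 p0 q b" by blast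
    then show ?thesis by (intro exI[of _ "(b, p0, q, n0, l1 (ve b))"]) (simp add: P_def)
  qed
  moreover have "\<exists>st'. P (Suc i) st' \<and> Q st st'" if "P i st" for i st
  proof -
    obtain b a q n S where st: "st = (b, a, q, n, S)" by (cases st)
    have "filterlim (\<lambda>n. sqrt (gm_f n)) at_top sequentially"
      by (rule filterlim_compose[OF sqrt_at_top gm_f_at_top])
    then have "eventually (\<lambda>n. S \<le> sqrt (gm_f n)) sequentially" by (simp add: filterlim_at_top)
    then have "eventually (\<lambda>k. S \<le> sqrt (gm_f k) \<and> n \<le> k) sequentially"
      using eventually_ge_at_top[of n] by (rule eventually_conj)
    then obtain n' where n': "S \<le> sqrt (gm_f n')" "n \<le> n'" by (auto simp: eventually_sequentially)
    from step[where n=n' and p=q] obtain b' q' where "q < q' \<and> supp_in (ve b') q q' \<and> spread D n' (ve b') \<and> \<Phi> n' q q' b'" by blast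
    then show ?thesis using n' that unfolding st
      by (intro exI[of _ "(b', q, q', n', S + l1 (ve b'))"]) (auto simp: P_def Q_def)
  qed
  ultimately obtain F where F: "\<And>i. P i (F i)" "\<And>i. Q (F i) (F (Suc i))"
    using dependent_nat_choice[of P "\<lambda>_. Q"] by blast
  define b a q n S where "b i = fst (F i)" and "a i = fst (snd (F i))" and "q i = fst (snd (snd (F i)))"
    and "n i = fst (snd (snd (snd (F i))))" and "S i = snd (snd (snd (snd (F i))))" for i
  have Fe: "F i = (b i, a i, q i, n i, S i)" for i by (simp add: b_def a_def q_def n_def S_def)
  have Pi: "a i < q i" "supp_in (ve (b i)) (a i) (q i)" "spread D (n i) (ve (b i))" "\<Phi> (n i) (a i) (q i) (b i)" "n0 \<le> n i" for i
    using F(1)[of i] unfolding P_def Fe by auto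
  have P0: "a 0 = p0" "S 0 = l1 (ve (b 0))" using F(1)[of 0] unfolding P_def Fe by auto
  have Qi: "a (Suc i) = q i" "n i \<le> n (Suc i)" "S i \<le> sqrt (gm_f (n (Suc i)))" "S (Suc i) = S i + l1 (ve (b (Suc i)))" for i
    using F(2)[of i] unfolding Q_def Fe by auto
  have S: "S i = (\<Sum>i'<Suc i. l1 (ve (b i')))" for i
    by (induction i) (simp_all add: P0 Qi)
  have mn: "n i' \<le> n i" if "i' \<le> i" for i i'
    by (rule lift_Suc_mono_le[of n, OF Qi(2) that])
  have "ris D m n a (\<lambda>i. ve (b i))" unfolding ris_def
  proof (intro conjI allI impI D)
    show "strict_mono a" using Pi(1) Qi(1) by (simp add: strict_mono_Suc_iff)
    show "supp_in (ve (b i)) (a i) (a (Suc i))" "spread D (n i) (ve (b i))" for i using Pi Qi by simp_all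
    show "(\<Sum>i'<i. l1 (ve (b i'))) \<le> sqrt (gm_f (n i))" for i
      using Qi(3) S by (cases i) auto
    show "n i' \<le> n i" if "i' \<le> i" for i i' by (rule mn[OF that])
    show "2 ^ m \<le> n 0" using Pi(5)[of 0] n0 by simp
  qed
  then show ?thesis using Pi Qi P0 by (intro exI[of _ n] exI[of _ a] exI[of _ b]) auto
qed

lemma gm_f_le_self: "gm_f M \<le> real M"
proof -
  have "real M + 1 \<le> 2 powr real M" using Bernoulli_inequality[of "1::real" M] by (simp add: powr_realpow)
  then have "log 2 (real M + 1) \<le> log 2 (2 powr real M)" by (subst log_le_cancel_iff) auto
  then show ?thesis by (simp add: gm_f_def)
qed

text \<open>A block that no breakpoint cuts is seen by at most one interval and contributes at most
  \<open>C\<close>. At most \<open>M + 1\<close> blocks are cut, each contributing at most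
  \<open>M * C\<close>, and since \<open>(K + 1)^2 <= n\<close> their share in the average is at
  most another \<open>C\<close>.\<close>

lemma spread_average:
  assumes s: "strict_mono s" and v: "\<And>i. c \<le> i \<Longrightarrow> i < c + n \<Longrightarrow> supp_in (v i) (s i) (s (Suc i)) \<and> N (v i) \<le> C"
    and n: "(K + 1)\<^sup>2 \<le> n" and C: "C \<ge> 0"
  shows "spread (2 * C) K (scl (1 / of_nat n) (\<Sum>i=c..<c + n. v i))"
  unfolding spread_def
proof (intro allI impI)
  fix M and t :: "nat \<Rightarrow> nat" assume M: "M \<le> K" and t: "mono t"
  let ?I = "{c..<c + n}"
  let ?S = "{i \<in> ?I. \<exists>l\<le>M. s i < t l \<and> t l < s (Suc i)}"
  have vG: "v i \<in> G" "N (v i) \<le> C" "supp_in (v i) (s i) (s (Suc i))" if "i \<in> ?I" for i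
    using v[of i] that c00_G[OF supp_in_c00, of "v i" "s i" "s (Suc i)"] by auto
  have n0: "n > 0" using n by (cases n) auto
  have cut: "(\<Sum>l<M. N (proj {t l..<t (Suc l)} (v i))) \<le> real M * C" if "i \<in> ?I" for i
  proof -
    have "(\<Sum>l<M. N (proj {t l..<t (Suc l)} (v i))) \<le> gm_f M * N (v i)" by (rule N_lower_estimate[OF vG(1)[OF that] t])
    also have "\<dots> \<le> real M * C" using gm_f_le_self vG(2)[OF that] N_nonneg[OF vG(1)[OF that]] by (intro mult_mono) auto
    finally show ?thesis .
  qed
  have uncut: "(\<Sum>l<M. N (proj {t l..<t (Suc l)} (v i))) \<le> C" if i: "i \<in> ?I" "i \<notin> ?S" for i
  proof (cases "\<exists>l<M. N (proj {t l..<t (Suc l)} (v i)) \<noteq> 0")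
    case False
    then show ?thesis using C by simp
  next
    case True
    then obtain l where l: "l < M" "N (proj {t l..<t (Suc l)} (v i)) \<noteq> 0" by blast
    have sub: "t l \<le> s i \<and> s (Suc i) \<le> t (Suc l)" if "l < M" "N (proj {t l..<t (Suc l)} (v i)) \<noteq> 0" for l
    proof -
      have "\<not> (t (Suc l) \<le> s i \<or> s (Suc i) \<le> t l)"
        using proj_disjoint[OF vG(3)[OF i(1)], of "t (Suc l)" "t l"] that(2) by auto
      moreover have "\<not> (s i < t l \<and> t l < s (Suc i))" "\<not> (s i < t (Suc l) \<and> t (Suc l) < s (Suc i))"
        using i that(1) by auto
      ultimately show ?thesis by linarith
    qed
    have "N (proj {t l'..<t (Suc l')} (v i)) = 0" if "l' < M" "l' \<noteq> l" for l'
    proof (rule ccontr)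
      assume "N (proj {t l'..<t (Suc l')} (v i)) \<noteq> 0"
      then have a: "t l' \<le> s i" "s (Suc i) \<le> t (Suc l')" "t l \<le> s i" "s (Suc i) \<le> t (Suc l)"
        using sub[OF that(1)] sub[OF l] by auto
      have "Suc l \<le> l' \<or> Suc l' \<le> l" using that by auto
      then have "t (Suc l) \<le> t l' \<or> t (Suc l') \<le> t l" using monoD[OF t] by blast
      then show False using a strict_monoD[OF s, of i "Suc i"] by auto
    qed
    then have "(\<Sum>l'<M. N (proj {t l'..<t (Suc l')} (v i))) = (\<Sum>l'<M. if l' = l then N (proj {t l..<t (Suc l)} (v i)) else 0)"
      by (intro sum.cong) auto
    also have "\<dots> = N (proj {t l..<t (Suc l)} (v i))" using l by simp
    also have "\<dots> \<le> C" using N_proj[OF vG(1)[OF i(1)]] vG(2)[OF i(1)] by (rule order_trans)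
    finally show ?thesis .
  qed
  have sumG: "(\<Sum>i\<in>?I. proj {t l..<t (Suc l)} (v i)) \<in> G"
    and sumN: "N (\<Sum>i\<in>?I. proj {t l..<t (Suc l)} (v i)) \<le> (\<Sum>i\<in>?I. N (proj {t l..<t (Suc l)} (v i)))" for l
    using N_sum[of ?I "\<lambda>i. proj {t l..<t (Suc l)} (v i)", OF N_proj_G] by auto
  have "(\<Sum>l<M. N (proj {t l..<t (Suc l)} (scl (1 / of_nat n) (\<Sum>i\<in>?I. v i))))
      = (1 / real n) * (\<Sum>l<M. N (\<Sum>i\<in>?I. proj {t l..<t (Suc l)} (v i)))"
    unfolding sum_distrib_left[of "1 / real n"]
  proof (rule sum.cong[OF refl])
    fix l
    have eq: "proj {t l..<t (Suc l)} (scl (1 / of_nat n) (\<Sum>i\<in>?I. v i)) = scl (1 / of_nat n) (\<Sum>i\<in>?I. proj {t l..<t (Suc l)} (v i))"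
      by (simp only: proj_scl proj_sum)
    show "N (proj {t l..<t (Suc l)} (scl (1 / of_nat n) (\<Sum>i\<in>?I. v i))) = 1 / real n * N (\<Sum>i\<in>?I. proj {t l..<t (Suc l)} (v i))"
      unfolding eq N_scl(2)[OF sumG] by (simp add: norm_divide)
  qed
  also have "\<dots> \<le> (1 / real n) * (real n * C + real n * C)"
  proof (rule mult_left_mono)
    have "(\<Sum>l<M. N (\<Sum>i\<in>?I. proj {t l..<t (Suc l)} (v i))) \<le> (\<Sum>l<M. \<Sum>i\<in>?I. N (proj {t l..<t (Suc l)} (v i)))"
      using sumN by (rule sum_mono)
    also have "\<dots> = (\<Sum>i\<in>?I. \<Sum>l<M. N (proj {t l..<t (Suc l)} (v i)))" by (rule sum.swap)
    also have "\<dots> = (\<Sum>i\<in>?I - ?S. \<Sum>l<M. N (proj {t l..<t (Suc l)} (v i))) + (\<Sum>i\<in>?S. \<Sum>l<M. N (proj {t l..<t (Suc l)} (v i)))"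
      by (rule sum.subset_diff) auto
    also have "\<dots> \<le> (\<Sum>i\<in>?I - ?S. C) + (\<Sum>i\<in>?S. real M * C)"
      using uncut cut by (intro add_mono sum_mono) auto
    also have "(\<Sum>i\<in>?I - ?S. C) \<le> (\<Sum>i\<in>?I. C)" using C by (intro sum_mono2) auto
    also have "(\<Sum>i\<in>?I. C) = real n * C" by simp
    also have "(\<Sum>i\<in>?S. real M * C) = real (card ?S * M) * C" by simp
    also have "real (card ?S * M) * C \<le> real n * C"
    proof (intro mult_right_mono C, unfold of_nat_le_iff)
      have "card ?S * M \<le> Suc M * M" by (intro mult_right_mono card_cut_le[OF s]) auto
      also have "\<dots> \<le> (K + 1) * (K + 1)" using M by (intro mult_mono) auto
      finally show "card ?S * M \<le> n" using n by (simp add: power2_eq_square)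
    qed
    finally show "(\<Sum>l<M. N (\<Sum>i\<in>?I. proj {t l..<t (Suc l)} (v i))) \<le> real n * C + real n * C" by linarith
  qed simp
  also have "\<dots> = 2 * C" using n0 by (simp add: field_simps)
  finally show "(\<Sum>l<M. N (proj {t l..<t (Suc l)} (scl (1 / of_nat n) (\<Sum>i=c..<c + n. v i)))) \<le> 2 * C" .
qed

lemma spread_mono: "spread D n x \<Longrightarrow> D \<le> D' \<Longrightarrow> n' \<le> n \<Longrightarrow> spread D' n' x"
  unfolding spread_def by (meson order_trans)

text \<open>Gliding hump: coordinatewise convergence makes the initial part of a late term small,
  and \<open>N_tail_tendsto\<close> makes its tail small.\<close>

lemma near_blocks:
  fixes p0 :: nat
  assumes u: "\<And>m. u m \<in> G" "\<And>i. (\<lambda>m. u m i) \<longlonglongrightarrow> 0" and e: "e > 0"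
  obtains r s where "strict_mono (r :: nat \<Rightarrow> nat)" "strict_mono s" "s 0 = p0"
    "\<And>i. N (u (r i) - proj {s i..<s (Suc i)} (u (r i))) \<le> e"
proof -
  define P where "P i st \<longleftrightarrow> (case st of (r, a, b) \<Rightarrow> a < b \<and> N (u r - proj {a..<b} (u r)) \<le> e \<and> (i = 0 \<longrightarrow> a = p0))"
    for i :: nat and st :: "nat \<times> nat \<times> nat"
  define Q where "Q st st' \<longleftrightarrow> (case st of (r, a, b) \<Rightarrow> case st' of (r', a', b') \<Rightarrow> r < r' \<and> a' = b)" for st st' :: "nat \<times> nat \<times> nat"
  have key: "\<exists>r b. r0 < r \<and> a < b \<and> N (u r - proj {a..<b} (u r)) \<le> e" for r0 a
  proof -
    have "(\<lambda>m. \<Sum>i=0..<a. norm (u m i)) \<longlonglongrightarrow> (\<Sum>i=0..<a. norm (0::'k))" by (intro tendsto_intros u(2))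
    then have "eventually (\<lambda>m. (\<Sum>i=0..<a. norm (u m i)) < e / 2) sequentially" using e by (intro order_tendstoD) auto
    then have "eventually (\<lambda>m. (\<Sum>i=0..<a. norm (u m i)) < e / 2 \<and> r0 < m) sequentially"
      using eventually_gt_at_top[of r0] by (rule eventually_conj)
    then obtain r where r: "(\<Sum>i=0..<a. norm (u r i)) < e / 2" "r0 < r" by (auto simp: eventually_sequentially)
    have "eventually (\<lambda>k. N (u r - proj {0..<k} (u r)) < e / 2) sequentially"
      using N_tail_tendsto[OF u(1)] e by (intro order_tendstoD) auto
    then have "eventually (\<lambda>k. N (u r - proj {0..<k} (u r)) < e / 2 \<and> a < k) sequentially"
      using eventually_gt_at_top[of a] by (rule eventually_conj)
    then obtain b where b: "N (u r - proj {0..<b} (u r)) < e / 2" "a < b" by (auto simp: eventually_sequentially)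
    have eq: "u r - proj {a..<b} (u r) = proj {0..<a} (u r) + (u r - proj {0..<b} (u r))"
      using b by (intro ext) (auto simp: seq_apply)
    have "N (proj {0..<a} (u r)) \<le> (\<Sum>i=0..<a. norm (u r i))"
      using N_le_l1[OF c00_proj_fin, of 0 a "u r"] by (subst (asm) l1_eq[OF supp_in_proj]) (simp add: seq_apply)
    then have "N (u r - proj {a..<b} (u r)) \<le> e" unfolding eq
      using N_add(2)[OF N_proj_G N_tail(1)[OF u(1)], of 0 a "u r" r b] r b by linarith
    then show ?thesis using r b by blast
  qed
  have "\<exists>st. P 0 st"
  proof -
    obtain r b where "0 < r \<and> p0 < b \<and> N (u r - proj {p0..<b} (u r)) \<le> e" using key by blast
    then show ?thesis by (intro exI[of _ "(r, p0, b)"]) (simp add: P_def)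
  qed
  moreover have "\<exists>st'. P (Suc i) st' \<and> Q st st'" for i st
  proof -
    obtain r a b where st: "st = (r, a, b)" by (cases st)
    obtain r' b' where "r < r' \<and> b < b' \<and> N (u r' - proj {b..<b'} (u r')) \<le> e" using key by blast
    then show ?thesis unfolding st by (intro exI[of _ "(r', b, b')"]) (simp add: P_def Q_def)
  qed
  ultimately obtain F where F: "\<And>i. P i (F i)" "\<And>i. Q (F i) (F (Suc i))"
    using dependent_nat_choice[of P "\<lambda>_. Q"] by blast
  define r a b where "r i = fst (F i)" and "a i = fst (snd (F i))" and "b i = snd (snd (F i))" for i
  have Fe: "F i = (r i, a i, b i)" for i by (simp add: b_def a_def r_def)
  have Pi: "a i < b i" "N (u (r i) - proj {a i..<b i} (u (r i))) \<le> e" for i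
    using F(1)[of i] unfolding P_def Fe by auto
  have a0: "a 0 = p0" using F(1)[of 0] unfolding P_def Fe by auto
  have Qi: "r i < r (Suc i)" "a (Suc i) = b i" for i
    using F(2)[of i] unfolding Q_def Fe by auto
  show ?thesis
  proof (rule that[of r a])
    show "strict_mono r" "strict_mono a" using Pi(1) Qi by (auto simp: strict_mono_Suc_iff)
    show "N (u (r i) - proj {a i..<a (Suc i)} (u (r i))) \<le> e" for i using Pi(2)[of i] Qi(2)[of i] by simp
  qed (rule a0)
qed

section \<open>Closed subspaces and coordinatewise limits\<close>

definition csub :: "(nat \<Rightarrow> 'k) set \<Rightarrow> bool" where
  "csub Y \<longleftrightarrow> Y \<subseteq> G \<and> 0 \<in> Y \<and> (\<forall>x\<in>Y. \<forall>y\<in>Y. x + y \<in> Y) \<and> (\<forall>c. \<forall>x\<in>Y. scl c x \<in> Y) \<and>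
     (\<forall>z\<in>G. (\<forall>e>0. \<exists>y\<in>Y. N (z - y) \<le> e) \<longrightarrow> z \<in> Y)"

lemma csubD:
  assumes "csub Y"
  shows "y \<in> Y \<Longrightarrow> y \<in> G" "0 \<in> Y" "x \<in> Y \<Longrightarrow> y \<in> Y \<Longrightarrow> x + y \<in> Y" "x \<in> Y \<Longrightarrow> scl c x \<in> Y"
    "x \<in> Y \<Longrightarrow> y \<in> Y \<Longrightarrow> x - y \<in> Y" "z \<in> G \<Longrightarrow> (\<And>e. e > 0 \<Longrightarrow> \<exists>y\<in>Y. N (z - y) \<le> e) \<Longrightarrow> z \<in> Y"
    "(\<And>i. i \<in> A \<Longrightarrow> u i \<in> Y) \<Longrightarrow> (\<Sum>i\<in>A. u i) \<in> Y"
proof -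
  show 1: "y \<in> Y \<Longrightarrow> y \<in> G" "0 \<in> Y" "x \<in> Y \<Longrightarrow> y \<in> Y \<Longrightarrow> x + y \<in> Y" "x \<in> Y \<Longrightarrow> scl c x \<in> Y" for x y c
    using assms unfolding csub_def by blast+
  show "x \<in> Y \<Longrightarrow> y \<in> Y \<Longrightarrow> x - y \<in> Y"
    using 1(3)[of x "scl (-1) y"] 1(4)[of y "-1"] by simp
  show "z \<in> G \<Longrightarrow> (\<And>e. e > 0 \<Longrightarrow> \<exists>y\<in>Y. N (z - y) \<le> e) \<Longrightarrow> z \<in> Y" using assms unfolding csub_def by blast
  show "(\<And>i. i \<in> A \<Longrightarrow> u i \<in> Y) \<Longrightarrow> (\<Sum>i\<in>A. u i) \<in> Y"
    by (induction A rule: infinite_finite_induct) (auto simp: 1)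
qed

lemma exists_L_large: "\<exists>r\<ge>1. even r \<and> C \<le> gm_f (j r) \<and> n \<le> r"
proof -
  have "eventually (\<lambda>k. C \<le> gm_f k) sequentially" using gm_f_at_top by (simp add: filterlim_at_top)
  then obtain k where k: "\<And>k'. k \<le> k' \<Longrightarrow> C \<le> gm_f k'" by (auto simp: eventually_sequentially)
  have ge: "r \<le> j r" if "r \<ge> 1" for r using that
  proof (induction r rule: dec_induct)
    case base then show ?case using gm_lacunaryD(3)[OF lac, of 1] by simp
  next
    case (step r) then show ?case using gm_lacunaryD(1)[OF lac, of r "Suc r"] by simp
  qed
  let ?r = "2 * (k + n + 1)"
  have "k \<le> j ?r" using ge[of ?r] by simp
  then show ?thesis using k by (intro exI[of _ ?r]) auto
qed

text \<open>Averages of averages of blocks form a rapidly increasing sequence, so they are small; hence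
  coordinatewise convergence of bounded sequences behaves like weak convergence.\<close>

theorem csub_weakly_closed:
  assumes Y: "csub Y" and y: "\<And>m. y m \<in> Y" "\<And>m. N (y m) \<le> C" "\<And>i. (\<lambda>m. y m i) \<longlonglongrightarrow> z i"
  shows "z \<in> Y"
proof -
  have yG: "y m \<in> G" for m using csubD(1)[OF Y y(1)] .
  have z: "z \<in> G" "N z \<le> C" using N_lsc[of y C z] yG y by auto
  have C0: "C \<ge> 0" using N_nonneg[OF z(1)] z(2) by linarith
  define u where "u m = y m - z" for m
  have uG: "u m \<in> G" for m unfolding u_def using N_diff yG z by blast
  have uN: "N (u m) \<le> 2 * C" for m unfolding u_def using N_diff(2)[OF yG z(1), of m] y(2)[of m] z(2) by linarith
  have u0: "(\<lambda>m. u m i) \<longlonglongrightarrow> 0" for i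
    unfolding u_def using tendsto_diff[OF y(3) tendsto_const, of i "z i"] by (simp add: seq_apply)
  show ?thesis
  proof (rule csubD(6)[OF Y z(1)])
    fix e :: real assume e: "e > 0"
    \<comment> \<open>Blocks of the \<open>u m\<close> have norm at most \<open>2 * C\<close>, so
      their averages are spread with constant \<open>4 * C\<close>; the summand 1 meets the
      requirement \<open>D >= 1\<close>.\<close>
    define D where "D = 4 * C + 1"
    \<comment> \<open>An average of blocks is close to an average of the \<open>u m\<close>, which
      has the form \<open>y' - z\<close> with \<open>y'\<close> in \<open>Y\<close>.\<close>
    define \<Phi> where "\<Phi> b \<longleftrightarrow> (\<exists>y'\<in>Y. N (b - (y' - z)) \<le> e / 2)" for b
    have step: "\<exists>b q. p < q \<and> supp_in b p q \<and> spread D n b \<and> \<Phi> b" for n p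
    proof -
      obtain r s where rs: "strict_mono (r :: nat \<Rightarrow> nat)" "strict_mono s" "s 0 = p"
        "\<And>i. N (u (r i) - proj {s i..<s (Suc i)} (u (r i))) \<le> e / 2"
        using near_blocks[OF uG u0, of "e/2" p] e by auto
      define k where "k = (n + 1)\<^sup>2"
      have k0: "k > 0" by (simp add: k_def)
      define v where "v i = proj {s i..<s (Suc i)} (u (r i))" for i
      define b where "b = scl (1 / of_nat k) (\<Sum>i=0..<0 + k. v i)"
      have vc: "v i \<in> G" for i unfolding v_def by (rule N_proj_G)
      have "spread (2 * (2 * C)) n b" unfolding b_def
      proof (rule spread_average[OF rs(2)])
        show "supp_in (v i) (s i) (s (Suc i)) \<and> N (v i) \<le> 2 * C" for i
          unfolding v_def using N_proj[OF uG] uN supp_in_proj by (meson order_trans)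
        show "(n + 1)\<^sup>2 \<le> k" by (simp add: k_def)
      qed (use C0 in auto)
      then have sp: "spread D n b" by (rule spread_mono) (simp_all add: D_def)
      have ss: "s a \<le> s b" if "a \<le> b" for a b using rs(2) that by (simp add: strict_mono_less_eq)
      have sup: "supp_in b p (s k)" unfolding b_def
      proof (intro supp_in_scl supp_in_sum)
        fix i assume "i \<in> {0..<0 + k}"
        then show "supp_in (v i) p (s k)" unfolding v_def rs(3)[symmetric]
          by (intro supp_in_mono[OF supp_in_proj] ss) auto
      qed
      have pq: "p < s k" using strict_monoD[OF rs(2) k0] rs(3) by simp
      have "\<Phi> b" unfolding \<Phi>_def
      proof (intro bexI)
        let ?y = "scl (1 / of_nat k) (\<Sum>i=0..<0 + k. y (r i))"
        show "?y \<in> Y" by (intro csubD(4)[OF Y] csubD(7)[OF Y] y(1))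
        have zz: "z = scl (1 / of_nat k) (\<Sum>i=0..<0 + k. z)"
          using k0 by (intro ext) (simp add: seq_apply sum_fun_apply)
        let ?S = "\<Sum>i=0..<0 + k. v i - u (r i)"
        have eq: "b - (?y - z) = scl (1 / of_nat k) ?S"
          unfolding b_def u_def by (subst zz) (simp only: scl_diff[symmetric] sum_subtractf[symmetric])
        have S: "?S \<in> G" "N ?S \<le> (\<Sum>i=0..<0 + k. N (v i - u (r i)))"
          using N_sum[of "{0..<0+k}" "\<lambda>i. v i - u (r i)", OF N_diff(1)[OF vc uG]] by auto
        have "(\<Sum>i=0..<0 + k. N (v i - u (r i))) \<le> (\<Sum>i=0..<0 + k. e / 2)"
        proof (rule sum_mono)
          fix i
          have "N (v i - u (r i)) = N (- (u (r i) - v i))" by (simp add: minus_diff_eq)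
          also have "\<dots> = N (u (r i) - v i)" using N_minus[OF N_diff(1)[OF uG vc]] by blast
          finally show "N (v i - u (r i)) \<le> e / 2" using rs(4)[of i] unfolding v_def by simp
        qed
        then have "N ?S \<le> real k * (e / 2)" using S(2) by simp
        then have "(1 / real k) * N ?S \<le> (1 / real k) * (real k * (e / 2))" by (rule mult_left_mono) simp
        then show "N (b - (?y - z)) \<le> e / 2" unfolding eq N_scl(2)[OF S(1)] using k0 by (simp add: norm_divide)
      qed
      then show ?thesis using pq sup sp by blast
    qed
    \<comment> \<open>With \<open>m\<close> in L there is no critical special functional. The
      average of \<open>m\<close> terms then has norm at most
      \<open>24 * D / gm_f m <= e / 2\<close>, where 24 = 3 * 8.\<close>
    obtain r where r: "r \<ge> 1" "even r" "48 * D / e \<le> gm_f (j r)" using exists_L_large by blast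
    define m where "m = j r"
    have m2: "m \<ge> 2" unfolding m_def by (rule gm_lacunaryD(3)[OF lac r(1)])
    have D1: "D \<ge> 1" unfolding D_def using C0 by simp
    obtain n s b where R: "ris D m n s b" and \<Phi>: "\<And>i. \<Phi> (b i)"
      using build_ris[of "\<lambda>b. b" D "\<lambda>_ _ _. \<Phi>" m "2^m" 0] step D1 by auto
    have "N (\<Sum>i=0..<m. b i) \<le> 3 * D * real (m - 0) powr (1 - be m)"
      by (rule upper_level_N[OF ris_upper_L[OF R m_def r(1,2)]]) (use m2 risD(8)[OF R] in auto)
    also have "\<dots> = 24 * D * real m / gm_f m"
      using powr_one_minus_be[OF J_big[OF lac r(1)]] by (simp add: m_def)
    also have "\<dots> \<le> real m * (e / 2)"
    proof -
      have f0: "gm_f m > 0" using gm_f_pos[of m] m2 by simp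
      have "48 * D \<le> gm_f m * e" using r(3) e by (simp add: m_def pos_divide_le_eq)
      then have "24 * D / gm_f m \<le> e / 2" using f0 by (simp add: field_simps)
      from mult_left_mono[OF this, of "real m"] show ?thesis by (simp add: mult_ac)
    qed
    finally have NB: "N (\<Sum>i=0..<m. b i) \<le> real m * (e / 2)" .
    obtain y' where y': "\<And>i. y' i \<in> Y" "\<And>i. N (b i - (y' i - z)) \<le> e / 2" using \<Phi> unfolding \<Phi>_def by metis
    have bG: "b i \<in> G" if "i < m" for i using c00_G risD(8)[OF R that] by blast
    have dG: "b i - (y' i - z) \<in> G" if "i < m" for i
      using N_diff(1)[OF bG[OF that] N_diff(1)[OF csubD(1)[OF Y y'(1)] z(1)]] .
    \<comment> \<open>The average of the \<open>b i\<close> is small and lies within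
      \<open>e / 2\<close> of an average of elements of \<open>Y\<close> minus \<open>z\<close>;
      hence \<open>z\<close> is close to \<open>Y\<close>.\<close>
    let ?y = "scl (1 / of_nat m) (\<Sum>i=0..<m. y' i)"
    have "?y \<in> Y" by (intro csubD(4)[OF Y] csubD(7)[OF Y] y'(1))
    moreover have "N (z - ?y) \<le> e"
    proof -
      have eq: "z - ?y = scl (1 / of_nat m) ((\<Sum>i=0..<m. b i - (y' i - z)) - (\<Sum>i=0..<m. b i))"
        using m2 by (intro ext) (simp add: seq_apply sum_fun_apply sum_subtractf sum.distrib field_simps)
      have s1: "(\<Sum>i=0..<m. b i - (y' i - z)) \<in> G" "N (\<Sum>i=0..<m. b i - (y' i - z)) \<le> (\<Sum>i=0..<m. N (b i - (y' i - z)))"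
        using N_sum[of "{0..<m}" "\<lambda>i. b i - (y' i - z)"] dG by auto
      have s2: "(\<Sum>i=0..<m. b i) \<in> G" using N_sum[of "{0..<m}" b] bG by auto
      have "(\<Sum>i=0..<m. N (b i - (y' i - z))) \<le> (\<Sum>i=0..<m. e / 2)" by (rule sum_mono) (rule y'(2))
      then have "N ((\<Sum>i=0..<m. b i - (y' i - z)) - (\<Sum>i=0..<m. b i)) \<le> real m * e"
        using N_diff(2)[OF s1(1) s2] s1(2) NB by simp
      then have "(1 / real m) * N ((\<Sum>i=0..<m. b i - (y' i - z)) - (\<Sum>i=0..<m. b i)) \<le> (1 / real m) * (real m * e)"
        by (rule mult_left_mono) simp
      then show ?thesis unfolding eq N_scl(2)[OF N_diff(1)[OF s1(1) s2]] using m2 by (simp add: norm_divide)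
    qed
    ultimately show "\<exists>y\<in>Y. N (z - y) \<le> e" by blast
  qed
qed

end


section \<open>Functionals on finitely many coordinates\<close>

definition sublin :: "((nat \<Rightarrow> 'k::real_normed_field) \<Rightarrow> real) \<Rightarrow> bool" where
  "sublin q \<longleftrightarrow> (\<forall>x y. q (x + y) \<le> q x + q y) \<and> (\<forall>r\<ge>0. \<forall>x. q (scl (of_real r) x) = r * q x)"

lemma sublinD:
  assumes "sublin q"
  shows "q (x + y) \<le> q x + q y" "r \<ge> 0 \<Longrightarrow> q (scl (of_real r) x) = r * q x" "q 0 = 0" "0 \<le> q x + q (- x)"
proof -
  show 1: "q (x + y) \<le> q x + q y" "r \<ge> 0 \<Longrightarrow> q (scl (of_real r) x) = r * q x" for x y r
    using assms unfolding sublin_def by blast+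
  show "q 0 = 0" using 1(2)[of 0 0] by simp
  then show "0 \<le> q x + q (- x)" using 1(1)[of x "- x"] by simp
qed

text \<open>One step of Hahn--Banach: the infimum over \<open>t >= 0\<close> of
  \<open>q (x + t y) - t * q y\<close> is a sublinear minorant of \<open>q\<close> that is odd at
  \<open>y\<close> and keeps the value there.\<close>

lemma sublin_straighten:
  fixes q :: "(nat \<Rightarrow> 'k::real_normed_field) \<Rightarrow> real"
  assumes q: "sublin q"
  shows "\<exists>q'. sublin q' \<and> (\<forall>x. q' x \<le> q x) \<and> q' (- y) = - q' y \<and> q' y = q y"
proof -
  define f where "f x t = q (x + scl (of_real t) y) - t * q y" for x t
  define q' where "q' x = (INF t\<in>{0..}. f x t)" for x
  have low: "- q (- x) \<le> f x t" if "t \<ge> 0" for x t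
  proof -
    have "t * q y = q ((x + scl (of_real t) y) + (- x))" using sublinD(2)[OF q that] by simp
    also have "\<dots> \<le> q (x + scl (of_real t) y) + q (- x)" by (rule sublinD(1)[OF q])
    finally show ?thesis by (simp add: f_def)
  qed
  then have bdd: "bdd_below (f x ` {0..})" for x by (intro bdd_belowI2[of _ "- q (- x)"]) auto
  have upper: "q' x \<le> f x t" if "t \<ge> 0" for x t unfolding q'_def using that by (intro cINF_lower bdd) auto
  have lower: "C \<le> q' x" if "\<And>t. t \<ge> 0 \<Longrightarrow> C \<le> f x t" for C x unfolding q'_def using that by (intro cINF_greatest) auto
  have approx: "\<exists>t\<ge>0. f x t < C" if "q' x < C" for x C
    using lower[of C x] that by (meson not_le)
  have add: "q' (x1 + x2) \<le> q' x1 + q' x2" for x1 x2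
  proof (rule field_le_epsilon)
    fix e :: real assume e: "e > 0"
    obtain t1 where t1: "t1 \<ge> 0" "f x1 t1 < q' x1 + e/2" using approx[of x1 "q' x1 + e/2"] e by auto
    obtain t2 where t2: "t2 \<ge> 0" "f x2 t2 < q' x2 + e/2" using approx[of x2 "q' x2 + e/2"] e by auto
    have "q' (x1 + x2) \<le> f (x1 + x2) (t1 + t2)" using t1 t2 by (intro upper) auto
    also have "x1 + x2 + scl (of_real (t1 + t2)) y = (x1 + scl (of_real t1) y) + (x2 + scl (of_real t2) y)"
      by (rule ext) (simp add: seq_apply algebra_simps)
    then have "f (x1 + x2) (t1 + t2) \<le> f x1 t1 + f x2 t2"
      unfolding f_def using sublinD(1)[OF q, of "x1 + scl (of_real t1) y" "x2 + scl (of_real t2) y"] by (simp add: algebra_simps)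
    finally show "q' (x1 + x2) \<le> q' x1 + q' x2 + e" using t1 t2 by linarith
  qed
  have zero: "q' 0 = 0"
  proof (rule antisym)
    show "q' 0 \<le> 0" using upper[of 0 0] sublinD(3)[OF q] by (simp add: f_def)
    show "0 \<le> q' 0" by (rule lower) (simp add: f_def sublinD(2)[OF q])
  qed
  have hom_le: "q' (scl (of_real r) x) \<le> r * q' x" if r: "r > 0" for r x
  proof (rule field_le_epsilon)
    fix e :: real assume e: "e > 0"
    obtain t where t: "t \<ge> 0" "f x t < q' x + e / r" using approx[of x "q' x + e / r"] e r by auto
    have "q' (scl (of_real r) x) \<le> f (scl (of_real r) x) (r * t)" using r t by (intro upper) auto
    also have "scl (of_real r) x + scl (of_real (r * t)) y = scl (of_real r) (x + scl (of_real t) y)"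
      by (rule ext) (simp add: seq_apply algebra_simps)
    then have "f (scl (of_real r) x) (r * t) = r * f x t"
      unfolding f_def using sublinD(2)[OF q, of r] r by (simp add: algebra_simps)
    also have "\<dots> \<le> r * (q' x + e / r)" using t r by (intro mult_left_mono) auto
    finally show "q' (scl (of_real r) x) \<le> r * q' x + e" using r by (simp add: algebra_simps)
  qed
  have hom: "q' (scl (of_real r) x) = r * q' x" if "r \<ge> 0" for r x
  proof (cases "r = 0")
    case False
    then have r: "r > 0" using that by simp
    have "q' (scl (of_real (1 / r)) (scl (of_real r) x)) \<le> (1 / r) * q' (scl (of_real r) x)" using r by (intro hom_le) auto
    moreover have "scl (of_real (1 / r)) (scl (of_real r) x) = x" using r by simp
    ultimately have "r * q' x \<le> q' (scl (of_real r) x)" using r by (simp add: field_simps)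
    then show ?thesis using hom_le[OF r, of x] by linarith
  qed (simp add: zero)
  have le: "q' x \<le> q x" for x using upper[of 0 x] by (simp add: f_def)
  have "q' (- y) \<le> - q y" using upper[of 1 "- y"] sublinD(3)[OF q] by (simp add: f_def)
  moreover have "0 \<le> q' y + q' (- y)" using add[of y "- y"] zero by simp
  ultimately have "q' (- y) = - q' y" "q' y = q y" using le[of y] by linarith+
  moreover have "sublin q'" unfolding sublin_def using add hom by blast
  ultimately show ?thesis using le by blast
qed

text \<open>A direction stays straight under further minorants, because
  \<open>u' (- z) <= u (- z) = - u z <= - u' z\<close>, while sublinearity gives the
  converse.\<close>

lemma sublin_straighten_all:
  fixes q :: "(nat \<Rightarrow> 'k::real_normed_field) \<Rightarrow> real"
  assumes "sublin q" "finite S"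
  shows "\<exists>u. sublin u \<and> (\<forall>x. u x \<le> q x) \<and> (\<forall>y\<in>S. u (- y) = - u y)"
  using assms(2)
proof induction
  case (insert y S)
  then obtain u where u: "sublin u" "\<forall>x. u x \<le> q x" "\<forall>y\<in>S. u (- y) = - u y" by blast
  obtain u' where u': "sublin u'" "\<forall>x. u' x \<le> u x" "u' (- y) = - u' y" using sublin_straighten[OF u(1), of y] by blast
  have "u' (- z) = - u' z" if "z \<in> S" for z
    using u'(2)[rule_format, of z] u'(2)[rule_format, of "- z"] u(3) that sublinD(4)[OF u'(1), of z] by force
  then show ?case using u u' by (intro exI[of _ u']) (auto intro: order_trans)
qed (use assms(1) in blast)

lemma sublin_additive:
  assumes u: "sublin u" "u (- y) = - u y"
  shows "u (x + scl (of_real t) y) = u x + t * u y"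
proof -
  have pos: "u (x + scl (of_real t) y) = u x + t * u y" if t: "t \<ge> 0" and y: "u (- y) = - u y" for t y x
  proof (rule antisym)
    show "u (x + scl (of_real t) y) \<le> u x + t * u y"
      using sublinD(1)[OF u(1), of x "scl (of_real t) y"] sublinD(2)[OF u(1) t] by simp
    have "x = (x + scl (of_real t) y) + scl (of_real t) (- y)" by (rule ext) (simp add: seq_apply)
    then have "u x \<le> u (x + scl (of_real t) y) + u (scl (of_real t) (- y))" using sublinD(1)[OF u(1)] by metis
    then show "u x + t * u y \<le> u (x + scl (of_real t) y)" using sublinD(2)[OF u(1) t, of "- y"] y by simp
  qed
  show ?thesis
  proof (cases "t \<ge> 0")
    case False
    have "scl (of_real t) y = scl (of_real (- t)) (- y)" by (rule ext) (simp add: seq_apply)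
    then show ?thesis using pos[of "- t" "- y" x] u(2) False by simp
  qed (use pos u(2) in blast)
qed

text \<open>Finite dimension of the scalar field over the reals leaves finitely many real directions
  in each coordinate, so that straightening ends after finitely many steps.\<close>

locale gm_field = gm +
  assumes finite_basis: "\<exists>B::'a set. finite B \<and> (\<forall>x. \<exists>c. x = (\<Sum>b\<in>B. of_real (c b) * b))"
begin

text \<open>Hahn--Banach on finitely many coordinates. Straightening at \<open>x0\<close> before all
  other directions fixes the value there. The real functional obtained is \<open>rho\<close> of a
  scalar one, and invariance of \<open>q\<close> under scalars of modulus 1 improves the bound for
  \<open>rho\<close> to a bound for the modulus.\<close>

lemma functional_below:
  fixes q :: "(nat \<Rightarrow> 'a) \<Rightarrow> real"
  assumes q: "sublin q" and circ: "\<And>c v. norm c = 1 \<Longrightarrow> q (scl c v) = q v" and x0: "supp_in x0 a b"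
  shows "\<exists>g. supp_in g a b \<and> (\<forall>v. supp_in v a b \<longrightarrow> norm (act g v) \<le> q v) \<and> act g x0 = of_real (q x0)"
proof -
  obtain B :: "'a set" where B: "finite B" "\<And>x. \<exists>c. x = (\<Sum>b\<in>B. of_real (c b) * b)" using finite_basis by blast
  define un where "un i = (\<lambda>k. if k = i then 1 else 0 :: 'a)" for i :: nat
  obtain q1 where q1: "sublin q1" "\<And>x. q1 x \<le> q x" "q1 (- x0) = - q1 x0" "q1 x0 = q x0"
    using sublin_straighten[OF q, of x0] by blast
  define S where "S = (\<lambda>(i, c). scl c (un i)) ` ({a..<b} \<times> B)"
  have "finite S" unfolding S_def using B(1) by simp
  from sublin_straighten_all[OF q1(1) this] obtain u where u: "sublin u" "\<And>x. u x \<le> q1 x" "\<And>y. y \<in> S \<Longrightarrow> u (- y) = - u y"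
    by blast
  have ux0: "u x0 = q x0"
    using u(2)[of x0] u(2)[of "- x0"] q1(3,4) sublinD(4)[OF u(1), of x0] by linarith
  have lin1: "u (x + scl c (un i)) = u x + u (scl c (un i))" if i: "i \<in> {a..<b}" for x c i
  proof -
    obtain d where d: "c = (\<Sum>b\<in>B. of_real (d b) * b)" using B(2) by blast
    have gen: "u (x + (\<Sum>b\<in>B'. scl (of_real (d b)) (scl b (un i)))) = u x + (\<Sum>b\<in>B'. d b * u (scl b (un i)))"
      if "B' \<subseteq> B" for B' x
      using finite_subset[OF that B(1)] that
    proof (induction B' arbitrary: x)
      case (insert b B')
      have "scl b (un i) \<in> S" using insert.prems i unfolding S_def by auto
      then have "u ((x + (\<Sum>b\<in>B'. scl (of_real (d b)) (scl b (un i)))) + scl (of_real (d b)) (scl b (un i)))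
         = u x + (\<Sum>b\<in>B'. d b * u (scl b (un i))) + d b * u (scl b (un i))"
        using sublin_additive[OF u(1) u(3)] insert by (simp del: scl_scl)
      then show ?case using insert.hyps by (simp add: add_ac del: scl_scl)
    qed simp
    have c: "scl c (un i) = (\<Sum>b\<in>B. scl (of_real (d b)) (scl b (un i)))"
      unfolding d by (rule ext) (simp add: seq_apply sum_fun_apply sum_distrib_right mult.assoc)
    show ?thesis unfolding c using gen[of B x] gen[of B 0] sublinD(3)[OF u(1)] by (simp del: scl_scl)
  qed
  have ex: "\<exists>al. \<forall>c. u (scl c (un i)) = rho (al * c)" if i: "i \<in> {a..<b}" for i
  proof (rule rho_rep)
    fix x y
    have "scl (x + y) (un i) = scl x (un i) + scl y (un i)" by (rule ext) (simp add: seq_apply algebra_simps)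
    then show "u (scl (x + y) (un i)) = u (scl x (un i)) + u (scl y (un i))" using lin1[OF i] by simp
  next
    fix r x
    have neg: "u (scl (- x) (un i)) = - u (scl x (un i))"
    proof -
      have "scl x (un i) + scl (- x) (un i) = 0" by (rule ext) (simp add: seq_apply)
      then show ?thesis using lin1[OF i, of "scl x (un i)" "- x"] sublinD(3)[OF u(1)] by simp
    qed
    have pos: "u (scl (of_real r * x) (un i)) = r * u (scl x (un i))" if "r \<ge> 0" for r x
      using sublinD(2)[OF u(1) that, of "scl x (un i)"] by simp
    show "u (scl (of_real r * x) (un i)) = r * u (scl x (un i))"
    proof (cases "r \<ge> 0")
      case False
      have "of_real r * x = of_real (- r) * (- x)" by simp
      then show ?thesis using pos[of "- r" "- x"] neg False by simp
    qed (rule pos)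
  qed
  then obtain al where al: "\<And>i c. i \<in> {a..<b} \<Longrightarrow> u (scl c (un i)) = rho (al i * c)" by metis
  define g where "g i = (if i \<in> {a..<b} then al i else 0)" for i
  have gs: "supp_in g a b" unfolding supp_in_def g_def by auto
  have rho_sum: "rho (\<Sum>i\<in>A. h i) = (\<Sum>i\<in>A. rho (h i))" for A :: "nat set" and h
    using rho_of_real[of 0] by (induction A rule: infinite_finite_induct) (auto simp: rho_add)
  have rep: "u v = rho (act g v)" if v: "supp_in v a b" for v
  proof -
    have gen: "u (\<Sum>i\<in>A. scl (v i) (un i)) = (\<Sum>i\<in>A. u (scl (v i) (un i)))" if "A \<subseteq> {a..<b}" for A
      using finite_subset[OF that] that
    proof (induction A rule: infinite_finite_induct)
      case (insert i A)
      then have "u ((\<Sum>i\<in>A. scl (v i) (un i)) + scl (v i) (un i)) = (\<Sum>i\<in>A. u (scl (v i) (un i))) + u (scl (v i) (un i))"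
        using lin1[of i] by auto
      then show ?case using insert.hyps by (simp add: add_ac)
    qed (auto simp: sublinD(3)[OF u(1)])
    have "v = (\<Sum>i\<in>{a..<b}. scl (v i) (un i))"
      using v by (intro ext) (auto simp: sum_fun_apply seq_apply un_def supp_in_def if_distrib cong: if_cong)
    then have "u v = (\<Sum>i\<in>{a..<b}. u (scl (v i) (un i)))" using gen[of "{a..<b}"] by simp
    also have "\<dots> = (\<Sum>i\<in>{a..<b}. rho (g i * v i))" by (rule sum.cong) (auto simp: al g_def)
    also have "\<dots> = rho (act g v)" by (simp add: rho_sum act_eq[OF gs])
    finally show ?thesis .
  qed
  have bound: "norm (act g v) \<le> q v" if v: "supp_in v a b" for v
  proof (cases "act g v = 0")
    case True
    have "0 \<le> q v + q (scl (-1) v)" using sublinD(4)[OF q, of v] by simp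
    then show ?thesis using circ[of "-1" v] True by simp
  next
    case False
    define c where "c = of_real (norm (act g v)) / act g v"
    have c: "norm c = 1" "c * act g v = of_real (norm (act g v))" using False by (auto simp: c_def norm_divide)
    have "norm (act g v) = rho (act g (scl c v))" unfolding act_scl c(2) by (rule rho_of_real[symmetric])
    also have "\<dots> = u (scl c v)" using rep[OF supp_in_scl[OF v], of c] by simp
    also have "\<dots> \<le> q (scl c v)" using u(2)[of "scl c v"] q1(2)[of "scl c v"] by linarith
    finally show ?thesis using circ[OF c(1)] by simp
  qed
  have "q x0 \<le> norm (act g x0)" using rep[OF x0] ux0 rho_le[of "act g x0"] by linarith
  then have n: "norm (act g x0) = q x0" using bound[OF x0] by linarith
  show ?thesis
  proof (cases "act g x0 = 0")
    case True
    then show ?thesis using gs bound n by (intro exI[of _ g]) auto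
  next
    case False
    define c where "c = of_real (norm (act g x0)) / act g x0"
    have c: "norm c = 1" "c * act g x0 = of_real (norm (act g x0))" using False by (auto simp: c_def norm_divide)
    then show ?thesis using gs bound n
      by (intro exI[of _ "scl c g"]) (auto intro: supp_in_scl simp: act_scl_left norm_mult)
  qed
qed

lemma N_lim_le:
  assumes "\<And>m. z m \<in> G" "\<And>m. N (z m) \<le> C" "\<And>i. (\<lambda>m. z m i) \<longlonglongrightarrow> z' i"
  shows "N z' \<le> C"
  using N_lsc[of z C z'] assms by blast

text \<open>The functional comes from Hahn--Banach applied to the distance to \<open>Y\<close> measured on the
  coordinates \<open>{lo..<r}\<close> only; weak closedness of \<open>Y\<close> is what makes this distance large as \<open>r\<close>
  and then \<open>m\<close> tend to infinity.\<close>

theorem separating_functional: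
  assumes Y: "csub Y" and a: "\<And>m. a m \<in> G" "\<And>i. (\<lambda>m. a m i) \<longlonglongrightarrow> 0"
    and dist: "\<And>m y. y \<in> Y \<Longrightarrow> N (a m - y) \<ge> 1" and eta: "\<eta> > 0"
  shows "\<exists>m\<ge>m0. \<exists>r\<ge>lo. \<exists>g t. supp_in g lo r \<and> (\<forall>x\<in>G. norm (act g x) \<le> N (proj {lo..<r} x)) \<and>
     (\<forall>y\<in>Y. norm (act g y) \<le> \<eta> * N y) \<and> act g (a m) = of_real t \<and> t \<ge> 1/3"
proof (rule ccontr)
  assume neg: "\<not> ?thesis"
  note YG = csubD(1)[OF Y]
  have ex: "\<exists>y\<in>Y. N (proj {lo..<r} (a m) - proj {lo..<r} y) + \<eta> * N y < 1/3" if m: "m \<ge> m0" and r: "r \<ge> lo" for m r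
  proof -
    let ?E = "proj {lo..<r}"
    \<comment> \<open>The distance to \<open>y\<close> in the window \<open>{lo..<r}\<close> plus a
      penalty for the norm of \<open>y\<close>. In the infimum \<open>q\<close>, the choice of
      \<open>y\<close> equal to the vector itself gives smallness on \<open>Y\<close>, and the
      choice \<open>y = 0\<close> gives the bound by the norm.\<close>
    define f where "f v y = N (?E v - ?E y) + \<eta> * N y" for v y
    define q where "q v = (INF y\<in>Y. f v y)" for v
    have Y0: "Y \<noteq> {}" using csubD(2)[OF Y] by auto
    have nn: "f v y \<ge> 0" if "y \<in> Y" for v y
      unfolding f_def using N_nonneg[OF N_diff(1)[OF N_proj_G N_proj_G]] N_nonneg[OF YG[OF that]] eta by simp
    have upper: "q v \<le> f v y" if "y \<in> Y" for v y
      unfolding q_def using that nn by (intro cINF_lower bdd_belowI2[of _ 0]) auto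
    have lower: "C \<le> q v" if "\<And>y. y \<in> Y \<Longrightarrow> C \<le> f v y" for C v
      unfolding q_def using that Y0 by (intro cINF_greatest) auto
    have approx: "\<exists>y\<in>Y. f v y < C" if "q v < C" for v C using lower[of C v] that by (meson not_le)
    have scl_le: "q (scl c v) \<le> norm c * q v" for c v
    proof (cases "c = 0")
      case True
      have "q (scl c v) \<le> f 0 0" using upper[OF csubD(2)[OF Y], of "scl c v"] True by simp
      then show ?thesis using True by (simp add: f_def)
    next
      case False
      have "q (scl c v) / norm c \<le> q v"
      proof (rule lower)
        fix y assume y: "y \<in> Y"
        have "q (scl c v) \<le> f (scl c v) (scl c y)" by (rule upper[OF csubD(4)[OF Y y]])
        also have "\<dots> = norm c * f v y"
          unfolding f_def proj_scl scl_diff[symmetric] N_scl(2)[OF N_diff(1)[OF N_proj_G N_proj_G]] N_scl(2)[OF YG[OF y]]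
          by (simp add: algebra_simps)
        finally show "q (scl c v) / norm c \<le> f v y" using False by (simp add: field_simps)
      qed
      then show ?thesis using False by (simp add: field_simps)
    qed
    have scl_eq: "q (scl c v) = norm c * q v" for c v
    proof (cases "c = 0")
      case True
      have "q (scl c v) \<ge> 0" by (rule lower) (rule nn)
      then show ?thesis using scl_le[of c v] True by simp
    next
      case False
      have "q (scl (inverse c) (scl c v)) \<le> norm (inverse c) * q (scl c v)" by (rule scl_le)
      then have "norm c * q v \<le> q (scl c v)" using False by (simp add: norm_inverse norm_divide field_simps)
      then show ?thesis using scl_le[of c v] by linarith
    qed
    have add: "q (v + w) \<le> q v + q w" for v w
    proof (rule field_le_epsilon)
      fix e :: real assume e: "e > 0"
      obtain y1 where y1: "y1 \<in> Y" "f v y1 < q v + e/2" using approx[of v "q v + e/2"] e by auto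
      obtain y2 where y2: "y2 \<in> Y" "f w y2 < q w + e/2" using approx[of w "q w + e/2"] e by auto
      have "q (v + w) \<le> f (v + w) (y1 + y2)" by (rule upper[OF csubD(3)[OF Y y1(1) y2(1)]])
      also have "\<dots> \<le> f v y1 + f w y2"
      proof -
        have "?E (v + w) - ?E (y1 + y2) = (?E v - ?E y1) + (?E w - ?E y2)" by (simp add: proj_add)
        then have "N (?E (v + w) - ?E (y1 + y2)) \<le> N (?E v - ?E y1) + N (?E w - ?E y2)"
          using N_add(2)[OF N_diff(1)[OF N_proj_G N_proj_G] N_diff(1)[OF N_proj_G N_proj_G]] by metis
        moreover have "\<eta> * N (y1 + y2) \<le> \<eta> * (N y1 + N y2)"
          using N_add(2)[OF YG[OF y1(1)] YG[OF y2(1)]] eta by (intro mult_left_mono) auto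
        ultimately show ?thesis unfolding f_def by (simp add: algebra_simps)
      qed
      finally show "q (v + w) \<le> q v + q w + e" using y1 y2 by linarith
    qed
    have q: "sublin q" unfolding sublin_def using add scl_eq by simp
    obtain g where g: "supp_in g lo r" "\<And>v. supp_in v lo r \<Longrightarrow> norm (act g v) \<le> q v" "act g (?E (a m)) = of_real (q (?E (a m)))"
      using functional_below[OF q _ supp_in_proj[of lo r "a m"]] scl_eq by fastforce
    have gE: "norm (act g x) \<le> q (?E x)" for x using g(2)[OF supp_in_proj] act_proj[OF g(1), of x] by simp
    have 1: "norm (act g x) \<le> N (?E x)" if "x \<in> G" for x
      using gE[of x] upper[OF csubD(2)[OF Y], of "?E x"] by (simp add: f_def)
    have 2: "norm (act g y) \<le> \<eta> * N y" if "y \<in> Y" for y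
      using gE[of y] upper[OF that, of "?E y"] by (simp add: f_def)
    have "\<not> q (?E (a m)) \<ge> 1/3"
      using neg m r g(1,3) 1 2 act_proj[OF g(1), of "a m"] by metis
    then obtain y where "y \<in> Y" "f (?E (a m)) y < 1/3" using approx[of "?E (a m)" "1/3"] by auto
    then show ?thesis unfolding f_def by (intro bexI[of _ y]) auto
  qed
  define T where "T z = z - proj {0..<lo} z" for z :: "nat \<Rightarrow> 'a"
  have T_app: "T z i = (if i < lo then 0 else z i)" for z i by (simp add: T_def seq_apply)
  have ex2: "\<exists>y\<in>Y. N y \<le> 1 / (3 * \<eta>) \<and> N (T (a m - y)) \<le> 1/3" if m: "m \<ge> m0" for m
  proof -
    \<comment> \<open>The right end of the window tends to infinity while \<open>m\<close> is fixed.
      The penalty keeps the approximants bounded, and by weak closedness a coordinatewise limit of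
      them is in \<open>Y\<close>.\<close>
    obtain y where y: "\<And>r. y r \<in> Y" "\<And>r. N (proj {lo..<lo + r} (a m) - proj {lo..<lo + r} (y r)) + \<eta> * N (y r) < 1/3"
      using ex[OF m, of "lo + r" for r] le_add1 by metis
    have yN: "N (y r) \<le> 1 / (3 * \<eta>)" for r
    proof -
      have "\<eta> * N (y r) < 1/3"
        using y(2)[of r] N_nonneg[OF N_diff(1)[OF N_proj_G N_proj_G], of lo "lo + r" "a m" lo "lo + r" "y r"] by linarith
      then show ?thesis using eta by (simp add: field_simps)
    qed
    have "norm (y r i) \<le> 1 / (3 * \<eta>)" for r i using N_coord[OF YG[OF y(1)]] yN order_trans by blast
    then obtain \<rho> y' where sub: "strict_mono (\<rho> :: nat \<Rightarrow> nat)" "\<And>i. (\<lambda>k. y (\<rho> k) i) \<longlonglongrightarrow> y' i"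
      using coordinatewise_subseq[of y "\<lambda>_. 1 / (3 * \<eta>)"] by blast
    have "y' \<in> Y" by (rule csub_weakly_closed[OF Y, of "\<lambda>k. y (\<rho> k)"]) (use y yN sub in auto)
    moreover have "N y' \<le> 1 / (3 * \<eta>)"
      by (rule N_lim_le[of "\<lambda>k. y (\<rho> k)"]) (use yN YG[OF y(1)] sub in auto)
    moreover have "N (T (a m - y')) \<le> 1/3"
    proof (rule N_lim_le[of "\<lambda>k. proj {lo..<lo + \<rho> k} (a m - y (\<rho> k))"])
      show "proj {lo..<lo + \<rho> k} (a m - y (\<rho> k)) \<in> G" for k by (rule N_proj_G)
      show "N (proj {lo..<lo + \<rho> k} (a m - y (\<rho> k))) \<le> 1/3" for k
      proof -
        have "0 \<le> \<eta> * N (y (\<rho> k))" using eta N_nonneg[OF YG[OF y(1)]] by simp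
        then show ?thesis using y(2)[of "\<rho> k"] unfolding proj_diff by linarith
      qed
      fix i
      have "eventually (\<lambda>k. proj {lo..<lo + \<rho> k} (a m - y (\<rho> k)) i = (if i < lo then 0 else a m i - y (\<rho> k) i)) sequentially"
        using eventually_gt_at_top[of i]
      proof eventually_elim
        case (elim k)
        then have "i < lo + \<rho> k" using strict_mono_imp_increasing[OF sub(1), of k] by simp
        then show ?case by (auto simp: seq_apply)
      qed
      moreover have "(\<lambda>k. if i < lo then 0 else a m i - y (\<rho> k) i) \<longlonglongrightarrow> T (a m - y') i"
        unfolding T_app using tendsto_diff[OF tendsto_const sub(2), of "a m i" i] by (simp add: seq_apply)
      ultimately show "(\<lambda>k. proj {lo..<lo + \<rho> k} (a m - y (\<rho> k)) i) \<longlonglongrightarrow> T (a m - y') i"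
        by (simp add: tendsto_cong)
    qed
    ultimately show ?thesis by blast
  qed
  \<comment> \<open>Now \<open>m\<close> varies. The approximants are bounded again and have a limit
    \<open>y'\<close> in \<open>Y\<close>; as \<open>a\<close> tends to 0 coordinatewise, the part
    of \<open>y'\<close> from \<open>lo\<close> on has norm at most 1/3.\<close>
  obtain y where y: "\<And>m. y m \<in> Y" "\<And>m. N (y m) \<le> 1 / (3 * \<eta>)" "\<And>m. N (T (a (m0 + m) - y m)) \<le> 1/3"
    using ex2[of "m0 + m" for m] le_add1 by metis
  have "norm (y m i) \<le> 1 / (3 * \<eta>)" for m i using N_coord[OF YG[OF y(1)]] y(2) order_trans by blast
  then obtain \<rho> y' where sub: "strict_mono (\<rho> :: nat \<Rightarrow> nat)" "\<And>i. (\<lambda>k. y (\<rho> k) i) \<longlonglongrightarrow> y' i"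
    using coordinatewise_subseq[of y "\<lambda>_. 1 / (3 * \<eta>)"] by blast
  have y'Y: "y' \<in> Y" by (rule csub_weakly_closed[OF Y, of "\<lambda>k. y (\<rho> k)"]) (use y sub in auto)
  define aa where "aa k = a (m0 + \<rho> k)" for k
  have aaG: "aa k \<in> G" for k unfolding aa_def by (rule a(1))
  have "strict_mono (\<lambda>k. m0 + \<rho> k)" using sub(1) by (simp add: strict_mono_def)
  then have aa0: "(\<lambda>k. aa k i) \<longlonglongrightarrow> 0" for i
    using LIMSEQ_subseq_LIMSEQ[OF a(2)[of i], of "\<lambda>k. m0 + \<rho> k"] by (simp add: aa_def o_def)
  have dG: "aa k - y (\<rho> k) \<in> G" for k by (intro N_diff(1) aaG YG y(1))
  have TG: "T z \<in> G" if "z \<in> G" for z unfolding T_def by (rule N_tail(1)[OF that])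
  have Ty': "N (T y') \<le> 1/3"
  proof (rule N_lim_le[of "\<lambda>k. T (- (aa k - y (\<rho> k)))"])
    show "T (- (aa k - y (\<rho> k))) \<in> G" for k using TG N_minus[OF dG] by blast
    have Tm: "T (- z) = - T z" for z by (rule ext) (simp add: T_app seq_apply)
    show "N (T (- (aa k - y (\<rho> k)))) \<le> 1/3" for k
      unfolding Tm using N_minus[OF TG[OF dG], of k] y(3)[of "\<rho> k"] by (simp only: aa_def)
    fix i
    have "(\<lambda>k. if i < lo then 0 else y (\<rho> k) i - aa k i) \<longlonglongrightarrow> (if i < lo then 0 else y' i)"
      using tendsto_diff[OF sub(2) aa0, of i i] by simp
    then show "(\<lambda>k. T (- (aa k - y (\<rho> k))) i) \<longlonglongrightarrow> T y' i" unfolding T_app by (cases "i < lo") (simp_all add: seq_apply)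
  qed
  \<comment> \<open>Below \<open>lo\<close> the vectors \<open>aa k - y (\<rho> k) + y'\<close> tend
    to 0, so some \<open>aa k\<close> is within 1/4 + 1/3 + 1/3 < 1 of \<open>Y\<close>, contrary to
    the distance hypothesis.\<close>
  have "(\<lambda>k. \<Sum>i=0..<lo. norm ((aa k i - y (\<rho> k) i) + y' i)) \<longlonglongrightarrow> (\<Sum>i=0..<lo. norm ((0 - y' i) + y' i))"
    by (intro tendsto_intros aa0 sub(2))
  then have "eventually (\<lambda>k. (\<Sum>i=0..<lo. norm ((aa k i - y (\<rho> k) i) + y' i)) < 1/4) sequentially"
    by (intro order_tendstoD) auto
  then obtain k where k: "(\<Sum>i=0..<lo. norm ((aa k i - y (\<rho> k) i) + y' i)) < 1/4" by (auto simp: eventually_sequentially)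
  let ?w = "(aa k - y (\<rho> k)) + y'"
  have wG: "?w \<in> G" by (intro N_add(1) dG YG y'Y)
  have "N (proj {0..<lo} ?w) \<le> (\<Sum>i=0..<lo. norm (aa k i - y (\<rho> k) i + y' i))"
    using N_le_l1[OF c00_proj_fin, of 0 lo ?w] by (subst (asm) l1_eq[OF supp_in_proj]) (simp add: seq_apply)
  moreover have "?w = proj {0..<lo} ?w + (T (aa k - y (\<rho> k)) + T y')" by (rule ext) (simp add: seq_apply T_app)
  from arg_cong[OF this, of N]
  have "N ?w \<le> N (proj {0..<lo} ?w) + (N (T (aa k - y (\<rho> k))) + N (T y'))"
    using N_add(2)[OF N_proj_G N_add(1)[OF TG[OF dG] TG[OF YG[OF y'Y]]], of 0 lo ?w k] N_add(2)[OF TG[OF dG] TG[OF YG[OF y'Y]], of k]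
    by linarith
  moreover have "N (T (aa k - y (\<rho> k))) \<le> 1/3" using y(3)[of "\<rho> k"] by (simp add: aa_def)
  ultimately have "N ?w < 1" using k Ty' by linarith
  moreover have "?w = a (m0 + \<rho> k) - (y (\<rho> k) - y')" by (simp add: aa_def algebra_simps)
  moreover have "N (a (m0 + \<rho> k) - (y (\<rho> k) - y')) \<ge> 1" by (rule dist) (rule csubD(5)[OF Y y(1) y'Y])
  ultimately show False by simp
qed

end


section \<open>Null sequences far from a subspace\<close>

context gm_field
begin

text \<open>The form taken in \<open>G\<close> by the preimage of a linear subspace of the
  quotient.\<close>

definition subsp :: "(nat \<Rightarrow> 'a) set \<Rightarrow> (nat \<Rightarrow> 'a) set \<Rightarrow> bool" where
  "subsp Y A \<longleftrightarrow> Y \<subseteq> A \<and> A \<subseteq> G \<and> (\<forall>x\<in>A. \<forall>y\<in>A. x + y \<in> A) \<and> (\<forall>c. \<forall>x\<in>A. scl c x \<in> A)"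

lemma subspD:
  assumes "subsp Y A"
  shows "x \<in> A \<Longrightarrow> x \<in> G" "x \<in> Y \<Longrightarrow> x \<in> A" "x \<in> A \<Longrightarrow> y \<in> A \<Longrightarrow> x + y \<in> A" "x \<in> A \<Longrightarrow> scl c x \<in> A"
    "x \<in> A \<Longrightarrow> y \<in> A \<Longrightarrow> x - y \<in> A" "0 \<in> Y \<Longrightarrow> (\<And>i. i \<in> I \<Longrightarrow> u i \<in> A) \<Longrightarrow> (\<Sum>i\<in>I. u i) \<in> A"
proof -
  show 1: "x \<in> A \<Longrightarrow> x \<in> G" "x \<in> Y \<Longrightarrow> x \<in> A" "x \<in> A \<Longrightarrow> y \<in> A \<Longrightarrow> x + y \<in> A" "x \<in> A \<Longrightarrow> scl c x \<in> A" for x y c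
    using assms unfolding subsp_def by blast+
  show "x \<in> A \<Longrightarrow> y \<in> A \<Longrightarrow> x - y \<in> A" using 1(3)[of x "scl (-1) y"] 1(4)[of y "-1"] by simp
  show "0 \<in> Y \<Longrightarrow> (\<And>i. i \<in> I \<Longrightarrow> u i \<in> A) \<Longrightarrow> (\<Sum>i\<in>I. u i) \<in> A"
    by (induction I rule: infinite_finite_induct) (auto simp: 1)
qed

text \<open>Infinite dimension of the image of \<open>A\<close> modulo \<open>Y\<close>, expressed
  by representatives.\<close>

definition infdim_mod :: "(nat \<Rightarrow> 'a) set \<Rightarrow> (nat \<Rightarrow> 'a) set \<Rightarrow> bool" where
  "infdim_mod Y A \<longleftrightarrow> \<not> (\<exists>(n::nat) v. (\<forall>i<n. v i \<in> A) \<and> (\<forall>a\<in>A. \<exists>c. a - (\<Sum>i<n. scl (c i) (v i)) \<in> Y))"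

text \<open>Closedness makes the distance \<open>d\<close> positive. Its approximate attainment, up
  to a factor 2, is the input for the Riesz lemma.\<close>

lemma csub_dist:
  assumes Y: "csub Y" and a: "a \<in> G" "a \<notin> Y"
  shows "\<exists>d>0. (\<forall>y\<in>Y. N (a - y) \<ge> d) \<and> (\<exists>y\<in>Y. N (a - y) \<le> 2 * d)"
proof -
  define d where "d = (INF y\<in>Y. N (a - y))"
  have nn: "N (a - y) \<ge> 0" if "y \<in> Y" for y using N_nonneg[OF N_diff(1)[OF a(1) csubD(1)[OF Y that]]] .
  have Y0: "Y \<noteq> {}" using csubD(2)[OF Y] by auto
  have lower: "d \<le> N (a - y)" if "y \<in> Y" for y
    unfolding d_def using that nn by (intro cINF_lower bdd_belowI2[of _ 0]) auto
  have ex: "\<exists>y\<in>Y. N (a - y) < C" if "d < C" for C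
  proof (rule ccontr)
    assume "\<not> ?thesis"
    then have "C \<le> d" unfolding d_def using Y0 by (intro cINF_greatest) (auto simp: not_less)
    then show False using that by simp
  qed
  have "d \<noteq> 0"
  proof
    assume "d = 0"
    then have "a \<in> Y" by (intro csubD(6)[OF Y a(1)]) (use ex in \<open>meson less_imp_le\<close>)
    then show False using a(2) by simp
  qed
  moreover have "d \<ge> 0" unfolding d_def using Y0 nn by (intro cINF_greatest) auto
  ultimately have "d > 0" by simp
  then show ?thesis using lower ex[of "2 * d"] by (intro exI[of _ d]) (auto intro: less_imp_le)
qed

text \<open>If \<open>a\<close> has distance at least \<open>d > 0\<close> from \<open>Y\<close>,
  the norm of \<open>y + scl c a\<close> controls \<open>c\<close>; so approximating coefficients
  are bounded and have a convergent subsequence.\<close>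

lemma csub_adjoin:
  assumes Y: "csub Y" and a: "a \<in> G"
  shows "csub {y + scl c a | y c. y \<in> Y}" (is "csub ?W")
proof (cases "a \<in> Y")
  case True
  have "?W = Y"
  proof (intro equalityI subsetI)
    fix x assume "x \<in> ?W" then show "x \<in> Y" using csubD(3,4)[OF Y] True by blast
  next
    fix x assume "x \<in> Y" then show "x \<in> ?W" by (intro CollectI exI[of _ x] exI[of _ 0]) simp
  qed
  then show ?thesis using Y by simp
next
  case False
  obtain d where d: "d > 0" "\<And>y. y \<in> Y \<Longrightarrow> N (a - y) \<ge> d" using csub_dist[OF Y a False] by blast
  note YG = csubD(1)[OF Y]
  show ?thesis unfolding csub_def
  proof (intro conjI ballI allI impI)
    show "?W \<subseteq> G" using YG a N_add(1) N_scl(1) by blast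
    show "0 \<in> ?W" using csubD(2)[OF Y] by (intro CollectI exI[of _ 0]) auto
  next
    fix x y assume "x \<in> ?W" "y \<in> ?W"
    then obtain y1 c1 y2 c2 where *: "x = y1 + scl c1 a" "y1 \<in> Y" "y = y2 + scl c2 a" "y2 \<in> Y" by blast
    have "x + y = (y1 + y2) + scl (c1 + c2) a" unfolding * by (rule ext) (simp add: seq_apply algebra_simps)
    then show "x + y \<in> ?W" using csubD(3)[OF Y] * by blast
  next
    fix c x assume "x \<in> ?W"
    then obtain y1 c1 where *: "x = y1 + scl c1 a" "y1 \<in> Y" by blast
    have "scl c x = scl c y1 + scl (c * c1) a" unfolding * by (rule ext) (simp add: seq_apply algebra_simps)
    then show "scl c x \<in> ?W" using csubD(4)[OF Y] * by blast
  next
    fix z assume z: "z \<in> G" and app: "\<forall>e>0. \<exists>y\<in>?W. N (z - y) \<le> e"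
    have "\<exists>y c. y \<in> Y \<and> N (z - (y + scl c a)) \<le> inverse (real (Suc n))" for n
      using app[rule_format, of "inverse (real (Suc n))"] by auto
    then obtain y c where yc: "\<And>n. y n \<in> Y" "\<And>n. N (z - (y n + scl (c n) a)) \<le> inverse (real (Suc n))" by metis
    have small: "inverse (real (Suc n)) \<le> 1" for n by (simp add: field_simps)
    have wG: "y n + scl (c n) a \<in> G" for n by (intro N_add(1) YG yc(1) N_scl(1) a)
    have cb: "norm (c n) \<le> (N z + 1) / d" for n
    proof (cases "c n = 0")
      case True then show ?thesis using d N_nonneg[OF z] by simp
    next
      case False
      have "y n + scl (c n) a = scl (c n) (a - scl (- inverse (c n)) (y n))" using False by (intro ext) (simp add: seq_apply algebra_simps)
      then have "N (y n + scl (c n) a) = norm (c n) * N (a - scl (- inverse (c n)) (y n))"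
        using N_scl(2)[OF N_diff(1)[OF a YG[OF csubD(4)[OF Y yc(1)]]]] by metis
      moreover have "norm (c n) * N (a - scl (- inverse (c n)) (y n)) \<ge> norm (c n) * d"
        by (intro mult_left_mono d(2) csubD(4)[OF Y yc(1)]) simp
      moreover have "N (y n + scl (c n) a) \<le> N z + 1"
        using N_diff(2)[OF z N_diff(1)[OF z wG], of n] yc(2)[of n] small[of n] by simp
      ultimately have "norm (c n) * d \<le> N z + 1" by linarith
      then show ?thesis using d(1) by (simp add: pos_le_divide_eq)
    qed
    obtain c' r where r: "strict_mono (r :: nat \<Rightarrow> nat)" "(\<lambda>n. c (r n)) \<longlonglongrightarrow> c'"
    proof -
      have "bounded (range c)" using cb by (auto intro: boundedI)
      then obtain l r where "strict_mono (r::nat\<Rightarrow>nat)" "((c \<circ> r) \<longlongrightarrow> l) sequentially"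
        using bounded_imp_convergent_subsequence by blast
      then show thesis using that[of r l] by (simp add: o_def)
    qed
    have "z - scl c' a \<in> Y"
    proof (rule csubD(6)[OF Y])
      show "z - scl c' a \<in> G" by (intro N_diff(1) z N_scl(1) a)
      fix e :: real assume e: "e > 0"
      have "(\<lambda>n. inverse (real (Suc (r n))) + norm (c (r n) - c') * N a) \<longlonglongrightarrow> 0 + norm (c' - c') * N a"
        by (intro tendsto_intros r(2) LIMSEQ_subseq_LIMSEQ[OF LIMSEQ_inverse_real_of_nat r(1), unfolded o_def])
      then have "eventually (\<lambda>n. inverse (real (Suc (r n))) + norm (c (r n) - c') * N a < e) sequentially"
        using e by (intro order_tendstoD) auto
      then obtain n where n: "inverse (real (Suc (r n))) + norm (c (r n) - c') * N a < e" by (auto simp: eventually_sequentially)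
      have "z - scl c' a - y (r n) = (z - (y (r n) + scl (c (r n)) a)) + scl (c (r n) - c') a"
        by (rule ext) (simp add: seq_apply algebra_simps)
      then have "N (z - scl c' a - y (r n)) \<le> N (z - (y (r n) + scl (c (r n)) a)) + norm (c (r n) - c') * N a"
        using N_add(2)[OF N_diff(1)[OF z wG] N_scl(1)[OF a], of "r n" "c (r n) - c'"] N_scl(2)[OF a] by metis
      then show "\<exists>y\<in>Y. N (z - scl c' a - y) \<le> e" using yc(1) yc(2)[of "r n"] n by (intro bexI[of _ "y (r n)"]) auto
    qed
    then show "z \<in> ?W" by (intro CollectI exI[of _ "z - scl c' a"] exI[of _ c']) simp
  qed
qed

text \<open>The Riesz lemma, iterated: each new vector is far from the closed subspace spanned by
  \<open>Y\<close> and its predecessors. Finite dimension of this subspace modulo \<open>Y\<close>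
  is carried along, so that it never exhausts \<open>A\<close>.\<close>

lemma separated_sequence:
  assumes Y: "csub Y" and A: "subsp Y A" and inf: "infdim_mod Y A"
  shows "\<exists>a. (\<forall>n. a n \<in> A \<and> N (a n) \<le> 2) \<and> (\<forall>m n::nat. \<forall>y\<in>Y. m < n \<longrightarrow> N (a n - a m - y) \<ge> 1)"
proof -
  define SP where "SP W \<longleftrightarrow> (\<exists>(n::nat) v. (\<forall>i<n. v i \<in> A) \<and> (\<forall>a\<in>W. \<exists>c. a - (\<Sum>i<n. scl (c i) (v i)) \<in> Y))" for W
  define I where "I W \<longleftrightarrow> csub W \<and> Y \<subseteq> W \<and> W \<subseteq> A \<and> SP W" for W
  have key: "\<exists>a W'. a \<in> A \<and> N a \<le> 2 \<and> (\<forall>w\<in>W. N (a - w) \<ge> 1) \<and> W \<subseteq> W' \<and> a \<in> W' \<and> I W'" if W: "I W" for W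
  proof -
    have cW: "csub W" "Y \<subseteq> W" "W \<subseteq> A" and "SP W" using W unfolding I_def by auto
    then obtain n :: nat and v where nv1: "\<forall>i<n. v i \<in> A" and nv2: "\<forall>a\<in>W. \<exists>c. a - (\<Sum>i<n. scl (c i) (v i)) \<in> Y"
      unfolding SP_def by (elim exE conjE)
    have "\<exists>a0\<in>A. a0 \<notin> W"
    proof (rule ccontr)
      assume "\<not> ?thesis"
      then have "A \<subseteq> W" by blast
      then have "\<forall>a\<in>A. \<exists>c. a - (\<Sum>i<n. scl (c i) (v i)) \<in> Y" using nv2 by (meson subsetD)
      then have "(\<forall>i<n. v i \<in> A) \<and> (\<forall>a\<in>A. \<exists>c. a - (\<Sum>i<n. scl (c i) (v i)) \<in> Y)" using nv1 by (rule conjI[rotated])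
      then show False using inf unfolding infdim_mod_def by (elim notE) (intro exI)
    qed
    then obtain a0 where a0: "a0 \<in> A" "a0 \<notin> W" by blast
    have a0G: "a0 \<in> G" by (rule subspD(1)[OF A a0(1)])
    obtain d w0 where d: "d > 0" "\<And>y. y \<in> W \<Longrightarrow> N (a0 - y) \<ge> d" "w0 \<in> W" "N (a0 - w0) \<le> 2 * d"
      using csub_dist[OF cW(1) a0G a0(2)] by blast
    have w0: "w0 \<in> A" "w0 \<in> G" using cW d subspD(1)[OF A] by blast+
    define a where "a = scl (of_real (1 / d)) (a0 - w0)"
    have aA: "a \<in> A" unfolding a_def by (intro subspD(4,5)[OF A] a0 w0)
    have aN: "N a \<le> 2" unfolding a_def using N_scl(2)[OF N_diff(1)[OF a0G w0(2)]] d by (simp add: norm_divide field_simps)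
    have far: "N (a - w) \<ge> 1" if w: "w \<in> W" for w
    proof -
      have wG: "w \<in> G" by (rule csubD(1)[OF cW(1) w])
      have "w0 + scl (of_real d) w \<in> W" by (intro csubD(3,4)[OF cW(1)] d w)
      then have "d \<le> N (a0 - (w0 + scl (of_real d) w))" by (rule d(2))
      also have "a0 - (w0 + scl (of_real d) w) = scl (of_real d) (a - w)"
        unfolding a_def using d(1) by (intro ext) (simp add: seq_apply field_simps)
      also have "N \<dots> = d * N (a - w)"
        using N_scl(2)[OF N_diff(1)[OF subspD(1)[OF A aA] wG]] d(1) by simp
      finally show ?thesis using d(1) by simp
    qed
    let ?W' = "{y + scl c a | y c. y \<in> W}"
    have sub: "W \<subseteq> ?W'" proof
      fix x assume "x \<in> W" then show "x \<in> ?W'" by (intro CollectI exI[of _ x] exI[of _ 0]) simp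
    qed
    have aW': "a \<in> ?W'" using csubD(2)[OF cW(1)] by (intro CollectI exI[of _ 0] exI[of _ 1]) simp
    have "I ?W'" unfolding I_def
    proof (intro conjI)
      show "csub ?W'" by (rule csub_adjoin[OF cW(1) subspD(1)[OF A aA]])
      show "Y \<subseteq> ?W'" using sub cW by blast
      show "?W' \<subseteq> A" using cW aA subspD(3,4)[OF A] by blast
      show "SP ?W'" unfolding SP_def
      proof (intro exI[of _ "Suc n"] exI[of _ "v(n := a)"] conjI allI impI ballI)
        show "(v(n := a)) i \<in> A" if "i < Suc n" for i using nv1[rule_format, of i] aA that by (cases "i = n") auto
        fix x assume "x \<in> ?W'"
        then obtain w c where x: "x = w + scl c a" "w \<in> W" by blast
        obtain c' where c': "w - (\<Sum>i<n. scl (c' i) (v i)) \<in> Y" using nv2[rule_format, OF x(2)] by (elim exE)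
        have "x - (\<Sum>i<Suc n. scl ((c'(n := c)) i) ((v(n := a)) i)) = w - (\<Sum>i<n. scl (c' i) (v i))"
          by (simp add: x)
        then show "\<exists>c. x - (\<Sum>i<Suc n. scl (c i) ((v(n := a)) i)) \<in> Y" using c' by metis
      qed
    qed
    then show ?thesis using aA aN far sub aW' by blast
  qed
  have "SP Y" unfolding SP_def by (intro exI[of _ "0::nat"] exI[of _ "\<lambda>_. 0"]) simp
  then have IY: "I Y" unfolding I_def using Y A by (simp add: subsp_def)
  define P where "P st \<longleftrightarrow> (case st of (a, W) \<Rightarrow> a \<in> A \<and> N a \<le> 2 \<and> a \<in> W \<and> I W)" for st
  define Q where "Q st st' \<longleftrightarrow> (case st of (a, W) \<Rightarrow> case st' of (a', W') \<Rightarrow> W \<subseteq> W' \<and> (\<forall>w\<in>W. N (a' - w) \<ge> 1))"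
    for st st' :: "(nat \<Rightarrow> 'a) \<times> (nat \<Rightarrow> 'a) set"
  have "\<exists>st. P st"
  proof -
    from key[OF IY] obtain a' W' where "a' \<in> A \<and> N a' \<le> 2 \<and> (\<forall>w\<in>Y. N (a' - w) \<ge> 1) \<and> Y \<subseteq> W' \<and> a' \<in> W' \<and> I W'"
      by (elim exE)
    then show ?thesis unfolding P_def by (intro exI[of _ "(a', W')"]) simp
  qed
  moreover have "\<exists>st'. P st' \<and> Q st st'" if "P st" for st
  proof -
    obtain a W where st: "st = (a, W)" by (cases st)
    have "I W" using that unfolding st P_def by simp
    from key[OF this] obtain a' W' where "a' \<in> A \<and> N a' \<le> 2 \<and> (\<forall>w\<in>W. N (a' - w) \<ge> 1) \<and> W \<subseteq> W' \<and> a' \<in> W' \<and> I W'"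
      by (elim exE)
    then show ?thesis unfolding st P_def Q_def by (intro exI[of _ "(a', W')"]) simp
  qed
  ultimately obtain F where F: "\<And>n. P (F n)" "\<And>n. Q (F n) (F (Suc n))"
    using dependent_nat_choice[of "\<lambda>_. P" "\<lambda>_. Q"] by blast
  define a W where "a n = fst (F n)" and "W n = snd (F n)" for n
  have Fe: "F n = (a n, W n)" for n by (simp add: a_def W_def)
  have p: "a n \<in> A" "N (a n) \<le> 2" "a n \<in> W n" "csub (W n)" "Y \<subseteq> W n" for n
    using F(1)[of n] unfolding Fe P_def I_def by auto
  have q: "W n \<subseteq> W (Suc n)" "\<And>w. w \<in> W n \<Longrightarrow> N (a (Suc n) - w) \<ge> 1" for n
    using F(2)[of n] unfolding Fe Q_def by auto
  have mono: "W m \<subseteq> W n" if "m \<le> n" for m n by (rule lift_Suc_mono_le[of W, OF q(1) that])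
  have "N (a n - a m - y) \<ge> 1" if "m < n" "y \<in> Y" for m n y
  proof -
    obtain n' where n': "n = Suc n'" "m \<le> n'" using \<open>m < n\<close> by (cases n) auto
    have "a m + y \<in> W n'" by (rule csubD(3)[OF p(4)]) (use p(3,5) mono[OF n'(2)] that in blast)+
    then have "N (a n - (a m + y)) \<ge> 1" unfolding n'(1) by (rule q(2))
    then show ?thesis by (simp add: diff_diff_eq)
  qed
  then show ?thesis using p by blast
qed

definition nullseq :: "(nat \<Rightarrow> 'a) set \<Rightarrow> (nat \<Rightarrow> nat \<Rightarrow> 'a) \<Rightarrow> bool" where
  "nullseq A b \<longleftrightarrow> (\<forall>n. b n \<in> A \<and> N (b n) \<le> 4) \<and> (\<forall>i. (\<lambda>n. b n i) \<longlonglongrightarrow> 0)"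

text \<open>Consecutive differences along a coordinatewise convergent subsequence tend to 0
  coordinatewise, and separation keeps them away from \<open>Y\<close>. The bound 4 in
  \<open>nullseq\<close> comes from subtracting two vectors of norm at most 2.\<close>

lemma exists_nullseq:
  assumes Y: "csub Y" and A: "subsp Y A" and inf: "infdim_mod Y A"
  shows "\<exists>b. nullseq A b \<and> (\<forall>n. \<forall>y\<in>Y. N (b n - y) \<ge> 1)"
proof -
  from separated_sequence[OF assms] obtain a where
    a0: "(\<forall>n. a n \<in> A \<and> N (a n) \<le> 2) \<and> (\<forall>m n::nat. \<forall>y\<in>Y. m < n \<longrightarrow> N (a n - a m - y) \<ge> 1)"
    by (elim exE)
  have a: "a n \<in> A" "N (a n) \<le> 2" for n using a0 by simp_all
  have a3: "N (a n - a m - y) \<ge> 1" if "y \<in> Y" "m < n" for m n y using a0 that by simp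
  note AG = subspD(1)[OF A]
  have "norm (a n i) \<le> 2" for n i using N_coord[OF AG[OF a(1)]] a(2) order_trans by blast
  then obtain r a' where r: "strict_mono (r :: nat \<Rightarrow> nat)" "\<And>i. (\<lambda>n. a (r n) i) \<longlonglongrightarrow> a' i"
    using coordinatewise_subseq[of a "\<lambda>_. 2"] by blast
  define b where "b n = a (r (Suc n)) - a (r n)" for n
  have "b n \<in> A" for n unfolding b_def by (intro subspD(5)[OF A] a)
  moreover have "N (b n) \<le> 4" for n
    unfolding b_def using N_diff(2)[OF AG[OF a(1)] AG[OF a(1)], of "r (Suc n)" "r n"] a(2)[of "r (Suc n)"] a(2)[of "r n"] by linarith
  moreover have "(\<lambda>n. b n i) \<longlonglongrightarrow> 0" for i
  proof -
    have "(\<lambda>n. a (r (Suc n)) i - a (r n) i) \<longlonglongrightarrow> a' i - a' i"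
      by (intro tendsto_diff r(2) LIMSEQ_Suc[OF r(2)])
    then show ?thesis by (simp add: b_def seq_apply)
  qed
  moreover have "N (b n - y) \<ge> 1" if "y \<in> Y" for n y
    unfolding b_def using a3[OF that] strict_monoD[OF r(1), of n "Suc n"] by simp
  ultimately show ?thesis unfolding nullseq_def by (intro exI[of _ b]) simp
qed

section \<open>Lower estimates modulo \<open>Y\<close>\<close>

lemma N_lower_estimate_set:
  assumes x: "x \<in> G" and S: "finite S" and ord: "\<And>i i'. i < i' \<Longrightarrow> hi i \<le> lo i'" "\<And>i. lo i \<le> hi (i::nat)"
  shows "(\<Sum>i\<in>S. N (proj {lo i..<hi i} x)) \<le> gm_f (card S) * N x"
proof -
  define xs where "xs = sorted_list_of_set S"
  define M where "M = card S"
  have xs: "sorted_wrt (<) xs" "set xs = S" "length xs = M" "distinct xs" using S by (auto simp: xs_def M_def)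
  define t where "t l = (if l < M then lo (xs ! l) else if M = 0 then 0 else hi (xs ! (M - 1)))" for l
  have le: "hi (xs ! l) \<le> t (Suc l)" if "l < M" for l
  proof (cases "Suc l < M")
    case True
    then have "xs ! l < xs ! (Suc l)" using xs by (simp add: sorted_wrt_nth_less)
    then show ?thesis using ord(1) True by (simp add: t_def)
  next
    case False
    then have "l = M - 1" using that by simp
    then show ?thesis using that False by (simp add: t_def)
  qed
  have "mono t"
  proof (rule mono_iff_le_Suc[THEN iffD2], rule)
    fix l show "t l \<le> t (Suc l)"
    proof (cases "l < M")
      case True
      then have "t l \<le> hi (xs ! l)" using ord(2) by (simp add: t_def)
      then show ?thesis using le[OF True] by linarith
    qed (simp add: t_def)
  qed
  have "(\<Sum>i\<in>S. N (proj {lo i..<hi i} x)) = (\<Sum>i\<leftarrow>xs. N (proj {lo i..<hi i} x))"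
    using xs by (simp add: sum_list_distinct_conv_sum_set)
  also have "\<dots> = (\<Sum>l<M. N (proj {lo (xs ! l)..<hi (xs ! l)} x))"
    by (simp add: sum_list_sum_nth atLeast0LessThan xs)
  also have "\<dots> \<le> (\<Sum>l<M. N (proj {t l..<t (Suc l)} x))"
  proof (rule sum_mono)
    fix l assume "l \<in> {..<M}"
    then have "proj {lo (xs ! l)..<hi (xs ! l)} x = proj {lo (xs ! l)..<hi (xs ! l)} (proj {t l..<t (Suc l)} x)"
      using le[of l] unfolding proj_proj by (subst Int_absorb2) (auto simp: t_def)
    then show "N (proj {lo (xs ! l)..<hi (xs ! l)} x) \<le> N (proj {t l..<t (Suc l)} x)"
      using N_proj[OF N_proj_G] by metis
  qed
  also have "\<dots> \<le> gm_f M * N x" by (rule N_lower_estimate[OF x \<open>mono t\<close>])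
  finally show ?thesis by (simp add: M_def)
qed

text \<open>Each chosen term has its own functional \<open>g i\<close>, nearly zero on
  \<open>Y\<close> and living on an interval disjoint from the others. The sum \<open>h\<close> of
  the \<open>g i\<close>, with inverse signs, is large at \<open>x - y\<close>, while the lower
  estimate of the norm bounds this value by \<open>gm_f (card S) * N (x - y)\<close>.\<close>

lemma lower_subsequence:
  assumes Y: "csub Y" and a: "\<And>m. a m \<in> G" "\<And>m. N (a m) \<le> 4" "\<And>i. (\<lambda>m. a m i) \<longlonglongrightarrow> 0"
    and dist: "\<And>m y. y \<in> Y \<Longrightarrow> N (a m - y) \<ge> 1" and M: "M \<ge> 1"
  shows "\<exists>r. strict_mono (r :: nat \<Rightarrow> nat) \<and> (\<forall>S e y. finite S \<longrightarrow> card S \<le> M \<longrightarrow> S \<noteq> {} \<longrightarrow> (\<forall>i\<in>S. norm (e i) = 1) \<longrightarrow> y \<in> Y \<longrightarrow>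
     N ((\<Sum>i\<in>S. scl (e i) (a (r i))) - y) \<ge> real (card S) / (6 * gm_f (card S)))"
proof -
  note YG = csubD(1)[OF Y]
  \<comment> \<open>The off-diagonal terms for one \<open>g i\<close> sum to at most
    \<open>M * \<delta> = 1/12\<close>, which leaves 1/3 - 1/12 = 1/4 per term. Only
    \<open>y\<close> with \<open>N y <= 5 * k\<close> matter, and for these \<open>\<eta>\<close>
    limits the loss to another 1/12 per term; 1/4 - 1/12 = 1/6 explains the 6 in the claim.\<close>
  define \<delta> where "\<delta> = 1 / (12 * real M)"
  define \<eta> where "\<eta> = 1 / (60 * real M)"
  have pos: "\<delta> > 0" "\<eta> > 0" using M by (auto simp: \<delta>_def \<eta>_def)
  define P where "P st \<longleftrightarrow> (case st of (m, lo, hi, g) \<Rightarrow> lo \<le> hi \<and> supp_in g lo hi \<and> (\<forall>x\<in>G. norm (act g x) \<le> N (proj {lo..<hi} x)) \<and>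
     (\<forall>y\<in>Y. norm (act g y) \<le> \<eta> * N y) \<and> (\<exists>t\<ge>1/3. act g (a m) = of_real t))" for st :: "nat \<times> nat \<times> nat \<times> (nat \<Rightarrow> 'a)"
  \<comment> \<open>The next window starts where the previous vector has a small tail, and the next
    vector comes so late that it is small on the previous windows; these are the two kinds of
    off-diagonal terms.\<close>
  define Q where "Q st st' \<longleftrightarrow> (case st of (m, lo, hi, g) \<Rightarrow> case st' of (m', lo', hi', g') \<Rightarrow> m < m' \<and> hi \<le> lo' \<and>
     (\<forall>k\<ge>lo'. N (a m - proj {0..<k} (a m)) \<le> \<delta>) \<and> (\<forall>k\<ge>m'. (\<Sum>i=0..<hi. norm (a k i)) \<le> \<delta>))"
     for st st' :: "nat \<times> nat \<times> nat \<times> (nat \<Rightarrow> 'a)"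
  have ex: "\<exists>m lo hi g. P (m, lo, hi, g) \<and> m \<ge> m0 \<and> lo = lo0" for m0 lo0
    using separating_functional[OF Y a(1,3) dist pos(2), of m0 lo0] unfolding P_def by fastforce
  have "\<exists>st. P st" using ex by blast
  moreover have "\<exists>st'. P st' \<and> Q st st'" for st
  proof -
    obtain m lo hi g where st: "st = (m, lo, hi, g)" by (cases st)
    have "eventually (\<lambda>k. N (a m - proj {0..<k} (a m)) < \<delta>) sequentially"
      using N_tail_tendsto[OF a(1)] pos by (intro order_tendstoD) auto
    then obtain k0 where k0: "\<And>k. k \<ge> k0 \<Longrightarrow> N (a m - proj {0..<k} (a m)) < \<delta>" by (auto simp: eventually_sequentially)
    have "(\<lambda>k. \<Sum>i=0..<hi. norm (a k i)) \<longlonglongrightarrow> (\<Sum>i=0..<hi. norm (0::'a))" by (intro tendsto_intros a(3))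
    then have "eventually (\<lambda>k. (\<Sum>i=0..<hi. norm (a k i)) < \<delta>) sequentially" using pos by (intro order_tendstoD) auto
    then obtain m1 where m1: "\<And>k. k \<ge> m1 \<Longrightarrow> (\<Sum>i=0..<hi. norm (a k i)) < \<delta>" by (auto simp: eventually_sequentially)
    obtain m' lo' hi' g' where "P (m', lo', hi', g')" "m' \<ge> max (Suc m) m1" "lo' = max hi k0" using ex by blast
    then show ?thesis using k0 m1 unfolding st Q_def
      by (intro exI[of _ "(m', lo', hi', g')"]) (auto intro: less_imp_le)
  qed
  ultimately obtain F where F: "\<And>n. P (F n)" "\<And>n. Q (F n) (F (Suc n))"
    using dependent_nat_choice[of "\<lambda>_. P" "\<lambda>_. Q"] by blast
  define r lo hi g where "r n = fst (F n)" and "lo n = fst (snd (F n))" and "hi n = fst (snd (snd (F n)))"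
    and "g n = snd (snd (snd (F n)))" for n
  have Fe: "F n = (r n, lo n, hi n, g n)" for n by (simp add: r_def lo_def hi_def g_def)
  have p: "lo n \<le> hi n" "supp_in (g n) (lo n) (hi n)" "\<And>x. x \<in> G \<Longrightarrow> norm (act (g n) x) \<le> N (proj {lo n..<hi n} x)"
    "\<And>y. y \<in> Y \<Longrightarrow> norm (act (g n) y) \<le> \<eta> * N y" "\<exists>t\<ge>1/3. act (g n) (a (r n)) = of_real t" for n
    using F(1)[of n] unfolding Fe P_def by auto
  have q: "r n < r (Suc n)" "hi n \<le> lo (Suc n)" "\<And>k. k \<ge> lo (Suc n) \<Longrightarrow> N (a (r n) - proj {0..<k} (a (r n))) \<le> \<delta>"
    "\<And>k. k \<ge> r (Suc n) \<Longrightarrow> (\<Sum>i=0..<hi n. norm (a k i)) \<le> \<delta>" for n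
    using F(2)[of n] unfolding Fe Q_def by auto
  obtain t where t: "\<And>n. t n \<ge> 1/3" "\<And>n. act (g n) (a (r n)) = of_real (t n)" using p(5) by metis
  have rm: "strict_mono r" using q(1) by (simp add: strict_mono_Suc_iff)
  have lom: "lo n \<le> lo n'" if "n \<le> n'" for n n'
    by (rule lift_Suc_mono_le[of lo, OF _ that]) (use p(1) q(2) order_trans in blast)
  have ord: "hi i \<le> lo i'" if "i < i'" for i i' using q(2)[of i] lom[of "Suc i" i'] that by simp
  have gc: "g n \<in> c00" for n using p(2) supp_in_c00 by blast
  have cross: "norm (act (g i) (a (r i'))) \<le> \<delta>" if "i \<noteq> i'" for i i'
  proof (cases "i' < i")
    case True
    have dz: "a (r i') - proj {0..<lo i} (a (r i')) \<in> G" by (rule N_tail(1)[OF a(1)])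
    have "act (g i) (proj {0..<lo i} (a (r i'))) = 0"
      unfolding act_eq[OF p(2)] by (rule sum.neutral) (simp add: seq_apply)
    then have "act (g i) (a (r i')) = act (g i) (a (r i') - proj {0..<lo i} (a (r i')))" by (simp add: act_diff)
    then have "norm (act (g i) (a (r i'))) \<le> N (a (r i') - proj {0..<lo i} (a (r i')))"
      using p(3)[OF dz, of i] N_proj[OF dz, of "lo i" "hi i"] by simp
    then show ?thesis using q(3)[OF lom[of "Suc i'" i]] True by simp
  next
    case False
    then have "r (Suc i) \<le> r i'" using that rm by (simp add: strict_mono_less_eq)
    then have s: "(\<Sum>k=0..<hi i. norm (a (r i') k)) \<le> \<delta>" by (rule q(4))
    have "norm (act (g i) (a (r i'))) \<le> N (proj {lo i..<hi i} (a (r i')))" by (rule p(3)[OF a(1)])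
    also have "\<dots> \<le> l1 (proj {lo i..<hi i} (a (r i')))" by (rule N_le_l1[OF c00_proj_fin])
    also have "\<dots> = (\<Sum>k=lo i..<hi i. norm (a (r i') k))" by (subst l1_eq[OF supp_in_proj]) (simp add: seq_apply)
    also have "\<dots> \<le> (\<Sum>k=0..<hi i. norm (a (r i') k))" by (rule sum_mono2) auto
    finally show ?thesis using s by linarith
  qed
  show ?thesis
  proof (intro exI[of _ r] conjI rm allI impI)
    fix S :: "nat set" and e :: "nat \<Rightarrow> 'a" and y assume S: "finite S" "card S \<le> M" "S \<noteq> {}" and e: "\<forall>i\<in>S. norm (e i) = 1" and y: "y \<in> Y"
    define k where "k = card S"
    have k1: "k \<ge> 1" using S unfolding k_def by (simp add: Suc_leI card_gt_0_iff)
    have kM: "real k \<le> real M" using S(2) by (simp add: k_def)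
    define x where "x = (\<Sum>i\<in>S. scl (e i) (a (r i)))"
    have xG: "x \<in> G" and xN: "N x \<le> 4 * real k"
    proof -
      have "x \<in> G \<and> N x \<le> (\<Sum>i\<in>S. N (scl (e i) (a (r i))))" unfolding x_def by (rule N_sum) (rule N_scl(1)[OF a(1)])
      moreover have "(\<Sum>i\<in>S. N (scl (e i) (a (r i)))) \<le> (\<Sum>i\<in>S. 4)"
        using e a(2) by (intro sum_mono) (simp add: N_scl(2)[OF a(1)])
      ultimately show "x \<in> G" "N x \<le> 4 * real k" by (auto simp: k_def mult.commute)
    qed
    define h where "h = (\<Sum>i\<in>S. scl (inverse (e i)) (g i))"
    have hact: "act h z = (\<Sum>i\<in>S. inverse (e i) * act (g i) z)" for z
      unfolding h_def using gc by (subst act_sum_left) (auto simp: act_scl_left)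
    have nh: "norm (act h z) \<le> (\<Sum>i\<in>S. norm (act (g i) z))" for z
      unfolding hact using e by (intro sum_norm_le) (simp add: norm_mult norm_inverse)
    have main: "norm (act h x) \<ge> real k / 4"
    proof -
      have term_: "norm (inverse (e i) * act (g i) x - of_real (t i)) \<le> real M * \<delta>" if i: "i \<in> S" for i
      proof -
        have "x = scl (e i) (a (r i)) + (\<Sum>i'\<in>S - {i}. scl (e i') (a (r i')))"
          unfolding x_def using S(1) i by (rule sum.remove)
        then have "act (g i) x = e i * of_real (t i) + (\<Sum>i'\<in>S - {i}. e i' * act (g i) (a (r i')))"
          by (simp add: act_add act_sum act_scl t(2))
        moreover have "e i \<noteq> 0" using e i by auto
        ultimately have "inverse (e i) * act (g i) x - of_real (t i) = inverse (e i) * (\<Sum>i'\<in>S - {i}. e i' * act (g i) (a (r i')))"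
          by (simp add: field_simps)
        then have "norm (inverse (e i) * act (g i) x - of_real (t i)) = norm (\<Sum>i'\<in>S - {i}. e i' * act (g i) (a (r i')))"
          using e i by (simp add: norm_mult norm_inverse)
        also have "\<dots> \<le> (\<Sum>i'\<in>S - {i}. \<delta>)" using e cross by (intro sum_norm_le) (auto simp: norm_mult)
        also have "\<dots> \<le> real M * \<delta>" using S pos by (simp add: mult_right_mono card_Diff_singleton i)
        finally show ?thesis .
      qed
      have "norm (act h x - of_real (\<Sum>i\<in>S. t i)) \<le> (\<Sum>i\<in>S. real M * \<delta>)"
        unfolding hact of_real_sum sum_subtractf[symmetric] by (intro sum_norm_le) (rule term_)
      also have "\<dots> = real k / 12" using M by (simp add: k_def \<delta>_def)
      finally have 1: "norm (act h x - of_real (\<Sum>i\<in>S. t i)) \<le> real k / 12" .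
      have "(\<Sum>i\<in>S. 1/3) \<le> (\<Sum>i\<in>S. t i)" using t(1) by (intro sum_mono) auto
      then have "real k / 3 \<le> norm (of_real (\<Sum>i\<in>S. t i) :: 'a)" unfolding norm_of_real by (simp add: k_def)
      also have "\<dots> \<le> norm (act h x) + norm (act h x - of_real (\<Sum>i\<in>S. t i))"
        by (metis norm_triangle_sub norm_minus_commute)
      finally show ?thesis using 1 by linarith
    qed
    have fk: "gm_f k > 0" using gm_f_pos[OF k1] .
    show "N ((\<Sum>i\<in>S. scl (e i) (a (r i))) - y) \<ge> real (card S) / (6 * gm_f (card S))"
      unfolding x_def[symmetric] k_def[symmetric]
    proof (rule ccontr)
      assume "\<not> real k / (6 * gm_f k) \<le> N (x - y)"
      then have less: "N (x - y) * (6 * gm_f k) < real k" using fk by (simp add: field_simps)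
      have dG: "x - y \<in> G" by (intro N_diff(1) xG YG y)
      have "N (x - y) \<le> N (x - y) * (6 * gm_f k)"
        using N_nonneg[OF dG] gm_f_ge1[OF k1] mult_left_mono[of 1 "6 * gm_f k" "N (x - y)"] by simp
      then have "N y \<le> 5 * real k"
        using N_diff(2)[OF xG dG] xN less by (simp add: algebra_simps)
      have "norm (act h y) \<le> (\<Sum>i\<in>S. \<eta> * N y)" by (rule order_trans[OF nh sum_mono]) (rule p(4)[OF y])
      also have "\<dots> = real k * (\<eta> * N y)" by (simp add: k_def)
      also have "\<dots> \<le> real k * (\<eta> * (5 * real M))"
        using \<open>N y \<le> 5 * real k\<close> kM pos by (intro mult_left_mono) auto
      also have "\<dots> = real k / 12" using M by (simp add: \<eta>_def)
      finally have hy: "norm (act h y) \<le> real k / 12" .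
      have "norm (act h (x - y)) \<le> (\<Sum>i\<in>S. N (proj {lo i..<hi i} (x - y)))"
        by (rule order_trans[OF nh sum_mono]) (rule p(3)[OF dG])
      also have "\<dots> \<le> gm_f k * N (x - y)" unfolding k_def by (rule N_lower_estimate_set[OF dG S(1) ord p(1)])
      finally have "norm (act h (x - y)) \<le> gm_f k * N (x - y)" .
      moreover have "norm (act h x) - norm (act h y) \<le> norm (act h (x - y))" unfolding act_diff by (rule norm_triangle_ineq2)
      ultimately have "real k / 4 - real k / 12 \<le> gm_f k * N (x - y)" using main hy by linarith
      then have "real k \<le> N (x - y) * (6 * gm_f k)" by (simp add: mult_ac)
      then show False using less by linarith
    qed
  qed
qed

section \<open>Tuples that behave like l1 modulo \<open>Y\<close>\<close>

lemma nullseq_subseq: "nullseq A b \<Longrightarrow> strict_mono r \<Longrightarrow> nullseq A (\<lambda>n. b (r n))"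
  unfolding nullseq_def using LIMSEQ_subseq_LIMSEQ[of _ 0 r] by (auto simp: o_def)

text \<open>\<open>gm_f ((2 * n) ^ l)\<close> grows only linearly in \<open>l\<close>.\<close>

lemma exponential_beats_f: assumes "n \<ge> 1" shows "\<exists>l. 4 ^ l > 24 * gm_f ((2 * n) ^ l)"
proof -
  define c where "c = log 2 (2 * real n)"
  have c: "c \<ge> 1" unfolding c_def using assms by (simp add: le_log_iff)
  obtain l :: nat where l: "24 * (1 + c) < real l" using reals_Archimedean2 by blast
  have "real l + 1 \<le> 2 ^ l" using Bernoulli_inequality[of "1::real" l] by (simp add: add.commute)
  then have "(real l + 1) * (real l + 1) \<le> 2 ^ l * 2 ^ l" by (intro mult_mono) auto
  also have "(2::real) ^ l * 2 ^ l = 4 ^ l" by (simp add: power_mult_distrib[symmetric])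
  finally have 1: "(real l + 1) * (real l + 1) \<le> 4 ^ l" .
  define xx where "xx = (2 * real n) ^ l"
  have xx: "xx \<ge> 1" unfolding xx_def using assms by (intro one_le_power) simp
  have "log 2 ((2 * real n) ^ l + 1) \<le> log 2 (2 * xx)"
    unfolding xx_def[symmetric] using xx by (subst log_le_cancel_iff) auto
  also have "log 2 (2 * xx) = 1 + log 2 xx" using xx by (subst log_mult) auto
  also have "log 2 xx = real l * c" unfolding xx_def c_def using assms by (subst log_nat_power) auto
  finally have "gm_f ((2 * n) ^ l) \<le> 1 + real l * c" by (simp add: gm_f_def)
  also have "\<dots> \<le> (real l + 1) * (1 + c)" using c by (simp add: algebra_simps)
  finally have "24 * gm_f ((2 * n) ^ l) \<le> 24 * ((real l + 1) * (1 + c))" by (rule mult_left_mono) simp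
  also have "\<dots> = (real l + 1) * (24 * (1 + c))" by (simp only: mult.left_commute)
  also have "\<dots> < (real l + 1) * (real l + 1)" using l by (intro mult_strict_left_mono) auto
  finally show ?thesis using 1 by (intro exI[of _ l]) linarith
qed

text \<open>If sums of \<open>n\<close> terms of null sequences could always be pushed to norm below \<open>n\<close> by
  subtracting an element of \<open>Y\<close>, then iterating with differences of such sums would contradict
  the lower estimate \<open>lower_subsequence\<close>.\<close>

lemma l1_tuple:
  fixes n p0 :: nat
  assumes Y: "csub Y" and A: "subsp Y A" and inf: "infdim_mod Y A" and n: "n \<ge> 1" and eps: "\<epsilon> > 0"
  shows "\<exists>a s. strict_mono s \<and> p0 \<le> s 0 \<and> (\<forall>i<n. a i \<in> A \<and> N (a i) \<le> 4 \<and> N (a i - proj {s i..<s (Suc i)} (a i)) \<le> \<epsilon>) \<and>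
     (\<forall>y\<in>Y. N ((\<Sum>i<n. a i) - y) \<ge> real n)"
proof (rule ccontr)
  assume neg: "\<not> ?thesis"
  have bad: "\<exists>y\<in>Y. N ((\<Sum>i<n. a i) - y) < real n"
    if "strict_mono s" "p0 \<le> s 0" "\<And>i. i < n \<Longrightarrow> a i \<in> A \<and> N (a i) \<le> 4 \<and> N (a i - proj {s i..<s (Suc i)} (a i)) \<le> \<epsilon>" for a s
  proof (rule ccontr)
    assume "\<not> ?thesis"
    then have "\<forall>y\<in>Y. N ((\<Sum>i<n. a i) - y) \<ge> real n" by (simp add: not_less)
    moreover have "\<forall>i<n. a i \<in> A \<and> N (a i) \<le> 4 \<and> N (a i - proj {s i..<s (Suc i)} (a i)) \<le> \<epsilon>" using that(3) by simp
    ultimately show False using neg that(1,2) by (elim notE, intro exI[of _ a] exI[of _ s] conjI)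
  qed
  note YG = csubD(1)[OF Y] and AG = subspD(1)[OF A]
  obtain l where l: "4 ^ l > 24 * gm_f ((2 * n) ^ l)" using exponential_beats_f[OF n] by blast
  define M where "M = (2 * n) ^ l"
  have M1: "M \<ge> 1" unfolding M_def using n by (intro one_le_power) simp
  obtain b where b: "nullseq A b" "\<And>m y. y \<in> Y \<Longrightarrow> N (b m - y) \<ge> 1" using exists_nullseq[OF Y A inf] by blast
  have bb: "b m \<in> G" "N (b m) \<le> 4" "(\<lambda>m. b m i) \<longlonglongrightarrow> 0" for m i using b(1) AG unfolding nullseq_def by auto
  have "\<exists>r. strict_mono (r :: nat \<Rightarrow> nat) \<and> (\<forall>S e y. finite S \<longrightarrow> card S \<le> M \<longrightarrow> S \<noteq> {} \<longrightarrow> (\<forall>i\<in>S. norm (e i) = 1) \<longrightarrow> y \<in> Y \<longrightarrow>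
     N ((\<Sum>i\<in>S. scl (e i) (b (r i))) - y) \<ge> real (card S) / (6 * gm_f (card S)))"
    by (rule lower_subsequence[OF Y bb _ M1]) (rule b(2))
  then obtain r where r: "strict_mono (r :: nat \<Rightarrow> nat)"
    and rl: "\<forall>S e y. finite S \<longrightarrow> card S \<le> M \<longrightarrow> S \<noteq> {} \<longrightarrow> (\<forall>i\<in>S. norm (e i) = 1) \<longrightarrow> y \<in> Y \<longrightarrow>
     N ((\<Sum>i\<in>S. scl (e i) (b (r i))) - y) \<ge> real (card S) / (6 * gm_f (card S))"
    by (elim exE conjE)
  define a where "a i = b (r i)" for i
  have an: "nullseq A a" unfolding a_def by (rule nullseq_subseq[OF b(1) r])
  \<comment> \<open>The invariant of the iteration: modulo \<open>Y\<close>, the terms of a null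
    sequence are \<open>(2 / n) ^ l'\<close> times signed sums of \<open>(2 * n) ^ l'\<close>
    distinct terms of \<open>a\<close>, with disjoint index sets for different terms.\<close>
  define T where "T l' \<longleftrightarrow> (\<exists>c S e. nullseq A c \<and> (\<forall>k. finite (S k) \<and> card (S k) = (2 * n) ^ l') \<and>
     (\<forall>k k'. k \<noteq> k' \<longrightarrow> S k \<inter> S k' = {}) \<and> (\<forall>s. norm (e s) = 1) \<and>
     (\<forall>k. c k - scl (of_real ((2 / real n) ^ l')) (\<Sum>s\<in>S k. scl (e s) (a s)) \<in> Y))" for l'
  have "T l'" for l'
  proof (induction l')
    case 0
    show ?case unfolding T_def
      by (intro exI[of _ a] exI[of _ "\<lambda>k. {k}"] exI[of _ "\<lambda>_. 1"]) (use an csubD(2)[OF Y] in simp)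
  next
    case (Suc l')
    define \<theta> where "\<theta> = (2 / real n) ^ l'"
    obtain c S e where c: "nullseq A c" and Sf: "\<forall>k. finite (S k) \<and> card (S k) = (2 * n) ^ l'"
      and Sd: "\<forall>k k'. k \<noteq> k' \<longrightarrow> S k \<inter> S k' = {}" and e: "\<forall>s. norm (e s) = 1"
      and cY: "\<forall>k. c k - scl (of_real \<theta>) (\<Sum>s\<in>S k. scl (e s) (a s)) \<in> Y"
      using Suc.IH unfolding T_def \<theta>_def by (elim exE conjE)
    have cA: "c k \<in> A" "c k \<in> G" "N (c k) \<le> 4" "(\<lambda>k. c k i) \<longlonglongrightarrow> 0" for k i using c AG unfolding nullseq_def by auto
    obtain r1 s where r1: "strict_mono (r1 :: nat \<Rightarrow> nat)" "strict_mono s" "s 0 = p0"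
      "\<And>i. N (c (r1 i) - proj {s i..<s (Suc i)} (c (r1 i))) \<le> \<epsilon>"
      using near_blocks[of c \<epsilon> p0] cA eps by blast
    have "\<exists>y\<in>Y. N ((\<Sum>i<n. c (r1 (k * n + i))) - y) < real n" for k
    proof (rule bad[of "\<lambda>i. s (k * n + i)"])
      show "strict_mono (\<lambda>i. s (k * n + i))" using r1(2) by (simp add: strict_mono_def)
      show "p0 \<le> s (k * n + 0)" using r1(2,3) by (metis le0 strict_mono_less_eq)
      show "c (r1 (k * n + i)) \<in> A \<and> N (c (r1 (k * n + i))) \<le> 4 \<and>
        N (c (r1 (k * n + i)) - proj {s (k * n + i)..<s (k * n + Suc i)} (c (r1 (k * n + i)))) \<le> \<epsilon>" for i
        using cA r1(4)[of "k * n + i"] by simp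
    qed
    then obtain y where y: "\<And>k. y k \<in> Y" "\<And>k. N ((\<Sum>i<n. c (r1 (k * n + i))) - y k) < real n" by metis
    define B where "B k = (\<Sum>i<n. c (r1 (k * n + i))) - y k" for k
    have BA: "B k \<in> A" for k unfolding B_def
      by (intro subspD(5)[OF A] subspD(6)[OF A] csubD(2)[OF Y] cA subspD(2)[OF A y(1)])
    have BG: "B k \<in> G" for k using AG BA by blast
    have BN: "N (B k) \<le> real n" for k unfolding B_def using y(2)[of k] by simp
    have "norm (B k i) \<le> real n" for k i by (rule order_trans[OF N_coord[OF BG] BN])
    then obtain \<rho> B' where \<rho>: "strict_mono (\<rho> :: nat \<Rightarrow> nat)" "\<And>i. (\<lambda>k. B (\<rho> k) i) \<longlonglongrightarrow> B' i"
      using coordinatewise_subseq[of B "\<lambda>_. real n"] by blast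
    \<comment> \<open>Two block sums are subtracted in order to have a null sequence again. Modulo
      \<open>Y\<close> each has norm at most \<open>n\<close>, so the factor \<open>2 / n\<close>
      restores the bound 4.\<close>
    define c' where "c' k = scl (of_real (2 / real n)) (B (\<rho> (2 * k + 1)) - B (\<rho> (2 * k)))" for k
    define U where "U q = (\<Union>i\<in>{..<n}. S (r1 (q * n + i)))" for q
    define S' where "S' k = U (\<rho> (2 * k + 1)) \<union> U (\<rho> (2 * k))" for k
    \<comment> \<open>The subtracted blocks are those at even positions. Their signs can be flipped
      once and for all because the sets \<open>U\<close> are pairwise disjoint.\<close>
    define E where "E = (\<Union>k. U (\<rho> (2 * k)))"
    define e' where "e' s = (if s \<in> E then - e s else e s)" for s
    have idx: "q = q' \<and> i = i'" if "q * n + i = q' * n + i'" "i < n" "i' < n" for q q' i i'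
    proof -
      have dm: "(q * n + i) div n = q" "(q * n + i) mod n = i" if "i < n" for q i using that by auto
      show ?thesis using dm[OF that(2), of q] dm[OF that(3), of q'] that(1) by metis
    qed
    have Sd1: "S (r1 (q * n + i)) \<inter> S (r1 (q' * n + i')) = {}" if "i < n" "i' < n" "q \<noteq> q' \<or> i \<noteq> i'" for q q' i i'
    proof -
      have "q * n + i \<noteq> q' * n + i'" using idx[OF _ that(1,2)] that(3) by blast
      then have "r1 (q * n + i) \<noteq> r1 (q' * n + i')" using strict_mono_eq[OF r1(1)] by simp
      then show ?thesis using Sd by simp
    qed
    have Ufin: "finite (U q)" for q unfolding U_def using Sf by simp
    have Ucard: "card (U q) = n * (2 * n) ^ l'" for q
    proof -
      have "card (U q) = (\<Sum>i\<in>{..<n}. card (S (r1 (q * n + i))))"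
        unfolding U_def by (rule card_UN_disjoint) (use Sf Sd1 in auto)
      then show ?thesis using Sf by simp
    qed
    have Udisj: "U q \<inter> U q' = {}" if "q \<noteq> q'" for q q'
      unfolding U_def using Sd1 that by blast
    have Usum: "B q - scl (of_real \<theta>) (\<Sum>s\<in>U q. scl (e s) (a s)) \<in> Y" for q
    proof -
      have "(\<Sum>s\<in>U q. scl (e s) (a s)) = (\<Sum>i\<in>{..<n}. \<Sum>s\<in>S (r1 (q * n + i)). scl (e s) (a s))"
        unfolding U_def by (rule sum.UNION_disjoint) (use Sf Sd1 in auto)
      then have "B q - scl (of_real \<theta>) (\<Sum>s\<in>U q. scl (e s) (a s)) =
         (\<Sum>i<n. c (r1 (q * n + i)) - scl (of_real \<theta>) (\<Sum>s\<in>S (r1 (q * n + i)). scl (e s) (a s))) - y q"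
        unfolding B_def by (simp add: scl_sum sum_subtractf)
      moreover have "\<dots> \<in> Y" by (rule csubD(5)[OF Y csubD(7)[OF Y] y(1)]) (rule cY[rule_format])
      ultimately show ?thesis by simp
    qed
    have \<rho>ne: "\<rho> i \<noteq> \<rho> i'" if "i \<noteq> i'" for i i' using that strict_mono_eq[OF \<rho>(1)] by simp
    have par: "2 * k + 1 \<noteq> 2 * k'" for k k' :: nat by presburger
    have "nullseq A c'" unfolding nullseq_def
    proof (intro conjI allI)
      show "c' k \<in> A" for k unfolding c'_def by (intro subspD(4,5)[OF A] BA)
      show "N (c' k) \<le> 4" for k
      proof -
        have "N (c' k) = 2 / real n * N (B (\<rho> (2 * k + 1)) - B (\<rho> (2 * k)))"
          unfolding c'_def N_scl(2)[OF N_diff(1)[OF BG BG]] using n by (simp add: norm_divide)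
        also have "\<dots> \<le> 2 / real n * (real n + real n)"
        proof (rule mult_left_mono)
          show "N (B (\<rho> (2 * k + 1)) - B (\<rho> (2 * k))) \<le> real n + real n"
            using N_diff(2)[OF BG BG, of "\<rho> (2 * k + 1)" "\<rho> (2 * k)"] BN[of "\<rho> (2 * k + 1)"] BN[of "\<rho> (2 * k)"] by linarith
        qed simp
        also have "\<dots> = 4" using n by simp
        finally show ?thesis .
      qed
      fix i
      have "(\<lambda>k. B (\<rho> (2 * k + 1)) i) \<longlonglongrightarrow> B' i"
        using LIMSEQ_subseq_LIMSEQ[OF \<rho>(2), of "\<lambda>k. 2 * k + 1"] by (simp add: o_def strict_mono_def)
      moreover have "(\<lambda>k. B (\<rho> (2 * k)) i) \<longlonglongrightarrow> B' i"
        using LIMSEQ_subseq_LIMSEQ[OF \<rho>(2), of "\<lambda>k. 2 * k"] by (simp add: o_def strict_mono_def)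
      ultimately have "(\<lambda>k. of_real (2 / real n) * (B (\<rho> (2 * k + 1)) i - B (\<rho> (2 * k)) i)) \<longlonglongrightarrow> of_real (2 / real n) * (B' i - B' i)"
        by (intro tendsto_intros)
      then show "(\<lambda>k. c' k i) \<longlonglongrightarrow> 0" by (simp add: c'_def seq_apply)
    qed
    moreover have "finite (S' k) \<and> card (S' k) = (2 * n) ^ Suc l'" for k
      unfolding S'_def using Ufin Ucard Udisj[OF \<rho>ne[OF par[of k k]]] by (subst card_Un_disjoint) auto
    moreover have "S' k \<inter> S' k' = {}" if "k \<noteq> k'" for k k'
    proof -
      have "U (\<rho> i) \<inter> U (\<rho> i') = {}" if "i \<noteq> i'" for i i' by (rule Udisj[OF \<rho>ne[OF that]])
      then have "U (\<rho> (2*k+1)) \<inter> U (\<rho> (2*k'+1)) = {}" "U (\<rho> (2*k+1)) \<inter> U (\<rho> (2*k')) = {}"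
        "U (\<rho> (2*k)) \<inter> U (\<rho> (2*k'+1)) = {}" "U (\<rho> (2*k)) \<inter> U (\<rho> (2*k')) = {}"
        using that par[of k k'] par[of k' k] by (metis (no_types) add_right_cancel mult_cancel1 zero_neq_numeral)+
      then show ?thesis unfolding S'_def by blast
    qed
    moreover have "norm (e' s) = 1" for s using e by (simp add: e'_def)
    moreover have "c' k - scl (of_real ((2 / real n) ^ Suc l')) (\<Sum>s\<in>S' k. scl (e' s) (a s)) \<in> Y" for k
    proof -
      let ?q = "\<rho> (2 * k + 1)" and ?q' = "\<rho> (2 * k)"
      have dis: "U ?q \<inter> U ?q' = {}" by (rule Udisj[OF \<rho>ne[OF par]])
      have notE: "s \<notin> E" if "s \<in> U ?q" for s
      proof
        assume "s \<in> E"
        then obtain k' where "s \<in> U (\<rho> (2 * k'))" unfolding E_def by blast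
        then show False using Udisj[OF \<rho>ne[OF par[of k k']]] \<open>s \<in> U ?q\<close> by blast
      qed
      have "(\<Sum>s\<in>S' k. scl (e' s) (a s)) = (\<Sum>s\<in>U ?q. scl (e' s) (a s)) + (\<Sum>s\<in>U ?q'. scl (e' s) (a s))"
        unfolding S'_def by (rule sum.union_disjoint[OF Ufin Ufin dis])
      also have "(\<Sum>s\<in>U ?q. scl (e' s) (a s)) = (\<Sum>s\<in>U ?q. scl (e s) (a s))"
        by (rule sum.cong) (use notE in \<open>auto simp: e'_def\<close>)
      also have "(\<Sum>s\<in>U ?q'. scl (e' s) (a s)) = (\<Sum>s\<in>U ?q'. - scl (e s) (a s))"
        by (rule sum.cong) (auto simp: e'_def E_def seq_apply fun_eq_iff)
      finally have eq: "(\<Sum>s\<in>S' k. scl (e' s) (a s)) = (\<Sum>s\<in>U ?q. scl (e s) (a s)) - (\<Sum>s\<in>U ?q'. scl (e s) (a s))"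
        by (simp add: sum_negf)
      have "c' k - scl (of_real ((2 / real n) ^ Suc l')) (\<Sum>s\<in>S' k. scl (e' s) (a s)) =
        scl (of_real (2 / real n)) ((B ?q - scl (of_real \<theta>) (\<Sum>s\<in>U ?q. scl (e s) (a s))) - (B ?q' - scl (of_real \<theta>) (\<Sum>s\<in>U ?q'. scl (e s) (a s))))"
        unfolding c'_def eq \<theta>_def by (rule ext) (simp add: seq_apply algebra_simps)
      also have "\<dots> \<in> Y" by (intro csubD(4)[OF Y] csubD(5)[OF Y] Usum)
      finally show ?thesis .
    qed
    ultimately show ?case unfolding T_def by (intro exI[of _ c'] exI[of _ S'] exI[of _ e'] conjI allI impI) auto
  qed
  then have "T l" .
  then obtain c S e where c: "nullseq A c" and Sf: "\<forall>k::nat. finite (S k) \<and> card (S k) = (2 * n) ^ l"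
      and "\<forall>k k'. k \<noteq> k' \<longrightarrow> S k \<inter> S k' = {}" and e: "\<forall>s. norm (e s) = 1"
      and cY: "\<forall>k. c k - scl (of_real ((2 / real n) ^ l)) (\<Sum>s\<in>S k. scl (e s) (a s)) \<in> Y"
    unfolding T_def by (elim exE conjE)
  define \<theta> where "\<theta> = (2 / real n) ^ l"
  have \<theta>: "\<theta> > 0" using n by (simp add: \<theta>_def)
  \<comment> \<open>The signed sum \<open>x\<close> of \<open>M\<close> terms has distance at least
    \<open>M / (6 * gm_f M)\<close> from \<open>Y\<close> by the lower estimate, but at most
    \<open>4 / \<theta>\<close> by the invariant; as \<open>M * \<theta> = 4 ^ l\<close>, this
    contradicts the choice of \<open>l\<close>.\<close>
  define x where "x = (\<Sum>s\<in>S 0. scl (e s) (a s))"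
  define y where "y = scl (of_real (- 1 / \<theta>)) (c 0 - scl (of_real \<theta>) x)"
  have y: "y \<in> Y" unfolding y_def x_def \<theta>_def by (rule csubD(4)[OF Y]) (use cY in blast)
  have Sne: "S 0 \<noteq> {}" using Sf M1 unfolding M_def by (metis card.empty not_one_le_zero)
  have low: "real M / (6 * gm_f M) \<le> N (x - y)"
    using rl[rule_format, of "S 0" e y] Sf Sne e y unfolding x_def a_def M_def by simp
  have "x - y = scl (of_real (1 / \<theta>)) (c 0)" unfolding y_def using \<theta> by (intro ext) (simp add: seq_apply field_simps)
  moreover have "c 0 \<in> G" "N (c 0) \<le> 4" using c AG unfolding nullseq_def by auto
  ultimately have "N (x - y) \<le> 4 / \<theta>" using \<theta> by (simp add: N_scl(2) norm_divide divide_right_mono)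
  then have "real M / (6 * gm_f M) \<le> 4 / \<theta>" using low by linarith
  then have "real M \<le> 4 / \<theta> * (6 * gm_f M)" using gm_f_pos[OF M1] by (subst (asm) pos_divide_le_eq) auto
  then have "real M * \<theta> \<le> (4 / \<theta> * (6 * gm_f M)) * \<theta>" using \<theta> by (intro mult_right_mono) auto
  also have "\<dots> = 24 * gm_f M" using \<theta> by simp
  finally have "real M * \<theta> \<le> 24 * gm_f M" .
  moreover have "real M * \<theta> = ((2 * real n) * (2 / real n)) ^ l"
    by (simp only: M_def \<theta>_def power_mult_distrib of_nat_power of_nat_mult of_nat_numeral)
  moreover have "(2 * real n) * (2 / real n) = 4" using n by simp
  ultimately have "4 ^ l \<le> 24 * gm_f M" by simp
  then show False using l unfolding M_def by linarith
qed

text \<open>The basic brick: a multiple of an average of an l1 tuple, close to \<open>A\<close>,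
  with a functional \<open>zs\<close> of value 1 at it. The norm bound 1/2 leaves room for passing
  to a finite level, and coordinates in \<open>\<phi> * R\<close> become elements of
  \<open>R\<close> when \<open>\<phi>\<close>, later \<open>gm_f m\<close>, is divided out.\<close>

lemma exists_pair:
  fixes K p0 :: nat
  assumes Y: "csub Y" and A: "subsp Y A" and inf: "infdim_mod Y A" and eps: "\<epsilon> > 0" and eta: "\<eta> > 0" and phi: "\<phi> > 0"
  shows "\<exists>z zs hi. p0 < hi \<and> supp_in z p0 hi \<and> supp_in zs p0 hi \<and> spread 160 K z \<and> (\<exists>a\<in>A. N (a - z) \<le> \<epsilon>) \<and>
    (\<forall>x\<in>G. norm (act zs x) \<le> N x / 2) \<and> (\<forall>y\<in>Y. norm (act zs y) \<le> \<eta> * N y) \<and> act zs z = 1 \<and>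
    (\<forall>i. \<exists>r\<in>R. zs i = of_real \<phi> * r)"
proof -
  note YG = csubD(1)[OF Y] and AG = subspD(1)[OF A]
  define n where "n = (K + 1)\<^sup>2"
  have n1: "n \<ge> 1" by (simp add: n_def)
  define \<epsilon>0 where "\<epsilon>0 = min (1/12) (\<epsilon> / 20)"
  have e0: "\<epsilon>0 > 0" "\<epsilon>0 \<le> 1/12" "20 * \<epsilon>0 \<le> \<epsilon>" using eps by (auto simp: \<epsilon>0_def)
  \<comment> \<open>The error tends to 0 with \<open>m\<close> and the \<open>m\<close>-th tuple
    starts beyond \<open>p0 + m\<close>; so the averages \<open>u m\<close> tend to 0 coordinatewise
    and \<open>separating_functional\<close> applies to them.\<close>
  define em where "em m = \<epsilon>0 / real (Suc m)" for m
  have em: "em m > 0" "em m \<le> \<epsilon>0" for m unfolding em_def using e0 by (auto simp: field_simps)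
  have "\<forall>m. \<exists>as. strict_mono (snd as) \<and> p0 + m \<le> snd as 0 \<and> (\<forall>i<n. fst as i \<in> A \<and> N (fst as i) \<le> 4 \<and>
      N (fst as i - proj {snd as i..<snd as (Suc i)} (fst as i)) \<le> em m) \<and> (\<forall>y\<in>Y. N ((\<Sum>i<n. fst as i) - y) \<ge> real n)" (is "\<forall>m. ?T m")
  proof
    fix m
    from l1_tuple[OF Y A inf n1 em(1), of "p0 + m" m] obtain a s where
      "strict_mono s \<and> p0 + m \<le> s 0 \<and> (\<forall>i<n. a i \<in> A \<and> N (a i) \<le> 4 \<and> N (a i - proj {s i..<s (Suc i)} (a i)) \<le> em m) \<and>
       (\<forall>y\<in>Y. N ((\<Sum>i<n. a i) - y) \<ge> real n)" by (elim exE)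
    then show "?T m" by (intro exI[of _ "(a, s)"]) simp
  qed
  then obtain as where as: "\<forall>m. strict_mono (snd (as m)) \<and> p0 + m \<le> snd (as m) 0 \<and> (\<forall>i<n. fst (as m) i \<in> A \<and> N (fst (as m) i) \<le> 4 \<and>
      N (fst (as m) i - proj {snd (as m) i..<snd (as m) (Suc i)} (fst (as m) i)) \<le> em m) \<and> (\<forall>y\<in>Y. N ((\<Sum>i<n. fst (as m) i) - y) \<ge> real n)"
    by (rule choice[THEN exE])
  define a s where "a m = fst (as m)" and "s m = snd (as m)" for m
  have s: "strict_mono (s m)" "p0 + m \<le> s m 0" for m using as unfolding s_def by blast+
  have a: "a m i \<in> A" "N (a m i) \<le> 4" "N (a m i - proj {s m i..<s m (Suc i)} (a m i)) \<le> em m" if "i < n" for m i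
    using as that unfolding s_def a_def by blast+
  have ad: "N ((\<Sum>i<n. a m i) - y) \<ge> real n" if "y \<in> Y" for m y using as that unfolding a_def by blast
  define v where "v m i = proj {s m i..<s m (Suc i)} (a m i)" for m i
  define u w where "u m = scl (1 / of_nat n) (\<Sum>i<n. a m i)" and "w m = scl (1 / of_nat n) (\<Sum>i=0..<0 + n. v m i)" for m
  have uA: "u m \<in> A" for m unfolding u_def by (intro subspD(4)[OF A] subspD(6)[OF A] csubD(2)[OF Y]) (use a in blast)
  have uG: "u m \<in> G" for m using AG uA by blast
  have avg: "N (scl (1 / of_nat n) (\<Sum>i<n. q i)) \<le> C" "(\<Sum>i<n. q i) \<in> G" if "\<And>i. i < n \<Longrightarrow> q i \<in> G \<and> N (q i) \<le> C" for q :: "nat \<Rightarrow> nat \<Rightarrow> 'a" and C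
  proof -
    have 1: "(\<Sum>i<n. q i) \<in> G" "N (\<Sum>i<n. q i) \<le> (\<Sum>i<n. N (q i))" using N_sum[of "{..<n}" q] that by auto
    then show "(\<Sum>i<n. q i) \<in> G" by blast
    have "(\<Sum>i<n. N (q i)) \<le> (\<Sum>i<n. C)" using that by (intro sum_mono) auto
    then have "N (\<Sum>i<n. q i) \<le> real n * C" using 1 by simp
    then have "(1 / real n) * N (\<Sum>i<n. q i) \<le> (1 / real n) * (real n * C)" by (rule mult_left_mono) simp
    then show "N (scl (1 / of_nat n) (\<Sum>i<n. q i)) \<le> C" using n1 by (simp add: N_scl(2)[OF 1(1)] norm_divide)
  qed
  have vG: "v m i \<in> G" for m i unfolding v_def by (rule N_proj_G)
  have uw: "N (u m - w m) \<le> em m" for m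
  proof -
    have "u m - w m = scl (1 / of_nat n) (\<Sum>i<n. a m i - v m i)"
      unfolding u_def w_def by (simp add: scl_diff[symmetric] sum_subtractf atLeast0LessThan)
    then show ?thesis using avg(1)[of "\<lambda>i. a m i - v m i" "em m"] a AG vG N_diff(1) unfolding v_def by simp
  qed
  have wsup: "supp_in (w m) (p0 + m) (s m n)" for m unfolding w_def
  proof (intro supp_in_scl supp_in_sum)
    fix i assume "i \<in> {0..<0 + n}"
    then have "s m 0 \<le> s m i" "s m (Suc i) \<le> s m n" using s(1)[of m] by (auto simp: strict_mono_less_eq)
    then show "supp_in (v m i) (p0 + m) (s m n)" unfolding v_def using s(2)[of m]
      by (intro supp_in_mono[OF supp_in_proj]) auto
  qed
  have wG: "w m \<in> G" for m using wsup supp_in_c00 c00_G by blast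
  have w4: "N (w m) \<le> 4" for m
    using avg(1)[of "v m" 4] vG N_proj[OF AG[OF a(1)]] a(2) unfolding w_def v_def by (simp add: atLeast0LessThan) (meson order_trans)
  have wspread: "spread (2 * 4) K (w m)" for m unfolding w_def
  proof (rule spread_average[OF s(1)])
    fix i assume "0 \<le> i" "i < 0 + n"
    then show "supp_in (v m i) (s m i) (s m (Suc i)) \<and> N (v m i) \<le> 4"
      unfolding v_def using N_proj[OF AG[OF a(1)]] a(2) by (simp add: supp_in_proj) (meson order_trans)
  qed (simp_all add: n_def)
  have u0: "(\<lambda>m. u m i) \<longlonglongrightarrow> 0" for i
  proof -
    have bound: "norm (u m i) \<le> \<epsilon>0 * inverse (real (Suc m))" if "m > i" for m
    proof -
      have "w m i = 0" by (rule supp_in_zero[OF wsup]) (use that in simp)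
      then have "norm (u m i) = norm ((u m - w m) i)" by (simp add: seq_apply)
      also have "\<dots> \<le> em m" using N_coord[OF N_diff(1)[OF uG wG], of m m i] uw[of m] by linarith
      finally show ?thesis by (simp add: em_def divide_inverse)
    qed
    have "(\<lambda>m. \<epsilon>0 * inverse (real (Suc m))) \<longlonglongrightarrow> \<epsilon>0 * 0" by (intro tendsto_intros LIMSEQ_inverse_real_of_nat)
    then have lim: "(\<lambda>m. \<epsilon>0 * inverse (real (Suc m))) \<longlonglongrightarrow> 0" by simp
    have "eventually (\<lambda>m. norm (u m i) \<le> \<epsilon>0 * inverse (real (Suc m))) sequentially"
      using eventually_gt_at_top[of i] by eventually_elim (rule bound)
    from Lim_null_comparison[OF this lim] show ?thesis .
  qed
  have ud: "N (u m - y) \<ge> 1" if "y \<in> Y" for m y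
  proof -
    have sG: "(\<Sum>i<n. a m i) \<in> G" using avg(2)[of "a m" 4] a AG by blast
    have "u m - y = scl (1 / of_nat n) ((\<Sum>i<n. a m i) - scl (of_nat n) y)"
      unfolding u_def using n1 by (intro ext) (simp add: seq_apply field_simps)
    then have "N (u m - y) = (1 / real n) * N ((\<Sum>i<n. a m i) - scl (of_nat n) y)"
      using N_scl(2)[OF N_diff(1)[OF sG N_scl(1)[OF YG[OF that]]]] by (simp add: norm_divide)
    moreover have "(1 / real n) * N ((\<Sum>i<n. a m i) - scl (of_nat n) y) \<ge> (1 / real n) * real n"
      by (intro mult_left_mono ad csubD(4)[OF Y that]) simp
    ultimately show ?thesis using n1 by simp
  qed
  obtain m r g t where g: "supp_in g p0 r" "\<forall>x\<in>G. norm (act g x) \<le> N (proj {p0..<r} x)"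
     "\<forall>y\<in>Y. norm (act g y) \<le> \<eta> * N y" "act g (u m) = of_real t" "t \<ge> 1/3"
    using separating_functional[OF Y uG u0 ud eta, of 0 p0] by blast
  define hi where "hi = max (Suc p0) (max r (s m n))"
  have hi: "p0 < hi" "r \<le> hi" "s m n \<le> hi" by (auto simp: hi_def)
  have gs: "supp_in g p0 hi" by (rule supp_in_mono[OF g(1)]) (use hi in auto)
  have ws: "supp_in (w m) p0 hi" by (rule supp_in_mono[OF wsup]) (use hi in auto)
  have gN: "norm (act g x) \<le> N x" if "x \<in> G" for x using g(2) N_proj[OF that] that order_trans by blast
  \<comment> \<open>Norm 2/5 plus at most 1/10 for rounding the coordinates keeps the functional
    below 1/2.\<close>
  define zs0 where "zs0 = scl (of_real (2/5)) g"
  have zs0: "norm (act zs0 x) = (2/5) * norm (act g x)" for x by (simp add: zs0_def act_scl_left norm_mult norm_divide)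
  define \<delta> where "\<delta> = min (1/80) (\<eta> / 2) / real hi"
  have hid: "real hi * \<delta> = min (1/80) (\<eta> / 2)" "\<delta> > 0" using hi(1) eta by (auto simp: \<delta>_def)
  have "\<exists>q\<in>R. norm (zs0 i - of_real \<phi> * q) \<le> \<delta>" for i
  proof -
    obtain q where q: "q \<in> R" "norm (zs0 i / of_real \<phi> - q) < \<delta> / \<phi>" using R_dense[of "\<delta> / \<phi>"] hid phi by (metis divide_pos_pos)
    have "zs0 i - of_real \<phi> * q = of_real \<phi> * (zs0 i / of_real \<phi> - q)" using phi by (simp add: field_simps)
    then have "norm (zs0 i - of_real \<phi> * q) = \<phi> * norm (zs0 i / of_real \<phi> - q)" using phi by (simp add: norm_mult)
    also have "\<dots> \<le> \<phi> * (\<delta> / \<phi>)" using q(2) phi by (intro mult_left_mono) auto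
    finally show ?thesis using q(1) phi by auto
  qed
  then obtain q where q: "\<And>i. q i \<in> R" "\<And>i. norm (zs0 i - of_real \<phi> * q i) \<le> \<delta>" by metis
  define zs where "zs i = (if i \<in> {p0..<hi} then of_real \<phi> * q i else 0)" for i
  have zss: "supp_in zs p0 hi" by (auto simp: supp_in_def zs_def)
  have zR: "\<exists>r\<in>R. zs i = of_real \<phi> * r" for i
    by (rule bexI[of _ "if i \<in> {p0..<hi} then q i else 0"]) (auto simp: zs_def q(1) R_0)
  have zs0s: "supp_in zs0 p0 hi" unfolding zs0_def by (rule supp_in_scl[OF gs])
  have pert: "norm (act zs x - act zs0 x) \<le> min (1/80) (\<eta> / 2) * N x" if x: "x \<in> G" for x
  proof -
    have "act zs x - act zs0 x = (\<Sum>i=p0..<hi. (of_real \<phi> * q i - zs0 i) * x i)"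
      unfolding act_eq[OF zss] act_eq[OF zs0s] sum_subtractf[symmetric] by (rule sum.cong) (auto simp: zs_def algebra_simps)
    also have "norm \<dots> \<le> (\<Sum>i=p0..<hi. \<delta> * N x)"
    proof (rule sum_norm_le)
      fix i
      show "norm ((of_real \<phi> * q i - zs0 i) * x i) \<le> \<delta> * N x"
        unfolding norm_mult using q(2)[of i] N_coord[OF x, of i] hid(2)
        by (intro mult_mono) (auto simp: norm_minus_commute)
    qed
    also have "\<dots> = real (hi - p0) * (\<delta> * N x)" by simp
    also have "\<dots> \<le> real hi * (\<delta> * N x)" using hid(2) N_nonneg[OF x] by (intro mult_right_mono) auto
    also have "\<dots> = min (1/80) (\<eta> / 2) * N x" unfolding hid(1)[symmetric] by simp
    finally show ?thesis .
  qed
  have zsle: "norm (act zs x) \<le> norm (act zs0 x) + min (1/80) (\<eta> / 2) * N x" if "x \<in> G" for x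
    using pert[OF that] norm_triangle_sub[of "act zs x" "act zs0 x"] by linarith
  have z1: "norm (act zs x) \<le> N x / 2" if "x \<in> G" for x
  proof -
    have "min (1/80) (\<eta> / 2) * N x \<le> (1/10) * N x" using N_nonneg[OF that] by (intro mult_right_mono) auto
    then show ?thesis using zsle[OF that] gN[OF that] zs0[of x] by linarith
  qed
  have z2: "norm (act zs y) \<le> \<eta> * N y" if "y \<in> Y" for y
  proof -
    have "min (1/80) (\<eta> / 2) * N y \<le> (\<eta> / 2) * N y" using N_nonneg[OF YG[OF that]] by (intro mult_right_mono) auto
    moreover have "(2/5) * norm (act g y) \<le> (2/5) * (\<eta> * N y)" using g(3) that by (intro mult_left_mono) auto
    moreover have "0 \<le> \<eta> * N y" using eta N_nonneg[OF YG[OF that]] by simp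
    ultimately show ?thesis using zsle[OF YG[OF that]] zs0[of y] by linarith
  qed
  \<comment> \<open>On \<open>w m\<close> the functional \<open>g\<close> is at least 1/3 - 1/12 =
    1/4; multiplied by 2/5 and diminished by a rounding error of at most 4/80, this leaves 1/20.
    Dividing by \<open>\<tau>\<close> multiplies the spreading constant 8 by at most 20.\<close>
  define \<tau> where "\<tau> = act zs (w m)"
  have tau: "norm \<tau> \<ge> 1/20"
  proof -
    have "1/3 \<le> norm (act g (u m))" using g(4,5) by simp
    also have "\<dots> \<le> norm (act g (w m)) + norm (act g (u m - w m))"
      unfolding act_diff using norm_triangle_sub[of "act g (u m)" "act g (w m)"] by linarith
    also have "norm (act g (u m - w m)) \<le> 1/12" using gN[OF N_diff(1)[OF uG wG], of m m] uw[of m] em(2)[of m] e0(2) by linarith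
    finally have "norm (act zs0 (w m)) \<ge> 1/10" using zs0[of "w m"] by simp
    moreover have "min (1/80) (\<eta> / 2) * N (w m) \<le> (1/80) * 4" using w4[of m] N_nonneg[OF wG, of m] by (intro mult_mono) auto
    then have "norm (act zs (w m) - act zs0 (w m)) \<le> 1/20" using pert[OF wG, of m] by linarith
    ultimately show ?thesis unfolding \<tau>_def using norm_triangle_ineq2[of "act zs0 (w m)" "act zs (w m)"]
      by (simp add: norm_minus_commute)
  qed
  then have t0: "\<tau> \<noteq> 0" by auto
  have it: "norm (1 / \<tau>) \<le> 20" using tau t0 by (simp add: norm_divide field_simps)
  define z where "z = scl (1 / \<tau>) (w m)"
  have zsp: "spread 160 K z" unfolding spread_def
  proof (intro allI impI)
    fix M and t :: "nat \<Rightarrow> nat" assume M: "M \<le> K" "mono t"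
    have "(\<Sum>l<M. N (proj {t l..<t (Suc l)} z)) = norm (1 / \<tau>) * (\<Sum>l<M. N (proj {t l..<t (Suc l)} (w m)))"
      unfolding z_def proj_scl N_scl(2)[OF N_proj_G] by (simp add: sum_distrib_left)
    also have "\<dots> \<le> 20 * (2 * 4)"
      using it wspread[of m] M N_nonneg[OF N_proj_G] unfolding spread_def by (intro mult_mono sum_nonneg) auto
    finally show "(\<Sum>l<M. N (proj {t l..<t (Suc l)} z)) \<le> 160" by simp
  qed
  have znear: "\<exists>a\<in>A. N (a - z) \<le> \<epsilon>"
  proof (rule bexI[of _ "scl (1 / \<tau>) (u m)"])
    show "scl (1 / \<tau>) (u m) \<in> A" by (rule subspD(4)[OF A uA])
    have "N (scl (1 / \<tau>) (u m) - z) = norm (1 / \<tau>) * N (u m - w m)"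
      unfolding z_def scl_diff[symmetric] by (rule N_scl(2)[OF N_diff(1)[OF uG wG]])
    also have "\<dots> \<le> 20 * \<epsilon>0" using it uw[of m] em(2)[of m] N_nonneg[OF N_diff(1)[OF uG wG], of m m] by (intro mult_mono) auto
    finally show "N (scl (1 / \<tau>) (u m) - z) \<le> \<epsilon>" using e0(3) by linarith
  qed
  have zone: "act zs z = 1" unfolding z_def act_scl using t0 by (simp add: \<tau>_def)
  have zsup: "supp_in z p0 hi" unfolding z_def by (rule supp_in_scl[OF ws])
  have z3: "\<forall>x\<in>G. norm (act zs x) \<le> N x / 2" using z1 by (intro ballI)
  have z4: "\<forall>y\<in>Y. norm (act zs y) \<le> \<eta> * N y" using z2 by (intro ballI)
  have z5: "\<forall>i. \<exists>r\<in>R. zs i = of_real \<phi> * r" using zR by (intro allI)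
  show ?thesis
    by (rule exI[of _ z], rule exI[of _ zs], rule exI[of _ hi], intro conjI; fact)
qed

text \<open>Dini's theorem on the finitely many coordinates that matter.\<close>

lemma exists_level:
  assumes g: "supp_in g a b" and le: "\<And>x. x \<in> G \<Longrightarrow> norm (act g x) \<le> N x / 2"
  shows "\<exists>n0. \<forall>n\<ge>n0. \<forall>x\<in>c00. norm (act g x) \<le> p n x"
proof (rule ccontr)
  assume not: "\<not> ?thesis"
  have neg: "\<not> (\<forall>n\<ge>k. \<forall>x\<in>c00. norm (act g x) \<le> p n x)" for k
  proof
    assume "\<forall>n\<ge>k. \<forall>x\<in>c00. norm (act g x) \<le> p n x"
    then have "\<exists>n0. \<forall>n\<ge>n0. \<forall>x\<in>c00. norm (act g x) \<le> p n x" by (rule exI[of _ k])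
    with not show False by (rule notE)
  qed
  have "\<forall>k. \<exists>nx. fst nx \<ge> k \<and> snd nx \<in> c00 \<and> norm (act g (snd nx)) > p (fst nx) (snd nx)"
  proof
    fix k
    obtain n x where "n \<ge> k" "x \<in> c00" "\<not> norm (act g x) \<le> p n x" using neg[of k] by auto
    then show "\<exists>nx. fst nx \<ge> k \<and> snd nx \<in> c00 \<and> norm (act g (snd nx)) > p (fst nx) (snd nx)"
      by (intro exI[of _ "(n, x)"]) simp
  qed
  then obtain nx where nx0: "\<forall>k. fst (nx k) \<ge> k \<and> snd (nx k) \<in> c00 \<and> norm (act g (snd (nx k))) > p (fst (nx k)) (snd (nx k))"
    by (rule choice[THEN exE])
  define n x where "n k = fst (nx k)" and "x k = snd (nx k)" for k
  have nx: "n k \<ge> k" "x k \<in> c00" "norm (act g (x k)) > p (n k) (x k)" for k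
    using nx0 unfolding n_def x_def by simp_all
  \<comment> \<open>Counterexamples are cut to the window of \<open>g\<close> and normalised by the
    value of \<open>g\<close>. Their coordinatewise limit \<open>u'\<close> has norm at most 1 at
    every level and \<open>act g u' = 1\<close>, although \<open>g\<close> is bounded by half the
    norm.\<close>
  define u where "u k = scl (1 / act g (x k)) (proj {a..<b} (x k))" for k
  have pos: "norm (act g (x k)) > 0" for k using nx(3)[of k] goodD(6)[OF good_p nx(2), of "n k" k] by linarith
  have us: "supp_in (u k) a b" for k unfolding u_def by (rule supp_in_scl[OF supp_in_proj])
  have uc: "u k \<in> c00" for k using us supp_in_c00 by blast
  have ug: "act g (u k) = 1" for k using pos[of k] unfolding u_def act_scl act_proj[OF g, symmetric] by simp
  have up: "p (n k) (u k) \<le> 1" for k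
  proof -
    have "p (n k) (u k) = p (n k) (proj {a..<b} (x k)) / norm (act g (x k))"
      unfolding u_def goodD(4)[OF good_p c00_proj_fin] by (simp add: norm_divide)
    also have "\<dots> \<le> p (n k) (x k) / norm (act g (x k))"
      by (intro divide_right_mono goodD(5)[OF good_p nx(2)]) simp
    also have "\<dots> \<le> 1" using nx(3)[of k] pos[of k] by (simp add: divide_le_eq_1)
    finally show ?thesis .
  qed
  have "norm (u k i) \<le> 1" for k i using goodD(1)[OF good_p uc, of k i "n k"] up[of k] by linarith
  then obtain r u' where r: "strict_mono (r :: nat \<Rightarrow> nat)" "\<And>i. (\<lambda>k. u (r k) i) \<longlonglongrightarrow> u' i"
    using coordinatewise_subseq[of u "\<lambda>_. 1"] by blast
  have u's: "supp_in u' a b" unfolding supp_in_def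
  proof (intro allI impI)
    fix i assume ne: "u' i \<noteq> 0"
    show "a \<le> i \<and> i < b"
    proof (rule ccontr)
      assume "\<not> (a \<le> i \<and> i < b)"
      then have "u (r k) i = 0" for k using us[of "r k"] unfolding supp_in_def by blast
      then have "(\<lambda>k. u (r k) i) \<longlonglongrightarrow> 0" by simp
      then show False using LIMSEQ_unique[OF r(2)[of i]] ne by blast
    qed
  qed
  have u'c: "u' \<in> c00" using u's supp_in_c00 by blast
  have "p m u' \<le> 1" for m
  proof (rule LIMSEQ_le_const[where X = "\<lambda>k. 1 + (\<Sum>i=a..<b. norm (u' i - u (r k) i))"])
    have "(\<lambda>k. 1 + (\<Sum>i=a..<b. norm (u' i - u (r k) i))) \<longlonglongrightarrow> 1 + (\<Sum>i=a..<b. norm (u' i - u' i))"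
      by (intro tendsto_intros r(2))
    then show "(\<lambda>k. 1 + (\<Sum>i=a..<b. norm (u' i - u (r k) i))) \<longlonglongrightarrow> 1" by simp
    show "\<exists>K. \<forall>k\<ge>K. p m u' \<le> 1 + (\<Sum>i=a..<b. norm (u' i - u (r k) i))"
    proof (intro exI[of _ m] allI impI)
      fix k assume "m \<le> k"
      then have mk: "m \<le> n (r k)" using nx(1)[of "r k"] strict_mono_imp_increasing[OF r(1), of k] by linarith
      have "p m u' = p m (u (r k) + (u' - u (r k)))" by simp
      also have "\<dots> \<le> p m (u (r k)) + p m (u' - u (r k))" by (intro goodD(3)[OF good_p] uc c00_diff u'c)
      also have "p m (u (r k)) \<le> p (n (r k)) (u (r k))" by (rule p_mono[OF uc mk])
      also have "p (n (r k)) (u (r k)) \<le> 1" by (rule up)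
      also have "p m (u' - u (r k)) \<le> l1 (u' - u (r k))" by (intro goodD(2)[OF good_p] c00_diff uc u'c)
      also have "l1 (u' - u (r k)) = (\<Sum>i=a..<b. norm (u' i - u (r k) i))"
        by (subst l1_eq[OF supp_in_diff[OF u's us]]) (simp add: seq_apply)
      finally show "p m u' \<le> 1 + (\<Sum>i=a..<b. norm (u' i - u (r k) i))" by simp
    qed
  qed
  then have "u' \<in> G" "N u' \<le> 1" using N_c00_least[OF u'c] by blast+
  then have "norm (act g u') \<le> 1/2" using le[of u'] by linarith
  moreover have "(\<lambda>k. act g (u (r k))) \<longlonglongrightarrow> act g u'" unfolding act_eq[OF g] by (intro tendsto_intros r(2))
  then have "act g u' = 1" using LIMSEQ_unique[OF _ tendsto_const] unfolding ug by blast
  ultimately show False by simp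
qed

end


section \<open>Special sequences close to two given subspaces\<close>

context gm_field
begin

text \<open>The spreading order attained by a normalised sum of \<open>m\<close> terms.\<close>

definition lnn :: "nat \<Rightarrow> nat" where "lnn m = nat \<lfloor>ln (real m)\<rfloor>"

text \<open>Functionals whose weight in J exceeds \<open>k\<close> and differs from \<open>m\<close>
  hardly see \<open>x\<close>. The bound by \<open>1 / k^2\<close> allows for \<open>k\<close> such
  functionals acting on \<open>k\<close> such vectors.\<close>

definition tame :: "real \<Rightarrow> nat \<Rightarrow> nat \<Rightarrow> (nat \<Rightarrow> 'a) \<Rightarrow> bool" where
  "tame C k m x \<longleftrightarrow> (\<forall>lev r y a b. r \<ge> 1 \<longrightarrow> j r \<noteq> m \<longrightarrow> k < j r \<longrightarrow> y \<in> gm_A (p lev) (j r) \<longrightarrow>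
     norm (act y (proj {a..<b} x)) \<le> C / (real k)\<^sup>2)"

lemma lnn_le: "m \<ge> 1 \<Longrightarrow> real (lnn m) \<le> ln (real m)"
  unfolding lnn_def by (simp add: of_nat_floor)

text \<open>The scalar undoes the upper estimate, which is of order \<open>m / gm_f m\<close>;
  cutting into at most \<open>ln m\<close> pieces costs a factor 2, whence 48 = 2 * 3 * 8. Against a
  functional of weight \<open>w\<close>, small \<open>w\<close> gain from
  \<open>gm_f w >= k^2\<close>, large ones from \<open>gm_f w >= m^2\<close>; beyond
  \<open>n 0\<close>, where a transitional vector appears, the gain is that
  \<open>gm_f m / m\<close> is small.\<close>

lemma normalized_sum:
  assumes R: "ris D m n s z" and m: "m = j r" "r \<ge> 1" "even r"
    and x: "x = scl (of_real (gm_f m / real m)) (\<Sum>i=0..<m. z i)"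
  shows "spread (48 * D) (lnn m) x" "1 \<le> a \<Longrightarrow> a < r \<Longrightarrow> tame (48 * D) (j a) m x"
proof -
  have bm: "big m" using J_big[OF lac m(2)] m(1) by simp
  note bb = be_bounds[OF bm]
  have m2: "m \<ge> 2" "ln (real m) \<ge> 170" using big_ln[OF bm] by auto
  have fm: "gm_f m > 0" using gm_f_pos[of m] m2 by simp
  have D: "D \<ge> 1" by (rule risD(1)[OF R])
  note up = ris_upper_L[OF R m]
  let ?Z = "\<Sum>i=0..<m. z i"
  have zc: "z i \<in> c00" if "i < m" for i by (rule risD(8)[OF R that])
  have Zc: "?Z \<in> c00" by (rule c00_sum) (use zc in simp)
  have n0: "m \<le> n 0" using risD(7)[OF R] less_exp[of m] by linarith
  have nsc: "norm (of_real (gm_f m / real m) :: 'a) = gm_f m / real m" using fm by (simp add: norm_divide)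
  have mul: "(2 * (3 * D)) * real m powr (1 - be m) = 48 * D * (real m / gm_f m)"
    unfolding powr_one_minus_be[OF bm] by simp
  have small: "(\<Sum>l<M. w l ?Z) \<le> 48 * D * (real m / gm_f m)"
    if w: "wfam M t w" and M: "M \<ge> 1" "real M \<le> ln (real m)"
      and B: "\<And>l u. l < M \<Longrightarrow> u \<in> c00 \<Longrightarrow> w l u \<le> N u" for M t w
  proof -
    have "ln (real m) \<le> real m" using ln_le_minus_one[of "real m"] m2 by simp
    then have Mm: "M \<le> m" using M(2) by linarith
    have "(\<Sum>l<M. w l (\<Sum>i=0..<m. z i)) \<le> (3 * D) * ((3 * real M) powr (1 - (1 - be m)) * real (m - 0) powr (1 - be m))"
    proof (rule ris_split[OF R _ order_refl w M(1)])
      show "0 < m" using m2 by simp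
      show "M \<le> n 0" using Mm n0 by simp
      show "D \<le> 3 * D" using D by simp
      fix l c d :: nat assume l: "l < M" and cd: "c < d" "d \<le> m"
      have "w l (\<Sum>i=c..<d. z i) \<le> N (\<Sum>i=c..<d. z i)" by (intro B l c00_sum zc) (use cd in auto)
      also have "\<dots> \<le> 3 * D * real (d - c) powr (1 - be m)" by (rule upper_level_N[OF up cd zc])
      finally show "w l (\<Sum>i=c..<d. z i) \<le> 3 * D * real (d - c) powr (1 - be m)" .
    qed (use bb in auto)
    also have "\<dots> \<le> (3 * D) * (2 * real m powr (1 - be m))"
      using powr_be_le_2[OF bm M(2)] D by (intro mult_left_mono) (auto intro: mult_right_mono)
    also have "\<dots> = 48 * D * (real m / gm_f m)" using mul by simp
    finally show ?thesis .
  qed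
  have cancel: "gm_f m / real m * (48 * D * (real m / gm_f m)) = 48 * D" using fm m2 by simp
  show "spread (48 * D) (lnn m) x" unfolding spread_def
  proof (intro allI impI)
    fix M and t :: "nat \<Rightarrow> nat" assume M: "M \<le> lnn m" and t: "mono t"
    show "(\<Sum>l<M. N (proj {t l..<t (Suc l)} x)) \<le> 48 * D"
    proof (cases "M = 0")
      case True then show ?thesis using D by simp
    next
      case False
      have "(\<Sum>l<M. N (proj {t l..<t (Suc l)} x)) = gm_f m / real m * (\<Sum>l<M. N (proj {t l..<t (Suc l)} ?Z))"
        unfolding x proj_scl N_scl(2)[OF N_proj_G] nsc by (simp only: sum_distrib_left)
      also have "\<dots> \<le> gm_f m / real m * (48 * D * (real m / gm_f m))"
      proof (intro mult_left_mono small[OF wfam_N[OF t]])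
        show "real M \<le> ln (real m)" using M lnn_le[of m] m2 by linarith
      qed (use False N_proj c00_G fm in auto)
      finally show ?thesis unfolding cancel .
    qed
  qed
  show "tame (48 * D) (j a) m x" if a: "1 \<le> a" "a < r" unfolding tame_def
  proof (intro allI impI)
    fix lev r' y c d assume r': "1 \<le> r'" and ne: "j r' \<noteq> m" and kw: "j a < j r'" and y: "y \<in> gm_A (p lev) (j r')"
    define k w where "k = real (j a)" and "w = j r'"
    have k: "k \<ge> 2" using gm_lacunaryD(3)[OF lac a(1)] by (simp add: k_def)
    then have k2: "k\<^sup>2 > 0" by simp
    have w1: "w \<ge> 1" using gm_lacunaryD(3)[OF lac r'] by (simp add: w_def)
    have fw: "gm_f w > 0" by (rule gm_f_pos[OF w1])
    have km: "4 * k\<^sup>2 \<le> ln (real m)" using J_gap_le(1)[OF lac a] by (simp add: k_def m)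
    obtain t where t: "mono t" "\<forall>u\<in>c00. \<forall>c d. norm (act y (proj {c..<d} u)) \<le> (\<Sum>s<w. p lev (proj {t s..<t (Suc s)} u)) / gm_f w"
      using act_gm_A[OF y] unfolding w_def by blast
    have "norm (act y (proj {c..<d} x)) = gm_f m / real m * norm (act y (proj {c..<d} ?Z))"
      unfolding x proj_scl act_scl norm_mult nsc ..
    also have "\<dots> \<le> gm_f m / real m * ((\<Sum>s<w. p lev (proj {t s..<t (Suc s)} ?Z)) / gm_f w)"
      using t(2) Zc fm by (intro mult_left_mono) auto
    finally have le: "norm (act y (proj {c..<d} x)) \<le> gm_f m / real m * ((\<Sum>s<w. p lev (proj {t s..<t (Suc s)} ?Z)) / gm_f w)" .
    have goal: "norm (act y (proj {c..<d} x)) \<le> 48 * D / k\<^sup>2"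
    proof (cases "w < m")
      case True
      then have "r' < r" using J_less_iff[OF r' m(2)] by (simp add: w_def m)
      then have wl: "real w \<le> ln (real m)" using J_gap_le(2)[OF lac r'] by (simp add: w_def m)
      have "a < r'" using kw J_less_iff[OF a(1) r'] by simp
      then have kf: "k\<^sup>2 \<le> gm_f w" using J_gap_le(3)[OF lac a(1)] by (simp add: k_def w_def)
      have "(\<Sum>s<w. p lev (proj {t s..<t (Suc s)} ?Z)) \<le> 48 * D * (real m / gm_f m)"
      proof (rule small[OF wfam_p[OF t(1)] w1 wl])
        show "p lev (proj {t l..<t (Suc l)} u) \<le> N u" if "u \<in> c00" for l u
          using goodD(5)[OF good_p that] p_le_N'[OF that] order_trans by blast
      qed
      then have "gm_f m / real m * ((\<Sum>s<w. p lev (proj {t s..<t (Suc s)} ?Z)) / gm_f w) \<le> gm_f m / real m * (48 * D * (real m / gm_f m) / gm_f w)"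
        using fm fw by (intro mult_left_mono divide_right_mono) auto
      also have "\<dots> = 48 * D / gm_f w" using fm m2 by simp
      also have "\<dots> \<le> 48 * D / k\<^sup>2" using kf k2 D by (intro frac_le) auto
      finally show ?thesis using le by linarith
    next
      case False
      then have rr: "r < r'" using ne J_less_iff[OF r' m(2)] J_eq_iff[OF r' m(2)] by (cases "r < r'") (auto simp: w_def m)
      then have mw: "(real m)\<^sup>2 \<le> gm_f w" using J_gap_le(3)[OF lac m(2)] by (simp add: w_def m)
      have mw1: "real m \<le> gm_f w"
      proof -
        have "real m * 1 \<le> real m * real m" using m2 by (intro mult_left_mono) auto
        then show ?thesis using mw by (simp add: power2_eq_square)
      qed
      show ?thesis
      proof (cases "w \<le> n 0")
        case True
        have "(\<Sum>s<w. p lev (proj {t s..<t (Suc s)} ?Z)) \<le> D * real (m - 0)"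
          by (rule ris_mid[OF R order_refl wfam_p[OF t(1)] True])
        then have "gm_f m / real m * ((\<Sum>s<w. p lev (proj {t s..<t (Suc s)} ?Z)) / gm_f w) \<le> gm_f m / real m * (D * real m / gm_f w)"
          using fm fw by (intro mult_left_mono divide_right_mono) auto
        also have "\<dots> = D * gm_f m / gm_f w" using m2 by simp
        also have "\<dots> \<le> D * real m / (real m)\<^sup>2"
          using mw D m2 fw gm_f_le_self[of m] by (intro frac_le mult_left_mono) auto
        also have "\<dots> = D / real m" using m2 by (simp add: power2_eq_square)
        also have "\<dots> \<le> 48 * D / k\<^sup>2"
        proof (rule frac_le)
          have "ln (real m) \<le> real m" using ln_le_minus_one[of "real m"] m2 by simp
          then show "k\<^sup>2 \<le> real m" using km k2 by linarith
        qed (use D k2 in auto)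
        finally show ?thesis using le by linarith
      next
        case wn: False
        define q where "q u = (\<Sum>s<w. p lev (proj {t s..<t (Suc s)} u))" for u
        have "q ?Z \<le> 1 * sqrt (gm_f w) + gm_f w * D + D * real (m - 0)"
        proof (rule ris_large[OF R order_refl])
          show "q (u + v) \<le> q u + q v" if "u \<in> c00" "v \<in> c00" for u v
            unfolding q_def sum.distrib[symmetric] proj_add by (intro sum_mono goodD(3)[OF good_p] c00_proj_fin)
          show "q 0 = 0" unfolding q_def by (simp add: good_zero[OF good_p])
          show "q u \<le> 1 * l1 u" if "u \<in> c00" for u
          proof -
            have "q u \<le> (\<Sum>l<w. l1 (proj {t l..<t (Suc l)} u))"
              unfolding q_def by (intro sum_mono goodD(2)[OF good_p] c00_proj_fin)
            then show ?thesis using sum_l1_proj_le[OF t(1) that, of w] by simp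
          qed
          show "q (z i) \<le> gm_f w * D" if "i < m" for i
          proof -
            have "q (z i) \<le> gm_f w * p (Suc lev) (z i)" unfolding q_def p_Suc
              by (rule nxt_ge1[OF good_p risD(8)[OF R that] t(1)])
            also have "p (Suc lev) (z i) \<le> D" using p_le_N'[OF risD(8)[OF R that], of "Suc lev"] risD(9)[OF R that] by linarith
            finally show ?thesis using fw by (simp add: mult_left_mono)
          qed
          show "q (z i) \<le> D" if "i < m" "w \<le> n i" for i
            unfolding q_def by (rule wfam_spread[OF wfam_p[OF t(1)] that(2) risD(4)[OF R that(1)] risD(8)[OF R that(1)]])
        qed (use D fw in auto)
        also have "1 * sqrt (gm_f w) \<le> gm_f w * D"
        proof -
          have "sqrt (gm_f w) \<le> gm_f w" using gm_f_ge1[OF w1] real_le_lsqrt[of "gm_f w" "gm_f w"] by (simp add: power2_eq_square)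
          also have "\<dots> \<le> gm_f w * D" using fw D by simp
          finally show ?thesis by simp
        qed
        also have "D * real (m - 0) \<le> gm_f w * D" using mw1 D by (simp add: mult.commute mult_left_mono)
        finally have "q ?Z \<le> (3 * D) * gm_f w" by (simp add: algebra_simps)
        then have "q ?Z / gm_f w \<le> 3 * D" using fw by (simp add: pos_divide_le_eq)
        then have "gm_f m / real m * (q ?Z / gm_f w) \<le> gm_f m / real m * (3 * D)"
          using fm by (intro mult_left_mono) auto
        also have "\<dots> \<le> 16 / k\<^sup>2 * (3 * D)"
        proof (rule mult_right_mono)
          \<comment> \<open>\<open>gm_f m <= 3 * ln m\<close> and \<open>m >= (ln m)^2 / 2\<close>
            bound the quotient by \<open>6 / ln m\<close>, and \<open>ln m >= 4 * k^2\<close> by the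
            gap in J.\<close>
          let ?y = "ln (real m)"
          have "real m = exp ?y" using m2 by simp
          also have "exp ?y \<ge> 1 + ?y + ?y\<^sup>2 / 2" using m2 by (intro exp_lower_Taylor_quadratic) auto
          finally have "?y\<^sup>2 / 2 \<le> real m" using m2 by linarith
          then have "gm_f m / real m \<le> (3 * ?y) / (?y\<^sup>2 / 2)" using big_f_le(2)[OF bm] m2 fm by (intro frac_le) auto
          also have "\<dots> = 6 / ?y" using m2 by (simp add: power2_eq_square)
          also have "\<dots> \<le> 16 / k\<^sup>2" using km k2 by (intro frac_le) linarith+
          finally show "gm_f m / real m \<le> 16 / k\<^sup>2" .
        qed (use D in simp)
        finally show ?thesis using le unfolding q_def by simp
      qed
    qed
    then show "norm (act y (proj {c..<d} x)) \<le> 48 * D / (real (j a))\<^sup>2" by (simp add: k_def)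
  qed
qed

text \<open>The constant \<open>7680\<close> is \<open>48 * 160\<close>, where \<open>160\<close> comes from \<open>exists_pair\<close>.\<close>

lemma exists_block_pair:
  fixes p0 :: nat
  assumes Y: "csub Y" and A: "subsp Y A" and inf: "infdim_mod Y A" and eps: "\<epsilon> > 0" and eta: "\<eta> > 0"
    and m: "m = j r" "r \<ge> 1" "even r" and a: "1 \<le> a" "a < r"
  shows "\<exists>x y hi. p0 < hi \<and> supp_in x p0 hi \<and> supp_in y p0 hi \<and> act y x = 1 \<and> spread 7680 (lnn m) x \<and> tame 7680 (j a) m x \<and>
    (\<exists>a\<in>A. N (a - x) \<le> \<epsilon>) \<and> (\<forall>u\<in>G. norm (act y u) \<le> N u) \<and> (\<forall>v\<in>Y. norm (act y v) \<le> \<eta> * N v) \<and>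
    y \<in> gm_Q R \<and> (\<exists>n0. \<forall>n\<ge>n0. \<forall>c. 1/2 \<le> c \<and> c \<le> 1 \<longrightarrow> scl (of_real c) y \<in> gm_A (p n) m)"
proof -
  note YG = csubD(1)[OF Y] and AG = subspD(1)[OF A]
  have bm: "big m" using J_big[OF lac m(2)] m(1) by simp
  have m2: "m \<ge> 2" using big_ln[OF bm] by auto
  have fm: "gm_f m \<ge> 1" using gm_f_ge1[of m] m2 by simp
  have fm0: "gm_f m > 0" using fm by simp
  \<comment> \<open>Adding \<open>m\<close> bricks with the factor \<open>gm_f m / m\<close>
    multiplies the distance to \<open>A\<close> by \<open>gm_f m\<close>. On \<open>Y\<close>,
    \<open>m\<close> values are added and divided by \<open>gm_f m >= 1\<close>.\<close>
  define \<epsilon>' \<eta>' where "\<epsilon>' = \<epsilon> / gm_f m" and "\<eta>' = \<eta> / real m"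
  have e': "\<epsilon>' > 0" "\<eta>' > 0" using eps eta fm m2 by (auto simp: \<epsilon>'_def \<eta>'_def)
  define \<Phi> where "\<Phi> = (\<lambda>(n::nat) lo hi b. case b of (z, zs) \<Rightarrow> supp_in zs lo hi \<and> (\<exists>a\<in>A. N (a - z) \<le> \<epsilon>') \<and>
    (\<forall>x\<in>G. norm (act zs x) \<le> N x / 2) \<and> (\<forall>y\<in>Y. norm (act zs y) \<le> \<eta>' * N y) \<and> act zs z = (1::'a) \<and>
    (\<forall>i. \<exists>r\<in>R. zs i = of_real (gm_f m) * r))"
  have "\<exists>b q. lo < q \<and> supp_in (fst b) lo q \<and> spread 160 n (fst b) \<and> \<Phi> n lo q b" for n lo
  proof -
    from exists_pair[OF Y A inf e' fm0, of lo n] obtain z zs hi where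
     "lo < hi \<and> supp_in z lo hi \<and> supp_in zs lo hi \<and> spread 160 n z \<and> (\<exists>a\<in>A. N (a - z) \<le> \<epsilon>') \<and>
    (\<forall>x\<in>G. norm (act zs x) \<le> N x / 2) \<and> (\<forall>y\<in>Y. norm (act zs y) \<le> \<eta>' * N y) \<and> act zs z = 1 \<and>
    (\<forall>i. \<exists>r\<in>R. zs i = of_real (gm_f m) * r)" by (elim exE) simp
    then show ?thesis unfolding \<Phi>_def by (intro exI[of _ "(z, zs)"] exI[of _ hi]) simp
  qed
  from build_ris[of fst 160 \<Phi> m "2^m" p0, OF this] obtain n s b where
    R0: "ris 160 m n s (\<lambda>i. fst (b i))" and s0: "s 0 = p0" and b: "\<forall>i. \<Phi> (n i) (s i) (s (Suc i)) (b i)" by auto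
  define z zs where "z i = fst (b i)" and "zs i = snd (b i)" for i
  have R: "ris 160 m n s z" using R0 unfolding z_def .
  have be: "b i = (z i, zs i)" for i by (simp add: z_def zs_def)
  have b1: "supp_in (zs i) (s i) (s (Suc i))" "\<exists>a\<in>A. N (a - z i) \<le> \<epsilon>'" "\<And>x. x \<in> G \<Longrightarrow> norm (act (zs i) x) \<le> N x / 2"
    "\<And>y. y \<in> Y \<Longrightarrow> norm (act (zs i) y) \<le> \<eta>' * N y" "act (zs i) (z i) = 1" "\<And>k. \<exists>r\<in>R. zs i k = of_real (gm_f m) * r" for i
    using b[rule_format, of i] unfolding \<Phi>_def be by simp_all
  have ms: "strict_mono s" by (rule risD(2)[OF R])
  then have mono_s: "mono s" by (rule strict_mono_mono)
  have sle: "s i \<le> s i'" if "i \<le> i'" for i i' using mono_s that by (simp add: mono_def)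
  have zsup: "supp_in (z i) (s i) (s (Suc i))" if "i < m" for i by (rule risD(3)[OF R that])
  have zc: "z i \<in> c00" if "i < m" for i by (rule risD(8)[OF R that])
  have zsc: "zs i \<in> c00" for i using b1(1) supp_in_c00 by blast
  have zsne: "zs i \<noteq> 0" for i using b1(5)[of i] by auto
  have zsN: "norm (act (zs i) x) \<le> N (proj {s i..<s (Suc i)} x) / 2" for i x
    using b1(3)[OF N_proj_G, of i "s i" "s (Suc i)" x] act_proj[OF b1(1), of i x] by simp
  define x y where "x = scl (of_real (gm_f m / real m)) (\<Sum>i=0..<m. z i)" and "y = scl (1 / of_real (gm_f m)) (\<Sum>i<m. zs i)"
  have cross: "act (zs i) (z i') = (if i = i' then 1 else 0)" if "i' < m" for i i'
  proof (cases "i = i'")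
    case False
    have "Suc i \<le> i' \<or> Suc i' \<le> i" using False by auto
    then have "s (Suc i) \<le> s i' \<or> s (Suc i') \<le> s i" using sle by blast
    then have "proj {s i..<s (Suc i)} (z i') = 0" by (rule proj_disjoint[OF zsup[OF that]])
    then show ?thesis using act_proj[OF b1(1), of i "z i'"] False by simp
  qed (simp add: b1(5))
  have sup: "supp_in u p0 (s m)" if "supp_in u (s i) (s (Suc i))" "i < m" for u :: "nat \<Rightarrow> 'a" and i
    unfolding s0[symmetric] by (rule supp_in_mono[OF that(1)]) (use that(2) sle in auto)
  have hi: "p0 < s m" using strict_monoD[OF ms, of 0 m] m2 s0 by simp
  have xsup: "supp_in x p0 (s m)" unfolding x_def by (intro supp_in_scl supp_in_sum) (use sup[OF zsup] in auto)
  have ysup: "supp_in y p0 (s m)" unfolding y_def by (intro supp_in_scl supp_in_sum) (use sup[OF b1(1)] in auto)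
  have yact: "act y u = (\<Sum>i<m. act (zs i) u) / of_real (gm_f m)" for u
    unfolding y_def act_scl_left using act_sum_left[of "{..<m}" zs u] zsc by simp
  have yx: "act y x = 1"
  proof -
    have "act (zs i) (\<Sum>i'=0..<m. z i') = 1" if "i < m" for i
    proof -
      have "act (zs i) (\<Sum>i'=0..<m. z i') = (\<Sum>i'=0..<m. if i = i' then 1 else 0)"
        unfolding act_sum by (rule sum.cong) (auto simp: cross)
      then show ?thesis using that by simp
    qed
    then have "(\<Sum>i<m. act (zs i) x) = (\<Sum>i<m. of_real (gm_f m / real m))"
      unfolding x_def act_scl by (intro sum.cong) auto
    also have "\<dots> = of_real (gm_f m)" using m2 by simp
    finally show ?thesis unfolding yact using fm by simp
  qed
  have yN: "norm (act y u) \<le> N u / 2" if u: "u \<in> G" for u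
  proof -
    have "norm (act y u) = norm (\<Sum>i<m. act (zs i) u) / gm_f m" unfolding yact using fm by (simp add: norm_divide)
    also have "\<dots> \<le> ((\<Sum>i<m. N (proj {s i..<s (Suc i)} u)) / 2) / gm_f m"
      unfolding sum_divide_distrib[of _ _ 2] using zsN fm by (intro divide_right_mono sum_norm_le) auto
    also have "\<dots> \<le> (gm_f m * N u / 2) / gm_f m"
      using N_lower_estimate[OF u mono_s, of m] fm by (intro divide_right_mono) auto
    also have "\<dots> = N u / 2" using fm by simp
    finally show ?thesis .
  qed
  have yN1: "norm (act y u) \<le> N u" if "u \<in> G" for u using yN[OF that] N_nonneg[OF that] by linarith
  have yY: "norm (act y v) \<le> \<eta> * N v" if v: "v \<in> Y" for v
  proof -
    have nn: "N v \<ge> 0" by (rule N_nonneg[OF YG[OF v]])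
    have "norm (\<Sum>i<m. act (zs i) v) \<le> (\<Sum>i<m. \<eta>' * N v)" by (intro sum_norm_le b1(4) v)
    also have "\<dots> = \<eta> * N v" using m2 by (simp add: \<eta>'_def)
    finally have "norm (\<Sum>i<m. act (zs i) v) / gm_f m \<le> \<eta> * N v / 1"
      using fm eta nn by (intro frac_le) auto
    then show ?thesis unfolding yact using fm by (simp add: norm_divide)
  qed
  have near: "\<exists>a\<in>A. N (a - x) \<le> \<epsilon>"
  proof -
    obtain a' where a': "\<And>i. a' i \<in> A" "\<And>i. N (a' i - z i) \<le> \<epsilon>'" using b1(2) by metis
    have dG: "a' i - z i \<in> G" if "i < m" for i by (intro N_diff(1) AG a' c00_G zc that)
    have S: "(\<Sum>i=0..<m. a' i - z i) \<in> G" "N (\<Sum>i=0..<m. a' i - z i) \<le> (\<Sum>i=0..<m. N (a' i - z i))"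
      using N_sum[of "{0..<m}" "\<lambda>i. a' i - z i"] dG by auto
    let ?a = "scl (of_real (gm_f m / real m)) (\<Sum>i=0..<m. a' i)"
    have "?a - x = scl (of_real (gm_f m / real m)) (\<Sum>i=0..<m. a' i - z i)"
      unfolding x_def by (simp only: scl_diff[symmetric] sum_subtractf)
    then have "N (?a - x) = gm_f m / real m * N (\<Sum>i=0..<m. a' i - z i)"
      using N_scl(2)[OF S(1)] fm by (simp add: norm_divide)
    also have "\<dots> \<le> gm_f m / real m * (\<Sum>i=0..<m. \<epsilon>')"
      using S(2) sum_mono[of "{0..<m}" "\<lambda>i. N (a' i - z i)" "\<lambda>_. \<epsilon>'"] a'(2) fm by (intro mult_left_mono) (auto intro: order_trans)
    also have "\<dots> = \<epsilon>" using m2 fm by (simp add: \<epsilon>'_def)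
    finally show ?thesis
      by (intro bexI[of _ ?a] subspD(4)[OF A] subspD(6)[OF A csubD(2)[OF Y]] a'(1))
  qed
  have yQ: "y \<in> gm_Q R" unfolding gm_Q_def
  proof (intro CollectI conjI allI)
    show "y \<in> c00" using ysup supp_in_c00 by blast
    fix k
    \<comment> \<open>A coordinate is the value at a unit vector, whose norm is at most 1.\<close>
    show "norm (y k) \<le> 1"
    proof -
      define un where "un = (\<lambda>i. if i = k then 1 else 0 :: 'a)"
      have us: "supp_in un k (Suc k)" by (auto simp: supp_in_def un_def)
      have "act y un = (\<Sum>i=p0..<s m. if i = k then y k else 0)"
        unfolding act_eq[OF ysup] by (rule sum.cong) (auto simp: un_def)
      also have "\<dots> = y k" using supp_in_zero[OF ysup, of k] by (auto simp: not_le not_less)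
      finally have "act y un = y k" .
      moreover have "N un \<le> 1"
        using N_le_l1[OF supp_in_c00[OF us]] unfolding l1_eq[OF us] by (simp add: un_def)
      moreover have "norm (act y un) \<le> N un" by (rule yN1[OF c00_G[OF supp_in_c00[OF us]]])
      ultimately have "norm (act y un) \<le> 1" "act y un = y k" by simp_all
      then show ?thesis by simp
    qed
    show "y k \<in> R"
    proof (cases "\<exists>i<m. zs i k \<noteq> 0")
      case True
      then obtain i where i: "i < m" "zs i k \<noteq> 0" by blast
      have "zs i' k = 0" if "i' \<noteq> i" for i'
      proof (rule ccontr)
        assume "zs i' k \<noteq> 0"
        then have "s i' \<le> k" "k < s (Suc i')" "s i \<le> k" "k < s (Suc i)" using b1(1) i(2) unfolding supp_in_def by blast+
        moreover have "Suc i \<le> i' \<or> Suc i' \<le> i" using that by auto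
        ultimately show False using sle by (meson leD le_trans)
      qed
      then have "(\<Sum>i'<m. zs i' k) = (\<Sum>i'<m. if i' = i then zs i k else 0)" by (intro sum.cong) auto
      also have "\<dots> = zs i k" using i(1) by simp
      finally have "y k = zs i k / of_real (gm_f m)" by (simp add: y_def seq_apply sum_fun_apply)
      moreover obtain q where "q \<in> R" "zs i k = of_real (gm_f m) * q" using b1(6) by blast
      ultimately show ?thesis using fm by simp
    next
      case False
      then show ?thesis using R_0 by (simp add: y_def seq_apply sum_fun_apply)
    qed
  qed
  have lev: "\<exists>n0. \<forall>n\<ge>n0. \<forall>c. 1/2 \<le> c \<and> c \<le> 1 \<longrightarrow> scl (of_real c) y \<in> gm_A (p n) m"
  proof -
    \<comment> \<open>Each \<open>zs i\<close> is in the dual unit ball from some level on; the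
      maximum over \<open>i < m\<close> serves for all of them, and shrinking by
      \<open>c <= 1\<close> does no harm.\<close>
    obtain n0 where n0: "\<And>i n x. n \<ge> n0 i \<Longrightarrow> x \<in> c00 \<Longrightarrow> norm (act (zs i) x) \<le> p n x"
      using exists_level[OF b1(1) b1(3)] by metis
    have "scl (of_real c) y \<in> gm_A (p n) m" if n: "n \<ge> Max (n0 ` {..<m})" and c: "1/2 \<le> c" "c \<le> 1" for n c
    proof -
      have "scl (1 / of_real (gm_f m)) (\<Sum>i<m. scl (of_real c) (zs i)) \<in> gm_A (p n) m"
      proof (rule gm_A_I[OF good_p mono_s])
        fix i assume i: "i < m"
        show "supp_in (scl (of_real c) (zs i)) (s i) (s (Suc i))" by (rule supp_in_scl[OF b1(1)])
        show "scl (of_real c) (zs i) \<noteq> 0"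
        proof
          assume "scl (of_real c) (zs i) = 0"
          then have "scl (of_real (1 / c)) (scl (of_real c) (zs i)) = 0" by simp
          then show False using c zsne[of i] by (simp add: of_real_divide)
        qed
        fix x :: "nat \<Rightarrow> 'a" assume x: "x \<in> c00"
        have "n0 i \<le> n" using n i by (meson Max_ge finite_imageI finite_lessThan image_eqI lessThan_iff order_trans)
        then have "norm (act (zs i) x) \<le> p n x" using n0 x by blast
        moreover have "norm (act (scl (of_real c) (zs i)) x) = c * norm (act (zs i) x)" using c by (simp add: act_scl_left norm_mult)
        moreover have "c * norm (act (zs i) x) \<le> 1 * norm (act (zs i) x)" using c by (intro mult_right_mono) auto
        ultimately show "norm (act (scl (of_real c) (zs i)) x) \<le> p n x" by linarith
      qed
      moreover have "scl (1 / of_real (gm_f m)) (\<Sum>i<m. scl (of_real c) (zs i)) = scl (of_real c) y"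
        unfolding y_def by (simp add: scl_sum mult.commute)
      ultimately show ?thesis by simp
    qed
    then show ?thesis by blast
  qed
  note ns = normalized_sum[OF R m x_def]
  have tm: "tame 7680 (j a) m x" using ns(2)[OF a] by simp
  have sp: "spread 7680 (lnn m) x" using ns(1) by simp
  have yN2: "\<forall>u\<in>G. norm (act y u) \<le> N u" using yN1 by (intro ballI)
  have yY2: "\<forall>v\<in>Y. norm (act y v) \<le> \<eta> * N v" using yY by (intro ballI)
  show ?thesis
    by (rule exI[of _ x], rule exI[of _ y], rule exI[of _ "s m"], intro conjI; fact)
qed

text \<open>The constant 15360 is twice 7680, because \<open>x\<close> is divided by the rational
  factor from [1/2, 1] that \<open>y\<close> receives.\<close>

definition block_ok :: "(nat \<Rightarrow> 'a) set \<Rightarrow> (nat \<Rightarrow> 'a) set \<Rightarrow> real \<Rightarrow> real \<Rightarrow> nat \<Rightarrow> nat \<Rightarrow> (nat \<Rightarrow> 'a) \<Rightarrow> (nat \<Rightarrow> 'a) \<Rightarrow> bool" where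
  "block_ok Y A \<epsilon> \<eta> k m x y \<longleftrightarrow> act y x = 1 \<and> spread 15360 (lnn m) x \<and> tame 15360 k m x \<and>
    (\<exists>a\<in>A. N (a - x) \<le> \<epsilon>) \<and> (\<forall>u\<in>G. norm (act y u) \<le> N u) \<and> (\<forall>v\<in>Y. norm (act y v) \<le> \<eta> * N v) \<and>
    y \<in> gm_Q R \<and> (\<exists>n0. \<forall>n\<ge>n0. y \<in> gm_A (p n) m)"

text \<open>Multiplying \<open>y\<close> by one of infinitely many rational scalars in \<open>[1/2, 1]\<close> makes its code as large
  as we please, because the coding is injective.\<close>

lemma next_block:
  fixes lo :: nat
  assumes Y: "csub Y" and A: "subsp Y A" and inf: "infdim_mod Y A" and eps: "\<epsilon> > 0" and eta: "\<eta> > 0"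
    and m: "m = j r" "r \<ge> 1" "even r" and a: "1 \<le> a" "a < r"
    and ys: "successive ys" "set ys \<subseteq> gm_Q R" "\<And>y. y \<in> set ys \<Longrightarrow> supp_in y 0 lo"
  shows "\<exists>x y hi. lo < hi \<and> supp_in x lo hi \<and> supp_in y lo hi \<and> block_ok Y A \<epsilon> \<eta> (j a) m x y \<and>
    successive (ys @ [y]) \<and> S + l1 x \<le> sqrt (gm_f (lnn (\<sigma> (ys @ [y])))) \<and> m < \<sigma> (ys @ [y])"
proof -
  from exists_block_pair[OF Y A inf half_gt_zero[OF eps] eta m a, of lo] obtain x0 y0 hi where
    xy: "lo < hi" "supp_in x0 lo hi" "supp_in y0 lo hi" "act y0 x0 = 1" "spread 7680 (lnn m) x0" "tame 7680 (j a) m x0"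
    "\<exists>a\<in>A. N (a - x0) \<le> \<epsilon> / 2" "\<forall>u\<in>G. norm (act y0 u) \<le> N u" "\<forall>v\<in>Y. norm (act y0 v) \<le> \<eta> * N v" "y0 \<in> gm_Q R"
    "\<exists>n0. \<forall>n\<ge>n0. \<forall>c. 1/2 \<le> c \<and> c \<le> 1 \<longrightarrow> scl (of_real c) y0 \<in> gm_A (p n) m" by (elim exE) (elim conjE, rule that)
  have y0: "y0 \<noteq> 0" using xy(4) by auto
  have "filterlim (\<lambda>w. sqrt (gm_f (lnn w))) at_top sequentially"
  proof -
    have "filterlim (\<lambda>w::nat. nat \<lfloor>ln (real w)\<rfloor>) at_top sequentially" by real_asymp
    then have "filterlim lnn at_top sequentially" by (simp add: lnn_def[abs_def])
    from filterlim_compose[OF filterlim_compose[OF sqrt_at_top gm_f_at_top] this] show ?thesis .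
  qed
  \<comment> \<open>The code is chosen before \<open>x0\<close> is rescaled by a factor of at most
    2, hence \<open>2 * l1 x0\<close>.\<close>
  then have "eventually (\<lambda>w. S + 2 * l1 x0 \<le> sqrt (gm_f (lnn w))) sequentially" by (simp add: filterlim_at_top)
  then obtain T where T: "\<And>w. w \<ge> T \<Longrightarrow> S + 2 * l1 x0 \<le> sqrt (gm_f (lnn w))" by (auto simp: eventually_sequentially)
  define c where "c q = 1/2 + 1 / (real q + 2)" for q
  have c: "1/2 \<le> c q" "c q \<le> 1" "c q > 0" "c q \<in> \<rat>" for q
  proof -
    show "1/2 \<le> c q" "c q \<le> 1" "c q > 0" unfolding c_def by (auto simp: field_simps add_pos_pos)
    show "c q \<in> \<rat>" unfolding c_def by (intro Rats_add Rats_divide) auto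
  qed
  define y where "y q = scl (of_real (c q)) y0" for q
  have yQ: "y q \<in> gm_Q R" for q
  proof -
    have y0Q: "y0 \<in> c00" "\<And>i. y0 i \<in> R" "\<And>i. norm (y0 i) \<le> 1" using xy(10) by (auto simp: gm_Q_def)
    have "norm (y q i) \<le> 1" for i
    proof -
      have "norm (y q i) = c q * norm (y0 i)" using c(3)[of q] by (simp add: y_def seq_apply norm_mult)
      also have "\<dots> \<le> 1 * 1" using c(2,3)[of q] y0Q(3)[of i] by (intro mult_mono) auto
      finally show ?thesis by simp
    qed
    moreover have "y q i \<in> R" for i unfolding y_def scl_apply by (intro R_mult R_rat c(4) y0Q(2))
    moreover have "y q \<in> c00" unfolding y_def using y0Q(1) by (rule c00_scl)
    ultimately show ?thesis by (simp add: gm_Q_def)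
  qed
  have ysup: "supp_in (y q) lo hi" for q unfolding y_def by (rule supp_in_scl[OF xy(3)])
  have yne: "y q \<noteq> 0" for q
  proof
    assume "y q = 0"
    then have "scl (of_real (1 / c q)) (y q) = 0" by simp
    then show False using y0 c(3)[of q] by (simp add: y_def of_real_divide)
  qed
  have suc: "successive (ys @ [y q])" for q by (rule successive_snoc[OF ys(1,3) ysup yne])
  have setQ: "set (ys @ [y q]) \<subseteq> gm_Q R" for q using ys(2) yQ by simp
  have "inj (\<lambda>q. \<sigma> (ys @ [y q]))"
  proof (rule injI)
    fix q q' assume "\<sigma> (ys @ [y q]) = \<sigma> (ys @ [y q'])"
    then have "ys @ [y q] = ys @ [y q']" by (intro sigma_inj suc setQ) auto
    then have "y q = y q'" by simp
    moreover obtain i where "y0 i \<noteq> 0" using y0 by (auto simp: fun_eq_iff seq_apply)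
    moreover have "of_real (c q) * y0 i = of_real (c q') * y0 i"
      using fun_cong[OF \<open>y q = y q'\<close>, of i] unfolding y_def scl_apply .
    ultimately have "c q = c q'" by simp
    then show "q = q'" by (simp add: c_def)
  qed
  then have "infinite (range (\<lambda>q. \<sigma> (ys @ [y q])))" by (rule range_inj_infinite)
  then obtain w where "w > max T m" "w \<in> range (\<lambda>q. \<sigma> (ys @ [y q]))" unfolding infinite_nat_iff_unbounded by blast
  then obtain q where q: "\<sigma> (ys @ [y q]) > T" "\<sigma> (ys @ [y q]) > m" by auto
  \<comment> \<open>Compensates the factor in \<open>y q\<close>, so that \<open>y q\<close> still
    takes the value 1 at \<open>x\<close>.\<close>
  define x where "x = scl (of_real (1 / c q)) x0"
  have ic: "1 / c q \<le> 2" "1 / c q > 0" using c(1,3)[of q] by (auto simp: field_simps)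
  have nic: "norm (of_real (1 / c q) :: 'a) = 1 / c q" using ic by (simp add: norm_divide)
  have l1x: "l1 x \<le> 2 * l1 x0" unfolding x_def l1_scl nic using ic by (intro mult_right_mono) auto
  have "block_ok Y A \<epsilon> \<eta> (j a) m x (y q)" unfolding block_ok_def
  proof (intro conjI ballI)
    show "act (y q) x = 1" unfolding y_def x_def act_scl act_scl_left xy(4) using c(3)[of q] by (simp add: of_real_divide)
    show "spread 15360 (lnn m) x" unfolding spread_def
    proof (intro allI impI)
      fix M and t :: "nat \<Rightarrow> nat" assume M: "M \<le> lnn m" "mono t"
      have "(\<Sum>l<M. N (proj {t l..<t (Suc l)} x)) = 1 / c q * (\<Sum>l<M. N (proj {t l..<t (Suc l)} x0))"
        unfolding x_def proj_scl N_scl(2)[OF N_proj_G] nic by (simp only: sum_distrib_left)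
      also have "\<dots> \<le> 2 * 7680"
        using xy(5) M ic N_nonneg[OF N_proj_G] unfolding spread_def by (intro mult_mono sum_nonneg) auto
      finally show "(\<Sum>l<M. N (proj {t l..<t (Suc l)} x)) \<le> 15360" by simp
    qed
    show "tame 15360 (j a) m x" unfolding tame_def
    proof (intro allI impI)
      fix lev r' y' c' d assume h: "1 \<le> r'" "j r' \<noteq> m" "j a < j r'" "y' \<in> gm_A (p lev) (j r')"
      have "norm (act y' (proj {c'..<d} x)) = 1 / c q * norm (act y' (proj {c'..<d} x0))"
        unfolding x_def proj_scl act_scl norm_mult nic ..
      also have "\<dots> \<le> 2 * (7680 / (real (j a))\<^sup>2)"
        using xy(6) h ic unfolding tame_def by (intro mult_mono) auto
      finally show "norm (act y' (proj {c'..<d} x)) \<le> 15360 / (real (j a))\<^sup>2" by simp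
    qed
    obtain a' where a': "a' \<in> A" "N (a' - x0) \<le> \<epsilon> / 2" using xy(7) by blast
    have dG: "a' - x0 \<in> G" by (intro N_diff(1) subspD(1)[OF A a'(1)] c00_G supp_in_c00[OF xy(2)])
    show "\<exists>a\<in>A. N (a - x) \<le> \<epsilon>"
    proof (rule bexI[of _ "scl (of_real (1 / c q)) a'"])
      have "N (scl (of_real (1 / c q)) a' - x) = 1 / c q * N (a' - x0)"
        unfolding x_def scl_diff[symmetric] N_scl(2)[OF dG] nic ..
      also have "\<dots> \<le> 2 * (\<epsilon> / 2)" using a'(2) ic N_nonneg[OF dG] by (intro mult_mono) auto
      finally show "N (scl (of_real (1 / c q)) a' - x) \<le> \<epsilon>" by simp
    qed (rule subspD(4)[OF A a'(1)])
    have yact: "norm (act (y q) u) \<le> norm (act y0 u)" for u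
    proof -
      have "norm (act (y q) u) = c q * norm (act y0 u)" using c(3)[of q] by (simp add: y_def act_scl_left norm_mult)
      also have "\<dots> \<le> 1 * norm (act y0 u)" using c(2)[of q] by (intro mult_right_mono) auto
      finally show ?thesis by simp
    qed
    show "norm (act (y q) u) \<le> N u" if "u \<in> G" for u using order_trans[OF yact] xy(8) that by blast
    show "norm (act (y q) v) \<le> \<eta> * N v" if "v \<in> Y" for v using order_trans[OF yact] xy(9) that by blast
    show "y q \<in> gm_Q R" by (rule yQ)
    obtain n0 where n0: "\<forall>n\<ge>n0. \<forall>c. 1/2 \<le> c \<and> c \<le> 1 \<longrightarrow> scl (of_real c) y0 \<in> gm_A (p n) m" using xy(11) by (elim exE)
    show "\<exists>n0. \<forall>n\<ge>n0. y q \<in> gm_A (p n) m" unfolding y_def using n0 c(1,2)[of q] by (intro exI[of _ n0]) simp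
  qed
  moreover have "supp_in x lo hi" unfolding x_def by (rule supp_in_scl[OF xy(2)])
  moreover have "S + l1 x \<le> sqrt (gm_f (lnn (\<sigma> (ys @ [y q]))))" using T[of "\<sigma> (ys @ [y q])"] q(1) l1x by linarith
  ultimately show ?thesis using xy(1) ysup[of q] suc[of q] q(2)
    by (intro exI[of _ x] exI[of _ "y q"] exI[of _ hi] conjI)
qed

text \<open>The recursion ties vectors and codes together: the weight of the next block is the code
  of all functionals so far and is thus known before the block is built. The l1 norms of the earlier
  vectors are already dominated at this weight, which makes the vectors rapidly increasing.\<close>

lemma special_sequence_near:
  fixes ae :: nat
  assumes Y: "csub Y" and A: "subsp Y A" "infdim_mod Y A" and B: "subsp Y B" "infdim_mod Y B"
    and eps: "\<epsilon> > 0" and eta: "\<eta> > 0" and k: "k = j ae" "1 \<le> ae" "odd ae"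
  shows "\<exists>x y s m. strict_mono s \<and> (\<forall>i. supp_in (x i) (s i) (s (Suc i)) \<and> supp_in (y i) (s i) (s (Suc i)) \<and>
     block_ok Y (if even i then A else B) \<epsilon> \<eta> k (m i) (x i) (y i) \<and>
     (\<Sum>i'\<le>i. l1 (x i')) \<le> sqrt (gm_f (lnn (m (Suc i)))) \<and> m i < m (Suc i) \<and>
     m (Suc i) = \<sigma> (map y [0..<Suc i]) \<and> successive (map y [0..<Suc i])) \<and> m 0 = j (2 * k)"
proof -
  define AB where "AB i = (if even i then A else B)" for i :: nat
  have AB: "subsp Y (AB i)" "infdim_mod Y (AB i)" for i using A B by (auto simp: AB_def)
  have k2: "k \<ge> 2" using gm_lacunaryD(3)[OF lac k(2)] k(1) by simp
  have ge: "r \<le> j r" if "r \<ge> 1" for r using that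
  proof (induction r rule: dec_induct)
    case base then show ?case using gm_lacunaryD(3)[OF lac, of 1] by simp
  next
    case (step r) then show ?case using gm_lacunaryD(1)[OF lac, of r "Suc r"] by simp
  qed
  \<comment> \<open>Ensures that the initial weight \<open>j (2 * k)\<close> lies beyond
    \<open>k = j ae\<close>.\<close>
  have aek: "ae \<le> k" using ge[OF k(2)] k(1) by simp
  define P where "P i st \<longleftrightarrow> (case st of (ys, x, lo, hi, m, S) \<Rightarrow> length ys = Suc i \<and> successive ys \<and> set ys \<subseteq> gm_Q R \<and>
     (\<forall>y\<in>set ys. supp_in y 0 hi) \<and> lo < hi \<and> supp_in x lo hi \<and> supp_in (last ys) lo hi \<and>
     block_ok Y (AB i) \<epsilon> \<eta> k m x (last ys) \<and> S \<le> sqrt (gm_f (lnn (\<sigma> ys))) \<and> m < \<sigma> ys \<and>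
     (\<exists>r. m = j r \<and> r \<ge> 1 \<and> even r \<and> ae < r) \<and> (i = 0 \<longrightarrow> m = j (2 * k) \<and> S = l1 x))"
     for i :: nat and st :: "(nat \<Rightarrow> 'a) list \<times> (nat \<Rightarrow> 'a) \<times> nat \<times> nat \<times> nat \<times> real"
  define Q where "Q st st' \<longleftrightarrow> (case st of (ys, x, lo, hi, m, S) \<Rightarrow> case st' of (ys', x', lo', hi', m', S') \<Rightarrow>
     butlast ys' = ys \<and> lo' = hi \<and> m' = \<sigma> ys \<and> S' = S + l1 x')"
     for st st' :: "(nat \<Rightarrow> 'a) list \<times> (nat \<Rightarrow> 'a) \<times> nat \<times> nat \<times> nat \<times> real"
  have "\<exists>st. P 0 st"
  proof -
    have r: "(1::nat) \<le> 2 * k" "even (2 * k)" "ae < 2 * k" using k2 aek by auto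
    have e: "successive ([] :: (nat \<Rightarrow> 'a) list)" "set ([] :: (nat \<Rightarrow> 'a) list) \<subseteq> gm_Q R" by (simp_all add: successive_def)
    have "\<exists>x y hi. 0 < hi \<and> supp_in x 0 hi \<and> supp_in y 0 hi \<and> block_ok Y (AB 0) \<epsilon> \<eta> (j ae) (j (2 * k)) x y \<and>
      successive ([] @ [y]) \<and> 0 + l1 x \<le> sqrt (gm_f (lnn (\<sigma> ([] @ [y])))) \<and> j (2 * k) < \<sigma> ([] @ [y])"
      by (rule next_block[OF Y AB[of 0] eps eta refl r(1,2) k(2) r(3) e]) simp
    then obtain x y hi where
      C: "0 < hi \<and> supp_in x 0 hi \<and> supp_in y 0 hi \<and> block_ok Y (AB 0) \<epsilon> \<eta> (j ae) (j (2 * k)) x y \<and>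
      successive ([] @ [y]) \<and> 0 + l1 x \<le> sqrt (gm_f (lnn (\<sigma> ([] @ [y])))) \<and> j (2 * k) < \<sigma> ([] @ [y])"
      by (elim exE)
    have "y \<in> gm_Q R" using C unfolding block_ok_def by blast
    then have "P 0 ([y], x, 0, hi, j (2 * k), l1 x)" using C r unfolding P_def k(1)[symmetric] by auto
    then show ?thesis by blast
  qed
  moreover have "\<exists>st'. P (Suc i) st' \<and> Q st st'" if "P i st" for i st
  proof -
    obtain ys x lo hi m S where st: "st = (ys, x, lo, hi, m, S)" by (cases st)
    have p: "length ys = Suc i" "successive ys" "set ys \<subseteq> gm_Q R" "\<And>y. y \<in> set ys \<Longrightarrow> supp_in y 0 hi" "m < \<sigma> ys"
      "\<exists>r. m = j r \<and> r \<ge> 1 \<and> even r \<and> ae < r" using that unfolding st P_def by simp_all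
    have ne: "ys \<noteq> []" using p(1) by auto
    obtain r where r: "m = j r" "r \<ge> 1" "ae < r" using p(6) by blast
    obtain r' where r': "r' \<ge> 1" "even r'" "\<sigma> ys = j r'" using sigma_L[OF ne p(2,3)] by blast
    have "r < r'" using p(5) J_less_iff[OF r(2) r'(1)] r(1) r'(3) by simp
    then have ar: "ae < r'" using r(3) by simp
    have "\<exists>x' y' hi'. hi < hi' \<and> supp_in x' hi hi' \<and> supp_in y' hi hi' \<and> block_ok Y (AB (Suc i)) \<epsilon> \<eta> (j ae) (\<sigma> ys) x' y' \<and>
      successive (ys @ [y']) \<and> S + l1 x' \<le> sqrt (gm_f (lnn (\<sigma> (ys @ [y'])))) \<and> \<sigma> ys < \<sigma> (ys @ [y'])"
      by (rule next_block[OF Y AB[of "Suc i"] eps eta r'(3,1,2) k(2) ar p(2,3)]) (rule p(4))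
    then obtain x' y' hi' where
      C: "hi < hi' \<and> supp_in x' hi hi' \<and> supp_in y' hi hi' \<and> block_ok Y (AB (Suc i)) \<epsilon> \<eta> (j ae) (\<sigma> ys) x' y' \<and>
      successive (ys @ [y']) \<and> S + l1 x' \<le> sqrt (gm_f (lnn (\<sigma> (ys @ [y'])))) \<and> \<sigma> ys < \<sigma> (ys @ [y'])"
      by (elim exE)
    have yQ: "y' \<in> gm_Q R" using C unfolding block_ok_def by blast
    have sup: "supp_in y 0 hi'" if "y \<in> set (ys @ [y'])" for y
    proof (cases "y = y'")
      case True then show ?thesis using C supp_in_mono[of y' hi hi' 0 hi'] by simp
    next
      case False
      then have "supp_in y 0 hi" using p(4) that by simp
      then show ?thesis using C supp_in_mono[of y 0 hi 0 hi'] by simp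
    qed
    have "\<exists>r. \<sigma> ys = j r \<and> r \<ge> 1 \<and> even r \<and> ae < r" using r' ar by blast
    then have "P (Suc i) (ys @ [y'], x', hi, hi', \<sigma> ys, S + l1 x')"
      using C p(1,3) yQ sup unfolding P_def k(1)[symmetric] by simp
    moreover have "Q st (ys @ [y'], x', hi, hi', \<sigma> ys, S + l1 x')" unfolding Q_def st by simp
    ultimately show ?thesis by blast
  qed
  ultimately obtain F where F: "\<And>i. P i (F i)" "\<And>i. Q (F i) (F (Suc i))"
    using dependent_nat_choice[of P "\<lambda>_. Q"] by blast
  define ys x lo hi m S where "ys i = fst (F i)" and "x i = fst (snd (F i))" and "lo i = fst (snd (snd (F i)))"
    and "hi i = fst (snd (snd (snd (F i))))" and "m i = fst (snd (snd (snd (snd (F i)))))" and "S i = snd (snd (snd (snd (snd (F i)))))" for i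
  have Fe: "F i = (ys i, x i, lo i, hi i, m i, S i)" for i by (simp add: ys_def x_def lo_def hi_def m_def S_def)
  define y where "y i = last (ys i)" for i
  have p: "length (ys i) = Suc i" "successive (ys i)" "lo i < hi i" "supp_in (x i) (lo i) (hi i)" "supp_in (y i) (lo i) (hi i)"
    "block_ok Y (AB i) \<epsilon> \<eta> k (m i) (x i) (y i)" "S i \<le> sqrt (gm_f (lnn (\<sigma> (ys i))))" "m i < \<sigma> (ys i)" for i
    using F(1)[of i] unfolding Fe P_def y_def by simp_all
  have p0: "m 0 = j (2 * k)" "S 0 = l1 (x 0)" using F(1)[of 0] unfolding Fe P_def by simp_all
  have q: "butlast (ys (Suc i)) = ys i" "lo (Suc i) = hi i" "m (Suc i) = \<sigma> (ys i)" "S (Suc i) = S i + l1 (x (Suc i))" for i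
    using F(2)[of i] unfolding Fe Q_def by simp_all
  have yse: "ys i = map y [0..<Suc i]" for i
  proof (induction i)
    case 0
    have "ys 0 = butlast (ys 0) @ [last (ys 0)]" using p(1)[of 0] by (intro append_butlast_last_id[symmetric]) auto
    moreover have "butlast (ys 0) = []" using p(1)[of 0] by (cases "ys 0") auto
    ultimately show ?case by (simp add: y_def)
  next
    case (Suc i)
    have "ys (Suc i) = ys i @ [y (Suc i)]" unfolding q(1)[of i, symmetric] y_def
      by (rule append_butlast_last_id[symmetric]) (use p(1)[of "Suc i"] in auto)
    then show ?case using Suc by simp
  qed
  have Se: "S i = (\<Sum>i'\<le>i. l1 (x i'))" for i by (induction i) (simp_all add: p0 q(4))
  have mono: "strict_mono lo" using p(3) q(2) by (simp add: strict_mono_Suc_iff)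
  have blocks: "supp_in (x i) (lo i) (lo (Suc i)) \<and> supp_in (y i) (lo i) (lo (Suc i)) \<and>
     block_ok Y (if even i then A else B) \<epsilon> \<eta> k (m i) (x i) (y i) \<and>
     (\<Sum>i'\<le>i. l1 (x i')) \<le> sqrt (gm_f (lnn (m (Suc i)))) \<and> m i < m (Suc i) \<and>
     m (Suc i) = \<sigma> (map y [0..<Suc i]) \<and> successive (map y [0..<Suc i])" for i
    unfolding q(2,3) yse[symmetric] Se[symmetric] AB_def[symmetric] using p[of i] by simp
  show ?thesis
    by (rule exI[of _ x], rule exI[of _ y], rule exI[of _ lo], rule exI[of _ m]) (rule conjI[OF mono conjI[OF allI[OF blocks] p0(1)]])
qed

text \<open>The functionals of another special sequence agree with \<open>y\<close> up to some index \<open>t\<close>; on the common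
  part the signs alternate, and beyond \<open>t\<close> all but at most one of the weights differ from those of \<open>y\<close>.\<close>

lemma alternating_special:
  fixes ae :: nat
  assumes k: "k = j ae" "1 \<le> ae" "odd ae"
    and R: "ris 15360 k n s (\<lambda>i. scl ((- 1) ^ i) (x i))" and P: "upper_level 46080 k (\<lambda>i. scl ((- 1) ^ i) (x i)) lev"
    and ysup: "\<And>i. supp_in (y i) (s i) (s (Suc i))" and yQ: "\<And>i. y i \<in> gm_Q R"
    and suc: "\<And>i. successive (map y [0..<Suc i])"
    and yx: "\<And>i. act (y i) (x i) = 1" and yN: "\<And>i u. u \<in> G \<Longrightarrow> norm (act (y i) u) \<le> N u"
    and tm: "\<And>i. tame 15360 k (m i) (x i)" and m0: "m 0 = j (2 * k)" and mm: "\<And>i. m (Suc i) = \<sigma> (map y [0..<Suc i])"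
    and z: "special_sequence R j \<sigma> (p lev) k zs" and I: "i0 < i1" "i1 \<le> k"
  shows "norm (act (spf k zs) (proj {a..<b} (\<Sum>i=i0..<i1. scl ((- 1) ^ i) (x i)))) \<le> 46080 * real (i1 - i0) powr (1 - be k)"
proof -
  let ?x = "\<lambda>i. scl ((- 1) ^ i) (x i)"
  let ?X = "proj {a..<b} (\<Sum>i=i0..<i1. scl ((- 1) ^ i) (x i))"
  let ?Bd = "46080 * real (i1 - i0) powr (1 - be k)"
  have bk: "big k" using J_big[OF lac k(2)] k(1) by simp
  have k2: "k \<ge> 2" using big_ln[OF bk] by simp
  have one: "real (i1 - i0) powr (1 - be k) \<ge> 1" using I be_bounds[OF bk] by (intro powr_ge_1) auto
  then have Bd: "?Bd \<ge> 46080" by simp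
  have f256: "gm_f k > 256" using bk by (simp add: big_def)
  then have s16: "sqrt (gm_f k) \<ge> 16" by (intro real_le_rsqrt) simp
  have xc: "?x i \<in> c00" and xN: "N (?x i) \<le> 15360" and xsup: "supp_in (?x i) (s i) (s (Suc i))" if "i < k" for i
    using risD(8,9,3)[OF R that] by auto
  have ms: "strict_mono s" by (rule risD(2)[OF R])
  have sle: "s i \<le> s i'" if "i \<le> i'" for i i' using ms that by (simp add: strict_mono_less_eq)
  have zl: "length zs = k" "successive zs" "set zs \<subseteq> gm_Q R" using z by (auto simp: special_sequence_def)
  define w where "w l = wt k zs l" for l
  have wA: "zs ! l \<in> gm_A (p lev) (w l)" "\<exists>r\<ge>1. even r \<and> w l = j r" if "l < k" for l
    unfolding w_def using special_member[OF z that] by auto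
  have w1: "w l \<ge> 1" if "l < k" for l using wt_pos[OF z that] by (simp add: w_def)
  have any: "norm (act (zs ! l) ?X) \<le> ?Bd" if l: "l < k" for l
  proof -
    obtain t where t: "mono t" "\<forall>u\<in>c00. \<forall>a b. norm (act (zs ! l) (proj {a..<b} u)) \<le> (\<Sum>s<w l. p lev (proj {t s..<t (Suc s)} u)) / gm_f (w l)"
      using act_gm_A[OF wA(1)[OF l]] by blast
    have Xc: "(\<Sum>i=i0..<i1. ?x i) \<in> c00" using xc I by (intro c00_sum) auto
    have "(\<Sum>s<w l. p lev (proj {t s..<t (Suc s)} (\<Sum>i=i0..<i1. ?x i))) \<le> gm_f (w l) * ?Bd"
      by (rule ris_fop[OF R bk _ P I t(1) w1[OF l]]) simp
    then have "(\<Sum>s<w l. p lev (proj {t s..<t (Suc s)} (\<Sum>i=i0..<i1. ?x i))) / gm_f (w l) \<le> ?Bd"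
      using gm_f_pos[OF w1[OF l]] by (simp only: pos_divide_le_eq mult.commute)
    then show ?thesis using t(2)[rule_format, OF Xc, of a b] by linarith
  qed
  define t where "t = (LEAST t. t = k \<or> zs ! t \<noteq> y t)"
  have tk: "t \<le> k" unfolding t_def by (rule Least_le) simp
  have t: "t = k \<or> zs ! t \<noteq> y t" unfolding t_def by (rule LeastI[of _ k]) simp
  have teq: "zs ! l = y l" if "l < t" for l using not_less_Least[of l "\<lambda>t. t = k \<or> zs ! t \<noteq> y t"] that unfolding t_def by blast
  have cross: "act (y l) (proj {a..<b} (?x i)) = 0" if "i \<noteq> l" "i < k" for i l
  proof -
    have "Suc i \<le> l \<or> Suc l \<le> i" using that by auto
    then have "s (Suc i) \<le> s l \<or> s (Suc l) \<le> s i" using sle by blast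
    then have "proj {s l..<s (Suc l)} (proj {a..<b} (?x i)) = 0"
      using proj_disjoint[OF supp_in_proj2[OF xsup[OF that(2)]], of "s (Suc l)" "s l" "{a..<b}"] by blast
    then show ?thesis using act_proj[OF ysup, of l "proj {a..<b} (?x i)"] by simp
  qed
  \<comment> \<open>At most two blocks are cut by \<open>a\<close> or \<open>b\<close>, each
    contributing at most 15360. The remaining visible blocks form an interval of indices with values
    \<open>(-1)^l\<close>, whose sum has modulus at most 1; 30721 = 2 * 15360 + 1.\<close>
  have prefix: "norm (\<Sum>l<t. act (zs ! l) ?X) \<le> 30721"
  proof -
    define i2 where "i2 = min i1 t"
    define c where "c l = act (y l) (proj {a..<b} (?x l))" for l
    have "(\<Sum>l<t. act (zs ! l) ?X) = (\<Sum>l<t. if l \<in> {i0..<i1} then c l else 0)"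
    proof (rule sum.cong[OF refl])
      fix l assume "l \<in> {..<t}"
      then have l: "l < t" by simp
      have "act (zs ! l) ?X = (\<Sum>i=i0..<i1. act (y l) (proj {a..<b} (?x i)))"
        unfolding teq[OF l] proj_sum act_sum ..
      also have "\<dots> = (\<Sum>i=i0..<i1. if i = l then c l else 0)" using cross I by (intro sum.cong) (auto simp: c_def)
      also have "\<dots> = (if l \<in> {i0..<i1} then c l else 0)" by simp
      finally show "act (zs ! l) ?X = (if l \<in> {i0..<i1} then c l else 0)" .
    qed
    also have "\<dots> = (\<Sum>l\<in>{..<t} \<inter> {i0..<i1}. c l)" by (simp add: sum.inter_restrict)
    also have "{..<t} \<inter> {i0..<i1} = {i0..<i2}" by (auto simp: i2_def)
    finally have eq: "(\<Sum>l<t. act (zs ! l) ?X) = (\<Sum>l=i0..<i2. c l)" .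
    define \<tau> where "\<tau> l = (if l = 0 then a else b)" for l :: nat
    define C where "C = {l \<in> {i0..<i2}. \<exists>q\<le>1. s l < \<tau> q \<and> \<tau> q < s (Suc l)}"
    define In where "In = {l \<in> {i0..<i2}. a \<le> s l \<and> s (Suc l) \<le> b}"
    have cC: "card C \<le> 2" unfolding C_def using card_cut_le[OF ms, of "{i0..<i2}" 1 \<tau>] by simp
    have disj: "C \<inter> In = {}" unfolding C_def In_def \<tau>_def by (auto split: if_splits)
    have i2k: "i2 \<le> k" using I by (simp add: i2_def)
    have c0: "c l = 0" if "l \<in> {i0..<i2}" "l \<notin> C" "l \<notin> In" for l
    proof -
      have n: "\<not> (s l < a \<and> a < s (Suc l))" "\<not> (s l < b \<and> b < s (Suc l))" "\<not> (a \<le> s l \<and> s (Suc l) \<le> b)"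
      proof -
        have "\<not> (s l < \<tau> q \<and> \<tau> q < s (Suc l))" if "q \<le> 1" for q
          using \<open>l \<in> {i0..<i2}\<close> \<open>l \<notin> C\<close> that unfolding C_def by blast
        from this[of 0] this[of 1] show "\<not> (s l < a \<and> a < s (Suc l))" "\<not> (s l < b \<and> b < s (Suc l))" by (simp_all add: \<tau>_def)
        show "\<not> (a \<le> s l \<and> s (Suc l) \<le> b)" using that unfolding In_def by blast
      qed
      have "s l < s (Suc l)" using strict_monoD[OF ms, of l "Suc l"] by simp
      then have "s (Suc l) \<le> a \<or> b \<le> s l" using n by linarith
      moreover have "l < k" using that(1) i2k by simp
      ultimately have "proj {a..<b} (?x l) = 0" using proj_disjoint[OF xsup] by blast
      then show ?thesis by (simp add: c_def)
    qed
    have cIn: "c l = (- 1) ^ l" if "l \<in> In" for l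
    proof -
      have lk: "l < k" and "a \<le> s l" "s (Suc l) \<le> b" using that i2k unfolding In_def by auto
      then have "supp_in (?x l) a b" using supp_in_mono[OF xsup[OF lk]] by simp
      then have "proj {a..<b} (?x l) = ?x l" by (rule supp_in_proj_eq)
      then show ?thesis unfolding c_def by (simp add: act_scl yx)
    qed
    have cC1: "norm (c l) \<le> 15360" if "l \<in> C" for l
    proof -
      have lk: "l < k" using that i2k unfolding C_def by auto
      have "norm (c l) \<le> N (proj {a..<b} (?x l))" unfolding c_def by (rule yN[OF N_proj_G])
      also have "\<dots> \<le> N (?x l)" by (rule N_proj[OF c00_G[OF xc[OF lk]]])
      finally show ?thesis using xN[OF lk] by linarith
    qed
    have alt: "norm (\<Sum>l\<in>In. (- 1) ^ l :: 'a) \<le> 1"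
    proof -
      have gen: "(\<Sum>l=c..<c + d. (- 1) ^ l :: 'a) = (if even d then 0 else (- 1) ^ c)" for c d :: nat
        by (induction d) (auto simp: power_add)
      show ?thesis
      proof (cases "In = {}")
        case False
        have fin: "finite In" by (simp add: In_def)
        have mi: "Min In \<in> In" "Max In \<in> In" using fin False by auto
        have "In = {Min In..<Suc (Max In)}"
        proof (intro equalityI subsetI)
          fix l assume "l \<in> In"
          then show "l \<in> {Min In..<Suc (Max In)}" using fin by (simp add: le_imp_less_Suc)
        next
          fix l assume l: "l \<in> {Min In..<Suc (Max In)}"
          then have "s (Min In) \<le> s l" "s (Suc l) \<le> s (Suc (Max In))" by (auto intro: sle)
          then show "l \<in> In" using mi l unfolding In_def by auto
        qed
        moreover have "Min In \<le> Suc (Max In)" using mi fin by (simp add: le_SucI)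
        ultimately have "In = {Min In..<Min In + (Suc (Max In) - Min In)}" by simp
        then obtain c d where "In = {c..<c + d}" by blast
        then show ?thesis using gen[of c d] by (simp add: norm_power)
      qed simp
    qed
    have "(\<Sum>l=i0..<i2. c l) = (\<Sum>l\<in>C \<union> In. c l)"
      by (rule sum.mono_neutral_right) (use c0 in \<open>auto simp: C_def In_def\<close>)
    also have "\<dots> = (\<Sum>l\<in>C. c l) + (\<Sum>l\<in>In. c l)" by (rule sum.union_disjoint) (use disj in \<open>auto simp: C_def In_def\<close>)
    also have "(\<Sum>l\<in>In. c l) = (\<Sum>l\<in>In. (- 1) ^ l)" by (rule sum.cong) (use cIn in auto)
    finally have "norm (\<Sum>l=i0..<i2. c l) \<le> norm (\<Sum>l\<in>C. c l) + norm (\<Sum>l\<in>In. (- 1) ^ l :: 'a)" by (simp add: norm_triangle_ineq)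
    moreover have "norm (\<Sum>l\<in>C. c l) \<le> (\<Sum>l\<in>C. 15360)" by (rule sum_norm_le) (rule cC1)
    moreover have "(\<Sum>l\<in>C. 15360) \<le> (30720::real)" using cC by simp
    ultimately show ?thesis unfolding eq using alt by linarith
  qed
  \<comment> \<open>If \<open>w l\<close> were the code \<open>m i\<close> with
    \<open>i > 0\<close>, injectivity of \<open>\<sigma>\<close> would identify initial segments
    that contain the index \<open>t\<close>. The weight \<open>m 0\<close> is prescribed rather than
    a code of earlier functionals, so it is excluded separately.\<close>
  have wne: "w l \<noteq> m i" if l: "t < l" "l < k" "w l \<noteq> m 0" for l i
  proof (cases i)
    case 0 then show ?thesis using l by simp
  next
    case (Suc i')
    have ne: "take l zs \<noteq> []" using l zl(1) by auto
    have sQ: "set (take l zs) \<subseteq> gm_Q R" using zl(3) set_take_subset[of l zs] by blast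
    have yQ': "set (map y [0..<Suc i']) \<subseteq> gm_Q R" using yQ by auto
    have wl: "w l = \<sigma> (take l zs)" using l by (simp add: w_def wt_def)
    show ?thesis
    proof
      assume "w l = m i"
      then have "\<sigma> (take l zs) = \<sigma> (map y [0..<Suc i'])" using wl mm[of i'] Suc by simp
      then have eq: "take l zs = map y [0..<Suc i']"
        by (intro sigma_inj[OF ne successive_take[OF zl(2)] sQ _ suc yQ']) auto
      have "l = Suc i'" using arg_cong[OF eq, of length] l zl(1) by (simp del: upt_Suc)
      then have "zs ! t = y t" using arg_cong[OF eq, of "\<lambda>xs. xs ! t"] l by (simp del: upt_Suc)
      then show False using t l by auto
    qed
  qed
  have winj: "inj_on w {t<..<k}"
  proof (rule inj_onI)
    fix l l' assume l: "l \<in> {t<..<k}" "l' \<in> {t<..<k}" and "w l = w l'"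
    have ne: "take l zs \<noteq> []" "take l' zs \<noteq> []" using l zl(1) by auto
    have sQ: "set (take l zs) \<subseteq> gm_Q R" "set (take l' zs) \<subseteq> gm_Q R"
      using zl(3) set_take_subset[of l zs] set_take_subset[of l' zs] by blast+
    have "\<sigma> (take l zs) = \<sigma> (take l' zs)" using \<open>w l = w l'\<close> l by (simp add: w_def wt_def)
    then have "take l zs = take l' zs"
      by (rule sigma_inj[OF ne(1) successive_take[OF zl(2)] sQ(1) ne(2) successive_take[OF zl(2)] sQ(2)])
    from arg_cong[OF this, of length] show "l = l'" using l zl(1) by simp
  qed
  have wk: "w l \<noteq> k" if "l < k" for l
  proof -
    from wA(2)[OF that] obtain r where "r \<ge> 1" "even r" "w l = j r" by blast
    then show ?thesis using J_eq_iff[of r ae] k by auto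
  qed
  \<comment> \<open>Exceptional indices after \<open>t\<close>: at most \<open>ae - 1\<close> with
    weight below \<open>k\<close>, and at most one with weight \<open>m 0\<close>. Together with
    \<open>t\<close> itself these are at most \<open>ae + 1\<close> indices, and each of them gets
    the general bound \<open>?Bd\<close>.\<close>
  define L1 where "L1 = {l \<in> {t<..<k}. w l < k}"
  define L3 where "L3 = {l \<in> {t<..<k}. w l = m 0}"
  define E where "E = insert t (L1 \<union> L3)"
  have cL1: "card L1 \<le> ae - 1"
  proof -
    have "w ` L1 \<subseteq> j ` {1..<ae}"
    proof
      fix v assume "v \<in> w ` L1"
      then obtain l where l: "l < k" "w l < k" "v = w l" unfolding L1_def by auto
      obtain r where r: "r \<ge> 1" "w l = j r" using wA(2)[OF l(1)] by blast
      then have "r < ae" using l(2) J_less_iff[OF r(1) k(2)] k(1) by simp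
      then show "v \<in> j ` {1..<ae}" using r l(3) by auto
    qed
    then have "card (w ` L1) \<le> card (j ` {1..<ae})" by (intro card_mono) auto
    also have "\<dots> \<le> card {1..<ae}" by (rule card_image_le) simp
    finally have "card (w ` L1) \<le> ae - 1" by simp
    moreover have "card (w ` L1) = card L1" by (intro card_image inj_on_subset[OF winj]) (auto simp: L1_def)
    ultimately show ?thesis by simp
  qed
  have cL3: "card L3 \<le> 1"
  proof -
    have "card (w ` L3) \<le> card {m 0}" by (intro card_mono) (auto simp: L3_def)
    moreover have "card (w ` L3) = card L3" by (intro card_image inj_on_subset[OF winj]) (auto simp: L3_def)
    ultimately show ?thesis by simp
  qed
  have cE: "card E \<le> ae + 1"
  proof -
    have "card E \<le> Suc (card (L1 \<union> L3))" unfolding E_def by (rule card_insert_le_m1) auto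
    also have "card (L1 \<union> L3) \<le> card L1 + card L3" by (rule card_Un_le)
    finally show ?thesis using cL1 cL3 k(2) by simp
  qed
  have finE: "finite E" by (simp add: E_def L1_def L3_def)
  have rest: "norm (act (zs ! l) ?X) \<le> 15360 / real k" if l: "l \<in> {t..<k}" "l \<notin> E" for l
  proof -
    have l': "t < l" "l < k" "w l \<noteq> m 0" "\<not> w l < k" using l unfolding E_def L1_def L3_def by auto
    have kw: "k < w l" using l'(4) wk[OF l'(2)] by simp
    obtain r where r: "r \<ge> 1" "w l = j r" using wA(2)[OF l'(2)] by blast
    have each: "norm (act (zs ! l) (proj {a..<b} (?x i))) \<le> 15360 / (real k)\<^sup>2" for i
    proof -
      have "norm (act (zs ! l) (proj {a..<b} (?x i))) = norm (act (zs ! l) (proj {a..<b} (x i)))"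
        unfolding proj_scl act_scl norm_mult by (simp add: norm_power)
      moreover have "j r \<noteq> m i" "k < j r" "zs ! l \<in> gm_A (p lev) (j r)"
        using wne[OF l'(1-3)] kw wA(1)[OF l'(2)] r(2) by simp_all
      ultimately show ?thesis using tm[of i] r(1) unfolding tame_def by simp
    qed
    have "norm (act (zs ! l) ?X) \<le> (\<Sum>i=i0..<i1. 15360 / (real k)\<^sup>2)"
      unfolding proj_sum act_sum by (intro sum_norm_le each)
    also have "\<dots> = real (i1 - i0) * (15360 / (real k)\<^sup>2)" by simp
    also have "\<dots> \<le> real k * (15360 / (real k)\<^sup>2)" using I by (intro mult_right_mono) auto
    also have "\<dots> = 15360 / real k" using k2 by (simp add: power2_eq_square)
    finally show ?thesis .
  qed
  have tail: "(\<Sum>l=t..<k. norm (act (zs ! l) ?X)) \<le> (real ae + 1) * ?Bd + 15360"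
  proof -
    have "(\<Sum>l=t..<k. norm (act (zs ! l) ?X)) \<le> (\<Sum>l=t..<k. (if l \<in> E then ?Bd else 0) + 15360 / real k)"
    proof (rule sum_mono)
      fix l assume l: "l \<in> {t..<k}"
      show "norm (act (zs ! l) ?X) \<le> (if l \<in> E then ?Bd else 0) + 15360 / real k"
        using any[of l] rest[OF l] l by (cases "l \<in> E") (auto intro: add_increasing2)
    qed
    also have "\<dots> = (\<Sum>l\<in>{t..<k} \<inter> E. ?Bd) + real (k - t) * (15360 / real k)"
      unfolding sum.distrib sum.inter_restrict[OF finite_atLeastLessThan] by simp
    also have "(\<Sum>l\<in>{t..<k} \<inter> E. ?Bd) = real (card ({t..<k} \<inter> E)) * ?Bd" by simp
    also have "\<dots> \<le> (real ae + 1) * ?Bd"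
    proof (rule mult_right_mono)
      have "card ({t..<k} \<inter> E) \<le> card E" using finE by (intro card_mono) auto
      then show "real (card ({t..<k} \<inter> E)) \<le> real ae + 1" using cE by linarith
    qed (use Bd in simp)
    also have "real (k - t) * (15360 / real k) \<le> real k * (15360 / real k)" by (intro mult_right_mono) auto
    also have "real k * (15360 / real k) = 15360" using k2 by simp
    finally show ?thesis by simp
  qed
  \<comment> \<open>The other contributions, 30721 + 15360, are at most \<open>2 * ?Bd\<close>; so
    \<open>ae + 3\<close> must be dominated by \<open>sqrt (gm_f k)\<close>, which the gap between
    \<open>j (ae - 1)\<close> and \<open>k\<close> provides.\<close>
  have aes: "real ae + 3 \<le> sqrt (gm_f k)"
  proof (cases "ae = 1")
    case True then show ?thesis using s16 by simp
  next
    case False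
    then have ae: "1 \<le> ae - 1" "ae - 1 < ae" using k(2) by auto
    have "(real (j (ae - 1)))\<^sup>2 \<le> gm_f k" using J_gap_le(3)[OF lac ae] k(1) by simp
    then have 1: "real (j (ae - 1)) \<le> sqrt (gm_f k)" by (rule real_le_rsqrt)
    have ge: "r + 9 \<le> j r" if "r \<ge> 1" for r using that
    proof (induction r rule: dec_induct)
      case base
      have b1: "big (j 1)" by (rule J_big[OF lac]) simp
      have "ln (real (j 1)) \<le> real (j 1) - 1" using big_ln(1)[OF b1] by (intro ln_le_minus_one) simp
      then show ?case using big_ln(2)[OF b1] by simp
    next
      case (step r) then show ?case using gm_lacunaryD(1)[OF lac, of r "Suc r"] by simp
    qed
    have "ae + 3 \<le> j (ae - 1)" using ge[OF ae(1)] ae by linarith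
    then show ?thesis using 1 by linarith
  qed
  have split: "(\<Sum>l<k. act (zs ! l) ?X) = (\<Sum>l<t. act (zs ! l) ?X) + (\<Sum>l=t..<k. act (zs ! l) ?X)"
    using sum.atLeastLessThan_concat[of 0 t k "\<lambda>l. act (zs ! l) ?X"] tk by (simp add: atLeast0LessThan)
  have "norm (\<Sum>l<k. act (zs ! l) ?X) \<le> norm (\<Sum>l<t. act (zs ! l) ?X) + norm (\<Sum>l=t..<k. act (zs ! l) ?X)"
    unfolding split by (rule norm_triangle_ineq)
  also have "\<dots> \<le> 30721 + ((real ae + 1) * ?Bd + 15360)"
    by (rule add_mono[OF prefix order_trans[OF norm_sum tail]])
  also have "\<dots> \<le> (real ae + 3) * ?Bd" using Bd by (simp add: algebra_simps)
  also have "\<dots> \<le> sqrt (gm_f k) * ?Bd" using aes Bd by (intro mult_right_mono) auto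
  finally have "norm (\<Sum>l<k. act (zs ! l) ?X) \<le> sqrt (gm_f k) * ?Bd" .
  then have "norm (\<Sum>l<k. act (zs ! l) ?X) / sqrt (gm_f k) \<le> ?Bd"
    using f256 by (subst pos_divide_le_eq) (auto simp: mult.commute)
  then show ?thesis unfolding spf_act[OF z] using f256 by (simp add: norm_divide)
qed

text \<open>Splitting the indices by parity writes the sum and the alternating sum of the
  \<open>x i\<close> as \<open>a + b\<close> and \<open>a - b\<close>, up to small errors and a
  common scaling. The ratio of their estimates is of order \<open>sqrt (gm_f k)\<close>, which is
  unbounded.\<close>

theorem exists_close_pair_far_from_subspace:
  assumes Y: "csub Y" and A: "subsp Y A" "infdim_mod Y A" and B: "subsp Y B" "infdim_mod Y B" and e: "e > 0"
  shows "\<exists>a\<in>A. \<exists>b\<in>B. (\<forall>y\<in>Y. N (a + b - y) \<ge> 1) \<and> N (a - b) \<le> e"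
proof -
  note YG = csubD(1)[OF Y]
  \<comment> \<open>Here 737282 = 2 * 368641 and 368641 = 8 * 46080 + 1: the upper estimate, the
    error of replacing the \<open>x i\<close> by elements of \<open>A\<close> and \<open>B\<close>,
    and the final scaling. As \<open>r\<close> is even, \<open>j (Suc r)\<close> lies in K.\<close>
  obtain r where r: "r \<ge> 1" "even r" "(737282 / e)\<^sup>2 \<le> gm_f (j r)" using exists_L_large by blast
  define ae k where "ae = Suc r" and "k = j (Suc r)"
  have ae: "k = j ae" "1 \<le> ae" "odd ae" using r by (auto simp: ae_def k_def)
  have bk: "big k" using J_big[OF lac ae(2)] ae(1) by simp
  have k2: "k \<ge> 2" using big_ln[OF bk] by simp
  have "j r \<le> k" unfolding k_def using gm_lacunaryD(1)[OF lac r(1), of "Suc r"] by simp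
  then have "(737282 / e)\<^sup>2 \<le> gm_f k" using r(3) gm_f_mono[of "j r" k] by linarith
  then have big_k: "737282 / e \<le> sqrt (gm_f k)" by (rule real_le_rsqrt)
  have f256: "gm_f k > 256" using bk by (simp add: big_def)
  then have s16: "sqrt (gm_f k) \<ge> 16" by (intro real_le_rsqrt) simp
  define q where "q = sqrt (gm_f k)"
  have q: "q \<ge> 16" "q * q = gm_f k" "737282 / e \<le> q" using s16 f256 big_k by (auto simp: q_def)
  have qk: "q \<le> real k"
  proof -
    have "q * 1 \<le> q * q" using q(1) by (intro mult_left_mono) auto
    then show ?thesis using q(2) gm_f_le_self[of k] by linarith
  qed
  \<comment> \<open>The \<open>k\<close> errors \<open>\<epsilon>\<close> add up to 1/4. A
    competitor in \<open>Y\<close> will have norm at most \<open>15362 * k\<close>, and 61448 = 4 *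
    15362 then bounds the special functional on it by \<open>k / q / 4\<close>.\<close>
  define \<epsilon> \<eta> where "\<epsilon> = 1 / (4 * real k)" and "\<eta> = 1 / (61448 * real k)"
  have ee: "\<epsilon> > 0" "\<eta> > 0" using k2 by (auto simp: \<epsilon>_def \<eta>_def)
  from special_sequence_near[OF Y A B ee ae] obtain x y s m where
    sm: "strict_mono s" and all: "\<forall>i. supp_in (x i) (s i) (s (Suc i)) \<and> supp_in (y i) (s i) (s (Suc i)) \<and>
     block_ok Y (if even i then A else B) \<epsilon> \<eta> k (m i) (x i) (y i) \<and>
     (\<Sum>i'\<le>i. l1 (x i')) \<le> sqrt (gm_f (lnn (m (Suc i)))) \<and> m i < m (Suc i) \<and>
     m (Suc i) = \<sigma> (map y [0..<Suc i]) \<and> successive (map y [0..<Suc i])" and m0: "m 0 = j (2 * k)"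
    by (elim exE conjE)
  have xsup: "supp_in (x i) (s i) (s (Suc i))" and ysup: "supp_in (y i) (s i) (s (Suc i))"
    and ok: "block_ok Y (if even i then A else B) \<epsilon> \<eta> k (m i) (x i) (y i)"
    and l1s: "(\<Sum>i'\<le>i. l1 (x i')) \<le> sqrt (gm_f (lnn (m (Suc i))))" and mlt: "m i < m (Suc i)"
    and mm: "m (Suc i) = \<sigma> (map y [0..<Suc i])" and suc: "successive (map y [0..<Suc i])" for i
    using all[rule_format, of i] by - (elim conjE, assumption)+
  have yx: "act (y i) (x i) = 1" and xsp: "spread 15360 (lnn (m i)) (x i)" and tm: "tame 15360 k (m i) (x i)"
    and near: "\<exists>a\<in>(if even i then A else B). N (a - x i) \<le> \<epsilon>" and yN: "\<And>u. u \<in> G \<Longrightarrow> norm (act (y i) u) \<le> N u"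
    and yY: "\<And>v. v \<in> Y \<Longrightarrow> norm (act (y i) v) \<le> \<eta> * N v" and yQ: "y i \<in> gm_Q R"
    and lev: "\<exists>n0. \<forall>n\<ge>n0. y i \<in> gm_A (p n) (m i)" for i
    using ok[of i] unfolding block_ok_def by simp_all
  have sle: "s i \<le> s i'" if "i \<le> i'" for i i' using sm that by (simp add: strict_mono_less_eq)
  have xc: "x i \<in> c00" for i using xsup supp_in_c00 by blast
  let ?x = "\<lambda>i. scl ((- 1) ^ i) (x i)"
  have n1: "norm ((- 1 :: 'a) ^ i) = 1" for i by (simp add: norm_power)
  have R: "ris 15360 k (\<lambda>i. lnn (m i)) s ?x" unfolding ris_def
  proof (intro conjI allI impI)
    show "strict_mono s" by (rule sm)
    fix i
    show "supp_in (?x i) (s i) (s (Suc i))" by (rule supp_in_scl[OF xsup])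
    show "spread 15360 (lnn (m i)) (?x i)"
      using xsp[of i] unfolding spread_def proj_scl N_scl(2)[OF N_proj_G] n1 by simp
    show "(\<Sum>i'<i. l1 (?x i')) \<le> sqrt (gm_f (lnn (m i)))"
    proof (cases i)
      case (Suc i')
      then show ?thesis using l1s[of i'] by (simp add: l1_scl n1 lessThan_Suc_atMost)
    qed simp
    fix i' assume "i' \<le> i"
    then have "m i' \<le> m i" by (rule lift_Suc_mono_le[of m, OF less_imp_le[OF mlt]])
    moreover have "m i' \<ge> 1"
    proof -
      have "m 0 \<le> m i'" by (rule lift_Suc_mono_le[of m, OF less_imp_le[OF mlt]]) simp
      then show ?thesis using m0 gm_lacunaryD(3)[OF lac, of "2 * k"] k2 by linarith
    qed
    ultimately show "lnn (m i') \<le> lnn (m i)" unfolding lnn_def by (intro nat_mono floor_mono) simp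
  next
    have ge: "r \<le> j r" if "r \<ge> 1" for r using that
    proof (induction r rule: dec_induct)
      case base then show ?case using gm_lacunaryD(3)[OF lac, of 1] by simp
    next
      case (step r) then show ?case using gm_lacunaryD(1)[OF lac, of r "Suc r"] by simp
    qed
    \<comment> \<open>Here the full strength of the gap in J is used: the first weight has to
      satisfy \<open>2 ^ k <= ln (m 0)\<close>.\<close>
    have "ae < 2 * k" using ge[OF ae(2)] ae(1) k2 by linarith
    then have g: "ln (real (j (2 * k))) \<ge> exp (exp (4 * (real k)\<^sup>2))" using J_gap[OF lac ae(2)] ae(1) by simp
    have "real k * 1 \<le> real k * real k" using k2 by (intro mult_left_mono) auto
    then have "real k \<le> 4 * (real k)\<^sup>2" by (simp add: power2_eq_square)
    also have "\<dots> \<le> exp (4 * (real k)\<^sup>2)" using exp_ge_add_one_self[of "4 * (real k)\<^sup>2"] by linarith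
    finally have "exp (real k) \<le> exp (exp (4 * (real k)\<^sup>2))" by simp
    moreover have "2 ^ k \<le> exp (real k)"
    proof -
      have "(2::real) \<le> exp 1" using exp_ge_add_one_self[of 1] by simp
      then have "2 ^ k \<le> exp (1::real) ^ k" by (rule power_mono) simp
      then show ?thesis by (simp add: exp_of_nat_mult[symmetric])
    qed
    ultimately have "2 ^ k \<le> ln (real (m 0))" using g unfolding m0 by linarith
    then show "2 ^ k \<le> lnn (m 0)" unfolding lnn_def by (intro le_nat_floor) simp
  qed simp
  have up: "upper_level 46080 k ?x lev" for lev
  proof (rule ris_upper[OF R ae(1,2)])
    fix lev zs a b i0 i1
    assume "upper_level 46080 k ?x lev" "special_sequence R j \<sigma> (p lev) k zs" "i0 < i1" "i1 \<le> k"
    then show "norm (act (spf k zs) (proj {a..<b} (\<Sum>i=i0..<i1. ?x i))) \<le> 46080 * real (i1 - i0) powr (1 - be k)"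
      by (intro alternating_special[OF ae R _ ysup yQ suc yx yN tm m0 mm])
  qed simp
  define Al where "Al = (\<Sum>i=0..<k. ?x i)"
  have AlN: "N Al \<le> 368640 * real k / gm_f k"
  proof -
    have "N Al \<le> 46080 * real (k - 0) powr (1 - be k)" unfolding Al_def
      by (rule upper_level_N[OF up _ order_refl]) (use k2 xc in auto)
    then show ?thesis by (simp add: powr_one_minus_be[OF bk])
  qed
  define XX where "XX = (\<Sum>i=0..<k. x i)"
  have xN: "N (x i) \<le> 15360" if "i < k" for i
    using risD(9)[OF R that] N_scl(2)[OF c00_G[OF xc], of "(-1)^i" i] n1 by simp
  have XG: "XX \<in> G" and XN: "N XX \<le> 15360 * real k"
  proof -
    have 1: "XX \<in> G" "N XX \<le> (\<Sum>i=0..<k. N (x i))" unfolding XX_def using N_sum[of "{0..<k}" x] c00_G[OF xc] by auto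
    have "(\<Sum>i=0..<k. N (x i)) \<le> (\<Sum>i=0..<k. 15360)" using xN by (intro sum_mono) auto
    then show "XX \<in> G" "N XX \<le> 15360 * real k" using 1 by (auto simp: mult.commute)
  qed
  have AlG: "Al \<in> G" unfolding Al_def using N_sum[of "{0..<k}" ?x] N_scl(1)[OF c00_G[OF xc]] by blast
  \<comment> \<open>Since there are finitely many functionals, they form a special sequence at a
    common level \<open>nn\<close>.\<close>
  obtain n0 where n0: "\<And>i n. n \<ge> n0 i \<Longrightarrow> y i \<in> gm_A (p n) (m i)" using lev by metis
  define nn where "nn = Max (n0 ` {..<k})"
  have yA: "y i \<in> gm_A (p nn) (m i)" if "i < k" for i
    by (rule n0) (use that in \<open>auto simp: nn_def\<close>)
  define ys where "ys = map y [0..<k]"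
  have spec: "special_sequence R j \<sigma> (p nn) k ys" unfolding special_sequence_def
  proof (intro conjI allI impI)
    show "length ys = k" by (simp add: ys_def)
    show "successive ys" using suc[of "k - 1"] k2 by (simp add: ys_def)
    show "set ys \<subseteq> gm_Q R" using yQ by (auto simp: ys_def)
    show "ys ! 0 \<in> gm_A (p nn) (j (2 * k))" using yA[of 0] k2 m0 by (simp add: ys_def)
    fix i assume i: "1 \<le> i \<and> i < k"
    then have "take i ys = map y [0..<Suc (i - 1)]" by (simp add: ys_def take_map take_upt)
    then have "\<sigma> (take i ys) = m i" using mm[of "i - 1"] i by simp
    then show "ys ! i \<in> gm_A (p nn) (\<sigma> (take i ys))" using yA[of i] i by (simp add: ys_def)
  qed
  define g where "g = spf k ys"
  have kK: "k \<in> gm_K j" unfolding gm_K_def using ae by auto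
  have gSF: "g \<in> SF (p nn)" unfolding SF_spf g_def using spec kK by blast
  have gact: "act g u = (\<Sum>l<k. act (y l) u) / of_real q" for u
    unfolding g_def spf_act[OF spec] q_def by (simp add: ys_def)
  have gsup: "supp_in g 0 (s k)" unfolding g_def spf_def
  proof (intro supp_in_scl supp_in_sum)
    fix l assume "l \<in> {..<k}"
    then show "supp_in (ys ! l) 0 (s k)"
      using supp_in_mono[OF ysup[of l], of 0 "s k"] sle[of "Suc l" k] by (simp add: ys_def)
  qed
  have gN: "norm (act g u) \<le> N u" if u: "u \<in> G" for u
  proof -
    have "norm (act g u) = norm (act g (proj {0..<s k} (proj {0..<s k} u)))" using act_proj[OF gsup, of u] by simp
    also have "\<dots> \<le> p (Suc nn) (proj {0..<s k} u)" unfolding p_Suc by (rule nxt_ge2[OF good_p c00_proj_fin gSF])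
    also have "\<dots> \<le> N (proj {0..<s k} u)" by (rule p_le_N'[OF c00_proj_fin])
    also have "\<dots> \<le> N u" by (rule N_proj[OF u])
    finally show ?thesis .
  qed
  have gY: "norm (act g v) \<le> real k / q * (\<eta> * N v)" if v: "v \<in> Y" for v
  proof -
    have "norm (\<Sum>l<k. act (y l) v) \<le> (\<Sum>l<k. \<eta> * N v)" by (intro sum_norm_le yY v)
    then have "norm (\<Sum>l<k. act (y l) v) / q \<le> real k * (\<eta> * N v) / q" using q(1) by (intro divide_right_mono) auto
    then show ?thesis unfolding gact using q(1) by (simp add: norm_divide)
  qed
  have cross: "act (y l) (x i) = (if i = l then 1 else 0)" for l i
  proof (cases "i = l")
    case False
    then have "Suc i \<le> l \<or> Suc l \<le> i" by auto
    then have "s (Suc i) \<le> s l \<or> s (Suc l) \<le> s i" using sle by blast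
    then have "proj {s l..<s (Suc l)} (x i) = 0" using proj_disjoint[OF xsup, of "s (Suc l)" i "s l"] by blast
    then show ?thesis using act_proj[OF ysup, of l "x i"] False by simp
  qed (simp add: yx)
  have gX: "act g XX = of_real (real k / q)"
  proof -
    have "act (y l) XX = 1" if "l < k" for l
      unfolding XX_def act_sum using that by (simp add: cross)
    then have "(\<Sum>l<k. act (y l) XX) = of_nat k" by simp
    then show ?thesis unfolding gact by simp
  qed
  obtain a' where a': "\<And>i. a' i \<in> (if even i then A else B)" "\<And>i. N (a' i - x i) \<le> \<epsilon>" using near by metis
  have a'AB: "even i \<Longrightarrow> a' i \<in> A" "odd i \<Longrightarrow> a' i \<in> B" for i using a'(1)[of i] by simp_all
  have a'G: "a' i \<in> G" for i using a'AB[of i] subspD(1)[OF A(1)] subspD(1)[OF B(1)] by blast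
  define u v where "u = (\<Sum>i\<in>{i\<in>{0..<k}. even i}. a' i)" and "v = (\<Sum>i\<in>{i\<in>{0..<k}. odd i}. a' i)"
  have uA: "u \<in> A" unfolding u_def by (rule subspD(6)[OF A(1) csubD(2)[OF Y]]) (use a'AB in auto)
  have vB: "v \<in> B" unfolding v_def by (rule subspD(6)[OF B(1) csubD(2)[OF Y]]) (use a'AB in auto)
  have uG: "u \<in> G" and vG: "v \<in> G" using uA vB subspD(1)[OF A(1)] subspD(1)[OF B(1)] by blast+
  have par: "(\<Sum>i=0..<k. h i) = (\<Sum>i\<in>{i\<in>{0..<k}. even i}. h i) + (\<Sum>i\<in>{i\<in>{0..<k}. odd i}. h i)" for h :: "nat \<Rightarrow> nat \<Rightarrow> 'a"
    by (subst sum.union_disjoint[symmetric]) (auto intro!: sum.cong)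
  have dG: "a' i - x i \<in> G" for i by (intro N_diff(1) a'G c00_G xc)
  have small: "(\<Sum>i=0..<k. scl (c i) (a' i - x i)) \<in> G \<and> N (\<Sum>i=0..<k. scl (c i) (a' i - x i)) \<le> 1/4"
    if "\<And>i. norm (c i) = 1" for c
  proof -
    have 1: "(\<Sum>i=0..<k. scl (c i) (a' i - x i)) \<in> G" "N (\<Sum>i=0..<k. scl (c i) (a' i - x i)) \<le> (\<Sum>i=0..<k. N (scl (c i) (a' i - x i)))"
      using N_sum[of "{0..<k}" "\<lambda>i. scl (c i) (a' i - x i)"] N_scl(1)[OF dG] by auto
    have "(\<Sum>i=0..<k. N (scl (c i) (a' i - x i))) \<le> (\<Sum>i=0..<k. \<epsilon>)"
      using a'(2) that by (intro sum_mono) (simp add: N_scl(2)[OF dG])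
    also have "\<dots> = 1/4" using k2 by (simp add: \<epsilon>_def)
    finally show ?thesis using 1 by simp
  qed
  have uv1: "u + v = XX + (\<Sum>i=0..<k. scl 1 (a' i - x i))"
    unfolding u_def v_def XX_def par[symmetric] by (simp add: sum_subtractf)
  have uv2: "u - v = Al + (\<Sum>i=0..<k. scl ((- 1) ^ i) (a' i - x i))"
  proof -
    have "u - v = (\<Sum>i=0..<k. scl ((- 1) ^ i) (a' i))"
      unfolding par u_def v_def by (simp add: sum_negf)
    then show ?thesis unfolding Al_def by (simp add: scl_diff sum_subtractf)
  qed
  have sG1: "(\<Sum>i=0..<k. scl 1 (a' i - x i)) \<in> G" "N (\<Sum>i=0..<k. scl 1 (a' i - x i)) \<le> 1/4" using small[of "\<lambda>_. 1"] by auto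
  have sG2: "(\<Sum>i=0..<k. scl ((- 1) ^ i) (a' i - x i)) \<in> G" "N (\<Sum>i=0..<k. scl ((- 1) ^ i) (a' i - x i)) \<le> 1/4"
    using small[of "\<lambda>i. (- 1) ^ i", OF n1] by auto
  have kq: "real k / q \<ge> 1" using qk q(1) by simp
  \<comment> \<open>A closer competitor \<open>w\<close> would have norm of order \<open>k\<close>,
    so the special functional would be at most \<open>k / q / 4\<close> on it. Its value
    \<open>k / q\<close> at \<open>XX\<close> would then be less than
    \<open>k / q / 2 + 1/4 + k / q / 4\<close>, which is at most \<open>k / q\<close> because
    \<open>k / q >= 1\<close>.\<close>
  have low: "N (u + v - w) \<ge> real k / q / 2" if w: "w \<in> Y" for w
  proof (rule ccontr)
    assume "\<not> ?thesis"
    then have less: "N (u + v - w) < real k / q / 2" by simp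
    have uvG: "u + v \<in> G" by (rule N_add(1)[OF uG vG])
    have "N (u + v) \<le> 15360 * real k + 1/4" unfolding uv1 using N_add(2)[OF XG sG1(1)] XN sG1(2) by linarith
    moreover have "N (u + v - w) < real k / 2"
    proof -
      have "real k / q / 2 \<le> real k / 1 / 2" using q(1) by (intro divide_right_mono divide_left_mono) auto
      then show ?thesis using less by linarith
    qed
    moreover have "N w \<le> N (u + v) + N (u + v - w)" using N_diff(2)[OF uvG N_diff(1)[OF uvG YG[OF w]]] by simp
    moreover have "real k \<ge> 2" using k2 by simp
    ultimately have Nw: "N w \<le> 15362 * real k" by linarith
    have "norm (act g w) \<le> real k / q * (\<eta> * N w)" by (rule gY[OF w])
    also have "\<dots> \<le> real k / q * (\<eta> * (15362 * real k))" using Nw ee(2) kq by (intro mult_left_mono) auto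
    also have "\<eta> * (15362 * real k) = 1/4" using k2 by (simp add: \<eta>_def)
    finally have gw: "norm (act g w) \<le> real k / q / 4" by simp
    have "act g (u + v - w) = of_real (real k / q) + act g (\<Sum>i=0..<k. scl 1 (a' i - x i)) - act g w"
      unfolding uv1 act_diff act_add gX ..
    then have "real k / q \<le> norm (act g (u + v - w)) + norm (act g (\<Sum>i=0..<k. scl 1 (a' i - x i))) + norm (act g w)"
    proof -
      assume eq: "act g (u + v - w) = of_real (real k / q) + act g (\<Sum>i=0..<k. scl 1 (a' i - x i)) - act g w"
      have "of_real (real k / q) = act g (u + v - w) - act g (\<Sum>i=0..<k. scl 1 (a' i - x i)) + act g w"
        unfolding eq by simp
      then have "norm (of_real (real k / q) :: 'a) \<le> norm (act g (u + v - w) - act g (\<Sum>i=0..<k. scl 1 (a' i - x i))) + norm (act g w)"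
        using norm_triangle_ineq by metis
      also have "norm (act g (u + v - w) - act g (\<Sum>i=0..<k. scl 1 (a' i - x i))) \<le> norm (act g (u + v - w)) + norm (act g (\<Sum>i=0..<k. scl 1 (a' i - x i)))"
        by (rule norm_triangle_ineq4)
      finally show ?thesis using kq unfolding norm_of_real by linarith
    qed
    moreover have "norm (act g (u + v - w)) \<le> N (u + v - w)" by (rule gN[OF N_diff(1)[OF uvG YG[OF w]]])
    moreover have "norm (act g (\<Sum>i=0..<k. scl 1 (a' i - x i))) \<le> 1/4" using gN[OF sG1(1)] sG1(2) by linarith
    ultimately show False using less gw kq by linarith
  qed
  have high: "N (u - v) \<le> 368641 * real k / gm_f k"
  proof -
    have "real k / gm_f k \<ge> 1" using gm_f_le_self[of k] f256 by simp
    then show ?thesis unfolding uv2 using N_add(2)[OF AlG sG2(1)] AlN sG2(2) by simp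
  qed
  \<comment> \<open>Scales the lower bound \<open>k / q / 2\<close> to 1.\<close>
  define c where "c = 2 * q / real k"
  have c: "c > 0" using q(1) k2 by (simp add: c_def)
  show ?thesis
  proof (intro bexI conjI ballI)
    show "scl (of_real c) u \<in> A" by (rule subspD(4)[OF A(1) uA])
    show "scl (of_real c) v \<in> B" by (rule subspD(4)[OF B(1) vB])
    have "N (scl (of_real c) u - scl (of_real c) v) = c * N (u - v)"
      unfolding scl_diff[symmetric] N_scl(2)[OF N_diff(1)[OF uG vG]] using c by simp
    also have "\<dots> \<le> c * (368641 * real k / gm_f k)" using high c by (intro mult_left_mono) auto
    also have "\<dots> = 737282 / q" unfolding q(2)[symmetric] c_def using q(1) k2 by (simp add: field_simps)
    also have "\<dots> \<le> e" using q(1,3) e by (simp add: field_simps)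
    finally show "N (scl (of_real c) u - scl (of_real c) v) \<le> e" .
    fix w assume w: "w \<in> Y"
    have w': "scl (of_real (1 / c)) w \<in> Y" by (rule csubD(4)[OF Y w])
    have "scl (of_real c) u + scl (of_real c) v - w = scl (of_real c) (u + v - scl (of_real (1 / c)) w)"
      using c by (intro ext) (simp add: seq_apply field_simps)
    then have "N (scl (of_real c) u + scl (of_real c) v - w) = c * N (u + v - scl (of_real (1 / c)) w)"
      using N_scl(2)[OF N_diff(1)[OF N_add(1)[OF uG vG] YG[OF w']], of "of_real c"] c by simp
    also have "\<dots> \<ge> c * (real k / q / 2)" using low[OF w'] c by (intro mult_left_mono) auto
    also have "c * (real k / q / 2) = 1" unfolding c_def using q(1) k2 by simp
    finally show "N (scl (of_real c) u + scl (of_real c) v - w) \<ge> 1" .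
  qed
qed

end


section \<open>Normed spaces with carriers\<close>

lemma ring_of_type_simps:
  "carrier (ring_of_type_algebra :: 'k::comm_ring_1 ring) = UNIV"
  "a \<oplus>\<^bsub>(ring_of_type_algebra :: 'k ring)\<^esub> b = a + b"
  "a \<otimes>\<^bsub>(ring_of_type_algebra :: 'k ring)\<^esub> b = a * b"
  "\<one>\<^bsub>(ring_of_type_algebra :: 'k ring)\<^esub> = 1" "\<zero>\<^bsub>(ring_of_type_algebra :: 'k ring)\<^esub> = 0"
  by (simp_all add: ring_of_type_algebra_def)

context normed_space
begin

lemma scalar_laws:
  assumes x: "x \<in> carrier V"
  shows "c \<odot> x \<in> carrier V" "y \<in> carrier V \<Longrightarrow> c \<odot> (x \<oplus> y) = c \<odot> x \<oplus> c \<odot> y"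
    "0 \<odot> x = \<zero>" "(- 1) \<odot> x = \<ominus> x"
proof -
  show c: "c \<odot> x \<in> carrier V" for c using smult_closed[of c x] x by (simp add: ring_of_type_simps)
  show "y \<in> carrier V \<Longrightarrow> c \<odot> (x \<oplus> y) = c \<odot> x \<oplus> c \<odot> y" using smult_r_distr[of c x y] x by (simp add: ring_of_type_simps)
  show 0: "0 \<odot> x = \<zero>" using smult_l_null[OF x] by (simp add: ring_of_type_simps)
  have "(- 1 + 1) \<odot> x = (- 1) \<odot> x \<oplus> 1 \<odot> x" using smult_l_distr[of "- 1" 1 x] x by (simp add: ring_of_type_simps)
  moreover have "1 \<odot> x = x" using smult_one[OF x] by (simp add: ring_of_type_simps)
  ultimately have "(- 1) \<odot> x \<oplus> x = \<zero>" using 0 by simp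
  then show "(- 1) \<odot> x = \<ominus> x" using minus_equality[of "(- 1) \<odot> x" x] x c by simp
qed

lemma nrm_zero: "nrm V \<zero> = 0"
  using nrm_eq_zero[of "\<zero>"] by simp

lemma nrm_minus: "x \<in> carrier V \<Longrightarrow> nrm V (\<ominus> x) = nrm V x"
  using nrm_smult[of x "- 1"] scalar_laws(4)[of x] by simp

lemma nrm_nonneg: assumes "x \<in> carrier V" shows "nrm V x \<ge> 0"
  using nrm_triangle[of x "\<ominus> x"] nrm_minus[of x] assms nrm_zero by (simp add: r_neg)

lemma nrm_sub_triangle:
  assumes "x \<in> carrier V" "y \<in> carrier V" "z \<in> carrier V"
  shows "nrm V (x \<ominus> z) \<le> nrm V (x \<ominus> y) + nrm V (y \<ominus> z)"
proof -
  have "x \<ominus> z = (x \<ominus> y) \<oplus> (y \<ominus> z)" using assms by (simp add: a_minus_def a_assoc r_neg1)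
  then show ?thesis using nrm_triangle[of "x \<ominus> y" "y \<ominus> z"] assms by simp
qed

lemma nrm_sub_commute:
  assumes "x \<in> carrier V" "y \<in> carrier V" shows "nrm V (x \<ominus> y) = nrm V (y \<ominus> x)"
proof -
  have "y \<ominus> x = \<ominus> (x \<ominus> y)" using assms by (simp add: a_minus_def minus_add a_comm)
  then show ?thesis using nrm_minus[of "x \<ominus> y"] assms by simp
qed

lemma nrm_sub_eq_zero:
  assumes "x \<in> carrier V" "y \<in> carrier V" shows "nrm V (x \<ominus> y) = 0 \<longleftrightarrow> x = y"
proof
  assume "nrm V (x \<ominus> y) = 0"
  then have "x \<ominus> y = \<zero>" using nrm_eq_zero[of "x \<ominus> y"] assms by simp
  moreover have "x = (x \<ominus> y) \<oplus> y" using assms by (simp add: a_minus_def a_assoc l_neg)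
  ultimately show "x = y" using assms by simp
qed (use assms nrm_zero in \<open>simp add: a_minus_def r_neg\<close>)

lemma sub_add_sub:
  assumes "a \<in> carrier V" "b \<in> carrier V" "c \<in> carrier V" "d \<in> carrier V"
  shows "(a \<oplus> b) \<ominus> (c \<oplus> d) = (a \<ominus> c) \<oplus> (b \<ominus> d)"
  using assms by (simp add: a_minus_def minus_add a_ac)

lemma smult_sub:
  assumes "a \<in> carrier V" "b \<in> carrier V" shows "c \<odot> (a \<ominus> b) = c \<odot> a \<ominus> c \<odot> b"
  using assms smult_r_minus[of c b] scalar_laws(2)[of a "\<ominus> b" c] by (simp add: a_minus_def ring_of_type_simps)

lemma nrm_diff_le:
  assumes "x \<in> carrier V" "y \<in> carrier V" shows "\<bar>nrm V x - nrm V y\<bar> \<le> nrm V (x \<ominus> y)"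
  using nrm_sub_triangle[OF assms zero_closed] nrm_sub_triangle[OF assms(2,1) zero_closed] nrm_sub_commute[OF assms] assms
    minus_equality[of \<zero> \<zero>]
  by (simp add: a_minus_def)

lemma metric: "Metric_space (carrier V) (nmetric V)"
  by unfold_locales (auto simp: nmetric_def nrm_nonneg nrm_sub_commute nrm_sub_eq_zero nrm_sub_triangle)

section \<open>Completeness, limits and closed subspaces\<close>

lemma banach_limit:
  assumes "banach_space V" "\<And>n. u n \<in> carrier V"
    and "\<And>e. e > 0 \<Longrightarrow> \<exists>n0::nat. \<forall>m\<ge>n0. \<forall>n\<ge>n0. nrm V (u m \<ominus> u n) < e"
  shows "\<exists>v\<in>carrier V. (\<lambda>n. nrm V (u n \<ominus> v)) \<longlonglongrightarrow> 0"
proof -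
  interpret M: Metric_space "carrier V" "nmetric V" by (rule metric)
  have "M.MCauchy u" unfolding M.MCauchy_def using assms(2,3) by (simp add: nmetric_def image_subset_iff)
  then obtain v where "limitin M.mtopology u v sequentially" using assms(1) unfolding banach_space_def M.mcomplete_def by blast
  then have v: "v \<in> carrier V" "\<And>e. e > 0 \<Longrightarrow> \<exists>n0. \<forall>n\<ge>n0. nmetric V (u n) v < e"
    unfolding M.limit_metric_sequentially by blast+
  have "(\<lambda>n. nrm V (u n \<ominus> v)) \<longlonglongrightarrow> 0"
    by (rule LIMSEQ_I) (use v assms(2) nrm_nonneg in \<open>simp add: nmetric_def\<close>)
  then show ?thesis using v(1) by blast
qed

lemma banachI:
  assumes "\<And>u. (\<And>n. u n \<in> carrier V) \<Longrightarrow> (\<And>e. e > 0 \<Longrightarrow> \<exists>n0::nat. \<forall>m\<ge>n0. \<forall>n\<ge>n0. nrm V (u m \<ominus> u n) < e) \<Longrightarrow>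
    \<exists>v\<in>carrier V. (\<lambda>n. nrm V (u n \<ominus> v)) \<longlonglongrightarrow> 0"
  shows "banach_space V"
proof -
  interpret M: Metric_space "carrier V" "nmetric V" by (rule metric)
  have "M.mcomplete" unfolding M.mcomplete_def
  proof (intro allI impI)
    fix u assume u: "M.MCauchy u"
    then have uc: "u n \<in> carrier V" for n by (auto simp: M.MCauchy_def)
    have C: "\<exists>n0::nat. \<forall>m\<ge>n0. \<forall>n\<ge>n0. nrm V (u m \<ominus> u n) < e" if "e > 0" for e
      using u that uc unfolding M.MCauchy_def by (simp add: nmetric_def)
    have "\<exists>v\<in>carrier V. (\<lambda>n. nrm V (u n \<ominus> v)) \<longlonglongrightarrow> 0" by (rule assms[OF uc]) (rule C)
    then obtain v where v: "v \<in> carrier V" "(\<lambda>n. nrm V (u n \<ominus> v)) \<longlonglongrightarrow> 0" by blast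
    have lim: "\<exists>n0. \<forall>n\<ge>n0. nmetric V (u n) v < e" if "e > 0" for e
      using LIMSEQ_D[OF v(2) that] uc v(1) nrm_nonneg by (simp add: nmetric_def)
    show "\<exists>v. limitin M.mtopology u v sequentially" unfolding M.limit_metric_sequentially
      by (intro exI[of _ v] conjI v(1) allI impI) (simp add: uc lim)
  qed
  then show ?thesis unfolding banach_space_def using normed_space_axioms by blast
qed

lemma limit_unique:
  assumes u: "\<And>n::nat. u n \<in> carrier V" and vw: "v \<in> carrier V" "w \<in> carrier V"
    and lim: "(\<lambda>n. nrm V (u n \<ominus> v)) \<longlonglongrightarrow> 0" "(\<lambda>n. nrm V (u n \<ominus> w)) \<longlonglongrightarrow> 0"
  shows "v = w"
proof -
  have "nrm V (v \<ominus> w) \<le> nrm V (u n \<ominus> v) + nrm V (u n \<ominus> w)" for n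
    using nrm_sub_triangle[OF vw(1) u vw(2), of n] nrm_sub_commute[OF vw(1) u, of n] by simp
  then have "nrm V (v \<ominus> w) \<le> 0 + 0" by (intro LIMSEQ_le_const[OF tendsto_add[OF lim]]) blast
  then have "nrm V (v \<ominus> w) = 0" using nrm_nonneg[of "v \<ominus> w"] vw by simp
  then show ?thesis using nrm_sub_eq_zero[OF vw] by blast
qed

lemma lin_subspaceD:
  assumes "lin_subspace V W"
  shows "x \<in> W \<Longrightarrow> x \<in> carrier V" "\<zero> \<in> W" "x \<in> W \<Longrightarrow> y \<in> W \<Longrightarrow> x \<oplus> y \<in> W" "x \<in> W \<Longrightarrow> c \<odot> x \<in> W" "x \<in> W \<Longrightarrow> \<ominus> x \<in> W"
proof -
  note E = submoduleE[OF assms[unfolded lin_subspace_def]]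
  show a: "x \<in> W \<Longrightarrow> x \<in> carrier V" for x using E(1) by blast
  show s: "x \<in> W \<Longrightarrow> y \<in> W \<Longrightarrow> x \<oplus> y \<in> W" for x y by (rule E(5))
  show "x \<in> W \<Longrightarrow> c \<odot> x \<in> W" by (rule E(4)) (simp_all add: ring_of_type_simps)
  show m: "x \<in> W \<Longrightarrow> \<ominus> x \<in> W" for x by (rule E(3))
  obtain x where x: "x \<in> W" using E(2) by blast
  have "x \<oplus> \<ominus> x = \<zero>" by (rule r_neg[OF a[OF x]])
  then show "\<zero> \<in> W" using s[OF x m[OF x]] by simp
qed

lemma closed_subspaceD:
  assumes W: "closed_subspace V W" and v: "v \<in> carrier V" and lim: "\<And>e. e > 0 \<Longrightarrow> \<exists>w\<in>W. nrm V (v \<ominus> w) < e"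
  shows "v \<in> W"
proof (rule ccontr)
  interpret M: Metric_space "carrier V" "nmetric V" by (rule metric)
  assume n: "v \<notin> W"
  have "closedin M.mtopology W" using W by (simp add: closed_subspace_def ntopology_def)
  then obtain r where r: "r > 0" "disjnt W (M.mball v r)" unfolding M.closedin_metric using n v by blast
  obtain w where w: "w \<in> W" "nrm V (v \<ominus> w) < r" using lim[OF r(1)] by blast
  have "w \<in> carrier V" using lin_subspaceD(1) W w(1) by (auto simp: closed_subspace_def)
  then have "w \<in> M.mball v r" using w v by (simp add: nmetric_def)
  then show False using r(2) w(1) by (auto simp: disjnt_def)
qed

text \<open>Continuity at zero of the inverse of the addition map: the map is open, so the image of
  a small box around the origin contains all elements of \<open>Z\<close> near zero, and injectivity
  identifies their summands.\<close>

lemma direct_sum_bound: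
  assumes ds: "topological_direct_sum V Z A B"
  shows "\<exists>\<delta>>0. \<forall>a\<in>A. \<forall>b\<in>B. nrm V (a \<oplus> b) < \<delta> \<longrightarrow> nrm V a < 1/2 \<and> nrm V b < 1/2"
proof -
  interpret M: Metric_space "carrier V" "nmetric V" by (rule metric)
  have nt: "ntopology V = M.mtopology" by (simp add: ntopology_def)
  have A: "lin_subspace V A" and B: "lin_subspace V B" and Z: "lin_subspace V Z" using ds by (auto simp: topological_direct_sum_def)
  have Ac: "A \<subseteq> carrier V" and Bc: "B \<subseteq> carrier V" and Zc: "Z \<subseteq> carrier V"
    using lin_subspaceD(1)[OF A] lin_subspaceD(1)[OF B] lin_subspaceD(1)[OF Z] by blast+
  define f where "f = (\<lambda>(a, b). a \<oplus> b)"
  let ?P = "prod_topology (subtopology M.mtopology A) (subtopology M.mtopology B)" and ?S = "subtopology M.mtopology Z"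
  have hom: "homeomorphic_map ?P ?S f" using ds unfolding topological_direct_sum_def nt f_def by blast
  have tops: "topspace ?P = A \<times> B" "topspace ?S = Z" using Ac Bc Zc by auto
  have img: "f ` (A \<times> B) = Z" using homeomorphic_imp_surjective_map[OF hom] unfolding tops .
  have inj: "inj_on f (A \<times> B)" using homeomorphic_imp_injective_map[OF hom] unfolding tops .
  define U where "U = (A \<inter> M.mball \<zero> (1/2)) \<times> (B \<inter> M.mball \<zero> (1/2))"
  have "openin ?P U" unfolding U_def openin_prod_Times_iff by (simp add: openin_subtopology_Int2)
  then have "openin ?S (f ` U)" using homeomorphic_imp_open_map[OF hom] unfolding open_map_def by blast
  then obtain T where T: "openin M.mtopology T" "f ` U = T \<inter> Z" unfolding openin_subtopology by blast
  have "(\<zero>, \<zero>) \<in> U" unfolding U_def using lin_subspaceD(2)[OF A] lin_subspaceD(2)[OF B] by simp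
  moreover have "f (\<zero>, \<zero>) = \<zero>" by (simp add: f_def)
  ultimately have "\<zero> \<in> T" using T(2) by (metis IntE imageI)
  then obtain d where d: "d > 0" "M.mball \<zero> d \<subseteq> T" using T(1) unfolding M.openin_mtopology by blast
  have n0: "nmetric V \<zero> x = nrm V x" if "x \<in> carrier V" for x
    using that nrm_minus[OF that] by (simp add: nmetric_def a_minus_def)
  have "nrm V a < 1/2 \<and> nrm V b < 1/2" if ab: "a \<in> A" "b \<in> B" "nrm V (a \<oplus> b) < d" for a b
  proof -
    have c: "a \<in> carrier V" "b \<in> carrier V" using ab Ac Bc by auto
    have "f (a, b) \<in> Z" using img ab(1,2) by blast
    moreover have "f (a, b) \<in> M.mball \<zero> d" using ab(3) c n0[of "a \<oplus> b"] by (simp add: f_def)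
    ultimately have "f (a, b) \<in> f ` U" using T(2) d(2) by blast
    then obtain u where u: "u \<in> U" "f (a, b) = f u" by blast
    moreover have "u \<in> A \<times> B" using u(1) by (auto simp: U_def)
    ultimately have "(a, b) = u" using inj ab(1,2) by (auto dest: inj_onD)
    then have "(a, b) \<in> U" using u(1) by simp
    then show ?thesis unfolding U_def using n0[OF c(1)] n0[OF c(2)] by simp
  qed
  then show ?thesis using d(1) by blast
qed

end


section \<open>The completion of the Gowers--Maurey norm\<close>

text \<open>The coordinates converge, and lower semicontinuity of the norm turns the Cauchy
  condition into norm convergence to the coordinatewise limit.\<close>

lemma (in gm) N_Cauchy_limit:
  assumes x: "\<And>n::nat. x n \<in> G" and C: "\<And>e. e > 0 \<Longrightarrow> \<exists>n0. \<forall>m\<ge>n0. \<forall>n\<ge>n0. N (x m - x n) \<le> e"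
  shows "\<exists>z\<in>G. (\<lambda>n. N (x n - z)) \<longlonglongrightarrow> 0"
proof -
  have "\<exists>l. (\<lambda>n. x n i) \<longlonglongrightarrow> l" for i
  proof -
    have "Cauchy (\<lambda>n. x n i)" unfolding Cauchy_iff
    proof (intro allI impI)
      fix e :: real assume e: "e > 0"
      obtain n0 where n0: "\<forall>m\<ge>n0. \<forall>n\<ge>n0. N (x m - x n) \<le> e / 2" using C[of "e / 2"] e by auto
      have "norm (x m i - x n i) < e" if "m \<ge> n0" "n \<ge> n0" for m n
        using N_coord[OF N_diff(1)[OF x x], of m n i] n0[rule_format, OF that] e by (simp add: seq_apply)
      then show "\<exists>M. \<forall>m\<ge>M. \<forall>n\<ge>M. norm (x m i - x n i) < e" by blast
    qed
    then show ?thesis by (simp add: Cauchy_convergent_iff convergent_def)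
  qed
  then obtain z where z: "\<And>i. (\<lambda>n. x n i) \<longlonglongrightarrow> z i" by metis
  have tail: "x m - z \<in> G \<and> N (x m - z) \<le> e" if n0: "\<forall>m\<ge>n0. \<forall>n\<ge>n0. N (x m - x n) \<le> e" and m: "m \<ge> n0" for e n0 m
  proof -
    have 1: "x m - x (n + n0) \<in> G" "N (x m - x (n + n0)) \<le> e" for n using N_diff(1)[OF x x] n0 m by auto
    have "(\<lambda>n. x m i - x (n + n0) i) \<longlonglongrightarrow> x m i - z i" for i by (intro tendsto_diff tendsto_const LIMSEQ_ignore_initial_segment z)
    then have 2: "(\<lambda>n. (x m - x (n + n0)) i) \<longlonglongrightarrow> (x m - z) i" for i by (simp add: seq_apply)
    show ?thesis using N_lsc[OF 1 2] by blast
  qed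
  obtain n1 where n1: "\<forall>m\<ge>n1. \<forall>n\<ge>n1. N (x m - x n) \<le> 1" using C[of 1] by auto
  have zG: "z \<in> G" using N_diff(1)[OF x[of n1], of "x n1 - z"] tail[OF n1, of n1] by simp
  have "(\<lambda>n. N (x n - z)) \<longlonglongrightarrow> 0"
  proof (rule LIMSEQ_I)
    fix e :: real assume e: "e > 0"
    obtain n0 where n0: "\<forall>m\<ge>n0. \<forall>n\<ge>n0. N (x m - x n) \<le> e / 2" using C[of "e / 2"] e by auto
    have "norm (N (x n - z) - 0) < e" if "n \<ge> n0" for n
      using tail[OF n0 that] N_nonneg[of "x n - z"] e by simp
    then show "\<exists>no. \<forall>n\<ge>no. norm (N (x n - z) - 0) < e" by blast
  qed
  then show ?thesis using zG by blast
qed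

lemma (in gm) N_sub_commute: "a \<in> G \<Longrightarrow> b \<in> G \<Longrightarrow> N (a - b) = N (b - a)"
  using N_minus[OF N_diff(1), of a b] by simp

lemma (in gm) N_sub_triangle: assumes "a \<in> G" "b \<in> G" "c \<in> G" shows "N (a - c) \<le> N (a - b) + N (b - c)"
  using N_add(2)[OF N_diff(1) N_diff(1), of a b b c] assms by simp

locale gm_completion = gm_field R j \<sigma> rho
  for R :: "'k::{real_normed_field,heine_borel} set" and j \<sigma> rho +
  fixes V :: "('k, 'v) nspace" (structure) and \<iota> :: "(nat \<Rightarrow> 'k) \<Rightarrow> 'v"
  assumes completion: "is_completion (gm_c00 R j \<sigma>) V \<iota>"
begin

lemma banach_V: "banach_space V"
  using completion by (simp add: is_completion_def)

sublocale V: normed_space V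
  using banach_V by (simp add: banach_space_def)

lemma embed:
  shows "x \<in> c00 \<Longrightarrow> \<iota> x \<in> carrier V" "x \<in> c00 \<Longrightarrow> y \<in> c00 \<Longrightarrow> \<iota> (x + y) = \<iota> x \<oplus> \<iota> y"
    "x \<in> c00 \<Longrightarrow> \<iota> (scl c x) = c \<odot> \<iota> x" "x \<in> c00 \<Longrightarrow> nrm V (\<iota> x) = N x"
  using completion gm_norm_eq_N[of x] by (auto simp: is_completion_def gm_c00_def plus_fun_def scl_def)

lemma embed_diff:
  assumes "x \<in> c00" "y \<in> c00" shows "\<iota> (x - y) = \<iota> x \<ominus> \<iota> y"
proof -
  have "x - y = x + scl (- 1) y" by simp
  then show ?thesis
    by (simp only: embed(2)[OF assms(1) c00_scl[OF assms(2)]] embed(3)[OF assms(2)] V.scalar_laws(4)[OF embed(1)[OF assms(2)]] a_minus_def)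
qed

lemma embed_dense:
  assumes "v \<in> carrier V" "e > 0" shows "\<exists>x\<in>c00. nrm V (v \<ominus> \<iota> x) < e"
proof -
  interpret M: Metric_space "carrier V" "nmetric V" by (rule V.metric)
  have "v \<in> M.mtopology closure_of (\<iota> ` c00)" using completion assms(1) by (simp add: is_completion_def ntopology_def gm_c00_def)
  then obtain x where "x \<in> c00" "\<iota> x \<in> M.mball v e" unfolding M.metric_closure_of using assms(2) by blast
  then show ?thesis by (auto simp: nmetric_def)
qed

text \<open>The isometric isomorphism from \<open>G\<close> onto the given completion, obtained as
  the limit of the embedded sections; it reduces statements about \<open>V\<close> to
  sequences.\<close>

definition \<phi> :: "(nat \<Rightarrow> 'k) \<Rightarrow> 'v" where
  "\<phi> z = (SOME v. v \<in> carrier V \<and> (\<lambda>k. nrm V (\<iota> (proj {0..<k} z) \<ominus> v)) \<longlonglongrightarrow> 0)"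

lemma phi:
  assumes z: "z \<in> G"
  shows "\<phi> z \<in> carrier V" "(\<lambda>k. nrm V (\<iota> (proj {0..<k} z) \<ominus> \<phi> z)) \<longlonglongrightarrow> 0"
proof -
  have c: "proj {0..<k} z \<in> c00" for k by (rule c00_proj_fin)
  have "\<exists>v\<in>carrier V. (\<lambda>k. nrm V (\<iota> (proj {0..<k} z) \<ominus> v)) \<longlonglongrightarrow> 0"
  proof (rule V.banach_limit[OF banach_V embed(1)[OF c]])
    fix e :: real assume e: "e > 0"
    obtain n0 where n0: "\<And>n. n \<ge> n0 \<Longrightarrow> N (z - proj {0..<n} z) < e / 2"
      using LIMSEQ_D[OF N_tail_tendsto[OF z], of "e / 2"] e N_nonneg[OF N_tail(1)[OF z]] by auto
    have "nrm V (\<iota> (proj {0..<m} z) \<ominus> \<iota> (proj {0..<n} z)) < e" if "m \<ge> n0" "n \<ge> n0" for m n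
    proof -
      have "nrm V (\<iota> (proj {0..<m} z) \<ominus> \<iota> (proj {0..<n} z)) = N (proj {0..<m} z - proj {0..<n} z)"
        unfolding embed_diff[OF c c, symmetric] by (rule embed(4)[OF c00_diff[OF c c]])
      also have "\<dots> \<le> N (z - proj {0..<m} z) + N (z - proj {0..<n} z)"
        using N_sub_triangle[OF c00_G[OF c] z c00_G[OF c], of m n] N_sub_commute[OF z c00_G[OF c], of m] by simp
      also have "\<dots> < e" using n0[OF that(1)] n0[OF that(2)] by simp
      finally show ?thesis .
    qed
    then show "\<exists>n0. \<forall>m\<ge>n0. \<forall>n\<ge>n0. nrm V (\<iota> (proj {0..<m} z) \<ominus> \<iota> (proj {0..<n} z)) < e" by blast
  qed
  then have "\<exists>v. v \<in> carrier V \<and> (\<lambda>k. nrm V (\<iota> (proj {0..<k} z) \<ominus> v)) \<longlonglongrightarrow> 0" by blast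
  from someI_ex[OF this] show "\<phi> z \<in> carrier V" "(\<lambda>k. nrm V (\<iota> (proj {0..<k} z) \<ominus> \<phi> z)) \<longlonglongrightarrow> 0"
    unfolding \<phi>_def by blast+
qed

lemma phi_add:
  assumes z: "z \<in> G" "w \<in> G" shows "\<phi> (z + w) = \<phi> z \<oplus> \<phi> w"
proof -
  have c: "\<iota> (proj {0..<k} z) \<in> carrier V" for k z by (rule embed(1)[OF c00_proj_fin])
  have "(\<lambda>k. nrm V (\<iota> (proj {0..<k} (z + w)) \<ominus> (\<phi> z \<oplus> \<phi> w))) \<longlonglongrightarrow> 0"
  proof (rule Lim_null_comparison[OF always_eventually[OF allI] tendsto_add_zero[OF phi(2)[OF z(1)] phi(2)[OF z(2)]]])
    fix k
    have "\<iota> (proj {0..<k} (z + w)) \<ominus> (\<phi> z \<oplus> \<phi> w) = (\<iota> (proj {0..<k} z) \<ominus> \<phi> z) \<oplus> (\<iota> (proj {0..<k} w) \<ominus> \<phi> w)"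
      unfolding proj_add embed(2)[OF c00_proj_fin c00_proj_fin] by (rule V.sub_add_sub[OF c c phi(1)[OF z(1)] phi(1)[OF z(2)]])
    then show "norm (nrm V (\<iota> (proj {0..<k} (z + w)) \<ominus> (\<phi> z \<oplus> \<phi> w))) \<le>
        nrm V (\<iota> (proj {0..<k} z) \<ominus> \<phi> z) + nrm V (\<iota> (proj {0..<k} w) \<ominus> \<phi> w)"
      using V.nrm_triangle[of "\<iota> (proj {0..<k} z) \<ominus> \<phi> z" "\<iota> (proj {0..<k} w) \<ominus> \<phi> w"]
        V.nrm_nonneg[of "(\<iota> (proj {0..<k} z) \<ominus> \<phi> z) \<oplus> (\<iota> (proj {0..<k} w) \<ominus> \<phi> w)"] c phi(1)[OF z(1)] phi(1)[OF z(2)] by simp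
  qed
  then show ?thesis
    by (rule V.limit_unique[OF c phi(1)[OF N_add(1)[OF z]] V.a_closed[OF phi(1)[OF z(1)] phi(1)[OF z(2)]] phi(2)[OF N_add(1)[OF z]]])
qed

lemma phi_scl:
  assumes z: "z \<in> G" shows "\<phi> (scl c z) = c \<odot> \<phi> z"
proof -
  have cr: "\<iota> (proj {0..<k} z) \<in> carrier V" for k z by (rule embed(1)[OF c00_proj_fin])
  have "(\<lambda>k. nrm V (\<iota> (proj {0..<k} (scl c z)) \<ominus> c \<odot> \<phi> z)) \<longlonglongrightarrow> 0"
  proof -
    have "\<iota> (proj {0..<k} (scl c z)) \<ominus> c \<odot> \<phi> z = c \<odot> (\<iota> (proj {0..<k} z) \<ominus> \<phi> z)" for k
      unfolding proj_scl embed(3)[OF c00_proj_fin] by (rule V.smult_sub[OF cr phi(1)[OF z], symmetric])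
    then have "nrm V (\<iota> (proj {0..<k} (scl c z)) \<ominus> c \<odot> \<phi> z) = norm c * nrm V (\<iota> (proj {0..<k} z) \<ominus> \<phi> z)" for k
      using V.nrm_smult[of "\<iota> (proj {0..<k} z) \<ominus> \<phi> z" c] cr phi(1)[OF z] by simp
    then show ?thesis using tendsto_mult_left[OF phi(2)[OF z], of "norm c"] by simp
  qed
  then show ?thesis
    by (rule V.limit_unique[OF cr phi(1)[OF N_scl(1)[OF z]] V.scalar_laws(1)[OF phi(1)[OF z]] phi(2)[OF N_scl(1)[OF z]]])
qed

lemma phi_nrm:
  assumes z: "z \<in> G" shows "nrm V (\<phi> z) = N z"
proof -
  have c: "proj {0..<k} z \<in> c00" for k by (rule c00_proj_fin)
  have "(\<lambda>k. N (proj {0..<k} z) - nrm V (\<phi> z)) \<longlonglongrightarrow> 0"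
    by (rule Lim_null_comparison[OF always_eventually[OF allI] phi(2)[OF z]])
      (use V.nrm_diff_le[OF embed(1)[OF c] phi(1)[OF z]] in \<open>simp add: embed(4)[OF c]\<close>)
  moreover have "(\<lambda>k. N (proj {0..<k} z) - N z) \<longlonglongrightarrow> 0"
  proof (rule Lim_null_comparison[OF always_eventually[OF allI] N_tail_tendsto[OF z]])
    fix k
    have "N z \<le> N (z - proj {0..<k} z) + N (proj {0..<k} z)" using N_add(2)[OF N_tail(1)[OF z, of k] c00_G[OF c[of k]]] by simp
    then show "norm (N (proj {0..<k} z) - N z) \<le> N (z - proj {0..<k} z)" using N_proj[OF z, of 0 k] by simp
  qed
  ultimately show ?thesis using LIMSEQ_unique[of "\<lambda>k. N (proj {0..<k} z)" "nrm V (\<phi> z)" "N z"] by (simp add: LIM_zero_iff)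
qed

lemma phi_diff:
  assumes "z \<in> G" "w \<in> G" shows "\<phi> (z - w) = \<phi> z \<ominus> \<phi> w"
proof -
  have "z - w = z + scl (- 1) w" by simp
  then show ?thesis
    by (simp only: phi_add[OF assms(1) N_scl(1)[OF assms(2)]] phi_scl[OF assms(2)] V.scalar_laws(4)[OF phi(1)[OF assms(2)]] a_minus_def)
qed

lemma phi_embed:
  assumes x: "x \<in> c00" shows "\<phi> x = \<iota> x"
proof -
  have c: "proj {0..<k} x \<in> c00" for k by (rule c00_proj_fin)
  have "nrm V (\<iota> (proj {0..<k} x) \<ominus> \<iota> x) = N (x - proj {0..<k} x)" for k
    using V.nrm_sub_commute[OF embed(1)[OF c] embed(1)[OF x]] embed_diff[OF x c] embed(4)[OF c00_diff[OF x c]] by simp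
  then have "(\<lambda>k. nrm V (\<iota> (proj {0..<k} x) \<ominus> \<iota> x)) \<longlonglongrightarrow> 0" using N_tail_tendsto[OF c00_G[OF x]] by simp
  then show ?thesis by (rule V.limit_unique[OF embed(1)[OF c] phi(1)[OF c00_G[OF x]] embed(1)[OF x] phi(2)[OF c00_G[OF x]]])
qed

text \<open>Approximants of \<open>v\<close> from \<open>c00\<close> form a Cauchy sequence in
  \<open>G\<close>, and its limit there is mapped to \<open>v\<close>.\<close>

lemma phi_surj:
  assumes v: "v \<in> carrier V" shows "\<exists>z\<in>G. \<phi> z = v"
proof -
  have "\<forall>n. \<exists>x\<in>c00. nrm V (v \<ominus> \<iota> x) < 1 / real (Suc n)" using embed_dense[OF v] by simp
  then obtain x where x: "\<And>n. x n \<in> c00" "\<And>n. nrm V (v \<ominus> \<iota> (x n)) < 1 / real (Suc n)" by metis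
  note xc = embed(1)[OF x(1)]
  have lim: "(\<lambda>n. nrm V (\<iota> (x n) \<ominus> v)) \<longlonglongrightarrow> 0"
    by (rule Lim_null_comparison[OF always_eventually[OF allI] LIMSEQ_Suc[OF lim_1_over_n]])
      (use x(2) V.nrm_sub_commute[OF v xc] V.nrm_nonneg[OF V.minus_closed[OF xc v]] in \<open>simp add: less_imp_le\<close>)
  have "\<exists>z\<in>G. (\<lambda>n. N (x n - z)) \<longlonglongrightarrow> 0"
  proof (rule N_Cauchy_limit[OF c00_G[OF x(1)]])
    fix e :: real assume e: "e > 0"
    obtain n0 where n0: "\<And>n. n \<ge> n0 \<Longrightarrow> nrm V (\<iota> (x n) \<ominus> v) < e / 2"
      using LIMSEQ_D[OF lim, of "e / 2"] e V.nrm_nonneg[OF V.minus_closed[OF xc v]] by auto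
    have "N (x m - x n) \<le> e" if "m \<ge> n0" "n \<ge> n0" for m n
    proof -
      have "N (x m - x n) = nrm V (\<iota> (x m) \<ominus> \<iota> (x n))" using embed_diff[OF x(1) x(1)] embed(4)[OF c00_diff[OF x(1) x(1)]] by metis
      also have "\<dots> \<le> nrm V (\<iota> (x m) \<ominus> v) + nrm V (\<iota> (x n) \<ominus> v)"
        using V.nrm_sub_triangle[OF xc v xc, of m n] V.nrm_sub_commute[OF v xc, of n] by simp
      finally show ?thesis using n0[OF that(1)] n0[OF that(2)] by simp
    qed
    then show "\<exists>n0. \<forall>m\<ge>n0. \<forall>n\<ge>n0. N (x m - x n) \<le> e" by blast
  qed
  then obtain z where z: "z \<in> G" "(\<lambda>n. N (x n - z)) \<longlonglongrightarrow> 0" by blast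
  have "nrm V (\<iota> (x n) \<ominus> \<phi> z) = N (x n - z)" for n
    using phi_diff[OF c00_G[OF x(1)] z(1), of n] phi_nrm[OF N_diff(1)[OF c00_G[OF x(1)] z(1)], of n] phi_embed[OF x(1), of n] by simp
  then have "(\<lambda>n. nrm V (\<iota> (x n) \<ominus> \<phi> z)) \<longlonglongrightarrow> 0" using z(2) by simp
  then have "\<phi> z = v" by (rule V.limit_unique[OF xc phi(1)[OF z(1)] v _ lim])
  then show ?thesis using z(1) by blast
qed

lemma phi_image: "\<phi> ` G = carrier V"
  using phi(1) phi_surj by blast

end


section \<open>Quotients of the completion\<close>

locale gm_quotient = gm_completion +
  fixes Y
  assumes closedY: "closed_subspace V Y"
begin

definition Y0 :: "(nat \<Rightarrow> 'a) set" where
  "Y0 = {z \<in> G. \<phi> z \<in> Y}"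

text \<open>The quotient seminorm; the form \<open>y + z\<close> matches the cosets
  \<open>Y +> x\<close>.\<close>

definition q :: "(nat \<Rightarrow> 'a) \<Rightarrow> real" where
  "q z = (INF y\<in>Y0. N (y + z))"

definition \<pi> :: "(nat \<Rightarrow> 'a) \<Rightarrow> 'b set" where
  "\<pi> z = Y +> \<phi> z"

abbreviation "Q \<equiv> quotient_space V Y"

lemma linY: "lin_subspace V Y"
  using closedY by (simp add: closed_subspace_def)

lemma phi_0: "\<phi> 0 = \<zero>"
  using V.nrm_eq_zero[OF phi(1)[OF N_zero(1)]] phi_nrm[OF N_zero(1)] by simp

lemma phi_Y0: "\<phi> ` Y0 = Y"
proof -
  have "y \<in> \<phi> ` Y0" if "y \<in> Y" for y
  proof -
    obtain z where "z \<in> G" "\<phi> z = y" using phi_surj[OF V.lin_subspaceD(1)[OF linY \<open>y \<in> Y\<close>]] by blast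
    then show ?thesis using \<open>y \<in> Y\<close> by (auto simp: Y0_def)
  qed
  then show ?thesis by (auto simp: Y0_def)
qed

lemma csub_Y0: "csub Y0"
  unfolding csub_def
proof (intro conjI ballI allI impI)
  show "Y0 \<subseteq> G" by (auto simp: Y0_def)
  show "0 \<in> Y0" using V.lin_subspaceD(2)[OF linY] by (simp add: Y0_def phi_0)
  show "x + y \<in> Y0" if "x \<in> Y0" "y \<in> Y0" for x y
    using that V.lin_subspaceD(3)[OF linY] by (simp add: Y0_def phi_add N_add(1))
  show "scl c x \<in> Y0" if "x \<in> Y0" for c x
    using that V.lin_subspaceD(4)[OF linY] by (simp add: Y0_def phi_scl N_scl(1))
  fix z assume z: "z \<in> G" and lim: "\<forall>e>0. \<exists>y\<in>Y0. N (z - y) \<le> e"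
  have "\<phi> z \<in> Y"
  proof (rule V.closed_subspaceD[OF closedY phi(1)[OF z]])
    fix e :: real assume e: "e > 0"
    obtain y where y: "y \<in> Y0" "N (z - y) \<le> e / 2" using lim e by (meson half_gt_zero)
    then have yG: "y \<in> G" "\<phi> y \<in> Y" by (auto simp: Y0_def)
    have "nrm V (\<phi> z \<ominus> \<phi> y) < e" unfolding phi_diff[OF z yG(1), symmetric] phi_nrm[OF N_diff(1)[OF z yG(1)]] using y(2) e by simp
    then show "\<exists>w\<in>Y. nrm V (\<phi> z \<ominus> w) < e" using yG(2) by blast
  qed
  then show "z \<in> Y0" using z by (simp add: Y0_def)
qed

lemmas Y0D = csubD[OF csub_Y0]

section \<open>Operations of the quotient in terms of representatives\<close>

lemma pi_image: assumes "z \<in> G" shows "\<pi> z = (\<lambda>y. \<phi> (y + z)) ` Y0"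
proof -
  have "\<pi> z = (\<lambda>h. h \<oplus> \<phi> z) ` \<phi> ` Y0" unfolding \<pi>_def phi_Y0 a_r_coset_def' by blast
  also have "\<dots> = (\<lambda>y. \<phi> (y + z)) ` Y0" unfolding image_image
    by (rule image_cong[OF refl]) (simp add: phi_add[OF Y0D(1) assms])
  finally show ?thesis .
qed

lemma pi_eqI: assumes "z \<in> G" "w \<in> G" "z - w \<in> Y0" shows "\<pi> z = \<pi> w"
proof -
  have le: "\<pi> z \<subseteq> \<pi> w" if "z \<in> G" "w \<in> G" "z - w \<in> Y0" for z w
    unfolding pi_image[OF that(1)] pi_image[OF that(2)]
  proof (rule image_subsetI)
    fix y assume "y \<in> Y0"
    then have "y + (z - w) \<in> Y0" by (rule Y0D(3)[OF _ that(3)])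
    moreover have "\<phi> (y + z) = \<phi> (y + (z - w) + w)" by simp
    ultimately show "\<phi> (y + z) \<in> (\<lambda>y. \<phi> (y + w)) ` Y0" by blast
  qed
  have "w - z \<in> Y0" using Y0D(5)[OF Y0D(2) assms(3)] by simp
  then show ?thesis using le[OF assms] le[OF assms(2,1)] by blast
qed

lemma zero_Q: "\<zero>\<^bsub>Q\<^esub> = \<pi> 0"
  unfolding pi_image[OF N_zero(1)] by (simp add: quotient_space_def phi_Y0)

lemma carrier_Q: "carrier Q = \<pi> ` G"
proof -
  have "carrier Q = (\<lambda>v. Y +> v) ` \<phi> ` G" unfolding phi_image by (auto simp: quotient_space_def A_RCOSETS_def')
  then show ?thesis by (simp add: image_image \<pi>_def)
qed

lemma add_Q: assumes "z \<in> G" "w \<in> G" shows "\<pi> z \<oplus>\<^bsub>Q\<^esub> \<pi> w = \<pi> (z + w)"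
proof -
  have e: "\<phi> (y + z) \<oplus> \<phi> (y' + w) = \<phi> (y + y' + (z + w))" if "y \<in> Y0" "y' \<in> Y0" for y y'
    using phi_add[OF N_add(1)[OF Y0D(1)[OF that(1)] assms(1)] N_add(1)[OF Y0D(1)[OF that(2)] assms(2)]] by (simp add: add_ac)
  have "\<pi> z \<oplus>\<^bsub>Q\<^esub> \<pi> w = (\<Union>h\<in>\<pi> z. \<Union>k\<in>\<pi> w. {h \<oplus> k})" by (simp add: quotient_space_def set_add_def')
  also have "\<dots> = \<pi> (z + w)" (is "?L = _")
    unfolding pi_image[OF assms(1)] pi_image[OF assms(2)] pi_image[OF N_add(1)[OF assms]]
  proof (intro equalityI subsetI)
    fix v assume "v \<in> (\<Union>h\<in>(\<lambda>y. \<phi> (y + z)) ` Y0. \<Union>k\<in>(\<lambda>y. \<phi> (y + w)) ` Y0. {h \<oplus> k})"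
    then obtain y y' where "y \<in> Y0" "y' \<in> Y0" "v = \<phi> (y + z) \<oplus> \<phi> (y' + w)" by blast
    then show "v \<in> (\<lambda>y. \<phi> (y + (z + w))) ` Y0" using e Y0D(3) by blast
  next
    fix v assume "v \<in> (\<lambda>y. \<phi> (y + (z + w))) ` Y0"
    then obtain y where y: "y \<in> Y0" "v = \<phi> (y + (z + w))" by blast
    then have "v = \<phi> (y + z) \<oplus> \<phi> (0 + w)" using e[OF y(1) Y0D(2)] by simp
    then show "v \<in> (\<Union>h\<in>(\<lambda>y. \<phi> (y + z)) ` Y0. \<Union>k\<in>(\<lambda>y. \<phi> (y + w)) ` Y0. {h \<oplus> k})" using y(1) Y0D(2) by blast
  qed
  finally show ?thesis .
qed

lemma smult_Q: assumes "z \<in> G" shows "c \<odot>\<^bsub>Q\<^esub> \<pi> z = \<pi> (scl c z)"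
proof -
  have "Y +> (c \<odot> \<phi> (y + z)) = \<pi> (scl c z)" if "y \<in> Y0" for y
  proof -
    have g: "y + z \<in> G" by (rule N_add(1)[OF Y0D(1)[OF that] assms])
    have "scl c (y + z) - scl c z \<in> Y0" using Y0D(4)[OF that, of c] by (simp add: scl_add)
    from pi_eqI[OF N_scl(1)[OF g] N_scl(1)[OF assms] this] show ?thesis unfolding \<pi>_def phi_scl[OF g] .
  qed
  then have "(\<Union>x\<in>\<pi> z. Y +> (c \<odot> x)) = \<pi> (scl c z)"
    unfolding pi_image[OF assms] using Y0D(2) by (simp add: image_image) blast
  then show ?thesis by (simp add: quotient_space_def)
qed

lemma nrm_Q: assumes "z \<in> G" shows "nrm Q (\<pi> z) = q z"
proof -
  have "nrm V ` \<pi> z = (\<lambda>y. N (y + z)) ` Y0" unfolding pi_image[OF assms] image_image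
    by (rule image_cong[OF refl]) (rule phi_nrm[OF N_add(1)[OF Y0D(1) assms]])
  then show ?thesis by (simp add: quotient_space_def q_def)
qed

section \<open>The quotient norm\<close>

lemma q_le: assumes "z \<in> G" "y \<in> Y0" shows "q z \<le> N (y + z)"
  unfolding q_def by (rule cINF_lower[OF _ assms(2)]) (rule bdd_belowI2[of _ 0], rule N_nonneg[OF N_add(1)[OF Y0D(1) assms(1)]])

lemma q_ge: assumes "\<And>y. y \<in> Y0 \<Longrightarrow> c \<le> N (y + z)" shows "c \<le> q z"
  unfolding q_def using Y0D(2) by (intro cINF_greatest assms) blast+

lemma q_near: assumes "z \<in> G" "e > 0" shows "\<exists>y\<in>Y0. N (y + z) < q z + e"
  using q_ge[of "q z + e" z] assms(2) by (meson add_le_same_cancel1 not_le)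

lemma q_nonneg: "z \<in> G \<Longrightarrow> q z \<ge> 0"
  by (rule q_ge) (rule N_nonneg[OF N_add(1)[OF Y0D(1)]])

lemma q_le_N: "z \<in> G \<Longrightarrow> q z \<le> N z"
  using q_le[OF _ Y0D(2)] by simp

lemma q_triangle: assumes "z \<in> G" "w \<in> G" shows "q (z + w) \<le> q z + q w"
proof (rule field_le_epsilon)
  fix e :: real assume e: "e > 0"
  obtain y y' where y: "y \<in> Y0" "N (y + z) < q z + e / 2" "y' \<in> Y0" "N (y' + w) < q w + e / 2"
    using q_near[OF assms(1), of "e / 2"] q_near[OF assms(2), of "e / 2"] e by auto
  have "q (z + w) \<le> N (y + y' + (z + w))" by (rule q_le[OF N_add(1)[OF assms] Y0D(3)[OF y(1,3)]])
  also have "\<dots> = N ((y + z) + (y' + w))" by (simp add: add_ac)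
  also have "\<dots> \<le> N (y + z) + N (y' + w)" by (rule N_add(2)[OF N_add(1)[OF Y0D(1)[OF y(1)] assms(1)] N_add(1)[OF Y0D(1)[OF y(3)] assms(2)]])
  finally show "q (z + w) \<le> q z + q w + e" using y(2,4) by linarith
qed

lemma q_scl: assumes z: "z \<in> G" shows "q (scl c z) = norm c * q z"
proof -
  have le: "q (scl c z) \<le> norm c * q z" if z: "z \<in> G" for c z
  proof (rule field_le_epsilon)
    fix e :: real assume e: "e > 0"
    define d where "d = e / (norm c + 1)"
    have d: "d > 0" "norm c * d \<le> e" using e by (auto simp: d_def field_simps add_pos_nonneg)
    obtain y where y: "y \<in> Y0" "N (y + z) < q z + d" using q_near[OF z d(1)] by blast
    have "q (scl c z) \<le> N (scl c y + scl c z)" by (rule q_le[OF N_scl(1)[OF z] Y0D(4)[OF y(1)]])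
    also have "\<dots> = norm c * N (y + z)" unfolding scl_add[symmetric] by (rule N_scl(2)[OF N_add(1)[OF Y0D(1)[OF y(1)] z]])
    also have "\<dots> \<le> norm c * (q z + d)" using y(2) by (intro mult_left_mono) auto
    finally show "q (scl c z) \<le> norm c * q z + e" using d(2) by (simp add: distrib_left)
  qed
  show ?thesis
  proof (cases "c = 0")
    case True
    then show ?thesis using le[OF z, of c] q_nonneg[OF N_scl(1)[OF z, of c]] by simp
  next
    case False
    have "z = scl (inverse c) (scl c z)" using False by simp
    then have "norm c * q z \<le> norm c * (norm (inverse c) * q (scl c z))"
      using le[OF N_scl(1)[OF z], of "inverse c" c] by (intro mult_left_mono) auto
    also have "\<dots> = q (scl c z)" using False by (simp add: norm_inverse)
    finally show ?thesis using le[OF z, of c] by simp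
  qed
qed

lemma q_eq_zero: assumes z: "z \<in> G" and q0: "q z = 0" shows "z \<in> Y0"
proof (rule Y0D(6)[OF z])
  fix e :: real assume e: "e > 0"
  obtain y where y: "y \<in> Y0" "N (y + z) < e" using q_near[OF z e] q0 by auto
  have "N (z - (- y)) \<le> e" using y(2) by (simp add: add.commute)
  moreover have "- y \<in> Y0" using Y0D(5)[OF Y0D(2) y(1)] by simp
  ultimately show "\<exists>y\<in>Y0. N (z - y) \<le> e" by blast
qed

lemma normed_Q: "normed_space Q"
proof -
  have grp: "abelian_group Q"
  proof (rule abelian_groupI)
    show "\<zero>\<^bsub>Q\<^esub> \<in> carrier Q" by (auto simp: carrier_Q zero_Q)
    fix x y z assume "x \<in> carrier Q" "y \<in> carrier Q" "z \<in> carrier Q"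
    then obtain a b c where abc: "x = \<pi> a" "y = \<pi> b" "z = \<pi> c" "a \<in> G" "b \<in> G" "c \<in> G" unfolding carrier_Q by blast
    show "x \<oplus>\<^bsub>Q\<^esub> y \<in> carrier Q" using abc by (auto simp: carrier_Q add_Q N_add(1))
    show "x \<oplus>\<^bsub>Q\<^esub> y \<oplus>\<^bsub>Q\<^esub> z = x \<oplus>\<^bsub>Q\<^esub> (y \<oplus>\<^bsub>Q\<^esub> z)" using abc by (simp add: add_Q N_add(1) add.assoc)
    show "x \<oplus>\<^bsub>Q\<^esub> y = y \<oplus>\<^bsub>Q\<^esub> x" using abc by (simp add: add_Q add.commute)
    show "\<zero>\<^bsub>Q\<^esub> \<oplus>\<^bsub>Q\<^esub> x = x" using abc by (simp add: zero_Q add_Q)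
    have "\<pi> (- a) \<oplus>\<^bsub>Q\<^esub> x = \<zero>\<^bsub>Q\<^esub>" "\<pi> (- a) \<in> carrier Q" using abc N_minus[OF abc(4)] by (auto simp: zero_Q add_Q carrier_Q)
    then show "\<exists>y\<in>carrier Q. y \<oplus>\<^bsub>Q\<^esub> x = \<zero>\<^bsub>Q\<^esub>" by blast
  qed
  have "module (ring_of_type_algebra :: 'a ring) Q"
  proof (rule moduleI[OF cring_from_type_algebra grp])
    fix a b :: 'a and x assume "x \<in> carrier Q"
    then obtain u where u: "x = \<pi> u" "u \<in> G" unfolding carrier_Q by blast
    show "a \<odot>\<^bsub>Q\<^esub> x \<in> carrier Q" using u by (auto simp: carrier_Q smult_Q N_scl(1))
    have "scl (a + b) u = scl a u + scl b u" by (rule ext) (simp add: seq_apply distrib_right)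
    then show "(a \<oplus>\<^bsub>ring_of_type_algebra\<^esub> b) \<odot>\<^bsub>Q\<^esub> x = a \<odot>\<^bsub>Q\<^esub> x \<oplus>\<^bsub>Q\<^esub> b \<odot>\<^bsub>Q\<^esub> x"
      using u by (simp add: ring_of_type_simps smult_Q add_Q N_scl(1))
    have "scl (a * b) u = scl a (scl b u)" by (rule ext) (simp add: seq_apply mult.assoc)
    then show "(a \<otimes>\<^bsub>ring_of_type_algebra\<^esub> b) \<odot>\<^bsub>Q\<^esub> x = a \<odot>\<^bsub>Q\<^esub> (b \<odot>\<^bsub>Q\<^esub> x)"
      using u by (simp add: ring_of_type_simps smult_Q N_scl(1))
    show "\<one>\<^bsub>ring_of_type_algebra\<^esub> \<odot>\<^bsub>Q\<^esub> x = x" using u by (simp add: ring_of_type_simps smult_Q)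
    fix y assume "y \<in> carrier Q"
    then obtain v where v: "y = \<pi> v" "v \<in> G" unfolding carrier_Q by blast
    show "a \<odot>\<^bsub>Q\<^esub> (x \<oplus>\<^bsub>Q\<^esub> y) = a \<odot>\<^bsub>Q\<^esub> x \<oplus>\<^bsub>Q\<^esub> a \<odot>\<^bsub>Q\<^esub> y"
      using u v by (simp add: smult_Q add_Q N_scl(1) N_add(1) scl_add)
  qed
  moreover have "normed_space_axioms Q"
  proof
    fix x assume "x \<in> carrier Q"
    then obtain u where u: "x = \<pi> u" "u \<in> G" unfolding carrier_Q by blast
    show "nrm Q x = 0 \<longleftrightarrow> x = \<zero>\<^bsub>Q\<^esub>"
    proof
      assume "nrm Q x = 0"
      then have "u \<in> Y0" using q_eq_zero[OF u(2)] nrm_Q[OF u(2)] u(1) by simp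
      then show "x = \<zero>\<^bsub>Q\<^esub>" using pi_eqI[OF u(2) N_zero(1)] u(1) by (simp add: zero_Q)
    next
      assume "x = \<zero>\<^bsub>Q\<^esub>"
      then show "nrm Q x = 0" using nrm_Q[OF N_zero(1)] q_nonneg[OF N_zero(1)] q_le_N[OF N_zero(1)] by (simp add: zero_Q)
    qed
    show "nrm Q (c \<odot>\<^bsub>Q\<^esub> x) = norm c * nrm Q x" for c using u by (simp add: smult_Q nrm_Q N_scl(1) q_scl)
    fix y assume "y \<in> carrier Q"
    then obtain v where v: "y = \<pi> v" "v \<in> G" unfolding carrier_Q by blast
    show "nrm Q (x \<oplus>\<^bsub>Q\<^esub> y) \<le> nrm Q x + nrm Q y" using u v by (simp add: add_Q nrm_Q N_add(1) q_triangle)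
  qed
  ultimately show ?thesis by (rule normed_space.intro)
qed

sublocale Q: normed_space Q
  by (rule normed_Q)

lemma minus_Q: assumes "z \<in> G" shows "\<ominus>\<^bsub>Q\<^esub> \<pi> z = \<pi> (- z)"
proof (rule Q.minus_equality)
  show "\<pi> (- z) \<oplus>\<^bsub>Q\<^esub> \<pi> z = \<zero>\<^bsub>Q\<^esub>" using add_Q[of "- z" z] N_minus[OF assms] assms by (simp add: zero_Q)
qed (use N_minus[OF assms] assms in \<open>auto simp: carrier_Q\<close>)

lemma sub_Q: assumes "z \<in> G" "w \<in> G" shows "\<pi> z \<ominus>\<^bsub>Q\<^esub> \<pi> w = \<pi> (z - w)"
  using add_Q[of z "- w"] minus_Q[OF assms(2)] N_minus[OF assms(2)] assms by (simp add: a_minus_def)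

text \<open>Along a subsequence with gaps below \<open>(1/2) ^ k\<close>, the differences have
  representatives modulo \<open>Y0\<close> of that size; these telescope to a Cauchy sequence
  \<open>w\<close> in \<open>G\<close>.\<close>

lemma q_complete:
  assumes x: "\<And>n::nat. x n \<in> G" and C: "\<And>e. e > 0 \<Longrightarrow> \<exists>n0. \<forall>m\<ge>n0. \<forall>n\<ge>n0. q (x m - x n) < e"
  shows "\<exists>z\<in>G. (\<lambda>n. q (x n - z)) \<longlonglongrightarrow> 0"
proof -
  have "\<exists>n0. \<forall>m\<ge>n0. \<forall>n\<ge>n0. q (x m - x n) < (1/2) ^ k" for k :: nat by (rule C) simp
  then obtain c where c: "\<And>k m n. m \<ge> c k \<Longrightarrow> n \<ge> c k \<Longrightarrow> q (x m - x n) < (1/2) ^ k" by metis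
  define r where "r k = Max (c ` {..k})" for k
  have r: "r k \<ge> c k" "r (Suc k) \<ge> r k" for k unfolding r_def by (auto intro!: Max_mono)
  have "\<exists>y\<in>Y0. N (y + (x (r (Suc k)) - x (r k))) < (1/2) ^ k" for k
  proof -
    let ?d = "x (r (Suc k)) - x (r k)"
    have "q ?d < (1/2) ^ k" by (rule c) (use r[of k] in linarith)+
    then have "\<exists>y\<in>Y0. N (y + ?d) < q ?d + ((1/2) ^ k - q ?d)" by (intro q_near N_diff(1) x) simp
    then show ?thesis by simp
  qed
  then obtain y where y: "\<And>k. y k \<in> Y0" "\<And>k. N (y k + (x (r (Suc k)) - x (r k))) < (1/2) ^ k" by metis
  define w where "w k = x (r k) + (\<Sum>i<k. y i)" for k
  have sY: "(\<Sum>i<k. y i) \<in> Y0" for k by (rule Y0D(7)[OF y(1)])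
  have wG: "w k \<in> G" for k unfolding w_def by (rule N_add(1)[OF x Y0D(1)[OF sY]])
  have step: "N (w (k + i) - w k) \<le> 2 * (1/2) ^ k - 2 * (1/2) ^ (k + i)" for k i
  proof (induction i)
    case (Suc i)
    have "w (Suc (k + i)) - w (k + i) = y (k + i) + (x (r (Suc (k + i))) - x (r (k + i)))" by (simp add: w_def)
    then have "N (w (Suc (k + i)) - w (k + i)) \<le> (1/2) ^ (k + i)" using y(2)[of "k + i"] by simp
    then show ?case using Suc N_sub_triangle[OF wG[of "Suc (k + i)"] wG[of "k + i"] wG[of k]] by simp
  qed simp
  have "\<exists>z\<in>G. (\<lambda>k. N (w k - z)) \<longlonglongrightarrow> 0"
  proof (rule N_Cauchy_limit[OF wG])
    fix e :: real assume e: "e > 0"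
    obtain k where k: "(1/2) ^ k < e / 4" using real_arch_pow_inv[of "e / 4" "1/2"] e by auto
    have near: "N (w m - w k) \<le> e / 2" if "m \<ge> k" for m
    proof -
      have "N (w m - w k) \<le> 2 * (1/2) ^ k - 2 * (1/2) ^ m" using step[of k "m - k"] that by simp
      moreover have "(0::real) \<le> (1/2) ^ m" by (rule zero_le_power) simp
      ultimately show ?thesis using k by linarith
    qed
    have "N (w m - w n) \<le> e" if "m \<ge> k" "n \<ge> k" for m n
      using near[OF that(1)] near[OF that(2)] N_sub_triangle[OF wG[of m] wG[of k] wG[of n]] N_sub_commute[OF wG[of k] wG[of n]] by linarith
    then show "\<exists>n0. \<forall>m\<ge>n0. \<forall>n\<ge>n0. N (w m - w n) \<le> e" by blast
  qed
  then obtain z where z: "z \<in> G" "(\<lambda>k. N (w k - z)) \<longlonglongrightarrow> 0" by blast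
  have qx: "q (x n - z) \<le> q (x n - x (r k)) + N (w k - z)" for n k
  proof -
    have "q (x n - z) \<le> q (x n - x (r k)) + q (x (r k) - z)"
      using q_triangle[OF N_diff(1)[OF x x] N_diff(1)[OF x z(1)], of n "r k" "r k"] by simp
    moreover have "q (x (r k) - z) \<le> N ((\<Sum>i<k. y i) + (x (r k) - z))" by (rule q_le[OF N_diff(1)[OF x z(1)] sY])
    moreover have "(\<Sum>i<k. y i) + (x (r k) - z) = w k - z" by (simp add: w_def)
    ultimately show ?thesis by simp
  qed
  have "(\<lambda>n. q (x n - z)) \<longlonglongrightarrow> 0"
  proof (rule LIMSEQ_I)
    fix e :: real assume e: "e > 0"
    obtain k1 where k1: "\<forall>k\<ge>k1. norm (N (w k - z) - 0) < e / 2" using LIMSEQ_D[OF z(2), of "e / 2"] e by auto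
    obtain k2 where k2: "(1/2) ^ k2 < e / 2" using real_arch_pow_inv[of "e / 2" "1/2"] e by auto
    define k where "k = max k1 k2"
    have "(1/2::real) ^ k \<le> (1/2) ^ k2" by (rule power_decreasing) (auto simp: k_def)
    then have k: "(1/2) ^ k < e / 2" using k2 by linarith
    have kN: "N (w k - z) < e / 2" using k1[rule_format, of k] N_nonneg[OF N_diff(1)[OF wG z(1)], of k] by (simp add: k_def)
    have "norm (q (x n - z) - 0) < e" if "n \<ge> r k" for n
      using qx[of n k] c[of k n "r k"] r(1)[of k] that k kN q_nonneg[OF N_diff(1)[OF x z(1)], of n] by simp
    then show "\<exists>no. \<forall>n\<ge>no. norm (q (x n - z) - 0) < e" by blast
  qed
  then show ?thesis using z(1) by blast
qed

lemma banach_Q: "banach_space Q"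
proof (rule Q.banachI)
  fix u assume u: "\<And>n. u n \<in> carrier Q" and C: "\<And>e. e > 0 \<Longrightarrow> \<exists>n0::nat. \<forall>m\<ge>n0. \<forall>n\<ge>n0. nrm Q (u m \<ominus>\<^bsub>Q\<^esub> u n) < e"
  have "\<forall>n. \<exists>x\<in>G. u n = \<pi> x" using u unfolding carrier_Q by blast
  then obtain x where x: "\<And>n. x n \<in> G" "\<And>n. u n = \<pi> (x n)" by metis
  have "nrm Q (u m \<ominus>\<^bsub>Q\<^esub> u n) = q (x m - x n)" for m n
    by (simp add: x sub_Q nrm_Q N_diff(1))
  then have "\<exists>z\<in>G. (\<lambda>n. q (x n - z)) \<longlonglongrightarrow> 0" using C by (intro q_complete x(1)) simp
  then obtain z where z: "z \<in> G" "(\<lambda>n. q (x n - z)) \<longlonglongrightarrow> 0" by blast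
  then have "(\<lambda>n. nrm Q (u n \<ominus>\<^bsub>Q\<^esub> \<pi> z)) \<longlonglongrightarrow> 0" by (simp add: x sub_Q nrm_Q N_diff(1))
  moreover have "\<pi> z \<in> carrier Q" using z(1) by (simp add: carrier_Q)
  ultimately show "\<exists>v\<in>carrier Q. (\<lambda>n. nrm Q (u n \<ominus>\<^bsub>Q\<^esub> v)) \<longlonglongrightarrow> 0" by blast
qed

text \<open>Finitely many vectors spanning the preimage modulo \<open>Y0\<close> would have images
  whose hull is all of \<open>A\<close>.\<close>

lemma subspace_pullback:
  assumes A: "lin_subspace Q A" and inf: "infinite_dim Q A"
  shows "subsp Y0 {z \<in> G. \<pi> z \<in> A}" "infdim_mod Y0 {z \<in> G. \<pi> z \<in> A}"
proof -
  note AD = Q.lin_subspaceD[OF A]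
  have "\<pi> y \<in> A" if "y \<in> Y0" for y
    using pi_eqI[OF Y0D(1)[OF that] N_zero(1)] that AD(2) by (simp add: zero_Q)
  moreover have "\<pi> (x + y) \<in> A" if "x \<in> G" "\<pi> x \<in> A" "y \<in> G" "\<pi> y \<in> A" for x y
    using AD(3)[OF that(2,4)] by (simp add: add_Q that)
  moreover have "\<pi> (scl c x) \<in> A" if "x \<in> G" "\<pi> x \<in> A" for c x
    using AD(4)[OF that(2), of c] by (simp add: smult_Q that)
  ultimately show "subsp Y0 {z \<in> G. \<pi> z \<in> A}" unfolding subsp_def using Y0D(1) N_add(1) N_scl(1) by auto
  show "infdim_mod Y0 {z \<in> G. \<pi> z \<in> A}" unfolding infdim_mod_def
  proof (intro notI, elim exE conjE)
    fix n :: nat and v assume v: "\<forall>i<n. v i \<in> {z \<in> G. \<pi> z \<in> A}"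
      and span: "\<forall>a\<in>{z \<in> G. \<pi> z \<in> A}. \<exists>c. a - (\<Sum>i<n. scl (c i) (v i)) \<in> Y0"
    define S where "S = (\<lambda>i. \<pi> (v i)) ` {..<n}"
    have SA: "S \<subseteq> A" "finite S" using v by (auto simp: S_def)
    have "lin_subspace Q hull S = A"
    proof
      show "lin_subspace Q hull S \<subseteq> A" by (rule hull_minimal[of S A "lin_subspace Q", OF SA(1) A])
      have "a \<in> T" if a: "a \<in> A" and T: "S \<subseteq> T" "lin_subspace Q T" for a T
      proof -
        note TD = Q.lin_subspaceD[OF T(2)]
        obtain z where z: "z \<in> G" "a = \<pi> z" using AD(1)[OF a] unfolding carrier_Q by blast
        obtain c where c: "z - (\<Sum>i<n. scl (c i) (v i)) \<in> Y0" using span z a by blast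
        have part: "(\<Sum>i<k. scl (c i) (v i)) \<in> G \<and> \<pi> (\<Sum>i<k. scl (c i) (v i)) \<in> T" if "k \<le> n" for k
          using that
        proof (induction k)
          case 0 show ?case using TD(2) by (simp add: zero_Q)
        next
          case (Suc k)
          have vk: "v k \<in> G" "\<pi> (v k) \<in> T" using v T(1) Suc(2) by (auto simp: S_def)
          have "\<pi> (scl (c k) (v k)) \<in> T" using TD(4)[OF vk(2), of "c k"] by (simp add: smult_Q vk(1))
          then show ?case using Suc N_add(1) N_scl(1)[OF vk(1)] TD(3) add_Q[symmetric] by simp
        qed
        have "a = \<pi> (\<Sum>i<n. scl (c i) (v i))" unfolding z(2) by (rule pi_eqI[OF z(1) _ c]) (use part[of n] in simp)
        then show ?thesis using part[of n] by simp
      qed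
      then show "A \<subseteq> lin_subspace Q hull S" unfolding hull_def by blast
    qed
    then show False using inf SA unfolding infinite_dim_def by blast
  qed
qed

text \<open>In a topological direct sum a small difference \<open>a - b\<close> forces both
  \<open>a\<close> and \<open>b\<close> to have quotient norm below 1/2, so that
  \<open>a + b\<close> has quotient norm below 1. The pair from
  \<open>exists_close_pair_far_from_subspace\<close> violates this.\<close>

lemma HI_Q: assumes inf: "infinite_dim Q (carrier Q)" shows "HI Q"
proof -
  have False if A: "closed_subspace Q A" "infinite_dim Q A" and B: "closed_subspace Q B" "infinite_dim Q B"
    and ds: "topological_direct_sum Q Z A B" for Z A B
  proof -
    have lA: "lin_subspace Q A" and lB: "lin_subspace Q B" using A(1) B(1) by (auto simp: closed_subspace_def)
    obtain d where d: "d > 0" "\<And>a b. a \<in> A \<Longrightarrow> b \<in> B \<Longrightarrow> nrm Q (a \<oplus>\<^bsub>Q\<^esub> b) < d \<Longrightarrow> nrm Q a < 1/2 \<and> nrm Q b < 1/2"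
      using Q.direct_sum_bound[OF ds] by blast
    from exists_close_pair_far_from_subspace[OF csub_Y0 subspace_pullback[OF lA A(2)] subspace_pullback[OF lB B(2)] half_gt_zero[OF d(1)]]
    obtain a b where ab: "a \<in> G" "\<pi> a \<in> A" "b \<in> G" "\<pi> b \<in> B" "\<forall>y\<in>Y0. N (a + b - y) \<ge> 1" "N (a - b) \<le> d / 2" by blast
    have "nrm Q (\<pi> a \<oplus>\<^bsub>Q\<^esub> \<pi> (- b)) = q (a - b)" using ab(1,3) N_minus[OF ab(3)] N_diff(1)[OF ab(1,3)] by (simp add: add_Q nrm_Q)
    also have "\<dots> < d" using q_le_N[OF N_diff(1)[OF ab(1,3)]] ab(6) d(1) by simp
    finally have 1: "nrm Q (\<pi> a) < 1/2 \<and> nrm Q (\<pi> (- b)) < 1/2"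
      using d(2)[OF ab(2) Q.lin_subspaceD(5)[OF lB ab(4)]] by (simp add: minus_Q[OF ab(3)])
    moreover have "q (- b) = q b" using q_scl[OF ab(3), of "- 1"] by simp
    ultimately have "q a + q b < 1" using nrm_Q[OF ab(1)] nrm_Q[of "- b"] N_minus[OF ab(3)] by simp
    moreover have "1 \<le> q (a + b)"
    proof (rule q_ge)
      fix y assume "y \<in> Y0"
      then have "- y \<in> Y0" using Y0D(5)[OF Y0D(2)] by force
      from ab(5)[rule_format, OF this] show "1 \<le> N (y + (a + b))" by (simp add: add_ac)
    qed
    ultimately show False using q_triangle[OF ab(1,3)] by linarith
  qed
  then show ?thesis unfolding HI_def using banach_Q inf by blast
qed

end

lemma (in gm_completion) QHI_V: "QHI V"
  unfolding QHI_def
proof (intro conjI allI impI banach_V, elim conjE)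
  fix Y assume "closed_subspace V Y" and inf: "infinite_dim (quotient_space V Y) (carrier (quotient_space V Y))"
  then interpret gm_quotient R j \<sigma> rho V \<iota> Y by unfold_locales
  show "HI (quotient_space V Y)" by (rule HI_Q[OF inf])
qed

theorem mainTheorem1:
  fixes j :: "nat \<Rightarrow> nat"
    and \<sigma> :: "(nat \<Rightarrow> real) list \<Rightarrow> nat"
    and V :: "(real, 'v) nspace"
    and \<iota> :: "(nat \<Rightarrow> real) \<Rightarrow> 'v"
    and \<sigma>' :: "(nat \<Rightarrow> complex) list \<Rightarrow> nat"
    and V' :: "(complex, 'w) nspace"
    and \<iota>' :: "(nat \<Rightarrow> complex) \<Rightarrow> 'w"
  assumes "gm_lacunary j"
  shows "(gm_coding \<rat> j \<sigma> \<and> is_completion (gm_c00 \<rat> j \<sigma>) V \<iota> \<longrightarrow> QHI V) \<and>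
         (gm_coding complex_rationals j \<sigma>' \<and>
          is_completion (gm_c00 complex_rationals j \<sigma>') V' \<iota>' \<longrightarrow> QHI V')"
proof (intro conjI impI; elim conjE)
  assume s: "gm_coding \<rat> j \<sigma>" and c: "is_completion (gm_c00 \<rat> j \<sigma>) V \<iota>"
  have "gm_completion \<rat> j \<sigma> (\<lambda>x. x) V \<iota>"
  proof
    show "\<exists>r\<in>\<rat>. norm (x - r) < e" if "e > 0" for x e :: real
    proof -
      from Rats_dense_in_real[of x "x + e"] that obtain r where "r \<in> \<rat>" "x < r" "r < x + e" by auto
      then show ?thesis by (intro bexI[of _ r]) auto
    qed
    show "\<exists>a. \<forall>x. u x = a * x" if "\<And>r x. u (of_real r * x) = r * u x" for u :: "real \<Rightarrow> real"
    proof (intro exI allI)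
      fix x show "u x = u 1 * x" using that[of x 1] by (simp add: mult.commute)
    qed
    show "\<exists>B::real set. finite B \<and> (\<forall>x. \<exists>c. x = (\<Sum>b\<in>B. of_real (c b) * b))"
      by (rule exI[of _ "{1}"]) auto
  qed (use assms s c in auto)
  then show "QHI V" by (rule gm_completion.QHI_V)
next
  assume s: "gm_coding complex_rationals j \<sigma>'" and c: "is_completion (gm_c00 complex_rationals j \<sigma>') V' \<iota>'"
  have "gm_completion complex_rationals j \<sigma>' Re V' \<iota>'"
  proof
    show "\<exists>r\<in>complex_rationals. norm (x - r) < e" if "e > 0" for x e
    proof -
      from Rats_dense_in_real[of "Re x" "Re x + e / 2"] Rats_dense_in_real[of "Im x" "Im x + e / 2"] that
      obtain r r' where r: "r \<in> \<rat>" "Re x < r" "r < Re x + e / 2" "r' \<in> \<rat>" "Im x < r'" "r' < Im x + e / 2" by auto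
      have "norm (x - Complex r r') \<le> \<bar>Re x - r\<bar> + \<bar>Im x - r'\<bar>" using cmod_le[of "x - Complex r r'"] by simp
      then show ?thesis using r by (intro bexI[of _ "Complex r r'"]) (auto simp: complex_rationals_def)
    qed
    \<comment> \<open>A real-linear functional on the complex numbers is the real part of the
      multiplication by \<open>u 1 - \<i> * u \<i>\<close>.\<close>
    show "\<exists>a. \<forall>x. u x = Re (a * x)" if add: "\<And>x y. u (x + y) = u x + u y" and sc: "\<And>r x. u (of_real r * x) = r * u x"
      for u :: "complex \<Rightarrow> real"
    proof (intro exI allI)
      fix x
      have "u x = u (of_real (Re x) * 1 + of_real (Im x) * \<i>)" by (rule arg_cong[of _ _ u]) (simp add: complex_eq_iff)
      then show "u x = Re (Complex (u 1) (- u \<i>) * x)" unfolding add sc by (simp add: mult.commute)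
    qed
    show "\<exists>B::complex set. finite B \<and> (\<forall>x. \<exists>c. x = (\<Sum>b\<in>B. of_real (c b) * b))"
    proof (rule exI[of _ "{1, \<i>}"], intro conjI allI)
      fix x
      show "\<exists>c. x = (\<Sum>b\<in>{1, \<i>}. of_real (c b) * b)"
        by (rule exI[of _ "\<lambda>b. if b = 1 then Re x else Im x"]) (simp add: complex_eq_iff)
    qed simp
  qed (use assms s c in \<open>auto simp: complex_rationals_def abs_Re_le_cmod\<close>)
  then show "QHI V'" by (rule gm_completion.QHI_V)
qed

end
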